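(* Let $M$ be a compact connected $C^\infty$ Riemannian manifold of dimension $n\ge 3$, let $X$ be a $C^1$ vector field on $M$ with flow $X_t$, and let $\Lambda\subset M$ be a compact invariant set for $X_t$ such that every singularity $\sigma\in\Lambda$ is hyperbolic. Suppose that there is a continuous $DX_t$-invariant splitting $T_\Lambda M=E\oplus F$, and let $p$ be an integer with $2\le p\le\dim F$. Then $\Lambda$ is $p$-singular hyperbolic for the flow (with respect to the splitting $E\oplus F$) if and only if, on a set of total probability in $\Lambda$, (1) $\displaystyle\liminf_{t\to+\infty}\frac1t\log\|DX_t|_{E_x}\|-\limsup_{t\to+\infty}\frac1t\log m(DX_t|_{F_x})<0$, (2) the Lyapunov exponents in the $E$ direction are negative, and (3) the $p$-sectional Lyapunov exponents in the $F$ direction are positive.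
   Context: $M$ may have boundary, in which case $X$ is assumed inwardly transverse to $\partial M$. A set $\Lambda$ is invariant if $X_t(\Lambda)=\Lambda$ for all $t\in\mathbb{R}$. A singularity is a point $\sigma$ with $X(\sigma)=0$; it is hyperbolic if all eigenvalues of $DX(\sigma)$ have nonzero real part. Splittings are nontrivial: $E_x\ne\{0\}$ and $F_x\neq\{0\}$ for every $x\in\Lambda$. A dominated splitting over $\Lambda$ is a continuous $DX_t$-invariant splitting $T_\Lambda M=E\oplus F$ with $E_x\neq\{0\}$, $F_x\ne\{0\}$ for all $x\in\Lambda$, for which there are $K,\lambda>0$ with $\|DX_t|_{E_x}\|\cdot\|DX_{-t}|_{F_{X_t(x)}}\|<Ke^{-\lambda t}$ for all $x\in\Lambda$, $t>0$. It is a partially hyperbolic splitting if moreover $E$ is uniformly contracted: there are $K,\lambda>0$ with $\|DX_t|_{E_x}\|\le Ke^{-\lambda t}$ for all $x\in\Lambda$, $t>0$. For $2\le p\le\dim F$, $F$ is $p$-sectionally expanding if there are $C,\lambda>0$ such that $|\det(DX_t|_{L_x})|>Ce^{\lambda t}$ for all $t>0$, $x\in\Lambda$ and every $p$-dimensional linear subspace $L_x\subset F_x$; equivalently $\|\wedge^pDX_t(x)\tilde v\|>Ce^{\lambda t}$ for every $t>0$ and every unit-norm $\tilde v=v_1\wedge\dots\wedge v_p\in\wedge^pF_x$ representing a $p$-plane. $\Lambda$ is $p$-singular hyperbolic (with respect to $E\oplus F$) if $T_\Lambda M=E\oplus F$ is a partially hyperbolic splitting with $E$ uniformly contracted and $F$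 $p$-sectionally expanding. The Lyapunov exponents at $x$ in the $E$ direction are the limits $\lim_{t\to+\infty}\frac1t\log\|DX_t(x)v\|$, $v\in E_x\setminus\{0\}$, and the $p$-sectional Lyapunov exponents at $x$ along $F$ are the limits $\lim_{t\to+\infty}\frac1t\log\|\wedge^pDX_t(x)\tilde v\|$, $\tilde v\in\wedge^pF_x\setminus\{0\}$, whenever these limits exist. For a linear isomorphism $A$, $\|A\|$ is the operator norm and $m(A)=\inf_{\|v\|=1}\|Av\|=\|A^{-1}\|^{-1}$ is the minimum norm (co-norm). A subset $Y\subset\Lambda$ has total probability in $\Lambda$ if $\mu(Y)=1$ for every probability measure $\mu$ on $\Lambda$ that is invariant under $X_t$ for all $t\in\mathbb{R}$. *)

theory Defs
  imports "HOL-Probability.Probability"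
begin

text \<open>
  Manifolds with boundary are modelled on a closed half-space of \<open>real ^ 'n\<close>; the underlying space
  of the manifold is the whole type \<open>'m\<close>.  The tangent space at \<open>x\<close> is \<open>real ^ 'n\<close>, its vectors
  being the coordinate vectors with respect to a preferred chart \<open>chart_at A x\<close> at \<open>x\<close>.
  \<open>tangent_coord\<close> passes from one chart at \<open>x\<close> to another, so that smoothness and continuity of
  tensor fields and subbundles are always stated in a chart that does not vary with the point.
\<close>

section \<open>Differentiability classes\<close>

primrec Ck_on :: "nat \<Rightarrow> 'a::real_normed_vector set \<Rightarrow> ('a \<Rightarrow> 'b::real_normed_vector) \<Rightarrow> bool" where
  "Ck_on 0 S f \<longleftrightarrow> continuous_on S f"
| "Ck_on (Suc k) S f \<longleftrightarrow>
     (\<forall>x\<in>S. f differentiable (at x)) \<and> (\<forall>v. Ck_on k S (\<lambda>x. frechet_derivative f (at x) v))"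

definition smooth_on :: "'a::real_normed_vector set \<Rightarrow> ('a \<Rightarrow> 'b::real_normed_vector) \<Rightarrow> bool" where
  "smooth_on S f \<longleftrightarrow> (\<forall>k. Ck_on k S f)"

text \<open>\<open>Ck_on\<close> and \<open>smooth_on\<close> are meant for open sets.  On relatively open subsets of the half-space
  regularity means local extendability to open sets.\<close>

definition locally_extends ::
  "('a::topological_space set \<Rightarrow> ('a \<Rightarrow> 'b) \<Rightarrow> bool) \<Rightarrow> 'a set \<Rightarrow> ('a \<Rightarrow> 'b) \<Rightarrow> bool" where
  "locally_extends P S f \<longleftrightarrow>
     (\<forall>x\<in>S. \<exists>U h. open U \<and> x \<in> U \<and> P U h \<and> (\<forall>y\<in>U \<inter> S. h y = f y))"


section \<open>Smooth manifolds with boundary\<close>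

type_synonym ('m, 'n) chart = "'m set \<times> ('m \<Rightarrow> real ^ 'n)"

definition chart_inv :: "('m, 'n::finite) chart \<Rightarrow> real ^ 'n \<Rightarrow> 'm" where
  "chart_inv c = inv_into (fst c) (snd c)"

definition bdry_index :: "'n::finite" where
  "bdry_index = (SOME k. True)"

definition half_space :: "(real ^ 'n::finite) set" where
  "half_space = {y. 0 \<le> y $ bdry_index}"

definition smooth_atlas :: "('m::topological_space, 'n::finite) chart set \<Rightarrow> bool" where
  "smooth_atlas A \<longleftrightarrow>
     (\<Union>c\<in>A. fst c) = UNIV \<and>
     (\<forall>c\<in>A. open (fst c) \<and>
            openin (top_of_set half_space) (snd c ` fst c) \<and>
            homeomorphism (fst c) (snd c ` fst c) (snd c) (chart_inv c)) \<and>
     (\<forall>c\<in>A. \<forall>d\<in>A. locally_extends smooth_on (snd c ` (fst c \<inter> fst d)) (snd d \<circ> chart_inv c))"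

definition chart_at :: "('m, 'n::finite) chart set \<Rightarrow> 'm \<Rightarrow> ('m, 'n) chart" where
  "chart_at A x = (SOME c. c \<in> A \<and> x \<in> fst c)"

definition manifold_boundary :: "('m, 'n::finite) chart set \<Rightarrow> 'm set" where
  "manifold_boundary A = {x. snd (chart_at A x) x $ bdry_index = 0}"

text \<open>Derivatives below are taken within relatively open subsets of the half-space, where they are
  unique also at boundary points.\<close>

definition tangent_coord ::
  "('m, 'n::finite) chart \<Rightarrow> ('m, 'n) chart \<Rightarrow> 'm \<Rightarrow> real ^ 'n \<Rightarrow> real ^ 'n" where
  "tangent_coord c d x =
     frechet_derivative (snd d \<circ> chart_inv c) (at (snd c x) within snd c ` (fst c \<inter> fst d))"

definition tangent_map ::
  "('m, 'n::finite) chart set \<Rightarrow> ('m \<Rightarrow> 'm) \<Rightarrow> 'm \<Rightarrow> real ^ 'n \<Rightarrow> real ^ 'n" where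
  "tangent_map A f x =
     frechet_derivative (snd (chart_at A (f x)) \<circ> f \<circ> chart_inv (chart_at A x))
       (at (snd (chart_at A x) x) within snd (chart_at A x) ` fst (chart_at A x))"


section \<open>Riemannian metrics\<close>

type_synonym ('m, 'n) metric_field = "'m \<Rightarrow> real ^ 'n \<Rightarrow> real ^ 'n \<Rightarrow> real"

definition riemannian_metric ::
  "('m, 'n::finite) chart set \<Rightarrow> ('m, 'n) metric_field \<Rightarrow> bool" where
  "riemannian_metric A g \<longleftrightarrow>
     (\<forall>x. bilinear (g x) \<and> (\<forall>u v. g x u v = g x v u) \<and> (\<forall>v. v \<noteq> 0 \<longrightarrow> 0 < g x v v)) \<and>
     (\<forall>c\<in>A. \<forall>u v. locally_extends smooth_on (snd c ` fst c)
        (\<lambda>y. let x = chart_inv c y; T = tangent_coord c (chart_at A x) x in g x (T u) (T v)))"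

definition tangent_norm :: "('m, 'n::finite) metric_field \<Rightarrow> 'm \<Rightarrow> real ^ 'n \<Rightarrow> real" where
  "tangent_norm g x v = sqrt (g x v v)"

text \<open>Operator norm and co-norm of the restriction to a subspace \<open>S \<noteq> {0}\<close> of the tangent space at
  \<open>x\<close> of a linear map \<open>L\<close> into the tangent space at \<open>y\<close>.\<close>

definition restr_norm ::
  "('m, 'n::finite) metric_field \<Rightarrow> 'm \<Rightarrow> 'm \<Rightarrow> (real ^ 'n \<Rightarrow> real ^ 'n) \<Rightarrow> (real ^ 'n) set \<Rightarrow> real" where
  "restr_norm g x y L S = (SUP v\<in>{v \<in> S. tangent_norm g x v = 1}. tangent_norm g y (L v))"

definition restr_conorm ::
  "('m, 'n::finite) metric_field \<Rightarrow> 'm \<Rightarrow> 'm \<Rightarrow> (real ^ 'n \<Rightarrow> real ^ 'n) \<Rightarrow> (real ^ 'n) set \<Rightarrow> real" where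
  "restr_conorm g x y L S = (INF v\<in>{v \<in> S. tangent_norm g x v = 1}. tangent_norm g y (L v))"

definition orthonormal_basis ::
  "(real ^ 'n::finite \<Rightarrow> real ^ 'n \<Rightarrow> real) \<Rightarrow> ('p::finite \<Rightarrow> real ^ 'n) \<Rightarrow> (real ^ 'n) set \<Rightarrow> bool" where
  "orthonormal_basis G e P \<longleftrightarrow>
     span (range e) = P \<and> (\<forall>a b. G (e a) (e b) = (if a = b then 1 else 0))"

text \<open>The absolute value of the determinant of \<open>L : P \<rightarrow> L P\<close>, for \<open>P\<close> of dimension \<open>CARD('p)\<close> and \<open>L\<close>
  injective on \<open>P\<close>, in orthonormal bases of \<open>P\<close> and \<open>L P\<close>; it does not depend on their choice.\<close>

definition abs_det_restr ::
  "'p::finite itself \<Rightarrow> ('m, 'n::finite) metric_field \<Rightarrow> 'm \<Rightarrow> 'm \<Rightarrow> (real ^ 'n \<Rightarrow> real ^ 'n) \<Rightarrow>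
   (real ^ 'n) set \<Rightarrow> real" where
  "abs_det_restr _ g x y L P =
     (THE d. \<exists>(e :: 'p \<Rightarrow> real ^ 'n) (f :: 'p \<Rightarrow> real ^ 'n).
        orthonormal_basis (g x) e P \<and> orthonormal_basis (g y) f (L ` P) \<and>
        d = \<bar>det (\<chi> a b. g y (f a) (L (e b)))\<bar>)"


section \<open>Exterior powers\<close>

text \<open>The \<open>CARD('p)\<close>-th exterior power of \<open>real ^ 'n\<close> is the space of antisymmetric tensors inside
  \<open>real ^ ('p \<Rightarrow> 'n)\<close>, the product \<open>v\<^sub>1 \<and> \<dots> \<and> v\<^sub>p\<close> being the alternating sum of
  \<open>v\<^bsub>\<pi> 1\<^esub> \<otimes> \<dots> \<otimes> v\<^bsub>\<pi> p\<^esub>\<close> over all permutations \<open>\<pi>\<close>.  The factorial in \<open>ext_norm\<close> normalises the inner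
  product to \<open>\<langle>v\<^sub>1 \<and> \<dots> \<and> v\<^sub>p, w\<^sub>1 \<and> \<dots> \<and> w\<^sub>p\<rangle> = det (G v\<^sub>i w\<^sub>j)\<close>.\<close>

definition wedge :: "('p::finite \<Rightarrow> real ^ 'n::finite) \<Rightarrow> real ^ ('p \<Rightarrow> 'n)" where
  "wedge v = (\<chi> i. det (\<chi> a b. v a $ i b))"

definition ext_power :: "(real ^ 'n::finite) set \<Rightarrow> (real ^ ('p::finite \<Rightarrow> 'n)) set" where
  "ext_power S = span {wedge v | v. \<forall>a. v a \<in> S}"

definition ext_map ::
  "(real ^ 'n::finite \<Rightarrow> real ^ 'n) \<Rightarrow> real ^ ('p::finite \<Rightarrow> 'n) \<Rightarrow> real ^ ('p \<Rightarrow> 'n)" where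
  "ext_map L T = (\<chi> i. \<Sum>j\<in>UNIV. (\<Prod>a\<in>UNIV. matrix L $ i a $ j a) * T $ j)"

definition ext_norm ::
  "(real ^ 'n::finite \<Rightarrow> real ^ 'n \<Rightarrow> real) \<Rightarrow> real ^ ('p::finite \<Rightarrow> 'n) \<Rightarrow> real" where
  "ext_norm G T =
     sqrt ((\<Sum>i\<in>UNIV. \<Sum>j\<in>UNIV. (\<Prod>a\<in>UNIV. G (axis (i a) 1) (axis (j a) 1)) * T $ i * T $ j)
           / fact CARD('p))"


section \<open>Vector fields and flows\<close>

type_synonym ('m, 'n) vector_field = "'m \<Rightarrow> real ^ 'n"

definition field_coord ::
  "('m, 'n::finite) chart set \<Rightarrow> ('m, 'n) vector_field \<Rightarrow> ('m, 'n) chart \<Rightarrow> real ^ 'n \<Rightarrow> real ^ 'n" where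
  "field_coord A X c y = (let x = chart_inv c y in tangent_coord (chart_at A x) c x (X x))"

definition C1_vector_field :: "('m, 'n::finite) chart set \<Rightarrow> ('m, 'n) vector_field \<Rightarrow> bool" where
  "C1_vector_field A X \<longleftrightarrow>
     (\<forall>c\<in>A. locally_extends (Ck_on 1) (snd c ` fst c) (field_coord A X c))"

definition inwardly_transverse :: "('m, 'n::finite) chart set \<Rightarrow> ('m, 'n) vector_field \<Rightarrow> bool" where
  "inwardly_transverse A X \<longleftrightarrow> (\<forall>x\<in>manifold_boundary A. 0 < X x $ bdry_index)"

definition integral_curve ::
  "('m::topological_space, 'n::finite) chart set \<Rightarrow> ('m, 'n) vector_field \<Rightarrow> (real \<Rightarrow> 'm) \<Rightarrow> real set \<Rightarrow> bool"
where
  "integral_curve A X \<gamma> I \<longleftrightarrow>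
     continuous_on I \<gamma> \<and>
     (\<forall>s\<in>I. ((\<lambda>r. snd (chart_at A (\<gamma> s)) (\<gamma> r)) has_vector_derivative X (\<gamma> s)) (at s within I))"

text \<open>When \<open>M\<close> has a boundary the flow is in general only partially defined for negative times.\<close>

definition flow_domain ::
  "('m::topological_space, 'n::finite) chart set \<Rightarrow> ('m, 'n) vector_field \<Rightarrow> (real \<times> 'm) set" where
  "flow_domain A X = {(t, x). \<exists>\<gamma>. integral_curve A X \<gamma> (closed_segment 0 t) \<and> \<gamma> 0 = x}"

definition flow ::
  "('m::topological_space, 'n::finite) chart set \<Rightarrow> ('m, 'n) vector_field \<Rightarrow> real \<Rightarrow> 'm \<Rightarrow> 'm" where
  "flow A X t x =
     (THE y. \<exists>\<gamma>. integral_curve A X \<gamma> (closed_segment 0 t) \<and> \<gamma> 0 = x \<and> \<gamma> t = y)"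

definition Dflow ::
  "('m::topological_space, 'n::finite) chart set \<Rightarrow> ('m, 'n) vector_field \<Rightarrow> real \<Rightarrow> 'm \<Rightarrow>
   real ^ 'n \<Rightarrow> real ^ 'n" where
  "Dflow A X t x = tangent_map A (flow A X t) x"

definition flow_invariant ::
  "('m::topological_space, 'n::finite) chart set \<Rightarrow> ('m, 'n) vector_field \<Rightarrow> 'm set \<Rightarrow> bool" where
  "flow_invariant A X \<Lambda> \<longleftrightarrow>
     (\<forall>t. (\<forall>x\<in>\<Lambda>. (t, x) \<in> flow_domain A X) \<and> flow A X t ` \<Lambda> = \<Lambda>)"

definition singularity :: "('m, 'n::finite) vector_field \<Rightarrow> 'm \<Rightarrow> bool" where
  "singularity X \<sigma> \<longleftrightarrow> X \<sigma> = 0"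

text \<open>At a singularity the derivative of \<open>X\<close> is an endomorphism of the tangent space that can be
  computed in any chart.\<close>

definition field_derivative ::
  "('m, 'n::finite) chart set \<Rightarrow> ('m, 'n) vector_field \<Rightarrow> 'm \<Rightarrow> real ^ 'n \<Rightarrow> real ^ 'n" where
  "field_derivative A X \<sigma> =
     (let c = chart_at A \<sigma> in
      frechet_derivative (field_coord A X c) (at (snd c \<sigma>) within snd c ` fst c))"

definition complex_eigenvalue :: "(real ^ 'n::finite \<Rightarrow> real ^ 'n) \<Rightarrow> complex \<Rightarrow> bool" where
  "complex_eigenvalue L z \<longleftrightarrow>
     (\<exists>v :: complex ^ 'n. v \<noteq> 0 \<and> (\<chi> i j. complex_of_real (matrix L $ i $ j)) *v v = z *s v)"

definition hyperbolic_singularity ::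
  "('m, 'n::finite) chart set \<Rightarrow> ('m, 'n) vector_field \<Rightarrow> 'm \<Rightarrow> bool" where
  "hyperbolic_singularity A X \<sigma> \<longleftrightarrow>
     singularity X \<sigma> \<and> (\<forall>z. complex_eigenvalue (field_derivative A X \<sigma>) z \<longrightarrow> Re z \<noteq> 0)"


section \<open>Splittings\<close>

text \<open>Continuity of a family of subspaces: locally, in the coordinates of a fixed chart, it has a
  continuous frame.\<close>

definition continuous_subbundle ::
  "('m::topological_space, 'n::finite) chart set \<Rightarrow> 'm set \<Rightarrow> ('m \<Rightarrow> (real ^ 'n) set) \<Rightarrow> bool" where
  "continuous_subbundle A \<Lambda> E \<longleftrightarrow>
     (\<forall>x\<in>\<Lambda>. subspace (E x)) \<and>
     (\<forall>x0\<in>\<Lambda>. \<exists>U k (e :: nat \<Rightarrow> 'm \<Rightarrow> real ^ 'n).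
        open U \<and> x0 \<in> U \<and> U \<subseteq> fst (chart_at A x0) \<and>
        (\<forall>i<k. continuous_on (U \<inter> \<Lambda>) (e i)) \<and>
        (\<forall>x\<in>U \<inter> \<Lambda>. inj_on (\<lambda>i. e i x) {..<k} \<and> independent ((\<lambda>i. e i x) ` {..<k}) \<and>
           span ((\<lambda>i. e i x) ` {..<k}) = tangent_coord (chart_at A x) (chart_at A x0) x ` E x))"

definition continuous_invariant_splitting ::
  "('m::topological_space, 'n::finite) chart set \<Rightarrow> ('m, 'n) vector_field \<Rightarrow> 'm set \<Rightarrow>
   ('m \<Rightarrow> (real ^ 'n) set) \<Rightarrow> ('m \<Rightarrow> (real ^ 'n) set) \<Rightarrow> bool" where
  "continuous_invariant_splitting A X \<Lambda> E F \<longleftrightarrow>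
     continuous_subbundle A \<Lambda> E \<and> continuous_subbundle A \<Lambda> F \<and>
     (\<forall>x\<in>\<Lambda>. E x \<noteq> {0} \<and> F x \<noteq> {0} \<and>
        E x \<inter> F x = {0} \<and> (\<forall>v. \<exists>a\<in>E x. \<exists>b\<in>F x. v = a + b)) \<and>
     (\<forall>t. \<forall>x\<in>\<Lambda>. Dflow A X t x ` E x = E (flow A X t x) \<and> Dflow A X t x ` F x = F (flow A X t x))"

definition dominated_splitting ::
  "('m::topological_space, 'n::finite) chart set \<Rightarrow> ('m, 'n) metric_field \<Rightarrow> ('m, 'n) vector_field \<Rightarrow>
   'm set \<Rightarrow> ('m \<Rightarrow> (real ^ 'n) set) \<Rightarrow> ('m \<Rightarrow> (real ^ 'n) set) \<Rightarrow> bool" where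
  "dominated_splitting A g X \<Lambda> E F \<longleftrightarrow>
     continuous_invariant_splitting A X \<Lambda> E F \<and>
     (\<exists>K>0. \<exists>l>0. \<forall>x\<in>\<Lambda>. \<forall>t>0.
        restr_norm g x (flow A X t x) (Dflow A X t x) (E x) *
        restr_norm g (flow A X t x) x (Dflow A X (- t) (flow A X t x)) (F (flow A X t x))
        < K * exp (- l * t))"

definition uniformly_contracted ::
  "('m::topological_space, 'n::finite) chart set \<Rightarrow> ('m, 'n) metric_field \<Rightarrow> ('m, 'n) vector_field \<Rightarrow>
   'm set \<Rightarrow> ('m \<Rightarrow> (real ^ 'n) set) \<Rightarrow> bool" where
  "uniformly_contracted A g X \<Lambda> E \<longleftrightarrow>
     (\<exists>K>0. \<exists>l>0. \<forall>x\<in>\<Lambda>. \<forall>t>0.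
        restr_norm g x (flow A X t x) (Dflow A X t x) (E x) \<le> K * exp (- l * t))"

definition partially_hyperbolic_splitting ::
  "('m::topological_space, 'n::finite) chart set \<Rightarrow> ('m, 'n) metric_field \<Rightarrow> ('m, 'n) vector_field \<Rightarrow>
   'm set \<Rightarrow> ('m \<Rightarrow> (real ^ 'n) set) \<Rightarrow> ('m \<Rightarrow> (real ^ 'n) set) \<Rightarrow> bool" where
  "partially_hyperbolic_splitting A g X \<Lambda> E F \<longleftrightarrow>
     dominated_splitting A g X \<Lambda> E F \<and> uniformly_contracted A g X \<Lambda> E"

definition sectionally_expanding ::
  "'p::finite itself \<Rightarrow> ('m::topological_space, 'n::finite) chart set \<Rightarrow> ('m, 'n) metric_field \<Rightarrow>
   ('m, 'n) vector_field \<Rightarrow> 'm set \<Rightarrow> ('m \<Rightarrow> (real ^ 'n) set) \<Rightarrow> bool" where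
  "sectionally_expanding p A g X \<Lambda> F \<longleftrightarrow>
     (\<exists>C>0. \<exists>l>0. \<forall>t>0. \<forall>x\<in>\<Lambda>. \<forall>P. subspace P \<and> P \<subseteq> F x \<and> dim P = CARD('p) \<longrightarrow>
        abs_det_restr p g x (flow A X t x) (Dflow A X t x) P > C * exp (l * t))"

definition singular_hyperbolic ::
  "'p::finite itself \<Rightarrow> ('m::topological_space, 'n::finite) chart set \<Rightarrow> ('m, 'n) metric_field \<Rightarrow>
   ('m, 'n) vector_field \<Rightarrow> 'm set \<Rightarrow> ('m \<Rightarrow> (real ^ 'n) set) \<Rightarrow> ('m \<Rightarrow> (real ^ 'n) set) \<Rightarrow> bool" where
  "singular_hyperbolic p A g X \<Lambda> E F \<longleftrightarrow>
     partially_hyperbolic_splitting A g X \<Lambda> E F \<and> sectionally_expanding p A g X \<Lambda> F"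


section \<open>Lyapunov exponents and sets of total probability\<close>

text \<open>The exponents are the limits that exist; a vector without a limit contributes no exponent.\<close>

definition lyapunov_exponents ::
  "('m::topological_space, 'n::finite) chart set \<Rightarrow> ('m, 'n) metric_field \<Rightarrow> ('m, 'n) vector_field \<Rightarrow>
   ('m \<Rightarrow> (real ^ 'n) set) \<Rightarrow> 'm \<Rightarrow> real set" where
  "lyapunov_exponents A g X E x =
     {r. \<exists>v\<in>E x - {0}.
        ((\<lambda>t. 1 / t * ln (tangent_norm g (flow A X t x) (Dflow A X t x v))) \<longlongrightarrow> r) at_top}"

definition sectional_lyapunov_exponents ::
  "'p::finite itself \<Rightarrow> ('m::topological_space, 'n::finite) chart set \<Rightarrow> ('m, 'n) metric_field \<Rightarrow>
   ('m, 'n) vector_field \<Rightarrow> ('m \<Rightarrow> (real ^ 'n) set) \<Rightarrow> 'm \<Rightarrow> real set" where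
  "sectional_lyapunov_exponents _ A g X F x =
     {r. \<exists>w \<in> (ext_power (F x) :: (real ^ ('p \<Rightarrow> 'n)) set) - {0}.
        ((\<lambda>t. 1 / t * ln (ext_norm (g (flow A X t x)) (ext_map (Dflow A X t x) w))) \<longlongrightarrow> r) at_top}"

definition invariant_probability ::
  "('m::topological_space, 'n::finite) chart set \<Rightarrow> ('m, 'n) vector_field \<Rightarrow> 'm set \<Rightarrow> 'm measure \<Rightarrow> bool"
where
  "invariant_probability A X \<Lambda> \<mu> \<longleftrightarrow>
     prob_space \<mu> \<and> sets \<mu> = sets (restrict_space borel \<Lambda>) \<and> (\<forall>t. distr \<mu> \<mu> (flow A X t) = \<mu>)"

definition total_probability ::
  "('m::topological_space, 'n::finite) chart set \<Rightarrow> ('m, 'n) vector_field \<Rightarrow> 'm set \<Rightarrow> 'm set \<Rightarrow> bool" where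
  "total_probability A X \<Lambda> Y \<longleftrightarrow>
     Y \<subseteq> \<Lambda> \<and> (\<forall>\<mu>. invariant_probability A X \<Lambda> \<mu> \<longrightarrow> measure \<mu> Y = 1)"

end

theory Submission
  imports Defs
begin

text \<open>
  Consider the compact bundle of states \<open>(x, u, v, w)\<close> with \<open>x \<in> \<Lambda>\<close> and unit vectors \<open>u \<in> E\<^sub>x\<close>, \<open>v \<in> F\<^sub>x\<close> and
  \<open>w\<close> in the exterior power of \<open>F\<^sub>x\<close>.  The normalised derivative flow acts on it, and the logarithms of
  the growth of \<open>u\<close>, \<open>v\<close> and \<open>w\<close> are additive cocycles over this action, so that neither Kingman's nor
  Oseledets' theorem is needed.  If a cocycle \<open>d\<close> violates every bound \<open>d t z \<le> C - l * t\<close> with \<open>l > 0\<close>,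
  there are arbitrarily long orbit segments on which it does not decrease by more than 1; the
  empirical measures along them accumulate at an invariant probability measure for which \<open>d 1\<close> has a
  nonnegative integral.  By Birkhoff's theorem the growth rates of all cocycles exist almost
  everywhere, and that of \<open>d\<close> is nonnegative on a set of positive measure.  The projection to \<open>\<Lambda>\<close> is
  invariant, so such a state exists over every set of total probability.  Applied to \<open>u\<close>, to
  the difference of \<open>u\<close> and \<open>v\<close>, and to \<open>-w\<close>, this contradicts (2), (1) and (3), respectively.

  Conversely the three estimates of singular hyperbolicity bound the rates directly, except that
  sectional expansion only concerns decomposable \<open>p\<close>-vectors.  Reversing time turns it into an upper
  bound, which extends from decomposable vectors to their linear combinations.
\<close>

section \<open>Birkhoff's theorem\<close>

text \<open>Norms over whole fibres are only submultiplicative in time, whereas the growth of one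
  normalised vector is exactly multiplicative; this is what the bundle of states buys, and
  independent choices of \<open>u\<close> and \<open>v\<close> still recover operator norm and
  co-norm. The price is a state space without a usable topology: the manifold type carries no
  distance, and tangent vectors are written in preferred charts that jump from point to point. Hence
  states are coded by a compact set \<open>K\<close> in a Euclidean space through a map
  \<open>\<Theta>\<close>, a function of states counts as continuous if its pullback to
  \<open>K\<close> is, and measures live on the sigma-algebra of such functions. Limits of measures
  come from the real line, on which \<open>K\<close> is coded once more. The second obstacle is the
  boundary, where the flow has no past. An invariant set lies in the interior, where charts have
  open images, but the derivative of the flow also sees neighbours outside \<open>\<Lambda>\<close>;
  so the flow is first extended to a neighbourhood of each point for any prescribed time.\<close>

primrec max_birkhoff :: "('a \<Rightarrow> 'a) \<Rightarrow> ('a \<Rightarrow> real) \<Rightarrow> nat \<Rightarrow> 'a \<Rightarrow> real" where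
  "max_birkhoff T g 0 x = 0"
| "max_birkhoff T g (Suc n) x = max 0 (g x + max_birkhoff T g n (T x))"

lemma max_birkhoff_nonneg: "0 \<le> max_birkhoff T g n x"
  by (cases n) auto

lemma max_birkhoff_mono: "max_birkhoff T g n x \<le> max_birkhoff T g (Suc n) x"
proof (induction n arbitrary: x)
  case (Suc n)
  show ?case using Suc[of "T x"] by (auto simp: max_def)
qed (simp add: max_birkhoff_nonneg)

lemma birkhoff_sum_shift:
  "(\<Sum>i<Suc k. g ((T ^^ i) x)) = (g x :: real) + (\<Sum>i<k. g ((T ^^ i) (T x)))"
  unfolding sum.lessThan_Suc_shift by (simp add: funpow_swap1)

text \<open>The recursion computes the largest of 0 and the Birkhoff sums of lengths 1 to
  \<open>n\<close>. In this recursive form the identity behind \<open>maximal_ergodic\<close> is the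
  defining equation.\<close>

lemma sum_le_max_birkhoff: "k \<le> n \<Longrightarrow> (\<Sum>i<k. g ((T ^^ i) x)) \<le> max_birkhoff T g n x"
proof (induction n arbitrary: k x)
  case (Suc n)
  show ?case
  proof (cases k)
    case (Suc l)
    then show ?thesis using Suc.IH[of l "T x"] Suc.prems
      by (simp add: birkhoff_sum_shift del: sum.lessThan_Suc)
  qed (simp add: le_max_iff_disj)
qed simp

lemma max_birkhoff_bound:
  assumes "\<And>x. x \<in> S \<Longrightarrow> \<bar>g x\<bar> \<le> B" "\<And>x. x \<in> S \<Longrightarrow> T x \<in> S" "x \<in> S"
  shows "max_birkhoff T g n x \<le> n * B"
  using assms(3)
proof (induction n arbitrary: x)
  case (Suc n)
  have "0 \<le> B" using assms(1)[OF Suc.prems] by linarith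
  then have "0 \<le> real n * B" by simp
  then show ?case using Suc.IH[OF assms(2)[OF Suc.prems]] assms(1)[OF Suc.prems] \<open>0 \<le> B\<close>
    by (auto simp: algebra_simps)
qed simp

lemma (in prob_space) max_birkhoff_measurable:
  assumes [measurable]: "T \<in> measurable M M" "g \<in> borel_measurable M"
  shows "max_birkhoff T g n \<in> borel_measurable M"
proof (induction n)
  case 0
  then show ?case by simp
next
  case (Suc n)
  note [measurable] = Suc
  have "(\<lambda>x. max 0 (g x + max_birkhoff T g n (T x))) \<in> borel_measurable M" by measurable
  then show ?case by simp
qed

text \<open>Garsia's argument. Where \<open>?m (Suc n)\<close> is positive it equals
  \<open>g\<close> plus \<open>?m n\<close> at \<open>T x\<close>, so there \<open>g\<close>
  dominates the decrease of \<open>?m (Suc n)\<close> from \<open>x\<close> to \<open>T x\<close>;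
  elsewhere this decrease is nonpositive. Its integral vanishes by invariance, so \<open>g\<close>
  has nonnegative integral over \<open>{0 < ?m (Suc n)}\<close>, and by \<open>ex\<close> these sets
  exhaust the space.\<close>

lemma (in prob_space) maximal_ergodic:
  fixes g :: "'a \<Rightarrow> real"
  assumes T[measurable]: "T \<in> measurable M M" and inv: "distr M M T = M"
    and g[measurable]: "g \<in> borel_measurable M" and B: "\<And>x. x \<in> space M \<Longrightarrow> \<bar>g x\<bar> \<le> B"
    and ex: "\<And>x. x \<in> space M \<Longrightarrow> \<exists>n. 0 < (\<Sum>i<n. g ((T ^^ i) x))"
  shows "0 \<le> integral\<^sup>L M g"
proof -
  note [measurable] = max_birkhoff_measurable[OF T g]
  let ?m = "max_birkhoff T g"
  have Tsp: "x \<in> space M \<Longrightarrow> T x \<in> space M" for x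
    using measurable_space[OF T] .
  have B0: "0 \<le> B"
  proof -
    obtain x where "x \<in> space M" using not_empty by blast
    then show ?thesis using B[of x] by linarith
  qed
  have int_m: "integrable M (?m n)" for n
    by (rule integrable_const_bound[where B="n * B"])
      (auto intro!: max_birkhoff_bound[OF B Tsp] simp: max_birkhoff_nonneg)
  have int_mT: "integrable M (\<lambda>x. ?m n (T x))" for n
    by (rule integrable_const_bound[where B="n * B"])
      (auto intro!: max_birkhoff_bound[OF B Tsp] Tsp simp: max_birkhoff_nonneg)
  have eq: "integral\<^sup>L M (\<lambda>x. ?m n (T x)) = integral\<^sup>L M (?m n)" for n
    using integral_distr[of T M M "?m n"] inv by simp
  have int_g: "integrable M (\<lambda>x. g x * indicator {x\<in>space M. 0 < ?m n x} x)" for n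
    by (rule integrable_const_bound[where B="B"])
      (use B B0 in \<open>auto simp: indicator_def\<close>)
  have "0 \<le> integral\<^sup>L M (\<lambda>x. g x * indicator {x\<in>space M. 0 < ?m (Suc n) x} x)" for n
  proof -
    have "0 = integral\<^sup>L M (\<lambda>x. ?m (Suc n) x - ?m (Suc n) (T x))"
      unfolding Bochner_Integration.integral_diff[OF int_m[of "Suc n"] int_mT[of "Suc n"]] eq[of "Suc n"]
      by (rule diff_self[symmetric])
    also have "\<dots> \<le> integral\<^sup>L M (\<lambda>x. g x * indicator {x\<in>space M. 0 < ?m (Suc n) x} x)"
    proof (rule integral_mono)
      show "integrable M (\<lambda>x. ?m (Suc n) x - ?m (Suc n) (T x))"
        by (intro Bochner_Integration.integrable_diff int_m int_mT)
      fix x assume x: "x \<in> space M"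
      show "?m (Suc n) x - ?m (Suc n) (T x) \<le> g x * indicator {x\<in>space M. 0 < ?m (Suc n) x} x"
      proof (cases "0 < ?m (Suc n) x")
        case True
        then have "?m (Suc n) x = g x + ?m n (T x)" by (auto simp: max_def split: if_splits)
        also have "\<dots> \<le> g x + ?m (Suc n) (T x)" using max_birkhoff_mono[of T g n "T x"] by linarith
        finally show ?thesis using True x by simp
      next
        case False
        then show ?thesis using max_birkhoff_nonneg[of T g "Suc n" "T x"] by (simp add: not_less)
      qed
    qed (rule int_g)
    finally show ?thesis .
  qed
  moreover have "(\<lambda>n. integral\<^sup>L M (\<lambda>x. g x * indicator {x\<in>space M. 0 < ?m (Suc n) x} x))
    \<longlonglongrightarrow> integral\<^sup>L M g"
  proof (rule integral_dominated_convergence[where w="\<lambda>_. B"])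
    show "AE x in M. (\<lambda>n. g x * indicator {x\<in>space M. 0 < ?m (Suc n) x} x) \<longlonglongrightarrow> g x"
    proof (rule AE_I2)
      fix x assume x: "x \<in> space M"
      then obtain N where N: "0 < (\<Sum>i<N. g ((T ^^ i) x))" using ex by blast
      have "eventually (\<lambda>n. g x * indicator {x\<in>space M. 0 < ?m (Suc n) x} x = g x) sequentially"
      proof (rule eventually_sequentiallyI[of N])
        fix n assume "N \<le> n"
        then have "0 < ?m (Suc n) x"
          using N sum_le_max_birkhoff[of N "Suc n" g T x] by (smt (verit) le_SucI)
        then show "g x * indicator {x\<in>space M. 0 < ?m (Suc n) x} x = g x" using x by simp
      qed
      then show "(\<lambda>n. g x * indicator {x\<in>space M. 0 < ?m (Suc n) x} x) \<longlonglongrightarrow> g x"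
        by (simp add: tendsto_eventually)
    qed
    show "AE x in M. norm (g x * indicator {x\<in>space M. 0 < ?m (Suc n) x} x) \<le> B" for n
      using B B0 by (intro AE_I2) (auto simp: indicator_def)
  qed auto
  ultimately show ?thesis by (intro LIMSEQ_le_const) auto
qed

lemma limsup_eq_of_diff_null:
  fixes X Y :: "nat \<Rightarrow> real"
  assumes "(\<lambda>n. X n - Y n) \<longlonglongrightarrow> 0"
  shows "limsup (\<lambda>n. ereal (X n)) = limsup (\<lambda>n. ereal (Y n))"
proof -
  have "(\<lambda>n. ereal (X n - Y n)) \<longlonglongrightarrow> ereal 0"
    using assms by simp
  from ereal_limsup_lim_add[OF this, of "\<lambda>n. ereal (Y n)"]
  show ?thesis by (simp add: zero_ereal_def[symmetric])
qed

text \<open>The upper average \<open>U\<close> is invariant under \<open>T\<close>, and for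
  \<open>e > 0\<close> some average of \<open>f\<close> exceeds \<open>U - e\<close> at each point.
  So at every point some Birkhoff sum of \<open>f - U + e\<close> is positive, and the maximal
  ergodic inequality bounds the integral of \<open>U\<close>.\<close>

lemma (in prob_space) birkhoff_upper:
  fixes f :: "'a \<Rightarrow> real"
  assumes T[measurable]: "T \<in> measurable M M" and inv: "distr M M T = M"
    and f[measurable]: "f \<in> borel_measurable M" and B: "\<And>x. x \<in> space M \<Longrightarrow> \<bar>f x\<bar> \<le> B"
  obtains U where "U \<in> borel_measurable M" "\<And>x. x \<in> space M \<Longrightarrow> \<bar>U x\<bar> \<le> B"
    "\<And>x. x \<in> space M \<Longrightarrow> limsup (\<lambda>n. ereal ((\<Sum>i<n. f ((T ^^ i) x)) / n)) = ereal (U x)"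
    "integral\<^sup>L M U \<le> integral\<^sup>L M f"
proof -
  define A where "A n x = (\<Sum>i<n. f ((T ^^ i) x)) / real n" for n x
  define L where "L x = limsup (\<lambda>n. ereal (A n x))" for x
  define U where "U x = real_of_ereal (L x)" for x
  have Tsp: "x \<in> space M \<Longrightarrow> T x \<in> space M" for x
    using measurable_space[OF T] .
  have Tnsp: "x \<in> space M \<Longrightarrow> (T ^^ i) x \<in> space M" for x i
    by (induction i) (auto intro: Tsp)
  have Tn[measurable]: "(T ^^ i) \<in> measurable M M" for i
    by (induction i) (auto intro: measurable_compose simp: comp_def)
  have [measurable]: "A n \<in> borel_measurable M" for n
    unfolding A_def by measurable
  have [measurable]: "L \<in> borel_measurable M"
    unfolding L_def by measurable
  have Um[measurable]: "U \<in> borel_measurable M"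
    unfolding U_def by measurable
  have B0: "0 \<le> B" if "x \<in> space M" for x
    using B[OF that] by linarith
  have Ab: "\<bar>A n x\<bar> \<le> B" if x: "x \<in> space M" for n x
  proof (cases "n = 0")
    case False
    have "\<bar>\<Sum>i<n. f ((T ^^ i) x)\<bar> \<le> (\<Sum>i<n. B)"
      by (rule order_trans[OF sum_abs]) (intro sum_mono B Tnsp x)
    then show ?thesis using False by (simp add: A_def field_simps)
  qed (simp add: A_def B0[OF x])
  have Lb: "ereal (-B) \<le> L x" "L x \<le> ereal B" if x: "x \<in> space M" for x
  proof -
    have "limsup (\<lambda>n. ereal (-B)) \<le> L x"
      unfolding L_def by (intro Limsup_mono always_eventually) (use Ab[OF x] in \<open>auto simp: abs_le_iff minus_le_iff\<close>)
    then show "ereal (-B) \<le> L x" by (simp add: Limsup_const)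
    show "L x \<le> ereal B"
      unfolding L_def by (intro Limsup_bounded always_eventually) (use Ab[OF x] in \<open>auto simp: abs_le_iff\<close>)
  qed
  have LU: "L x = ereal (U x)" if "x \<in> space M" for x
    using Lb[OF that] unfolding U_def by (cases "L x") auto
  have Ub: "\<bar>U x\<bar> \<le> B" if "x \<in> space M" for x
    using Lb[OF that] LU[OF that] by auto
  have Uinv: "U (T x) = U x" if x: "x \<in> space M" for x
  proof -
    have "(\<lambda>n. A n (T x) - A (Suc n) x) \<longlonglongrightarrow> 0"
    proof (rule Lim_null_comparison)
      show "(\<lambda>n. 2 * B * (1 / real n)) \<longlonglongrightarrow> 0"
        using tendsto_mult_right_zero[OF lim_1_over_n] by blast
      show "\<forall>\<^sub>F n in sequentially. norm (A n (T x) - A (Suc n) x) \<le> 2 * B * (1 / real n)"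
      proof (rule eventually_sequentiallyI[of 1])
        fix n :: nat assume n: "1 \<le> n"
        have e: "real (Suc n) * A (Suc n) x = f x + real n * A n (T x)"
          unfolding A_def birkhoff_sum_shift using n by simp
        then have "A n (T x) - A (Suc n) x = (A (Suc n) x - f x) / n"
          using n by (simp add: field_simps)
        moreover have "\<bar>A (Suc n) x - f x\<bar> \<le> 2 * B"
          using Ab[OF x, of "Suc n"] B[OF x] by linarith
        ultimately show "norm (A n (T x) - A (Suc n) x) \<le> 2 * B * (1 / real n)"
          using n by (simp add: divide_right_mono)
      qed
    qed
    then have "L (T x) = limsup (\<lambda>n. ereal (A (Suc n) x))"
      unfolding L_def by (rule limsup_eq_of_diff_null)
    also have "\<dots> = L x"
      unfolding L_def using limsup_shift[of "\<lambda>n. ereal (A n x)"] by simp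
    finally show ?thesis unfolding U_def by simp
  qed
  have Uinvn: "U ((T ^^ i) x) = U x" if x: "x \<in> space M" for x i
    by (induction i) (auto simp: Uinv Tnsp x)
  have intU: "integrable M U"
    by (rule integrable_const_bound[where B=B]) (use Ub in auto)
  have intf: "integrable M f"
    by (rule integrable_const_bound[where B=B]) (use B in auto)
  have "integral\<^sup>L M U \<le> integral\<^sup>L M f + e" if e: "0 < e" for e
  proof -
    have "0 \<le> integral\<^sup>L M (\<lambda>x. f x - U x + e)"
    proof (rule maximal_ergodic[OF T inv, where B="2 * B + e"])
      fix x assume x: "x \<in> space M"
      show "\<bar>f x - U x + e\<bar> \<le> 2 * B + e" using B[OF x] Ub[OF x] e by linarith
      have "ereal (U x - e) < L x" using LU[OF x] e by simp
      then have "\<exists>\<^sub>F n in sequentially. ereal (U x - e) < ereal (A n x)"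
        unfolding L_def frequently_def
        using Limsup_bounded[of "\<lambda>n. ereal (A n x)" "ereal (U x - e)" sequentially]
        by (auto simp: not_less elim!: eventually_mono)
      \<comment> \<open>Length 0 has to be excluded: \<open>A 0 x\<close> is 0 by the convention for
        division by zero and may exceed \<open>U x - e\<close>, while the empty sum is not
        positive.\<close>
      then have "\<exists>n\<ge>1. ereal (U x - e) < ereal (A n x)"
        by (simp add: frequently_sequentially)
      then obtain n where n: "n \<ge> 1" "U x - e < A n x" by auto
      have "(\<Sum>i<n. f ((T ^^ i) x) - U ((T ^^ i) x) + e) = n * (A n x - U x + e)"
        using n Uinvn[OF x] by (simp add: A_def sum.distrib sum_subtractf algebra_simps)
      also have "\<dots> > 0" using n by simp
      finally show "\<exists>n. 0 < (\<Sum>i<n. f ((T ^^ i) x) - U ((T ^^ i) x) + e)" by blast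
    qed auto
    also have "\<dots> = integral\<^sup>L M f - integral\<^sup>L M U + e"
      using intU intf by (simp add: prob_space)
    finally show ?thesis by simp
  qed
  then have "integral\<^sup>L M U \<le> integral\<^sup>L M f" by (rule field_le_epsilon)
  then show thesis
    using that[OF Um Ub] LU unfolding L_def A_def by blast
qed

text \<open>The one-sided bound applied to \<open>f\<close> and to \<open>- f\<close> gives the
  upper limit \<open>U\<close> and the lower limit \<open>- V\<close>, with \<open>U + V\<close> of
  integral at most 0. As \<open>U + V\<close> is nonnegative pointwise, it vanishes almost
  everywhere.\<close>

theorem (in prob_space) birkhoff:
  fixes f :: "'a \<Rightarrow> real"
  assumes T[measurable]: "T \<in> measurable M M" and inv: "distr M M T = M"
    and f[measurable]: "f \<in> borel_measurable M" and B: "\<And>x. x \<in> space M \<Longrightarrow> \<bar>f x\<bar> \<le> B"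
  obtains U where "U \<in> borel_measurable M" "\<And>x. x \<in> space M \<Longrightarrow> \<bar>U x\<bar> \<le> B"
    "AE x in M. (\<lambda>n. (\<Sum>i<n. f ((T ^^ i) x)) / n) \<longlonglongrightarrow> U x"
    "integral\<^sup>L M U = integral\<^sup>L M f"
proof -
  let ?A = "\<lambda>f n x. (\<Sum>i<n. f ((T ^^ i) x)) / real n"
  obtain U where U[measurable]: "U \<in> borel_measurable M" and Ub: "\<And>x. x \<in> space M \<Longrightarrow> \<bar>U x\<bar> \<le> B"
    and Ul: "\<And>x. x \<in> space M \<Longrightarrow> limsup (\<lambda>n. ereal (?A f n x)) = ereal (U x)"
    and Ui: "integral\<^sup>L M U \<le> integral\<^sup>L M f"
    using birkhoff_upper[OF T inv f B] by blast
  have "(\<lambda>x. - f x) \<in> borel_measurable M" "\<And>x. x \<in> space M \<Longrightarrow> \<bar>- f x\<bar> \<le> B"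
    using B by auto
  from birkhoff_upper[OF T inv this]
  obtain V where V[measurable]: "V \<in> borel_measurable M" and Vb: "\<And>x. x \<in> space M \<Longrightarrow> \<bar>V x\<bar> \<le> B"
    and Vl: "\<And>x. x \<in> space M \<Longrightarrow> limsup (\<lambda>n. ereal (?A (\<lambda>x. - f x) n x)) = ereal (V x)"
    and Vi: "integral\<^sup>L M V \<le> integral\<^sup>L M (\<lambda>x. - f x)"
    by blast
  have Vl': "liminf (\<lambda>n. ereal (?A f n x)) = ereal (- V x)" if x: "x \<in> space M" for x
  proof -
    have "(\<lambda>n. ereal (?A (\<lambda>x. - f x) n x)) = (\<lambda>n. - ereal (?A f n x))"
      by (auto simp: sum_negf)
    then have "- liminf (\<lambda>n. ereal (?A f n x)) = ereal (V x)"
      using Vl[OF x] ereal_Limsup_uminus[of sequentially "\<lambda>n. ereal (?A f n x)"] by simp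
    then show ?thesis by (metis ereal_uminus_uminus uminus_ereal.simps(1))
  qed
  have intU: "integrable M U"
    by (rule integrable_const_bound[where B=B]) (use Ub in auto)
  have intV: "integrable M V"
    by (rule integrable_const_bound[where B=B]) (use Vb in auto)
  have ge: "0 \<le> U x + V x" if x: "x \<in> space M" for x
  proof -
    have "ereal (- V x) \<le> ereal (U x)"
      unfolding Vl'[OF x, symmetric] Ul[OF x, symmetric] by (rule Liminf_le_Limsup) simp
    then show ?thesis by simp
  qed
  have i0: "integral\<^sup>L M (\<lambda>x. U x + V x) = integral\<^sup>L M U + integral\<^sup>L M V"
    using intU intV by simp
  have "integral\<^sup>L M U + integral\<^sup>L M V \<le> 0" using Ui Vi by simp
  moreover have "0 \<le> integral\<^sup>L M (\<lambda>x. U x + V x)"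
    using ge by (intro integral_nonneg_AE AE_I2)
  ultimately have z: "integral\<^sup>L M (\<lambda>x. U x + V x) = 0" using i0 by simp
  then have ae: "AE x in M. U x + V x = 0"
    using integral_nonneg_eq_0_iff_AE[of M "\<lambda>x. U x + V x"] intU intV ge by auto
  have "AE x in M. (\<lambda>n. ?A f n x) \<longlonglongrightarrow> U x"
    using ae
  proof (rule AE_mp, intro AE_I2 impI)
    fix x assume x: "x \<in> space M" "U x + V x = 0"
    then have "- V x = U x" by simp
    then have "(\<lambda>n. ereal (?A f n x)) \<longlonglongrightarrow> ereal (U x)"
      using Ul[OF x(1)] Vl'[OF x(1)] by (intro Liminf_eq_Limsup) auto
    then show "(\<lambda>n. ?A f n x) \<longlonglongrightarrow> U x" by simp
  qed
  moreover have "integral\<^sup>L M U = integral\<^sup>L M f" using Ui Vi z i0 by simp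
  ultimately show thesis using that[OF U Ub] by blast
qed


section \<open>Empirical measures\<close>

text \<open>The first nonzero digit, at position \<open>m\<close>, contributes
  \<open>1 / 4 ^ m\<close>, and all later ones together at most a third of that. Base 4 leaves this
  gap; in base 2 the tail could cancel the leading digit.\<close>

lemma quaternary_separation:
  fixes D :: "nat \<Rightarrow> real"
  assumes "\<And>n. D n \<in> {-1, 0, 1}" and small: "\<bar>\<Sum>n. D n / 4 ^ n\<bar> < 1 / (3 * 4 ^ J)" and "n < J"
  shows "D n = 0"
proof (rule ccontr)
  assume "D n \<noteq> 0"
  define m where "m = (LEAST n. D n \<noteq> 0)"
  have Dm: "D m \<noteq> 0" and m: "m \<le> n" and z: "k < m \<Longrightarrow> D k = 0" for k
    using \<open>D n \<noteq> 0\<close> LeastI[of "\<lambda>n. D n \<noteq> 0" n] Least_le[of "\<lambda>n. D n \<noteq> 0" n] not_less_Least[of k "\<lambda>n. D n \<noteq> 0"]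
    unfolding m_def by auto
  have Db: "\<bar>D k\<bar> \<le> 1" for k using assms(1)[of k] by auto
  have D1: "\<bar>D m\<bar> = 1" using assms(1)[of m] Dm by auto
  have geo: "summable (\<lambda>n. (1 / 4) ^ n :: real)" by simp
  have sm: "summable (\<lambda>n. D n / 4 ^ n)"
    by (rule summable_comparison_test'[OF geo, of 0]) (use Db in \<open>auto simp: power_one_over divide_simps\<close>)
  have "(\<Sum>n. D n / 4 ^ n) = (\<Sum>k. D (k + Suc m) / 4 ^ (k + Suc m)) + (\<Sum>k<Suc m. D k / 4 ^ k)"
    by (rule suminf_split_initial_segment[OF sm])
  also have "(\<Sum>k<Suc m. D k / 4 ^ k) = D m / 4 ^ m" using z by simp
  finally have e: "(\<Sum>n. D n / 4 ^ n) = (\<Sum>k. D (k + Suc m) / 4 ^ (k + Suc m)) + D m / 4 ^ m" .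
  have geo2: "summable (\<lambda>k. (1 / 4) ^ k * (1 / 4 ^ Suc m) :: real)"
    using geo by (rule summable_mult2)
  have "\<bar>\<Sum>k. D (k + Suc m) / 4 ^ (k + Suc m)\<bar> \<le> (\<Sum>k. (1 / 4) ^ k * (1 / 4 ^ Suc m))"
    unfolding real_norm_def[symmetric]
    by (rule norm_suminf_le[OF _ geo2])
      (use Db in \<open>auto simp: power_one_over power_add divide_simps\<close>)
  also have "\<dots> = (1 / 3) / 4 ^ m"
    using suminf_mult2[OF geo, of "1 / 4 ^ Suc m"] suminf_geometric[of "1/4 :: real"] by simp
  finally have "\<bar>\<Sum>k. D (k + Suc m) / 4 ^ (k + Suc m)\<bar> \<le> (1 / 3) / 4 ^ m" .
  moreover have "\<bar>D m / 4 ^ m\<bar> = 1 / 4 ^ m" using D1 by (simp add: abs_divide)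
  ultimately have "\<bar>\<Sum>n. D n / 4 ^ n\<bar> \<ge> 1 / 4 ^ m - (1 / 3) / 4 ^ m" unfolding e by linarith
  also have "1 / 4 ^ m - (1 / 3) / 4 ^ m = (2 / 3) * (1 / 4 ^ m :: real)" by simp
  finally have "(2 / 3) * (1 / 4 ^ m) < 1 / (3 * 4 ^ J :: real)" using small by linarith
  moreover have "1 / 4 ^ J \<le> (1 / 4 ^ m :: real)"
    by (intro divide_left_mono power_increasing) (use m \<open>n < J\<close> in auto)
  moreover have "1 / (3 * 4 ^ J) = (1 / 3) * (1 / 4 ^ J :: real)" by simp
  moreover have "0 < (1 / 4 ^ m :: real)" by simp
  ultimately show False by linarith
qed

text \<open>This makes Helly's selection theorem on the line available on \<open>K\<close>.  The base 4 digits of the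
  code of a point record to which members of a countable base it belongs.\<close>

lemma compact_real_coding:
  fixes K :: "'b::euclidean_space set"
  assumes "compact K"
  obtains C :: "real set" and q s where "compact C" "continuous_on C q" "q ` C \<subseteq> K"
    "\<And>x. x \<in> K \<Longrightarrow> s x \<in> C" "\<And>x. x \<in> K \<Longrightarrow> q (s x) = x"
proof -
  obtain B :: "nat \<Rightarrow> 'b set" where B: "\<And>n. open (B n)"
    "\<And>S. open S \<Longrightarrow> \<exists>k. S = \<Union>{B n |n. n \<in> k}"
    by (rule univ_second_countable_sequence) blast
  define b where "b n x = (if x \<in> B n then 1 else 0 :: real)" for n x
  define s where "s x = (\<Sum>n. b n x / 4 ^ n)" for x
  have geo: "summable (\<lambda>n. (1 / 4) ^ n :: real)" by simp
  have sm: "summable (\<lambda>n. b n x / 4 ^ n)" for x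
    by (rule summable_comparison_test'[OF geo, of 0]) (auto simp: b_def power_one_over divide_simps)
  have agree: "x \<in> B n \<longleftrightarrow> y \<in> B n" if "\<bar>s x - s y\<bar> < 1 / (3 * 4 ^ J)" "n < J" for x y n J
  proof -
    have "s x - s y = (\<Sum>n. (b n x - b n y) / 4 ^ n)"
      unfolding s_def by (subst suminf_diff[OF sm sm]) (simp add: diff_divide_distrib)
    then have "b n x - b n y = 0"
      using that by (intro quaternary_separation[where J=J]) (auto simp: b_def)
    then show ?thesis by (auto simp: b_def split: if_splits)
  qed
  have sb: "\<bar>s x\<bar> \<le> 2" for x
  proof -
    have "norm (s x) \<le> (\<Sum>n. (1 / 4) ^ n)"
      unfolding s_def by (rule norm_suminf_le[OF _ geo]) (auto simp: b_def power_one_over divide_simps)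
    also have "\<dots> \<le> 2" using suminf_geometric[of "1/4 :: real"] by simp
    finally show ?thesis by simp
  qed
  \<comment> \<open>Membership in base sets is all that a code records, yet close codes must give
    close points: finitely many base sets, each inside a ball of radius \<open>e / 2\<close>, cover
    \<open>K\<close>, and \<open>J\<close> exceeds all their indices.\<close>
  have fine: "\<exists>d>0. \<forall>x\<in>K. \<forall>y\<in>K. \<bar>s x - s y\<bar> < d \<longrightarrow> dist x y < e" if e: "0 < e" for e
  proof -
    have "\<exists>n. x \<in> B n \<and> B n \<subseteq> ball x (e / 2)" for x
    proof -
      obtain k where k: "ball x (e / 2) = \<Union>{B n |n. n \<in> k}" using B(2)[OF open_ball] by blast
      then have "x \<in> \<Union>{B n |n. n \<in> k}" using e by (metis centre_in_ball half_gt_zero)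
      with k show ?thesis by blast
    qed
    then obtain n where n: "\<And>x. x \<in> B (n x)" "\<And>x. B (n x) \<subseteq> ball x (e / 2)" by metis
    have "K \<subseteq> (\<Union>x\<in>K. B (n x))" using n(1) by blast
    then obtain F where F: "F \<subseteq> K" "finite F" "K \<subseteq> (\<Union>x\<in>F. B (n x))"
      using compactE_image[OF assms, of K "\<lambda>x. B (n x)"] B(1) by blast
    define J where "J = Suc (Max (insert 0 (n ` F)))"
    have J: "n x < J" if "x \<in> F" for x
      using that F(2) by (auto simp: J_def le_imp_less_Suc)
    show ?thesis
    proof (intro exI[of _ "1 / (3 * 4 ^ J)"] conjI ballI impI)
      fix x y assume xy: "x \<in> K" "y \<in> K" "\<bar>s x - s y\<bar> < 1 / (3 * 4 ^ J)"
      obtain z where z: "z \<in> F" "x \<in> B (n z)" using F(3) xy(1) by blast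
      then have "y \<in> B (n z)" using agree[OF xy(3) J] by blast
      then have "x \<in> ball z (e / 2)" "y \<in> ball z (e / 2)" using z n(2) by blast+
      then show "dist x y < e" by (metis dist_commute dist_triangle_half_r mem_ball)
    qed simp
  qed
  have inj: "inj_on s K"
  proof (rule inj_onI, rule ccontr)
    fix x y assume xy: "x \<in> K" "y \<in> K" "s x = s y" "x \<noteq> y"
    then have "0 < dist x y" by simp
    from fine[OF this] obtain d where "0 < d" "\<bar>s x - s y\<bar> < d \<longrightarrow> dist x y < dist x y"
      using xy(1,2) by blast
    then show False using xy(3) by simp
  qed
  have inv: "inv_into K s (s x) = x" if "x \<in> K" for x
    by (rule inv_into_f_f[OF inj that])
  have uc: "uniformly_continuous_on (s ` K) (inv_into K s)"
    unfolding uniformly_continuous_on_def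
  proof (intro allI impI)
    fix e :: real assume "0 < e"
    from fine[OF this] obtain d where d: "d > 0" "\<forall>x\<in>K. \<forall>y\<in>K. \<bar>s x - s y\<bar> < d \<longrightarrow> dist x y < e" by blast
    then show "\<exists>d>0. \<forall>x\<in>s ` K. \<forall>x'\<in>s ` K. dist x' x < d \<longrightarrow> dist (inv_into K s x') (inv_into K s x) < e"
      by (intro exI[of _ d]) (auto simp: inv dist_real_def)
  qed
  \<comment> \<open>The coding map \<open>s\<close> need not be continuous, and its image need not
    be closed. Decoding is uniformly continuous, however, and therefore extends to the closure of
    the codes.\<close>
  obtain q where q: "uniformly_continuous_on (closure (s ` K)) q" "\<And>y. y \<in> s ` K \<Longrightarrow> inv_into K s y = q y"
    using uniformly_continuous_on_extension_on_closure[OF uc] by metis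
  have cq: "continuous_on (closure (s ` K)) q"
    using q(1) uniformly_continuous_imp_continuous by blast
  show thesis
  proof
    have "bounded (s ` K)" using sb by (auto simp: bounded_iff)
    then show "compact (closure (s ` K))" by (simp add: compact_closure)
    show "q ` closure (s ` K) \<subseteq> K"
      by (rule image_closure_subset[OF cq compact_imp_closed[OF assms]]) (use q(2) inv in force)
    show "s x \<in> closure (s ` K)" if "x \<in> K" for x
      using that closure_subset by fastforce
    show "q (s x) = x" if "x \<in> K" for x
      using q(2)[of "s x"] inv that by auto
  qed (rule cq)
qed

section \<open>Measures on a quotient of a compact set\<close>

text \<open>The quotient \<open>\<Theta> ` K\<close> carries no topology of its own: a function on it counts as continuous if its
  pullback to the compact set \<open>K\<close> is.\<close>

definition quotient_baire :: "'b::topological_space set \<Rightarrow> ('b \<Rightarrow> 'z) \<Rightarrow> 'z measure" where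
  "quotient_baire K \<Theta> = sigma (\<Theta> ` K) {{z \<in> \<Theta> ` K. 0 < f z} |f :: 'z \<Rightarrow> real. continuous_on K (f \<circ> \<Theta>)}"

lemma space_quotient_baire [simp]: "space (quotient_baire K \<Theta>) = \<Theta> ` K"
  unfolding quotient_baire_def by (rule space_measure_of) auto

lemma sets_quotient_baire:
  "sets (quotient_baire K \<Theta>) =
    sigma_sets (\<Theta> ` K) {{z \<in> \<Theta> ` K. 0 < f z} |f :: 'z \<Rightarrow> real. continuous_on K (f \<circ> \<Theta>)}"
  unfolding quotient_baire_def by (rule sets_measure_of) auto

lemma measurable_from_quotient_baire:
  fixes f :: "'z \<Rightarrow> real"
  assumes "continuous_on K (f \<circ> \<Theta>)"
  shows "f \<in> borel_measurable (quotient_baire K \<Theta>)"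
  unfolding borel_measurable_iff_greater
proof
  fix a
  have "continuous_on K ((\<lambda>z. f z - a) \<circ> \<Theta>)"
    using assms by (auto simp: comp_def intro: continuous_intros)
  then have "{z \<in> \<Theta> ` K. 0 < f z - a} \<in> sets (quotient_baire K \<Theta>)"
    unfolding sets_quotient_baire by (intro sigma_sets.Basic CollectI exI conjI) (rule refl)
  then show "{w \<in> space (quotient_baire K \<Theta>). a < f w} \<in> sets (quotient_baire K \<Theta>)"
    by simp
qed

lemma measurable_into_quotient_baire:
  assumes "\<And>x. x \<in> space N \<Longrightarrow> h x \<in> \<Theta> ` K"
    and "\<And>f :: 'z \<Rightarrow> real. continuous_on K (f \<circ> \<Theta>) \<Longrightarrow> (\<lambda>x. f (h x)) \<in> borel_measurable N"
  shows "h \<in> measurable N (quotient_baire K \<Theta>)"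
  unfolding quotient_baire_def
proof (rule measurable_measure_of)
  fix A assume "A \<in> {{z \<in> \<Theta> ` K. 0 < f z} |f :: 'z \<Rightarrow> real. continuous_on K (f \<circ> \<Theta>)}"
  then obtain f :: "'z \<Rightarrow> real" where f: "continuous_on K (f \<circ> \<Theta>)" and A: "A = {z \<in> \<Theta> ` K. 0 < f z}" by blast
  have "h -` A \<inter> space N = {x \<in> space N. 0 < f (h x)}" using assms(1) A by auto
  also have "\<dots> \<in> sets N" using assms(2)[OF f] by measurable
  finally show "h -` A \<inter> space N \<in> sets N" .
qed (use assms(1) in auto)

lemma continuous_quotient_bounded:
  fixes f :: "'z \<Rightarrow> real"
  assumes "compact K" "continuous_on K (f \<circ> \<Theta>)"
  obtains B where "0 \<le> B" "\<And>z. z \<in> \<Theta> ` K \<Longrightarrow> \<bar>f z\<bar> \<le> B"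
proof -
  have "bounded ((f \<circ> \<Theta>) ` K)"
    using assms compact_continuous_image compact_imp_bounded by blast
  then obtain B where "0 < B" "\<And>y. y \<in> (f \<circ> \<Theta>) ` K \<Longrightarrow> norm y \<le> B" using bounded_pos by metis
  then show thesis by (intro that[of B]) auto
qed

text \<open>The functions \<open>min 1 (n * max 0 f)\<close> increase to the indicator of
  \<open>{0 < f}\<close>, so integrals of continuous functions determine the measures of these sets.
  They are stable under intersection because the minimum of two continuous functions is
  continuous.\<close>

lemma quotient_baire_measure_eqI:
  fixes M N :: "'z measure"
  assumes K: "compact K" and M: "prob_space M" "sets M = sets (quotient_baire K \<Theta>)"
    and N: "prob_space N" "sets N = sets (quotient_baire K \<Theta>)"
    and eq: "\<And>f :: 'z \<Rightarrow> real. continuous_on K (f \<circ> \<Theta>) \<Longrightarrow> integral\<^sup>L M f = integral\<^sup>L N f"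
  shows "M = N"
proof -
  have conv: "(\<lambda>n. integral\<^sup>L P (\<lambda>z. min 1 (real n * max 0 (f z)))) \<longlonglongrightarrow> measure P {z \<in> \<Theta> ` K. 0 < f z}"
    if P: "prob_space P" "sets P = sets (quotient_baire K \<Theta>)" and f: "continuous_on K (f \<circ> \<Theta>)"
    for P and f :: "'z \<Rightarrow> real"
  proof -
    interpret P: prob_space P by fact
    have sp: "space P = \<Theta> ` K" using sets_eq_imp_space_eq[OF P(2)] by simp
    have [measurable]: "f \<in> borel_measurable P"
      using measurable_from_quotient_baire[OF f] measurable_cong_sets[OF P(2) refl] by blast
    have "(\<lambda>n. integral\<^sup>L P (\<lambda>z. min 1 (real n * max 0 (f z)))) \<longlonglongrightarrow>
      integral\<^sup>L P (indicator {z \<in> \<Theta> ` K. 0 < f z} :: 'z \<Rightarrow> real)"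
    proof (rule integral_dominated_convergence[where w="\<lambda>_. 1"])
      show "(indicator {z \<in> \<Theta> ` K. 0 < f z} :: 'z \<Rightarrow> real) \<in> borel_measurable P"
        unfolding sp[symmetric] by measurable
      show "AE z in P. (\<lambda>n. min 1 (real n * max 0 (f z))) \<longlonglongrightarrow> indicator {z \<in> \<Theta> ` K. 0 < f z} z"
      proof (rule AE_I2)
        fix z assume z: "z \<in> space P"
        show "(\<lambda>n. min 1 (real n * max 0 (f z))) \<longlonglongrightarrow> indicator {z \<in> \<Theta> ` K. 0 < f z} z"
        proof (cases "0 < f z")
          case True
          then obtain m where m: "1 < real m * f z" using ex_less_of_nat_mult by blast
          have "eventually (\<lambda>n. min 1 (real n * max 0 (f z)) = 1) sequentially"
          proof (rule eventually_sequentiallyI[of m])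
            fix n assume "m \<le> n"
            then have "real m * f z \<le> real n * f z" using True by (simp add: mult_right_mono)
            then have "1 < real n * f z" using m by linarith
            moreover have "max 0 (f z) = f z" using True by simp
            ultimately show "min 1 (real n * max 0 (f z)) = 1" by simp
          qed
          moreover have "indicator {z \<in> \<Theta> ` K. 0 < f z} z = (1::real)" using True z sp by simp
          ultimately show ?thesis by (simp only: tendsto_eventually)
        next
          case False
          then have "max 0 (f z) = 0" "indicator {z \<in> \<Theta> ` K. 0 < f z} z = (0::real)" by simp_all
          then show ?thesis by simp
        qed
      qed
    qed (auto simp: min_def)
    moreover have "{z \<in> \<Theta> ` K. 0 < f z} \<in> sets P" unfolding sp[symmetric] by measurable
    ultimately show ?thesis by simp
  qed
  let ?G = "{{z \<in> \<Theta> ` K. 0 < f z} |f :: 'z \<Rightarrow> real. continuous_on K (f \<circ> \<Theta>)}"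
  show ?thesis
  proof (rule measure_eqI_generator_eq[where E="?G" and \<Omega>="\<Theta> ` K" and A="\<lambda>_. \<Theta> ` K"])
    show "Int_stable ?G"
    proof (rule Int_stableI)
      fix a b assume "a \<in> ?G" "b \<in> ?G"
      then obtain f h :: "'z \<Rightarrow> real" where fh: "continuous_on K (f \<circ> \<Theta>)" "continuous_on K (h \<circ> \<Theta>)"
        "a = {z \<in> \<Theta> ` K. 0 < f z}" "b = {z \<in> \<Theta> ` K. 0 < h z}" by blast
      have "continuous_on K ((\<lambda>z. min (f z) (h z)) \<circ> \<Theta>)"
        using continuous_on_min[OF fh(1,2)] by (simp add: comp_def)
      moreover have "a \<inter> b = {z \<in> \<Theta> ` K. 0 < min (f z) (h z)}" using fh by auto
      ultimately show "a \<inter> b \<in> ?G"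
        by (intro CollectI exI[of _ "\<lambda>z. min (f z) (h z)"] conjI)
    qed
    have "\<Theta> ` K \<in> ?G"
      by (intro CollectI exI[of _ "\<lambda>_. 1"]) (auto simp: comp_def)
    then show "range (\<lambda>_::nat. \<Theta> ` K) \<subseteq> ?G" by blast
    fix X assume "X \<in> ?G"
    then obtain f :: "'z \<Rightarrow> real" where f: "continuous_on K (f \<circ> \<Theta>)" "X = {z \<in> \<Theta> ` K. 0 < f z}" by blast
    have c: "continuous_on K ((\<lambda>z. min 1 (real n * max 0 (f z))) \<circ> \<Theta>)" for n
      using f(1) unfolding comp_def by (intro continuous_intros)
    have "(\<lambda>n. integral\<^sup>L N (\<lambda>z. min 1 (real n * max 0 (f z)))) \<longlonglongrightarrow> measure M X"
      using conv[OF M f(1)] eq[OF c] f(2) by simp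
    then have "measure M X = measure N X"
      using conv[OF N f(1)] f(2) LIMSEQ_unique by blast
    then show "emeasure M X = emeasure N X"
      using finite_measure.emeasure_eq_measure prob_space.finite_measure M(1) N(1) by metis
  next
    show "emeasure M (\<Theta> ` K) \<noteq> \<infinity>" for i :: nat
      using finite_measure.emeasure_finite[OF prob_space.finite_measure[OF M(1)]] by simp
  qed (auto simp: M N sets_quotient_baire)
qed


text \<open>The samples are lifted to \<open>K\<close> and pushed to the line by the code map, where
  boundedness gives tightness and a weakly convergent subsequence. The limit \<open>L\<close> is
  carried back by decoding; test functions reach the line through \<open>q\<close> and are extended
  from \<open>C\<close> by Tietze's theorem.\<close>

lemma empirical_limit:
  fixes \<Theta> :: "'b::euclidean_space \<Rightarrow> 'z" and N :: "nat \<Rightarrow> nat"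
  assumes K: "compact K" and N: "\<And>n. 0 < N n" and zs: "\<And>n j. zs n j \<in> \<Theta> ` K"
  obtains \<nu> and r :: "nat \<Rightarrow> nat" where "strict_mono r" "prob_space \<nu>"
    "sets \<nu> = sets (quotient_baire K \<Theta>)"
    "\<And>f :: 'z \<Rightarrow> real. continuous_on K (f \<circ> \<Theta>) \<Longrightarrow>
      (\<lambda>n. (\<Sum>j<N (r n). f (zs (r n) j)) / real (N (r n))) \<longlonglongrightarrow> integral\<^sup>L \<nu> f"
proof -
  obtain C :: "real set" and q s where C: "compact C" and q: "continuous_on C q" "q ` C \<subseteq> K"
    and s: "\<And>x. x \<in> K \<Longrightarrow> s x \<in> C" "\<And>x. x \<in> K \<Longrightarrow> q (s x) = x"
    using compact_real_coding[OF K] by blast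
  have "\<exists>k. k \<in> K \<and> \<Theta> k = zs n j" for n j using zs[of n j] by auto
  then obtain k where k: "\<And>n j. k n j \<in> K" "\<And>n j. \<Theta> (k n j) = zs n j" by metis
  define P where "P n = distr (measure_pmf (pmf_of_set {..<N n})) borel (\<lambda>j. s (k n j))" for n
  have rd: "real_distribution (P n)" for n
    unfolding P_def by (intro real_distribution.intro real_distribution_axioms.intro
      prob_space.prob_space_distr prob_space_measure_pmf) auto
  have int_P: "integral\<^sup>L (P n) h = (\<Sum>j<N n. h (s (k n j))) / real (N n)"
    if [measurable]: "h \<in> borel_measurable borel" for h :: "real \<Rightarrow> real" and n
  proof -
    have "{..<N n} \<noteq> {}" using N[of n] by auto
    then show ?thesis
      unfolding P_def by (subst integral_distr) (auto simp: integral_pmf_of_set)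
  qed
  obtain b where b: "0 < b" "\<And>y. y \<in> C \<Longrightarrow> \<bar>y\<bar> < b"
    using compact_imp_bounded[OF C] unfolding bounded_pos_less by auto
  have "tight P"
    unfolding tight_def
  proof (intro conjI allI impI)
    fix e :: real assume "0 < e"
    have "measure (P n) {-b<..b} = 1" for n
    proof -
      have "(\<lambda>j. s (k n j)) -` {-b<..b} = UNIV"
      proof (intro equalityI subsetI)
        fix j
        have "\<bar>s (k n j)\<bar> < b" by (intro b(2) s(1) k(1))
        then show "j \<in> (\<lambda>j. s (k n j)) -` {-b<..b}" by auto
      qed simp
      then have "measure (P n) {-b<..b} = measure (measure_pmf (pmf_of_set {..<N n})) UNIV"
        unfolding P_def by (subst measure_distr) auto
      then show ?thesis using measure_pmf.prob_space by simp
    qed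
    then show "\<exists>a b. a < b \<and> (\<forall>n. 1 - e < measure (P n) {a<..b})"
      using b(1) \<open>0 < e\<close> by (intro exI[of _ "-b"] exI[of _ b]) auto
  qed (rule rd)
  from tight_imp_convergent_subsubsequence[OF this strict_mono_id]
  obtain r and L :: "real measure" where r: "strict_mono (r :: nat \<Rightarrow> nat)" and L: "real_distribution L"
    and w: "weak_conv_m (P \<circ> id \<circ> r) L" by blast
  interpret L: real_distribution L by fact
  have conv: "(\<lambda>n. (\<Sum>j<N (r n). h (s (k (r n) j))) / real (N (r n))) \<longlonglongrightarrow> integral\<^sup>L L h"
    if h: "continuous_on UNIV h" and hb: "\<And>x. \<bar>h x\<bar> \<le> B" for h :: "real \<Rightarrow> real" and B
  proof -
    have "(\<lambda>n. integral\<^sup>L ((P \<circ> id \<circ> r) n) h) \<longlonglongrightarrow> integral\<^sup>L L h"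
      by (rule weak_conv_imp_integral_bdd_continuous_conv[OF _ L w, where B=B])
        (use rd h hb in \<open>auto simp: continuous_on_eq_continuous_at\<close>)
    then show ?thesis using int_P[OF borel_measurable_continuous_onI[OF h]] by simp
  qed
  show thesis
  proof (cases "C = {}")
    case True
    then show ?thesis using s(1)[OF k(1)[of 0 0]] by blast
  next
    case False
    then obtain c0 where c0: "c0 \<in> C" by blast
    have cl: "closed C" using C by (rule compact_imp_closed)
    have Cb[measurable]: "C \<in> sets borel" using cl by (rule borel_closed)
    \<comment> \<open>The truncated distance to \<open>C\<close> is a continuous test function that
      vanishes at all samples. Its integral under \<open>L\<close> is therefore 0, which puts
      \<open>L\<close> on the closed set \<open>C\<close>.\<close>
    define h where "h x = min 1 (infdist x C)" for x
    have hc: "continuous_on UNIV h" unfolding h_def by (intro continuous_intros)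
    have hb: "\<bar>h x\<bar> \<le> 1" for x unfolding h_def using infdist_nonneg[of x C] by auto
    have "h (s (k n j)) = 0" for n j using s(1)[OF k(1)] by (simp add: h_def)
    then have "integral\<^sup>L L h = 0"
      using LIMSEQ_unique[OF conv[OF hc hb]] by simp
    moreover have "integrable L h"
      by (rule L.integrable_const_bound[where B=1])
        (use hb borel_measurable_continuous_onI[OF hc] in auto)
    ultimately have "AE x in L. h x = 0"
      using integral_nonneg_eq_0_iff_AE[of L h] by (auto simp: h_def infdist_nonneg)
    then have AEC: "AE x in L. x \<in> C"
      by (rule AE_mp) (use in_closed_iff_infdist_zero[OF cl False] in \<open>auto simp: h_def min_def split: if_splits\<close>)
    \<comment> \<open>The value at \<open>c0\<close> only makes \<open>Q\<close> total; it is used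
      off \<open>C\<close>, on a null set.\<close>
    define Q where "Q x = \<Theta> (q (if x \<in> C then x else c0))" for x
    have meas: "Q \<in> measurable L (quotient_baire K \<Theta>)"
    proof (rule measurable_into_quotient_baire)
      show "Q x \<in> \<Theta> ` K" for x using q(2) c0 by (auto simp: Q_def)
      fix f :: "'z \<Rightarrow> real" assume f: "continuous_on K (f \<circ> \<Theta>)"
      have c: "continuous_on C (\<lambda>x. f (\<Theta> (q x)))"
        using continuous_on_compose2[OF f q] by (simp add: comp_def)
      have "(\<lambda>x. if x \<in> C then f (\<Theta> (q x)) else f (\<Theta> (q c0))) \<in> borel_measurable borel"
        by (rule borel_measurable_continuous_on_if[OF Cb c]) simp
      moreover have "(\<lambda>x. f (Q x)) = (\<lambda>x. if x \<in> C then f (\<Theta> (q x)) else f (\<Theta> (q c0)))"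
        by (auto simp: Q_def)
      ultimately show "(\<lambda>x. f (Q x)) \<in> borel_measurable L" by simp
    qed
    define \<nu> where "\<nu> = distr L (quotient_baire K \<Theta>) Q"
    show ?thesis
    proof (rule that[OF r])
      show "prob_space \<nu>" unfolding \<nu>_def by (rule L.prob_space_distr[OF meas])
      show "sets \<nu> = sets (quotient_baire K \<Theta>)" by (simp add: \<nu>_def)
      fix f :: "'z \<Rightarrow> real" assume f: "continuous_on K (f \<circ> \<Theta>)"
      obtain B where B: "0 \<le> B" "\<And>z. z \<in> \<Theta> ` K \<Longrightarrow> \<bar>f z\<bar> \<le> B"
        using continuous_quotient_bounded[OF K f] by blast
      have c: "continuous_on C (\<lambda>x. f (\<Theta> (q x)))"
        using continuous_on_compose2[OF f q] by (simp add: comp_def)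
      obtain g where g: "continuous_on UNIV g" "\<And>x. x \<in> C \<Longrightarrow> g x = f (\<Theta> (q x))"
        "\<And>x. x \<in> UNIV \<Longrightarrow> norm (g x) \<le> B"
        by (rule Tietze[of C "\<lambda>x. f (\<Theta> (q x))" UNIV B]) (use c cl B q(2) in auto)
      have "(\<lambda>n. (\<Sum>j<N (r n). g (s (k (r n) j))) / real (N (r n))) \<longlonglongrightarrow> integral\<^sup>L L g"
        by (rule conv[OF g(1)]) (use g(3) in auto)
      moreover have "g (s (k n j)) = f (zs n j)" for n j
        using g(2)[OF s(1)[OF k(1)]] s(2)[OF k(1)] k(2) by simp
      moreover have "integral\<^sup>L L g = integral\<^sup>L \<nu> f"
      proof -
        have "integral\<^sup>L \<nu> f = integral\<^sup>L L (\<lambda>x. f (Q x))"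
          unfolding \<nu>_def by (rule integral_distr[OF meas measurable_from_quotient_baire[OF f]])
        also have "\<dots> = integral\<^sup>L L g"
          by (rule integral_cong_AE)
            (use AEC g measurable_compose[OF meas measurable_from_quotient_baire[OF f]]
              borel_measurable_continuous_onI[OF g(1)] in \<open>auto simp: Q_def\<close>)
        finally show ?thesis ..
      qed
      ultimately show "(\<lambda>n. (\<Sum>j<N (r n). f (zs (r n) j)) / real (N (r n))) \<longlonglongrightarrow> integral\<^sup>L \<nu> f"
        by simp
    qed
  qed
qed


section \<open>Flows on a compact quotient\<close>

text \<open>The image of \<open>K\<close> has no topology and \<open>\<Theta>\<close> may identify
  codes, so continuity of the flow can only be expressed through test functions \<open>f\<close> and
  their pullbacks.\<close>

locale quotient_flow =
  fixes K :: "'b::euclidean_space set" and \<Theta> :: "'b \<Rightarrow> 'z" and \<Psi> :: "real \<Rightarrow> 'z \<Rightarrow> 'z"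
  assumes compact_K: "compact K"
    and flow_in: "z \<in> \<Theta> ` K \<Longrightarrow> \<Psi> t z \<in> \<Theta> ` K"
    and flow_add: "z \<in> \<Theta> ` K \<Longrightarrow> \<Psi> (s + t) z = \<Psi> s (\<Psi> t z)"
    and flow_zero: "z \<in> \<Theta> ` K \<Longrightarrow> \<Psi> 0 z = z"
    and flow_cont: "\<And>f :: 'z \<Rightarrow> real. continuous_on K (f \<circ> \<Theta>) \<Longrightarrow>
      continuous_on (UNIV \<times> K) (\<lambda>(t, k). f (\<Psi> t (\<Theta> k)))"
begin

definition cocycle :: "(real \<Rightarrow> 'z \<Rightarrow> real) \<Rightarrow> bool" where
  "cocycle a \<longleftrightarrow> (\<forall>s t. \<forall>z\<in>\<Theta> ` K. a (s + t) z = a s (\<Psi> t z) + a t z) \<and>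
    continuous_on (UNIV \<times> K) (\<lambda>(t, k). a t (\<Theta> k))"

definition invariant_prob :: "'z measure \<Rightarrow> bool" where
  "invariant_prob \<nu> \<longleftrightarrow> prob_space \<nu> \<and> sets \<nu> = sets (quotient_baire K \<Theta>) \<and>
    (\<forall>t. \<Psi> t \<in> measurable \<nu> \<nu>) \<and> (\<forall>t. distr \<nu> \<nu> (\<Psi> t) = \<nu>)"

lemma cont_flow_time:
  fixes f :: "'z \<Rightarrow> real"
  assumes "continuous_on K (f \<circ> \<Theta>)"
  shows "continuous_on K ((\<lambda>z. f (\<Psi> t z)) \<circ> \<Theta>)"
proof -
  have "continuous_on K (\<lambda>k. (\<lambda>(t, k). f (\<Psi> t (\<Theta> k))) (t, k))"
    by (rule continuous_on_compose2[OF flow_cont[OF assms]]) (auto intro!: continuous_intros)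
  then show ?thesis by (simp add: comp_def)
qed

lemma cont_flow_point:
  fixes f :: "'z \<Rightarrow> real"
  assumes "continuous_on K (f \<circ> \<Theta>)" "z \<in> \<Theta> ` K"
  shows "continuous_on UNIV (\<lambda>t. f (\<Psi> t z))"
proof -
  obtain k where k: "k \<in> K" "z = \<Theta> k" using assms(2) by blast
  have "continuous_on UNIV (\<lambda>t. (\<lambda>(t, k). f (\<Psi> t (\<Theta> k))) (t, k))"
    by (rule continuous_on_compose2[OF flow_cont[OF assms(1)]]) (use k in \<open>auto intro!: continuous_intros\<close>)
  then show ?thesis using k by simp
qed

section \<open>Additive cocycles and invariant measures\<close>

lemma cocycle_cont:
  assumes "cocycle a"
  shows "continuous_on K (a t \<circ> \<Theta>)"
proof -
  have "continuous_on K (\<lambda>k. (\<lambda>(t, k). a t (\<Theta> k)) (t, k))"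
    by (rule continuous_on_compose2[of "UNIV \<times> K"]) (use assms in \<open>auto simp: cocycle_def intro!: continuous_intros\<close>)
  then show ?thesis by (simp add: comp_def)
qed

lemma cocycle_add: "cocycle a \<Longrightarrow> z \<in> \<Theta> ` K \<Longrightarrow> a (s + t) z = a s (\<Psi> t z) + a t z"
  unfolding cocycle_def by blast

lemma cocycle_zero: "cocycle a \<Longrightarrow> z \<in> \<Theta> ` K \<Longrightarrow> a 0 z = 0"
  using cocycle_add[of a z 0 0] flow_zero[of z] by simp

lemma cocycle_bounded:
  assumes "cocycle a"
  obtains B where "0 \<le> B" "\<And>t z. 0 \<le> t \<Longrightarrow> t \<le> T \<Longrightarrow> z \<in> \<Theta> ` K \<Longrightarrow> \<bar>a t z\<bar> \<le> B"
proof -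
  have "continuous_on ({0..T} \<times> K) (\<lambda>(t, k). a t (\<Theta> k))"
    using assms unfolding cocycle_def by (auto elim: continuous_on_subset)
  then have "bounded ((\<lambda>(t, k). a t (\<Theta> k)) ` ({0..T} \<times> K))"
    by (intro compact_imp_bounded compact_continuous_image compact_Times compact_K) auto
  then obtain B where B: "0 < B" "\<And>y. y \<in> (\<lambda>(t, k). a t (\<Theta> k)) ` ({0..T} \<times> K) \<Longrightarrow> norm y \<le> B"
    using bounded_pos by metis
  show thesis
  proof (rule that[of B])
    fix t z assume "0 \<le> t" "t \<le> T" "z \<in> \<Theta> ` K"
    then show "\<bar>a t z\<bar> \<le> B" by (intro B(2)[unfolded real_norm_def]) force
  qed (use B in simp)
qed

lemma flow_measurable:
  assumes "sets \<nu> = sets (quotient_baire K \<Theta>)"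
  shows "\<Psi> t \<in> measurable \<nu> \<nu>"
proof -
  have sp: "space \<nu> = \<Theta> ` K" using sets_eq_imp_space_eq[OF assms] by simp
  have "\<Psi> t \<in> measurable \<nu> (quotient_baire K \<Theta>)"
  proof (rule measurable_into_quotient_baire)
    fix f :: "'z \<Rightarrow> real" assume "continuous_on K (f \<circ> \<Theta>)"
    from measurable_from_quotient_baire[OF cont_flow_time[OF this]]
    show "(\<lambda>z. f (\<Psi> t z)) \<in> borel_measurable \<nu>"
      using measurable_cong_sets[OF assms refl] by blast
  qed (use sp flow_in in auto)
  then show ?thesis using measurable_cong_sets[OF refl assms] by blast
qed

text \<open>The times that preserve all integrals of continuous functions form a group; it contains
  every \<open>1 / n\<close>, hence the rationals, and is closed by dominated convergence. Empirical
  measures show their invariance directly only for the times \<open>1 / n\<close>.\<close>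

lemma invariant_probI:
  assumes \<nu>: "prob_space \<nu>" "sets \<nu> = sets (quotient_baire K \<Theta>)"
    and inv: "\<And>f :: 'z \<Rightarrow> real. \<And>n. continuous_on K (f \<circ> \<Theta>) \<Longrightarrow> 0 < n \<Longrightarrow>
      integral\<^sup>L \<nu> (\<lambda>z. f (\<Psi> (1 / real n) z)) = integral\<^sup>L \<nu> f"
  shows "invariant_prob \<nu>"
proof -
  interpret prob_space \<nu> by fact
  have sp: "space \<nu> = \<Theta> ` K" using sets_eq_imp_space_eq[OF \<nu>(2)] by simp
  define S where "S = {t. \<forall>f :: 'z \<Rightarrow> real. continuous_on K (f \<circ> \<Theta>) \<longrightarrow>
    integral\<^sup>L \<nu> (\<lambda>z. f (\<Psi> t z)) = integral\<^sup>L \<nu> f}"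
  have SD: "integral\<^sup>L \<nu> (\<lambda>z. f (\<Psi> t z)) = integral\<^sup>L \<nu> f" if "t \<in> S" "continuous_on K (f \<circ> \<Theta>)" for t and f :: "'z \<Rightarrow> real"
    using that unfolding S_def by blast
  have add: "s + t \<in> S" if "s \<in> S" "t \<in> S" for s t
    unfolding S_def
  proof (intro CollectI allI impI)
    fix f :: "'z \<Rightarrow> real" assume f: "continuous_on K (f \<circ> \<Theta>)"
    have "integral\<^sup>L \<nu> (\<lambda>z. f (\<Psi> (s + t) z)) = integral\<^sup>L \<nu> (\<lambda>z. f (\<Psi> s (\<Psi> t z)))"
      by (rule Bochner_Integration.integral_cong) (use flow_add sp in auto)
    also have "\<dots> = integral\<^sup>L \<nu> (\<lambda>z. f (\<Psi> s z))"
      by (rule SD[OF \<open>t \<in> S\<close> cont_flow_time[OF f]])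
    also have "\<dots> = integral\<^sup>L \<nu> f" by (rule SD[OF \<open>s \<in> S\<close> f])
    finally show "integral\<^sup>L \<nu> (\<lambda>z. f (\<Psi> (s + t) z)) = integral\<^sup>L \<nu> f" .
  qed
  have neg: "- t \<in> S" if "t \<in> S" for t
    unfolding S_def
  proof (intro CollectI allI impI)
    fix f :: "'z \<Rightarrow> real" assume f: "continuous_on K (f \<circ> \<Theta>)"
    have "integral\<^sup>L \<nu> (\<lambda>z. f (\<Psi> (- t) z)) = integral\<^sup>L \<nu> (\<lambda>z. f (\<Psi> (- t) (\<Psi> t z)))"
      by (rule SD[OF \<open>t \<in> S\<close> cont_flow_time[OF f], symmetric])
    also have "\<dots> = integral\<^sup>L \<nu> f"
      by (rule Bochner_Integration.integral_cong) (use flow_add[of _ "-t" t] flow_zero sp in auto)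
    finally show "integral\<^sup>L \<nu> (\<lambda>z. f (\<Psi> (- t) z)) = integral\<^sup>L \<nu> f" .
  qed
  have nat_mult: "real k * t \<in> S" if "t \<in> S" for k t
  proof (induction k)
    case 0
    show ?case using add[OF that neg[OF that]] by simp
  next
    case (Suc k)
    show ?case using add[OF that Suc] by (simp add: algebra_simps)
  qed
  have rat: "of_int i / real n \<in> S" if "0 < n" for i n
  proof -
    have b: "1 / real n \<in> S" using inv that unfolding S_def by blast
    show ?thesis
    proof (cases "0 \<le> i")
      case True
      then show ?thesis using nat_mult[OF b, of "nat i"] by simp
    next
      case False
      then show ?thesis using neg[OF nat_mult[OF b, of "nat (- i)"]] by simp
    qed
  qed
  have all: "t \<in> S" for t
    unfolding S_def
  proof (intro CollectI allI impI)
    fix f :: "'z \<Rightarrow> real" assume f: "continuous_on K (f \<circ> \<Theta>)"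
    obtain B where B: "0 \<le> B" "\<And>z. z \<in> \<Theta> ` K \<Longrightarrow> \<bar>f z\<bar> \<le> B"
      using continuous_quotient_bounded[OF compact_K f] by blast
    define u where "u n = of_int \<lfloor>t * real (Suc n)\<rfloor> / real (Suc n)" for n
    have u: "u \<longlonglongrightarrow> t"
    proof (rule Lim_null[THEN iffD2], rule Lim_null_comparison[OF _ LIMSEQ_inverse_real_of_nat], intro always_eventually allI)
      fix n
      have "real (Suc n) * (u n - t) = of_int \<lfloor>t * real (Suc n)\<rfloor> - t * real (Suc n)"
        by (simp add: u_def field_simps)
      then have "\<bar>real (Suc n) * (u n - t)\<bar> \<le> 1" by linarith
      then have "real (Suc n) * \<bar>u n - t\<bar> \<le> 1" by (simp add: abs_mult)
      then show "norm (u n - t) \<le> inverse (real (Suc n))"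
        by (simp add: field_simps)
    qed
    have "(\<lambda>n. integral\<^sup>L \<nu> (\<lambda>z. f (\<Psi> (u n) z))) \<longlonglongrightarrow> integral\<^sup>L \<nu> (\<lambda>z. f (\<Psi> t z))"
    proof (rule integral_dominated_convergence[where w="\<lambda>_. B"])
      have m: "(\<lambda>z. f (\<Psi> t z)) \<in> borel_measurable \<nu>" for t
        using measurable_from_quotient_baire[OF cont_flow_time[OF f]] measurable_cong_sets[OF \<nu>(2) refl] by blast
      show "(\<lambda>z. f (\<Psi> t z)) \<in> borel_measurable \<nu>" "\<And>n. (\<lambda>z. f (\<Psi> (u n) z)) \<in> borel_measurable \<nu>"
        by (rule m)+
      show "AE z in \<nu>. (\<lambda>n. f (\<Psi> (u n) z)) \<longlonglongrightarrow> f (\<Psi> t z)"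
      proof (rule AE_I2)
        fix z assume "z \<in> space \<nu>"
        then have "isCont (\<lambda>t. f (\<Psi> t z)) t"
          using cont_flow_point[OF f] sp by (simp add: continuous_on_eq_continuous_at)
        then show "(\<lambda>n. f (\<Psi> (u n) z)) \<longlonglongrightarrow> f (\<Psi> t z)" using u by (rule isCont_tendsto_compose)
      qed
      show "\<And>n. AE z in \<nu>. norm (f (\<Psi> (u n) z)) \<le> B"
        using B(2) flow_in sp by (intro AE_I2) auto
    qed simp
    moreover have "integral\<^sup>L \<nu> (\<lambda>z. f (\<Psi> (u n) z)) = integral\<^sup>L \<nu> f" for n
      unfolding u_def by (rule SD[OF rat f]) simp
    ultimately show "integral\<^sup>L \<nu> (\<lambda>z. f (\<Psi> t z)) = integral\<^sup>L \<nu> f"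
      by (simp add: LIMSEQ_const_iff)
  qed
  have "distr \<nu> \<nu> (\<Psi> t) = \<nu>" for t
  proof (rule quotient_baire_measure_eqI[OF compact_K])
    show "prob_space (distr \<nu> \<nu> (\<Psi> t))" by (rule prob_space_distr[OF flow_measurable[OF \<nu>(2)]])
    fix f :: "'z \<Rightarrow> real" assume f: "continuous_on K (f \<circ> \<Theta>)"
    have "f \<in> borel_measurable \<nu>"
      using measurable_from_quotient_baire[OF f] measurable_cong_sets[OF \<nu>(2) refl] by blast
    then have "integral\<^sup>L (distr \<nu> \<nu> (\<Psi> t)) f = integral\<^sup>L \<nu> (\<lambda>z. f (\<Psi> t z))"
      by (rule integral_distr[OF flow_measurable[OF \<nu>(2)]])
    then show "integral\<^sup>L (distr \<nu> \<nu> (\<Psi> t)) f = integral\<^sup>L \<nu> f"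
      using SD[OF all f] by simp
  qed (use \<nu> in auto)
  then show ?thesis
    unfolding invariant_prob_def using \<nu> flow_measurable by blast
qed


text \<open>The Krylov-Bogoliubov construction, carried out along orbit segments of length
  \<open>n + 1\<close> on which \<open>d\<close> loses at most 1. These segments start at different
  states, and not along one fixed orbit.\<close>

theorem nonuniform_imp_invariant:
  assumes d: "cocycle d"
    and non: "\<not> (\<exists>C. \<exists>l>0. \<forall>z\<in>\<Theta> ` K. \<forall>t>0. d t z \<le> C - l * t)"
  obtains \<nu> where "invariant_prob \<nu>" "0 \<le> integral\<^sup>L \<nu> (d 1)"
proof -
  \<comment> \<open>If \<open>d (real n)\<close> were at most -1 at every state, concatenating
    blocks of length \<open>n\<close> would give decay at rate \<open>1 / n\<close>. In the constant
    \<open>B + 1\<close>, \<open>B\<close> bounds the incomplete block and 1 pays for rounding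
    \<open>t / n\<close> down.\<close>
  have slow: "\<exists>z\<in>\<Theta> ` K. -1 \<le> d (real n) z" if n: "0 < n" for n
  proof (rule ccontr)
    assume "\<not> ?thesis"
    then have neg: "d (real n) z \<le> -1" if "z \<in> \<Theta> ` K" for z using that by force
    have iter: "d (real j * real n) z \<le> - real j" if "z \<in> \<Theta> ` K" for j z
    proof (induction j)
      case 0
      then show ?case using cocycle_zero[OF d that] by simp
    next
      case (Suc j)
      have "d (real (Suc j) * real n) z = d (real n) (\<Psi> (real j * real n) z) + d (real j * real n) z"
        using cocycle_add[OF d that, of "real n" "real j * real n"] by (simp add: algebra_simps)
      also have "\<dots> \<le> -1 + - real j" by (intro add_mono neg flow_in that Suc)
      finally show ?case by simp
    qed
    obtain B where B: "0 \<le> B" "\<And>t z. 0 \<le> t \<Longrightarrow> t \<le> real n \<Longrightarrow> z \<in> \<Theta> ` K \<Longrightarrow> \<bar>d t z\<bar> \<le> B"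
      using cocycle_bounded[OF d, of "real n"] by blast
    have "d t z \<le> (B + 1) - (1 / real n) * t" if z: "z \<in> \<Theta> ` K" and t: "0 < t" for z t
    proof -
      define j where "j = nat \<lfloor>t / real n\<rfloor>"
      have j: "real j \<le> t / real n" "t / real n < real j + 1"
        unfolding j_def using t n by (auto simp: of_nat_nat)
      have r: "0 \<le> t - real j * real n" "t - real j * real n \<le> real n"
        using j n by (auto simp: field_simps)
      have "d t z = d (t - real j * real n) (\<Psi> (real j * real n) z) + d (real j * real n) z"
        using cocycle_add[OF d z, of "t - real j * real n" "real j * real n"] by simp
      also have "\<dots> \<le> B + - real j"
        using B(2)[OF r flow_in[OF z]] iter[OF z] by (intro add_mono) (auto simp: abs_le_iff)
      also have "\<dots> \<le> (B + 1) - t / real n" using j(2) by linarith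
      finally show ?thesis by simp
    qed
    moreover have "0 < 1 / real n" using n by simp
    ultimately show False using non by blast
  qed
  then have "\<exists>z. z \<in> \<Theta> ` K \<and> -1 \<le> d (real (Suc n)) z" for n by blast
  then obtain z where z: "\<And>n. z n \<in> \<Theta> ` K" and zd: "\<And>n. -1 \<le> d (real (Suc n)) (z n)" by metis
  \<comment> \<open>The segment is sampled at mesh \<open>1 / fact (n + 1)\<close>: as soon as
    \<open>k \<le> n + 1\<close>, a shift by time \<open>1 / k\<close> moves the samples by a whole
    number of places.\<close>
  define m :: "nat \<Rightarrow> nat" where "m n = fact (Suc n)" for n
  have m0: "0 < m n" for n unfolding m_def by simp
  define N where "N n = Suc n * m n" for n
  have Nm: "real (N n) = real (Suc n) * real (m n)" for n unfolding N_def by (rule of_nat_mult)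
  have N0: "0 < N n" for n unfolding N_def using m0 by simp
  define zs where "zs n j = \<Psi> (real j / real (m n)) (z n)" for n j
  have zsK: "zs n j \<in> \<Theta> ` K" for n j unfolding zs_def by (intro flow_in z)
  obtain \<nu> and r :: "nat \<Rightarrow> nat" where r: "strict_mono r" and \<nu>: "prob_space \<nu>"
    "sets \<nu> = sets (quotient_baire K \<Theta>)"
    and lim: "\<And>f :: 'z \<Rightarrow> real. continuous_on K (f \<circ> \<Theta>) \<Longrightarrow>
      (\<lambda>n. (\<Sum>j<N (r n). f (zs (r n) j)) / real (N (r n))) \<longlonglongrightarrow> integral\<^sup>L \<nu> f"
    by (rule empirical_limit[OF compact_K N0 zsK]) (rule that)
  have null: "(\<lambda>n. c / real (Suc (r n))) \<longlonglongrightarrow> 0" for c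
  proof -
    have "(\<lambda>n. c * inverse (real (Suc n))) \<longlonglongrightarrow> 0"
      by (rule tendsto_mult_right_zero[OF LIMSEQ_inverse_real_of_nat])
    from LIMSEQ_subseq_LIMSEQ[OF this r] show ?thesis by (simp add: comp_def divide_inverse)
  qed
  \<comment> \<open>Shifting the window by \<open>i\<close> places exchanges at most
    \<open>i\<close> terms at each end.\<close>
  have shift: "\<bar>(\<Sum>j<n. h (j + i)) - (\<Sum>j<n. h j)\<bar> \<le> 2 * real i * B"
    if "\<And>j. \<bar>h j\<bar> \<le> B" for h :: "nat \<Rightarrow> real" and n i B
  proof -
    have "(\<Sum>j<n + i. h j) = (\<Sum>j<i. h j) + (\<Sum>j<n. h (j + i))"
      by (induction n) (auto simp: algebra_simps)
    moreover have "(\<Sum>j<n + i. h j) = (\<Sum>j<n. h j) + (\<Sum>j<i. h (n + j))"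
      by (induction i) (auto simp: algebra_simps)
    moreover have "\<bar>\<Sum>j<i. h (l + j)\<bar> \<le> real i * B" for l
      using sum_bounded_above[of "{..<i}" "\<lambda>j. \<bar>h (l + j)\<bar>" B] that
      by (intro order_trans[OF sum_abs]) simp
    from this[of 0] this[of n] have "\<bar>\<Sum>j<i. h j\<bar> \<le> real i * B" "\<bar>\<Sum>j<i. h (n + j)\<bar> \<le> real i * B"
      by simp_all
    moreover have "2 * real i * B = real i * B + real i * B" by simp
    ultimately show ?thesis by linarith
  qed
  have "invariant_prob \<nu>"
  proof (rule invariant_probI[OF \<nu>])
    fix f :: "'z \<Rightarrow> real" and k :: nat assume f: "continuous_on K (f \<circ> \<Theta>)" and k: "0 < k"
    let ?f' = "\<lambda>z. f (\<Psi> (1 / real k) z)"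
    obtain B where B: "0 \<le> B" "\<And>z. z \<in> \<Theta> ` K \<Longrightarrow> \<bar>f z\<bar> \<le> B"
      using continuous_quotient_bounded[OF compact_K f] by blast
    have f': "continuous_on K (?f' \<circ> \<Theta>)" by (rule cont_flow_time[OF f])
    have "(\<lambda>n. (\<Sum>j<N (r n). ?f' (zs (r n) j)) / real (N (r n)) -
        (\<Sum>j<N (r n). f (zs (r n) j)) / real (N (r n))) \<longlonglongrightarrow> 0"
    proof (rule Lim_null_comparison[OF _ null[of "2 * B"]], rule eventually_sequentiallyI[of k])
      fix n assume "k \<le> n"
      then have "k \<le> Suc (r n)" using seq_suble[OF r, of n] by linarith
      then have "k dvd m (r n)" unfolding m_def using k by (intro dvd_fact) auto
      then obtain i where i: "m (r n) = k * i" by blast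
      then have ik: "real i / real (m (r n)) = 1 / real k" using m0[of "r n"] by (auto simp: field_simps)
      have "i \<le> k * i" using k by simp
      then have i0: "real i \<le> real (m (r n))" unfolding i by (rule of_nat_mono)
      have e: "?f' (zs (r n) j) = f (zs (r n) (j + i))" for j
      proof -
        have "real (j + i) / real (m (r n)) = 1 / real k + real j / real (m (r n))"
          by (simp add: add_divide_distrib ik)
        then show ?thesis by (simp only: zs_def flow_add[OF z])
      qed
      have "\<bar>(\<Sum>j<N (r n). ?f' (zs (r n) j)) - (\<Sum>j<N (r n). f (zs (r n) j))\<bar> \<le> 2 * real i * B"
        unfolding e by (rule shift) (intro B zsK)
      also have "\<dots> \<le> 2 * real (m (r n)) * B" using i0 B(1) by (intro mult_right_mono) auto
      finally have "\<bar>(\<Sum>j<N (r n). ?f' (zs (r n) j)) - (\<Sum>j<N (r n). f (zs (r n) j))\<bar> / real (N (r n))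
        \<le> 2 * real (m (r n)) * B / real (N (r n))" by (rule divide_right_mono) simp
      also have "\<dots> = 2 * B / real (Suc (r n))" using m0[of "r n"] unfolding Nm by (simp del: of_nat_Suc)
      finally show "norm ((\<Sum>j<N (r n). ?f' (zs (r n) j)) / real (N (r n)) -
        (\<Sum>j<N (r n). f (zs (r n) j)) / real (N (r n))) \<le> 2 * B / real (Suc (r n))"
        unfolding diff_divide_distrib[symmetric] by simp
    qed
    moreover have "(\<lambda>n. (\<Sum>j<N (r n). ?f' (zs (r n) j)) / real (N (r n)) -
        (\<Sum>j<N (r n). f (zs (r n) j)) / real (N (r n))) \<longlonglongrightarrow> integral\<^sup>L \<nu> ?f' - integral\<^sup>L \<nu> f"
      by (intro tendsto_diff lim f f')
    ultimately have "integral\<^sup>L \<nu> ?f' - integral\<^sup>L \<nu> f = 0"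
      by (rule LIMSEQ_unique[rotated])
    then show "integral\<^sup>L \<nu> ?f' = integral\<^sup>L \<nu> f" by simp
  qed
  moreover have "0 \<le> integral\<^sup>L \<nu> (d 1)"
  proof -
    obtain B where B: "0 \<le> B" "\<And>t z. 0 \<le> t \<Longrightarrow> t \<le> 1 \<Longrightarrow> z \<in> \<Theta> ` K \<Longrightarrow> \<bar>d t z\<bar> \<le> B"
      using cocycle_bounded[OF d, of 1] by blast
    \<comment> \<open>The increments of \<open>d\<close> over unit time telescope to the last
      \<open>m n\<close> values of \<open>h\<close> minus the first \<open>m n\<close>. Matching
      entries are a full segment apart, which costs at most 1, and the two partial pieces of
      duration at most 1 cost \<open>B\<close> each.\<close>
    have low: "- (1 + 2 * B) / real (Suc n) \<le> (\<Sum>j<N n. d 1 (zs n j)) / real (N n)" for n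
    proof -
      define h where "h j = d (real j / real (m n)) (z n)" for j
      have e: "d 1 (zs n j) = h (j + m n) - h j" for j
      proof -
        have "real (j + m n) / real (m n) = 1 + real j / real (m n)"
          using m0[of n] by (simp add: add_divide_distrib)
        then show ?thesis
          using cocycle_add[OF d z, of 1 "real j / real (m n)" n] by (simp only: zs_def h_def)
      qed
      have s1: "(\<Sum>j<q + m n. h j) = (\<Sum>j<m n. h j) + (\<Sum>j<q. h (j + m n))" for q
        by (induction q) (auto simp: algebra_simps)
      have s2: "(\<Sum>j<N n + q. h j) = (\<Sum>j<N n. h j) + (\<Sum>j<q. h (N n + j))" for q
        by (induction q) (auto simp: algebra_simps)
      have "(\<Sum>j<N n. d 1 (zs n j)) = (\<Sum>j<N n. h (j + m n)) - (\<Sum>j<N n. h j)"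
        by (simp only: e sum_subtractf)
      also have "\<dots> = (\<Sum>j<m n. h (N n + j)) - (\<Sum>j<m n. h j)"
        using s1[of "N n"] s2[of "m n"] by linarith
      also have "\<dots> = (\<Sum>j<m n. h (N n + j) - h j)" by (simp add: sum_subtractf)
      also have "\<dots> \<ge> (\<Sum>j<m n. - (1 + 2 * B))"
      proof (rule sum_mono)
        fix j assume "j \<in> {..<m n}"
        then have j: "0 \<le> real j / real (m n)" "real j / real (m n) \<le> 1" by auto
        have "h (N n + j) = d (real j / real (m n)) (\<Psi> (real (Suc n)) (z n)) + d (real (Suc n)) (z n)"
        proof -
          have "real (N n + j) / real (m n) = real j / real (m n) + real (Suc n)"
            using m0[of n] unfolding N_def by (simp add: add_divide_distrib)
          then show ?thesis
            using cocycle_add[OF d z, of "real j / real (m n)" "real (Suc n)" n] by (simp only: h_def)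
        qed
        then show "- (1 + 2 * B) \<le> h (N n + j) - h j"
          using B(2)[OF j z[of n]] B(2)[OF j flow_in[OF z[of n], of "real (Suc n)"]] zd[of n]
          unfolding h_def by linarith
      qed
      finally have "real (m n) * - (1 + 2 * B) / real (N n) \<le> (\<Sum>j<N n. d 1 (zs n j)) / real (N n)"
        by (intro divide_right_mono) auto
      moreover have "real (m n) * - (1 + 2 * B) / real (N n) = - (1 + 2 * B) / real (Suc n)"
        using m0[of n] unfolding Nm by (simp del: of_nat_Suc)
      ultimately show ?thesis by simp
    qed
    show ?thesis
      by (rule LIMSEQ_le[OF null[of "- (1 + 2 * B)"] lim[OF cocycle_cont[OF d]]]) (intro exI[of _ 0] allI impI low)
  qed
  ultimately show thesis by (rule that)
qed

text \<open>By additivity the Birkhoff sums of \<open>a 1\<close> under the time-one map are the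
  values \<open>a n\<close>. Between consecutive integers \<open>a\<close> changes by at most
  \<open>B\<close>, which disappears after division by \<open>t\<close>.\<close>

theorem cocycle_average:
  assumes \<nu>: "invariant_prob \<nu>" and a: "cocycle a"
  obtains U where "U \<in> borel_measurable \<nu>" "integrable \<nu> U"
    "AE z in \<nu>. ((\<lambda>t. a t z / t) \<longlongrightarrow> U z) at_top" "integral\<^sup>L \<nu> U = integral\<^sup>L \<nu> (a 1)"
proof -
  interpret prob_space \<nu> using \<nu> unfolding invariant_prob_def by blast
  have st: "sets \<nu> = sets (quotient_baire K \<Theta>)" using \<nu> unfolding invariant_prob_def by blast
  have sp: "space \<nu> = \<Theta> ` K" using sets_eq_imp_space_eq[OF st] by simp
  obtain B where B: "0 \<le> B" "\<And>t z. 0 \<le> t \<Longrightarrow> t \<le> 1 \<Longrightarrow> z \<in> \<Theta> ` K \<Longrightarrow> \<bar>a t z\<bar> \<le> B"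
    using cocycle_bounded[OF a, of 1] by blast
  have am: "a 1 \<in> borel_measurable \<nu>"
    using measurable_from_quotient_baire[OF cocycle_cont[OF a]] measurable_cong_sets[OF st refl] by blast
  have T: "\<Psi> 1 \<in> measurable \<nu> \<nu>" "distr \<nu> \<nu> (\<Psi> 1) = \<nu>"
    using \<nu> unfolding invariant_prob_def by blast+
  have ab: "\<bar>a 1 z\<bar> \<le> B" if "z \<in> space \<nu>" for z using B(2)[of 1 z] that sp by auto
  obtain U where U: "U \<in> borel_measurable \<nu>" "\<And>x. x \<in> space \<nu> \<Longrightarrow> \<bar>U x\<bar> \<le> B"
    and AEU: "AE z in \<nu>. (\<lambda>n. (\<Sum>i<n. a 1 ((\<Psi> 1 ^^ i) z)) / n) \<longlonglongrightarrow> U z"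
    and intU: "integral\<^sup>L \<nu> U = integral\<^sup>L \<nu> (a 1)"
    by (rule birkhoff[OF T am]) (rule ab, assumption, rule that)
  have conv: "((\<lambda>t. a t z / t) \<longlongrightarrow> U z) at_top"
    if z: "z \<in> \<Theta> ` K" and l: "(\<lambda>n. (\<Sum>i<n. a 1 ((\<Psi> 1 ^^ i) z)) / n) \<longlonglongrightarrow> U z" for z
  proof -
    have pow: "(\<Psi> 1 ^^ i) z = \<Psi> (real i) z" for i
      by (induction i) (simp_all add: flow_zero[OF z] flow_add[OF z])
    have sum: "(\<Sum>i<n. a 1 ((\<Psi> 1 ^^ i) z)) = a (real n) z" for n
      by (induction n) (simp_all add: cocycle_zero[OF a z] cocycle_add[OF a z] pow)
    define fl where "fl t = nat \<lfloor>t :: real\<rfloor>" for t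
    have fl: "real (fl t) \<le> t" "t < real (fl t) + 1" if "0 \<le> t" for t
      using that unfolding fl_def by (auto simp: of_nat_nat)
    have flim: "filterlim fl sequentially at_top"
      unfolding fl_def by (intro filterlim_compose[OF filterlim_nat_sequentially] filterlim_floor_sequentially)
    have l1: "((\<lambda>t. a (real (fl t)) z / real (fl t)) \<longlongrightarrow> U z) at_top"
      by (rule filterlim_compose[OF l[unfolded sum] flim])
    have l2: "((\<lambda>t. real (fl t) / t) \<longlongrightarrow> 1) at_top"
    proof (rule real_tendsto_sandwich)
      show "\<forall>\<^sub>F t in at_top. 1 - 1 / t \<le> real (fl t) / t"
        using eventually_gt_at_top[of 0]
      proof eventually_elim
        case (elim t)
        then have "(t - 1) / t \<le> real (fl t) / t" using fl(2)[of t] by (intro divide_right_mono) auto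
        then show ?case using elim by (simp add: diff_divide_distrib)
      qed
      show "\<forall>\<^sub>F t in at_top. real (fl t) / t \<le> 1"
        using eventually_gt_at_top[of 0]
      proof eventually_elim
        case (elim t)
        then show ?case using fl(1)[of t] by (simp add: field_simps)
      qed
      have "((\<lambda>t::real. 1 - 1 / t) \<longlongrightarrow> 1 - 0) at_top"
        by (intro tendsto_intros tendsto_divide_0[OF tendsto_const] filterlim_at_top_imp_at_infinity filterlim_ident)
      then show "((\<lambda>t::real. 1 - 1 / t) \<longlongrightarrow> 1) at_top" by simp
    qed simp
    have l3: "((\<lambda>t. a (t - real (fl t)) (\<Psi> (real (fl t)) z) / t) \<longlongrightarrow> 0) at_top"
    proof (rule Lim_null_comparison)
      show "((\<lambda>t. B / t) \<longlongrightarrow> 0) at_top"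
        by (intro tendsto_divide_0[OF tendsto_const] filterlim_at_top_imp_at_infinity filterlim_ident)
      show "\<forall>\<^sub>F t in at_top. norm (a (t - real (fl t)) (\<Psi> (real (fl t)) z) / t) \<le> B / t"
        using eventually_gt_at_top[of 0]
      proof eventually_elim
        case (elim t)
        have "\<bar>a (t - real (fl t)) (\<Psi> (real (fl t)) z)\<bar> \<le> B"
          using fl[of t] elim by (intro B(2) flow_in z) auto
        then show ?case using elim by (simp add: divide_right_mono)
      qed
    qed
    have "((\<lambda>t. (a (real (fl t)) z / real (fl t)) * (real (fl t) / t) +
        a (t - real (fl t)) (\<Psi> (real (fl t)) z) / t) \<longlongrightarrow> U z * 1 + 0) at_top"
      by (intro tendsto_intros l1 l2 l3)
    then have "((\<lambda>t. (a (real (fl t)) z / real (fl t)) * (real (fl t) / t) +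
        a (t - real (fl t)) (\<Psi> (real (fl t)) z) / t) \<longlongrightarrow> U z) at_top" by simp
    then show ?thesis
    proof (rule Lim_transform_eventually)
      show "\<forall>\<^sub>F t in at_top. (a (real (fl t)) z / real (fl t)) * (real (fl t) / t) +
        a (t - real (fl t)) (\<Psi> (real (fl t)) z) / t = a t z / t"
        using eventually_ge_at_top[of 1]
      proof eventually_elim
        case (elim t)
        then have "0 < real (fl t)" using fl[of t] by linarith
        moreover have "a t z = a (t - real (fl t)) (\<Psi> (real (fl t)) z) + a (real (fl t)) z"
          using cocycle_add[OF a z, of "t - real (fl t)" "real (fl t)"] by simp
        ultimately show ?case by (simp add: add_divide_distrib)
      qed
    qed
  qed
  show thesis
  proof (rule that[OF U(1) _ _ intU])
    show "integrable \<nu> U"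
      by (rule integrable_const_bound[where B=B]) (use U in auto)
    show "AE z in \<nu>. ((\<lambda>t. a t z / t) \<longlongrightarrow> U z) at_top"
      using AEU by (rule AE_mp) (use conv sp in auto)
  qed
qed

text \<open>The last conclusion is a negated almost-everywhere statement, which makes sense without
  measurability of the set of states with negative rate. If it failed, the limit \<open>U\<close> of
  \<open>d t z / t\<close> would be negative almost everywhere although its integral, that of
  \<open>d 1\<close>, is nonnegative.\<close>

theorem nonuniform_imp_nonnegative_average:
  assumes d: "cocycle d"
    and non: "\<not> (\<exists>C. \<exists>l>0. \<forall>z\<in>\<Theta> ` K. \<forall>t>0. d t z \<le> C - l * t)"
  obtains \<nu> where "invariant_prob \<nu>"
    "\<And>a. cocycle a \<Longrightarrow> AE z in \<nu>. \<exists>l. ((\<lambda>t. a t z / t) \<longlongrightarrow> l) at_top"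
    "\<not> (AE z in \<nu>. \<exists>l<0. ((\<lambda>t. d t z / t) \<longlongrightarrow> l) at_top)"
proof -
  obtain \<nu> where \<nu>: "invariant_prob \<nu>" and pos: "0 \<le> integral\<^sup>L \<nu> (d 1)"
    using nonuniform_imp_invariant[OF d non] .
  interpret prob_space \<nu> using \<nu> unfolding invariant_prob_def by blast
  show thesis
  proof (rule that[OF \<nu>])
    fix a assume a: "cocycle a"
    obtain U where "AE z in \<nu>. ((\<lambda>t. a t z / t) \<longlongrightarrow> U z) at_top"
      by (rule cocycle_average[OF \<nu> a]) (rule that)
    then show "AE z in \<nu>. \<exists>l. ((\<lambda>t. a t z / t) \<longlongrightarrow> l) at_top"
      by (rule AE_mp) auto
  next
    obtain U where U: "U \<in> borel_measurable \<nu>" "integrable \<nu> U"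
      "AE z in \<nu>. ((\<lambda>t. d t z / t) \<longlongrightarrow> U z) at_top" "integral\<^sup>L \<nu> U = integral\<^sup>L \<nu> (d 1)"
      by (rule cocycle_average[OF \<nu> d]) (rule that)
    show "\<not> (AE z in \<nu>. \<exists>l<0. ((\<lambda>t. d t z / t) \<longlongrightarrow> l) at_top)"
    proof
      assume "AE z in \<nu>. \<exists>l<0. ((\<lambda>t. d t z / t) \<longlongrightarrow> l) at_top"
      with U(3) have neg: "AE z in \<nu>. U z < 0"
      proof eventually_elim
        case (elim z)
        then obtain l where "l < 0" "((\<lambda>t. d t z / t) \<longlongrightarrow> l) at_top" by blast
        then show ?case using tendsto_unique[OF trivial_limit_at_top_linorder elim(1)] by blast
      qed
      then have nn: "AE z in \<nu>. 0 \<le> - U z" by eventually_elim simp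
      then have "0 \<le> integral\<^sup>L \<nu> (\<lambda>z. - U z)" by (rule integral_nonneg_AE)
      then have "integral\<^sup>L \<nu> (\<lambda>z. - U z) = 0" using pos U(4) by simp
      moreover have "integrable \<nu> (\<lambda>z. - U z)" using U(2) by simp
      ultimately have "AE z in \<nu>. - U z = 0"
        using integral_nonneg_eq_0_iff_AE[OF _ nn] by blast
      with neg have "AE z in \<nu>. False" by eventually_elim simp
      then show False by simp
    qed
  qed
qed

end

section \<open>Differentiable dependence on initial values\<close>

lemma vector_derivative_mean_value:
  fixes u :: "real \<Rightarrow> 'a::real_normed_vector"
  assumes "convex S" "\<And>t. t \<in> S \<Longrightarrow> (u has_vector_derivative u' t) (at t within S)"
    "\<And>t. t \<in> S \<Longrightarrow> norm (u' t) \<le> B" "s \<in> S" "t \<in> S"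
  shows "norm (u t - u s) \<le> B * \<bar>t - s\<bar>"
  using differentiable_bound[of S u "\<lambda>t h. h *\<^sub>R u' t" B t s] assms
  by (auto simp: has_vector_derivative_def onorm_scaleR_left[OF bounded_linear_ident] onorm_id)

text \<open>At the time \<open>s\<close> where \<open>norm (u t)\<close> is largest, the mean value
  inequality from \<open>c\<close> bounds it by \<open>norm (u c)\<close> plus half of itself plus
  \<open>(b - a) * e\<close>; absorbing the half gives the factor 2. Restricting to short intervals
  replaces the usual exponential by this constant.\<close>

lemma short_time_gronwall:
  fixes u :: "real \<Rightarrow> 'a::real_normed_vector"
  assumes u: "\<And>t. t \<in> {a..b} \<Longrightarrow> (u has_vector_derivative u' t) (at t within {a..b})"
    and le: "\<And>t. t \<in> {a..b} \<Longrightarrow> norm (u' t) \<le> L * norm (u t) + e"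
    and L: "0 \<le> L" "(b - a) * L \<le> 1 / 2" and e: "0 \<le> e" and c: "c \<in> {a..b}" and t: "t \<in> {a..b}"
  shows "norm (u t) \<le> 2 * (norm (u c) + (b - a) * e)"
proof -
  have "continuous_on {a..b} u"
    using u by (meson continuous_on_eq_continuous_within has_vector_derivative_continuous)
  then have "continuous_on {a..b} (\<lambda>t. norm (u t))" by (intro continuous_intros)
  then obtain s where s: "s \<in> {a..b}" "\<And>t. t \<in> {a..b} \<Longrightarrow> norm (u t) \<le> norm (u s)"
    using continuous_attains_sup[of "{a..b}" "\<lambda>t. norm (u t)"] c by force
  have "norm (u s - u c) \<le> (L * norm (u s) + e) * \<bar>s - c\<bar>"
  proof (rule vector_derivative_mean_value[OF _ u _ c s(1)])
    show "norm (u' t) \<le> L * norm (u s) + e" if "t \<in> {a..b}" for t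
      using le[OF that] mult_left_mono[OF s(2)[OF that] L(1)] by linarith
  qed auto
  also have "\<dots> \<le> (L * norm (u s) + e) * (b - a)"
    using c s(1) L(1) e by (intro mult_left_mono) auto
  also have "\<dots> = ((b - a) * L) * norm (u s) + (b - a) * e" by (simp add: algebra_simps)
  also have "\<dots> \<le> 1 / 2 * norm (u s) + (b - a) * e"
    using L(2) by (intro add_right_mono mult_right_mono) auto
  finally have "norm (u s) \<le> norm (u c) + 1 / 2 * norm (u s) + (b - a) * e"
    using norm_triangle_sub[of "u s" "u c"] by linarith
  then show ?thesis using s(2)[OF t] by (simp add: algebra_simps)
qed

text \<open>Half of the radius \<open>R\<close> is reserved for the initial value and half for the
  motion, by \<open>dB\<close>; by \<open>dL\<close> the integral operator contracts by 1/2. The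
  field may depend on time, as the linearised equation along a trajectory does.\<close>

lemma picard:
  fixes F :: "real \<Rightarrow> 'a::banach \<Rightarrow> 'a"
  assumes d: "0 < d"
    and cont: "continuous_on ({-d..d} \<times> cball c R) (\<lambda>(t, y). F t y)"
    and lip: "\<And>t y z. t \<in> {-d..d} \<Longrightarrow> y \<in> cball c R \<Longrightarrow> z \<in> cball c R \<Longrightarrow>
      norm (F t y - F t z) \<le> L * norm (y - z)"
    and bd: "\<And>t y. t \<in> {-d..d} \<Longrightarrow> y \<in> cball c R \<Longrightarrow> norm (F t y) \<le> B"
    and dB: "d * B \<le> R / 2" and dL: "d * L \<le> 1 / 2" and L: "0 \<le> L" and R: "0 \<le> R"
    and x: "x \<in> cball c (R / 2)"
  obtains y where "y 0 = x" "\<And>t. t \<in> {-d..d} \<Longrightarrow> y t \<in> cball c R"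
    "\<And>t. t \<in> {-d..d} \<Longrightarrow> (y has_vector_derivative F t (y t)) (at t within {-d..d})"
proof -
  let ?I = "{-d..d}"
  \<comment> \<open>Integrals start at \<open>-d\<close> and are renormalised at 0, so that one
    formula serves both time directions.\<close>
  define P where "P g t = x + (integral {-d..t} (\<lambda>s. F s (g s)) - integral {-d..0} (\<lambda>s. F s (g s)))" for g and t :: real
  have cF: "continuous_on ?I (\<lambda>s. F s (g s))" if "continuous_on ?I g" "\<And>t. t \<in> ?I \<Longrightarrow> g t \<in> cball c R" for g
  proof -
    have "continuous_on ?I (\<lambda>s. (\<lambda>(t, y). F t y) (s, g s))"
      by (rule continuous_on_compose2[OF cont]) (use that in \<open>auto intro!: continuous_intros\<close>)
    then show ?thesis by simp
  qed
  have P0: "P g 0 = x" for g unfolding P_def by simp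
  have Pd: "(P g has_vector_derivative F t (g t)) (at t within ?I)"
    if "continuous_on ?I g" "\<And>t. t \<in> ?I \<Longrightarrow> g t \<in> cball c R" "t \<in> ?I" for g t
    unfolding P_def using integral_has_vector_derivative[OF cF[OF that(1,2)] that(3)]
    by (auto intro!: derivative_eq_intros)
  have Pin: "P g t \<in> cball c R"
    if "continuous_on ?I g" "\<And>t. t \<in> ?I \<Longrightarrow> g t \<in> cball c R" "t \<in> ?I" for g t
  proof -
    have B0: "0 \<le> B" using bd[of 0 c] d R order_trans[OF norm_ge_zero] by fastforce
    have "norm (P g t - P g 0) \<le> B * \<bar>t - 0\<bar>"
      by (rule vector_derivative_mean_value[of ?I _ "\<lambda>t. F t (g t)"]) (use Pd that bd d in auto)
    also have "\<dots> \<le> B * d" using that(3) B0 by (intro mult_left_mono) auto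
    finally have "norm (P g t - x) \<le> R / 2" using dB by (simp add: P0 mult.commute)
    moreover have "norm (x - c) \<le> R / 2" using x by (simp add: dist_norm norm_minus_commute)
    ultimately have "norm (P g t - c) \<le> R"
      using norm_triangle_ineq[of "P g t - x" "x - c"] by simp
    then show ?thesis by (simp add: dist_norm norm_minus_commute)
  qed
  have Pcont: "continuous_on ?I (P g)"
    if "continuous_on ?I g" "\<And>t. t \<in> ?I \<Longrightarrow> g t \<in> cball c R" for g
    using Pd[OF that] by (meson continuous_on_eq_continuous_within has_vector_derivative_continuous)
  have Pcontr: "norm (P g t - P h t) \<le> e / 2"
    if g: "continuous_on ?I g" "\<And>t. t \<in> ?I \<Longrightarrow> g t \<in> cball c R"
      and h: "continuous_on ?I h" "\<And>t. t \<in> ?I \<Longrightarrow> h t \<in> cball c R"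
      and e: "\<And>t. t \<in> ?I \<Longrightarrow> norm (g t - h t) \<le> e" and t: "t \<in> ?I" for g h e t
  proof -
    have e0: "0 \<le> e" using e[OF t] norm_ge_zero order_trans by blast
    have "norm ((P g t - P h t) - (P g 0 - P h 0)) \<le> (L * e) * \<bar>t - 0\<bar>"
    proof (rule vector_derivative_mean_value[of ?I "\<lambda>t. P g t - P h t" "\<lambda>t. F t (g t) - F t (h t)"])
      fix t assume t: "t \<in> ?I"
      show "((\<lambda>t. P g t - P h t) has_vector_derivative F t (g t) - F t (h t)) (at t within ?I)"
        by (intro has_vector_derivative_diff Pd g h t)
      show "norm (F t (g t) - F t (h t)) \<le> L * e"
        using lip[OF t g(2)[OF t] h(2)[OF t]] mult_left_mono[OF e[OF t] L] by linarith
    qed (use t d in auto)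
    also have "\<dots> \<le> (L * e) * d" using t e0 L by (intro mult_left_mono) auto
    also have "\<dots> = (d * L) * e" by simp
    also have "\<dots> \<le> 1 / 2 * e" using dL e0 by (intro mult_right_mono)
    finally show ?thesis by (simp add: P0)
  qed
  define Y where "Y n = (P ^^ n) (\<lambda>_. x)" for n
  have Y0: "Y 0 = (\<lambda>_. x)" and YS: "Y (Suc n) = P (Y n)" for n by (simp_all add: Y_def)
  have xR: "x \<in> cball c R" using x R by auto
  have Y: "continuous_on ?I (Y n) \<and> (\<forall>t\<in>?I. Y n t \<in> cball c R)" for n
  proof (induction n)
    case 0
    show ?case using xR by (simp add: Y0)
  next
    case (Suc n)
    then show ?case unfolding YS using Pcont[of "Y n"] Pin[of "Y n"] by blast
  qed
  \<comment> \<open>\<open>2 * R\<close> bounds the diameter of the ball, and each further iteration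
    halves the distance.\<close>
  have step: "norm (Y (Suc n) t - Y n t) \<le> (2 * R) * (1 / 2) ^ n" if "t \<in> ?I" for n t
    using that
  proof (induction n arbitrary: t)
    case 0
    have "Y (Suc 0) t \<in> cball c R" using Y 0 by blast
    then have "dist (Y (Suc 0) t) x \<le> R + R" using xR by (intro order_trans[OF dist_triangle[of _ _ c]] add_mono) (auto simp: dist_commute)
    then show ?case by (simp add: Y0 dist_norm)
  next
    case (Suc n)
    have "norm (P (Y (Suc n)) t - P (Y n) t) \<le> ((2 * R) * (1 / 2) ^ n) / 2"
      by (rule Pcontr) (use Y Suc in auto)
    then show ?case unfolding YS[symmetric] by simp
  qed
  have "uniform_limit ?I (\<lambda>n t. \<Sum>i<n. Y (Suc i) t - Y i t) (\<lambda>t. \<Sum>i. Y (Suc i) t - Y i t) sequentially"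
    by (rule Weierstrass_m_test[where M="\<lambda>n. (2 * R) * (1 / 2) ^ n"]) (use step in \<open>auto intro!: summable_mult\<close>)
  then have ul: "uniform_limit ?I (\<lambda>n t. x + (\<Sum>i<n. Y (Suc i) t - Y i t)) (\<lambda>t. x + (\<Sum>i. Y (Suc i) t - Y i t)) sequentially"
    by (intro uniform_limit_intros)
  define y where "y t = x + (\<Sum>i. Y (Suc i) t - Y i t)" for t
  have ul: "uniform_limit ?I Y y sequentially"
  proof -
    have "x + (\<Sum>i<n. Y (Suc i) t - Y i t) = Y n t" for n t
      using sum_lessThan_telescope[of "\<lambda>i. Y i t" n] by (simp add: Y0)
    then show ?thesis using ul unfolding y_def by presburger
  qed
  have yc: "continuous_on ?I y"
    by (rule uniform_limit_theorem[OF _ ul]) (use Y in auto)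
  have lim: "(\<lambda>n. Y n t) \<longlonglongrightarrow> y t" if "t \<in> ?I" for t
    using tendsto_uniform_limitI[OF ul that] .
  have yin: "y t \<in> cball c R" if "t \<in> ?I" for t
    by (rule Lim_in_closed_set[OF closed_cball _ _ lim[OF that]]) (use Y that in auto)
  have fixpt: "P y t = y t" if t: "t \<in> ?I" for t
  proof -
    have "(\<lambda>n. Y (Suc n) t) \<longlonglongrightarrow> P y t"
    proof (rule tendstoI)
      fix e :: real assume e: "0 < e"
      show "\<forall>\<^sub>F n in sequentially. dist (Y (Suc n) t) (P y t) < e"
        using uniform_limitD[OF ul e]
      proof eventually_elim
        case (elim n)
        have "norm (P (Y n) t - P y t) \<le> e / 2"
          by (rule Pcontr) (use Y elim yc yin t in \<open>auto simp: dist_norm less_imp_le\<close>)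
        then show ?case using e by (simp add: YS dist_norm)
      qed
    qed
    then show ?thesis using LIMSEQ_Suc[OF lim[OF t]] LIMSEQ_unique by blast
  qed
  show thesis
  proof (rule that[of y])
    show "y 0 = x" using fixpt[of 0] P0[of y] d by simp
    show "(y has_vector_derivative F t (y t)) (at t within ?I)" if "t \<in> ?I" for t
      by (rule has_vector_derivative_transform[OF that _ Pd[OF yc yin that]]) (simp add: fixpt)
  qed (rule yin)
qed

lemma pointwise_continuous_linear_bound:
  fixes f' :: "'a::euclidean_space \<Rightarrow> 'a \<Rightarrow> 'a"
  assumes K: "compact K" and lin: "\<And>x. x \<in> K \<Longrightarrow> linear (f' x)"
    and cont: "\<And>v. continuous_on K (\<lambda>x. f' x v)"
  obtains L where "0 \<le> L" "\<And>x v. x \<in> K \<Longrightarrow> norm (f' x v) \<le> L * norm v"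
proof -
  have "\<exists>C. \<forall>x\<in>K. norm (f' x b) \<le> C" for b
    using compact_imp_bounded[OF compact_continuous_image[OF cont[of b] K]] by (auto simp: bounded_iff)
  then obtain C where C: "\<And>x b. x \<in> K \<Longrightarrow> norm (f' x b) \<le> C b" by metis
  define D where "D b = max 0 (C b)" for b
  show thesis
  proof (rule that[of "\<Sum>b\<in>Basis. D b"])
    show "0 \<le> (\<Sum>b\<in>Basis. D b)" by (intro sum_nonneg) (simp add: D_def)
    fix x v assume x: "x \<in> K"
    have "f' x v = f' x (\<Sum>b\<in>Basis. (v \<bullet> b) *\<^sub>R b)" by (simp add: euclidean_representation)
    also have "\<dots> = (\<Sum>b\<in>Basis. (v \<bullet> b) *\<^sub>R f' x b)"
      by (simp add: linear_sum[OF lin[OF x]] linear_scale[OF lin[OF x]])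
    also have "norm \<dots> \<le> (\<Sum>b\<in>Basis. norm v * D b)"
      by (rule sum_norm_le) (use C[OF x] in \<open>auto simp: D_def intro!: mult_mono Basis_le_norm intro: max.coboundedI2\<close>)
    finally show "norm (f' x v) \<le> (\<Sum>b\<in>Basis. D b) * norm v"
      by (simp add: sum_distrib_left mult.commute)
  qed
qed

text \<open>The mean value inequality for \<open>f - f' x\<close> on a small convex piece around
  \<open>x\<close>, where the derivative deviates from \<open>f' x\<close> by at most
  \<open>e\<close>. Uniform continuity is applied to each basis vector separately, whence the
  division of \<open>e\<close> by the dimension.\<close>

lemma uniform_linear_approximation:
  fixes f :: "'a::euclidean_space \<Rightarrow> 'a"
  assumes f: "\<And>x. x \<in> cball c R \<Longrightarrow> (f has_derivative f' x) (at x)"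
    and cont: "\<And>v. continuous_on (cball c R) (\<lambda>x. f' x v)" and e: "0 < e"
  obtains h where "0 < h" "\<And>x y. x \<in> cball c R \<Longrightarrow> y \<in> cball c R \<Longrightarrow> norm (y - x) < h \<Longrightarrow>
    norm (f y - f x - f' x (y - x)) \<le> e * norm (y - x)"
proof -
  let ?K = "cball c R"
  have lin: "linear (f' x)" if "x \<in> ?K" for x using f[OF that] has_derivative_linear by blast
  define e' where "e' = e / real DIM('a)"
  have e': "0 < e'" unfolding e'_def using e by simp
  have "\<exists>h>0. \<forall>x\<in>?K. \<forall>y\<in>?K. dist y x < h \<longrightarrow> dist (f' y b) (f' x b) < e'" for b
    using compact_uniformly_continuous[OF cont compact_cball] e' unfolding uniformly_continuous_on_def by blast
  then obtain h where h: "\<And>b. 0 < h b"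
    "\<And>b x y. x \<in> ?K \<Longrightarrow> y \<in> ?K \<Longrightarrow> dist y x < h b \<Longrightarrow> dist (f' y b) (f' x b) < e'"
    by metis
  define H where "H = Min (h ` Basis)"
  have H: "0 < H" "\<And>b. b \<in> Basis \<Longrightarrow> H \<le> h b" unfolding H_def using h(1) by auto
  have close: "norm (f' y v - f' x v) \<le> e * norm v"
    if xy: "x \<in> ?K" "y \<in> ?K" "dist y x < H" for x y v
  proof -
    have "f' y v - f' x v = (\<Sum>b\<in>Basis. (v \<bullet> b) *\<^sub>R (f' y b - f' x b))"
    proof -
      have "f' z v = (\<Sum>b\<in>Basis. (v \<bullet> b) *\<^sub>R f' z b)" if "z \<in> ?K" for z
        using linear_sum[OF lin[OF that], of "\<lambda>b. (v \<bullet> b) *\<^sub>R b" Basis]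
        by (simp add: linear_scale[OF lin[OF that]] euclidean_representation)
      then show ?thesis using xy by (simp add: sum_subtractf scaleR_diff_right)
    qed
    also have "norm \<dots> \<le> (\<Sum>b\<in>(Basis::'a set). norm v * e')"
    proof (rule sum_norm_le)
      fix b :: 'a assume b: "b \<in> Basis"
      have "norm (f' y b - f' x b) \<le> e'"
        using h(2)[OF xy(1,2), of b] xy(3) H(2)[OF b] by (simp add: dist_norm)
      then show "norm ((v \<bullet> b) *\<^sub>R (f' y b - f' x b)) \<le> norm v * e'"
        using Basis_le_norm[OF b, of v] by (auto intro!: mult_mono)
    qed
    also have "\<dots> = e * norm v" by (simp add: e'_def)
    finally show ?thesis .
  qed
  show thesis
  proof (rule that[OF H(1)])
    fix x y assume x: "x \<in> ?K" and y: "y \<in> ?K" and xy: "norm (y - x) < H"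
    let ?S = "?K \<inter> ball x H"
    have "norm ((f y - f' x y) - (f x - f' x x)) \<le> e * norm (y - x)"
    proof (rule differentiable_bound[where S="?S" and f'="\<lambda>z v. f' z v - f' x v"])
      show "convex ?S" by (intro convex_Int convex_cball convex_ball)
      have bl: "bounded_linear (f' x)" using f[OF x] has_derivative_bounded_linear by blast
      fix z assume z: "z \<in> ?S"
      show "((\<lambda>z. f z - f' x z) has_derivative (\<lambda>v. f' z v - f' x v)) (at z within ?S)"
        using f[of z] z has_derivative_at_withinI
        by (intro has_derivative_diff bounded_linear_imp_has_derivative[OF bl]) blast
      show "onorm (\<lambda>v. f' z v - f' x v) \<le> e"
        by (rule onorm_le) (use close x z in \<open>auto simp: dist_commute\<close>)
    qed (use x y xy H in \<open>auto simp: dist_norm norm_minus_commute\<close>)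
    moreover have "(f y - f' x y) - (f x - f' x x) = f y - f x - f' x (y - x)"
      by (simp add: linear_diff[OF lin[OF x]])
    ultimately show "norm (f y - f x - f' x (y - x)) \<le> e * norm (y - x)" by simp
  qed
qed


text \<open>\<open>W t x\<close> solves the variational equation along the trajectory of
  \<open>x\<close>. Gronwall's estimate shows that the difference of two nearby trajectories follows
  it up to a small multiple of the initial difference, uniformly in time and base point; both
  differentiability and continuity of the derivative come from this.\<close>

theorem local_flow_C1:
  fixes f :: "'a::euclidean_space \<Rightarrow> 'a"
  assumes V: "open V" "x0 \<in> V" and f: "\<And>x. x \<in> V \<Longrightarrow> (f has_derivative f' x) (at x)"
    and cont: "\<And>v. continuous_on V (\<lambda>x. f' x v)"
  obtains r d \<phi> W where "0 < r" "0 < (d::real)"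
    "\<And>t x. t \<in> {-d..d} \<Longrightarrow> x \<in> ball x0 r \<Longrightarrow> \<phi> t x \<in> V"
    "\<And>x. x \<in> ball x0 r \<Longrightarrow> \<phi> 0 x = x"
    "\<And>t x. t \<in> {-d..d} \<Longrightarrow> x \<in> ball x0 r \<Longrightarrow>
      ((\<lambda>t. \<phi> t x) has_vector_derivative f (\<phi> t x)) (at t within {-d..d})"
    "continuous_on ({-d..d} \<times> ball x0 r) (\<lambda>(t, x). \<phi> t x)"
    "\<And>t x. t \<in> {-d..d} \<Longrightarrow> x \<in> ball x0 r \<Longrightarrow> (\<phi> t has_derivative W t x) (at x)"
    "\<And>v. continuous_on ({-d..d} \<times> ball x0 r) (\<lambda>(t, x). W t x v)"
proof -
  obtain R where R: "0 < R" "cball x0 R \<subseteq> V" using V open_contains_cball by blast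
  let ?K = "cball x0 R"
  have lin: "linear (f' x)" if "x \<in> V" for x using f[OF that] has_derivative_linear by blast
  have contK: "continuous_on ?K (\<lambda>x. f' x v)" for v using cont R(2) continuous_on_subset by blast
  have linK: "linear (f' x)" if "x \<in> ?K" for x using that lin R(2) by blast
  obtain L where L: "0 \<le> L" "\<And>x v. x \<in> ?K \<Longrightarrow> norm (f' x v) \<le> L * norm v"
    by (rule pointwise_continuous_linear_bound[OF compact_cball linK contK]) (assumption, rule that)
  have fc: "continuous_on ?K f"
    using f R(2) by (meson continuous_at_imp_continuous_on has_derivative_continuous subsetD)
  have lip: "norm (f y - f z) \<le> L * norm (y - z)" if "y \<in> ?K" "z \<in> ?K" for y z
    by (rule differentiable_bound[OF convex_cball _ _ that])
      (use f R(2) L has_derivative_at_withinI in \<open>blast intro!: onorm_le\<close>)+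
  obtain B where B: "0 < B" "\<And>x. x \<in> ?K \<Longrightarrow> norm (f x) \<le> B"
    using compact_imp_bounded[OF compact_continuous_image[OF fc compact_cball]] unfolding bounded_pos by auto
  \<comment> \<open>The first bound keeps trajectories from the half ball inside the ball; the
    second gives \<open>d * L \<le> 1 / 4\<close>, as Gronwall's estimate runs over the whole
    interval of length \<open>2 * d\<close>.\<close>
  define d where "d = min (R / (2 * B)) (1 / (4 * (L + 1)))"
  have d: "0 < d" using R B L by (simp add: d_def)
  have "d * B \<le> (R / (2 * B)) * B" unfolding d_def using B by (intro mult_right_mono) auto
  then have dB: "d * B \<le> R / 2" using B by simp
  have "d * L \<le> (1 / (4 * (L + 1))) * L" unfolding d_def using L by (intro mult_right_mono) auto
  also have "\<dots> \<le> 1 / 4" using L by (simp add: field_simps)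
  finally have dL: "d * L \<le> 1 / 4" .
  then have dL2: "(d - (- d)) * L \<le> 1 / 2" and dL1: "d * L \<le> 1 / 2" by auto
  let ?I = "{-d..d}" and ?K2 = "cball x0 (R / 2)"
  have I0: "0 \<in> ?I" using d by simp
  have "\<exists>y. y 0 = x \<and> (\<forall>t\<in>?I. y t \<in> ?K \<and> (y has_vector_derivative f (y t)) (at t within ?I))"
    if x: "x \<in> ?K2" for x
  proof (rule picard[of d x0 R "\<lambda>_. f" L B x])
    show "continuous_on (?I \<times> ?K) (\<lambda>(t, y). f y)"
      using continuous_on_compose2[OF fc continuous_on_snd[OF continuous_on_id], of "?I \<times> ?K"]
      by (auto simp: case_prod_beta)
  qed (use d lip B dB dL1 L R x in auto)
  then obtain y where y0: "\<And>x. x \<in> ?K2 \<Longrightarrow> y x 0 = x"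
    and yK: "\<And>x t. x \<in> ?K2 \<Longrightarrow> t \<in> ?I \<Longrightarrow> y x t \<in> ?K"
    and yd: "\<And>x t. x \<in> ?K2 \<Longrightarrow> t \<in> ?I \<Longrightarrow> (y x has_vector_derivative f (y x t)) (at t within ?I)"
    by metis
  have yc: "continuous_on ?I (y x)" if "x \<in> ?K2" for x
    using yd[OF that] by (meson continuous_on_eq_continuous_within has_vector_derivative_continuous)
  have ylip: "norm (y x t - y z t) \<le> 2 * norm (x - z)"
    if x: "x \<in> ?K2" and z: "z \<in> ?K2" and t: "t \<in> ?I" for x z t
  proof -
    have "norm (y x t - y z t) \<le> 2 * (norm (y x 0 - y z 0) + (d - (- d)) * 0)"
    proof (rule short_time_gronwall[OF _ _ L(1) dL2 order_refl I0 t])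
      fix t assume t: "t \<in> ?I"
      show "((\<lambda>t. y x t - y z t) has_vector_derivative f (y x t) - f (y z t)) (at t within ?I)"
        by (intro has_vector_derivative_diff yd x z t)
      show "norm (f (y x t) - f (y z t)) \<le> L * norm (y x t - y z t) + 0"
        using lip[OF yK[OF x t] yK[OF z t]] by simp
    qed
    then show ?thesis using y0 x z by simp
  qed
  have jc: "continuous_on (?I \<times> ?K2) (\<lambda>(t, x). y x t)"
    unfolding continuous_on_iff
  proof (intro ballI allI impI)
    fix p e assume p: "p \<in> ?I \<times> ?K2" and e: "0 < (e::real)"
    obtain t x where tx: "p = (t, x)" "t \<in> ?I" "x \<in> ?K2" using p by auto
    obtain h where h: "0 < h" "\<And>s. s \<in> ?I \<Longrightarrow> dist s t < h \<Longrightarrow> dist (y x s) (y x t) < e / 2"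
      using yc[OF tx(3)] tx(2) e unfolding continuous_on_iff by (meson half_gt_zero)
    show "\<exists>h>0. \<forall>q\<in>?I \<times> ?K2. dist q p < h \<longrightarrow>
      dist (case q of (t, x) \<Rightarrow> y x t) (case p of (t, x) \<Rightarrow> y x t) < e"
    proof (intro exI[of _ "min h (e / 4)"] conjI ballI impI)
      fix q assume q: "q \<in> ?I \<times> ?K2" "dist q p < min h (e / 4)"
      obtain s z where sz: "q = (s, z)" "s \<in> ?I" "z \<in> ?K2" using q by auto
      have "dist s t < h" "dist z x < e / 4"
        using q(2) dist_fst_le[of q p] dist_snd_le[of q p] unfolding sz tx by auto
      then have "dist (y x s) (y x t) < e / 2" "dist (y z s) (y x s) \<le> e / 2"
        using h(2)[OF sz(2)] ylip[OF sz(3) tx(3) sz(2)] by (auto simp: dist_norm)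
      then have "dist (y z s) (y x t) < e" using dist_triangle[of "y z s" "y x t" "y x s"] by linarith
      then show "dist (case q of (t, x) \<Rightarrow> y x t) (case p of (t, x) \<Rightarrow> y x t) < e"
        by (simp add: sz tx)
    qed (use h e in auto)
  qed
  have approx: "norm (u t - w t) \<le> 2 * (norm (u 0 - w 0) + (d - (- d)) * e)"
    if x: "x \<in> ?K2" and t: "t \<in> ?I" and e: "0 \<le> e"
      and u: "\<And>t. t \<in> ?I \<Longrightarrow> (u has_vector_derivative u' t) (at t within ?I)"
      and w: "\<And>t. t \<in> ?I \<Longrightarrow> (w has_vector_derivative f' (y x t) (w t)) (at t within ?I)"
      and ue: "\<And>t. t \<in> ?I \<Longrightarrow> norm (u' t - f' (y x t) (u t)) \<le> e" for x t e u u' w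
  proof (rule short_time_gronwall[OF _ _ L(1) dL2 e I0 t])
    fix t assume t: "t \<in> ?I"
    show "((\<lambda>t. u t - w t) has_vector_derivative u' t - f' (y x t) (w t)) (at t within ?I)"
      by (intro has_vector_derivative_diff u w t)
    have "u' t - f' (y x t) (w t) = f' (y x t) (u t - w t) + (u' t - f' (y x t) (u t))"
      by (simp add: linear_diff[OF linK[OF yK[OF x t]]])
    then show "norm (u' t - f' (y x t) (w t)) \<le> L * norm (u t - w t) + e"
      using L(2)[OF yK[OF x t], of "u t - w t"] ue[OF t] norm_triangle_ineq by (metis add_mono order_trans)
  qed
  have "\<exists>w. w 0 = v \<and> (\<forall>t\<in>?I. (w has_vector_derivative f' (y x t) (w t)) (at t within ?I))"
    if x: "x \<in> ?K2" for x v
  \<comment> \<open>The linear equation is bounded by \<open>L * (2 * norm v)\<close> on the ball of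
    radius \<open>2 * norm v\<close> about 0, and \<open>v\<close> lies in the half ball. Both scale
    with \<open>v\<close>, so the same \<open>d\<close> works for every initial vector.\<close>
  proof (rule picard[of d 0 "2 * norm v" "\<lambda>t z. f' (y x t) z" L "L * (2 * norm v)" v])
    have c: "continuous_on ?I (\<lambda>t. f' (y x t) b)" for b
      by (rule continuous_on_compose2[OF contK yc[OF x]]) (use yK x in blast)
    have c1: "continuous_on (?I \<times> cball 0 (2 * norm v)) (\<lambda>p. \<Sum>b\<in>Basis. (snd p \<bullet> b) *\<^sub>R f' (y x (fst p)) b)"
      by (intro continuous_intros continuous_on_compose2[OF c]) auto
    have c2: "(\<Sum>b\<in>Basis. (z \<bullet> b) *\<^sub>R f' (y x t) b) = f' (y x t) z" if "t \<in> ?I" for t z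
      using linear_sum[OF linK[OF yK[OF x that]], of "\<lambda>b. (z \<bullet> b) *\<^sub>R b" Basis]
      by (simp add: linear_scale[OF linK[OF yK[OF x that]]] euclidean_representation)
    show "continuous_on (?I \<times> cball 0 (2 * norm v)) (\<lambda>(t, z). f' (y x t) z)"
      by (rule continuous_on_eq[OF c1]) (use c2 in \<open>auto simp: case_prod_beta\<close>)
    show "norm (f' (y x t) z - f' (y x t) z') \<le> L * norm (z - z')" if "t \<in> ?I" for t z z'
      using L(2)[OF yK[OF x that], of "z - z'"] by (simp add: linear_diff[OF linK[OF yK[OF x that]]])
    show "norm (f' (y x t) z) \<le> L * (2 * norm v)" if "t \<in> ?I" "z \<in> cball 0 (2 * norm v)" for t z
      using L(2)[OF yK[OF x that(1)], of z] mult_left_mono[of "norm z" "2 * norm v" L] that(2) L(1) by auto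
    have "d * L * (2 * norm v) \<le> 1 / 2 * (2 * norm v)" using dL1 by (intro mult_right_mono) auto
    then show "d * (L * (2 * norm v)) \<le> 2 * norm v / 2" by (simp add: mult.assoc)
  qed (use d dL1 L in auto)
  then obtain w where w0: "\<And>x v. x \<in> ?K2 \<Longrightarrow> w x v 0 = v"
    and wd: "\<And>x v t. x \<in> ?K2 \<Longrightarrow> t \<in> ?I \<Longrightarrow> (w x v has_vector_derivative f' (y x t) (w x v t)) (at t within ?I)"
    by metis
  have wuniq: "u t = w x v t"
    if x: "x \<in> ?K2" and t: "t \<in> ?I" and u0: "u 0 = v"
      and u: "\<And>t. t \<in> ?I \<Longrightarrow> (u has_vector_derivative f' (y x t) (u t)) (at t within ?I)" for x v t u
  proof -
    have "norm (u t - w x v t) \<le> 2 * (norm (u 0 - w x v 0) + (d - (- d)) * 0)"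
      by (rule approx[OF x t order_refl u wd[OF x]]) auto
    then show ?thesis using w0[OF x] u0 by simp
  qed
  have wlin: "linear (\<lambda>v. w x v t)" if x: "x \<in> ?K2" and t: "t \<in> ?I" for x t
  proof (rule linearI)
    have l: "linear (f' (y x t))" if "t \<in> ?I" for t using linK[OF yK[OF x that]] .
    show "w x (v + v') t = w x v t + w x v' t" for v v'
    proof (rule wuniq[OF x t, symmetric])
      show "((\<lambda>t. w x v t + w x v' t) has_vector_derivative f' (y x t) (w x v t + w x v' t)) (at t within ?I)"
        if t: "t \<in> ?I" for t
        unfolding linear_add[OF l[OF t]] by (intro has_vector_derivative_add wd x t)
    qed (simp add: w0[OF x])
    show "w x (c *\<^sub>R v) t = c *\<^sub>R w x v t" for c v
    proof (rule wuniq[OF x t, symmetric])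
      fix t assume t: "t \<in> ?I"
      have "((\<lambda>t. c *\<^sub>R w x v t) has_vector_derivative c *\<^sub>R f' (y x t) (w x v t)) (at t within ?I)"
        by (rule bounded_linear.has_vector_derivative[OF bounded_linear_scaleR_right wd[OF x t]])
      then show "((\<lambda>t. c *\<^sub>R w x v t) has_vector_derivative f' (y x t) (c *\<^sub>R w x v t)) (at t within ?I)"
        by (simp add: linear_scale[OF l[OF t]])
    qed (simp add: w0[OF x])
  qed
  have key: "\<exists>h>0. \<forall>x\<in>?K2. \<forall>v. x + v \<in> ?K2 \<longrightarrow> norm v < h \<longrightarrow>
      (\<forall>t\<in>?I. norm (y (x + v) t - y x t - w x v t) \<le> e * norm v)" if e: "0 < e" for e
  proof -
    have fK: "(f has_derivative f' x) (at x)" if "x \<in> ?K" for x using f that R(2) by blast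
    \<comment> \<open>Gronwall's estimate yields \<open>2 * (2 * d) * (e' * (2 * norm v))\<close>,
      which this choice turns into \<open>e * norm v\<close>.\<close>
    define e' where "e' = e / (8 * d)"
    have e': "0 < e'" unfolding e'_def using e d by simp
    obtain h where h: "0 < h" "\<And>x y. x \<in> ?K \<Longrightarrow> y \<in> ?K \<Longrightarrow> norm (y - x) < h \<Longrightarrow>
        norm (f y - f x - f' x (y - x)) \<le> e' * norm (y - x)"
      by (rule uniform_linear_approximation[OF fK contK e']) (assumption, rule that)
    show ?thesis
    proof (intro exI[of _ "h / 2"] conjI ballI allI impI)
      fix x v t assume x: "x \<in> ?K2" and xv: "x + v \<in> ?K2" and v: "norm v < h / 2" and t: "t \<in> ?I"
      have le: "norm (y (x + v) t - y x t) \<le> 2 * norm v" if "t \<in> ?I" for t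
        using ylip[OF xv x that] by simp
      have "norm ((y (x + v) t - y x t) - w x v t) \<le> 2 * (norm ((y (x + v) 0 - y x 0) - w x v 0) + (d - (- d)) * (e' * (2 * norm v)))"
      proof (rule approx[OF x t, where u'="\<lambda>t. f (y (x + v) t) - f (y x t)"])
        fix t assume t: "t \<in> ?I"
        show "((\<lambda>t. y (x + v) t - y x t) has_vector_derivative f (y (x + v) t) - f (y x t)) (at t within ?I)"
          by (intro has_vector_derivative_diff yd x xv t)
        have "norm (f (y (x + v) t) - f (y x t) - f' (y x t) (y (x + v) t - y x t)) \<le> e' * norm (y (x + v) t - y x t)"
          by (rule h(2)[OF yK[OF x t] yK[OF xv t]]) (use le[OF t] v in linarith)
        also have "\<dots> \<le> e' * (2 * norm v)" using le[OF t] e' by (intro mult_left_mono) auto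
        finally show "norm (f (y (x + v) t) - f (y x t) - f' (y x t) (y (x + v) t - y x t)) \<le> e' * (2 * norm v)" .
      qed (use e' wd x in auto)
      also have "\<dots> = (8 * d * e') * norm v" using y0[OF x] y0[OF xv] w0[OF x] by simp
      also have "\<dots> = e * norm v" using d by (simp add: e'_def)
      finally show "norm (y (x + v) t - y x t - w x v t) \<le> e * norm v" .
    qed (use h in simp)
  qed
  \<comment> \<open>The radius \<open>R / 4\<close> leaves room for perturbations of norm below
    \<open>R / 4\<close> inside the half ball, where the estimates hold.\<close>
  let ?S = "?I \<times> ball x0 (R / 4)"
  show thesis
  proof (rule that[of "R / 4" d "\<lambda>t x. y x t" "\<lambda>t x v. w x v t"])
    have in2: "x \<in> ?K2" if "x \<in> ball x0 (R / 4)" for x using that R(1) unfolding mem_ball mem_cball by linarith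
    have add2: "x + v \<in> ?K2" if "x \<in> ball x0 (R / 4)" "norm v < R / 4" for x v
    proof -
      have "dist x0 (x + v) \<le> dist x0 x + norm v" using dist_triangle[of x0 "x + v" x] by (simp add: dist_norm)
      then show ?thesis using that unfolding mem_ball mem_cball by linarith
    qed
    show "0 < R / 4" using R by simp
    show "0 < d" by (rule d)
    show "y x t \<in> V" if "t \<in> ?I" "x \<in> ball x0 (R / 4)" for t x
      using yK[OF in2[OF that(2)] that(1)] R(2) by blast
    show "y x 0 = x" if "x \<in> ball x0 (R / 4)" for x using y0 in2[OF that] by blast
    show "(y x has_vector_derivative f (y x t)) (at t within ?I)" if "t \<in> ?I" "x \<in> ball x0 (R / 4)" for t x
      using yd in2 that by blast
    show cS: "continuous_on ?S (\<lambda>(t, x). y x t)"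
      by (rule continuous_on_subset[OF jc]) (use in2 in auto)
    show "((\<lambda>x. y x t) has_derivative (\<lambda>v. w x v t)) (at x)" if t: "t \<in> ?I" and x: "x \<in> ball x0 (R / 4)" for t x
      unfolding has_derivative_at_alt
    proof (intro conjI allI impI)
      show "bounded_linear (\<lambda>v. w x v t)" using wlin[OF in2[OF x] t] by (simp add: linear_conv_bounded_linear)
      fix e :: real assume "0 < e"
      from key[OF this] obtain h where h: "0 < h" "\<And>v. x + v \<in> ?K2 \<Longrightarrow> norm v < h \<Longrightarrow>
        norm (y (x + v) t - y x t - w x v t) \<le> e * norm v" using in2[OF x] t by blast
      show "\<exists>h>0. \<forall>z. norm (z - x) < h \<longrightarrow> norm (y z t - y x t - w x (z - x) t) \<le> e * norm (z - x)"
      proof (intro exI[of _ "min h (R / 4)"] conjI allI impI)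
        fix z assume "norm (z - x) < min h (R / 4)"
        then show "norm (y z t - y x t - w x (z - x) t) \<le> e * norm (z - x)"
          using h(2)[of "z - x"] add2[OF x, of "z - x"] by simp
      qed (use h R in auto)
    qed
    \<comment> \<open>The derivative in direction \<open>v\<close> is a uniform limit of difference
      quotients of the flow, by the uniformity in \<open>key\<close>, and these quotients are
      continuous.\<close>
    show "continuous_on ?S (\<lambda>(t, x). w x v t)" for v
    proof (rule uniform_limit_theorem)
      define g where "g n = (\<lambda>(t, x). real (Suc n) *\<^sub>R (y (x + (1 / real (Suc n)) *\<^sub>R v) t - y x t))" for n
      have vs: "(\<lambda>n. norm ((1 / real (Suc n)) *\<^sub>R v)) \<longlonglongrightarrow> 0"
        using tendsto_mult_left_zero[OF LIMSEQ_inverse_real_of_nat, of "norm v"] by (simp add: divide_inverse)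
      have small: "\<forall>\<^sub>F n in sequentially. norm ((1 / real (Suc n)) *\<^sub>R v) < h" if "0 < h" for h
        using order_tendstoD(2)[OF vs that] .
      have "0 < R / 4" using R by simp
      from small[OF this] show "\<forall>\<^sub>F n in sequentially. continuous_on ?S (g n)"
      proof eventually_elim
        case (elim n)
        have "continuous_on ?S (\<lambda>p. (\<lambda>(t, x). y x t) (fst p, snd p + (1 / real (Suc n)) *\<^sub>R v))"
          by (rule continuous_on_compose2[OF jc]) (use add2 elim in \<open>auto intro!: continuous_intros\<close>)
        then show ?case using cS unfolding g_def case_prod_beta by (intro continuous_intros) simp_all
      qed
      show "uniform_limit ?S g (\<lambda>(t, x). w x v t) sequentially"
      proof (rule uniform_limitI)
        fix e :: real assume e: "0 < e"
        define e' where "e' = e / (norm v + 1)"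
        have e': "0 < e'" unfolding e'_def using e by (simp add: add_nonneg_pos)
        from key[OF e'] obtain h where h: "0 < h" "\<And>x v t. x \<in> ?K2 \<Longrightarrow> x + v \<in> ?K2 \<Longrightarrow> norm v < h \<Longrightarrow> t \<in> ?I \<Longrightarrow>
          norm (y (x + v) t - y x t - w x v t) \<le> e' * norm v" by metis
        have "0 < min h (R / 4)" using h R by simp
        from small[OF this] show "\<forall>\<^sub>F n in sequentially. \<forall>p\<in>?S. dist (g n p) (case p of (t, x) \<Rightarrow> w x v t) < e"
        proof eventually_elim
          case (elim n)
          show ?case
          proof
            fix p assume "p \<in> ?S"
            then obtain t x where p: "p = (t, x)" and t: "t \<in> ?I" and x: "x \<in> ball x0 (R / 4)" by auto
            let ?s = "real (Suc n)"
            have s: "0 < ?s" by simp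
            have "norm (y (x + (1 / ?s) *\<^sub>R v) t - y x t - w x ((1 / ?s) *\<^sub>R v) t) \<le> e' * norm ((1 / ?s) *\<^sub>R v)"
              using elim by (intro h(2) in2 add2 x t) auto
            then have "?s * norm (y (x + (1 / ?s) *\<^sub>R v) t - y x t - (1 / ?s) *\<^sub>R w x v t) \<le> ?s * (e' * norm ((1 / ?s) *\<^sub>R v))"
              unfolding linear_scale[OF wlin[OF in2[OF x] t]] using s by (intro mult_left_mono) auto
            also have "?s * norm (y (x + (1 / ?s) *\<^sub>R v) t - y x t - (1 / ?s) *\<^sub>R w x v t) =
              norm (?s *\<^sub>R (y (x + (1 / ?s) *\<^sub>R v) t - y x t - (1 / ?s) *\<^sub>R w x v t))"
              using s by (simp del: of_nat_Suc)
            also have "\<dots> = dist (g n p) (w x v t)"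
              unfolding scaleR_diff_right[of ?s _ "(1 / ?s) *\<^sub>R w x v t"] using s
              by (simp add: p g_def dist_norm del: of_nat_Suc)
            also have "?s * (e' * norm ((1 / ?s) *\<^sub>R v)) = e' * norm v" using s by (simp del: of_nat_Suc)
            also have "\<dots> < e' * (norm v + 1)" using e' by simp
            also have "\<dots> = e" unfolding e'_def using norm_ge_zero[of v] by (simp add: add_nonneg_eq_0_iff)
            finally show "dist (g n p) (case p of (t, x) \<Rightarrow> w x v t) < e" by (simp add: p)
          qed
        qed
      qed
    qed simp
  qed
qed

text \<open>For a short time both curves stay in a ball on which the field is Lipschitz; Gronwall's
  estimate with zero error and zero initial difference then applies on the interval between
  \<open>s\<close> and \<open>t\<close>, in whichever order they come.\<close>

lemma solutions_agree_near:
  fixes f :: "'a::euclidean_space \<Rightarrow> 'a"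
  assumes V: "open V" "u s \<in> V" and f: "\<And>x. x \<in> V \<Longrightarrow> (f has_derivative f' x) (at x)"
    and cont: "\<And>v. continuous_on V (\<lambda>x. f' x v)"
    and J: "is_interval J" "s \<in> J" and e: "0 < e"
    and u: "continuous_on J u" "\<And>t. t \<in> J \<Longrightarrow> \<bar>t - s\<bar> < e \<Longrightarrow> u t \<in> V \<Longrightarrow> (u has_vector_derivative f (u t)) (at t within J)"
    and w: "continuous_on J w" "\<And>t. t \<in> J \<Longrightarrow> \<bar>t - s\<bar> < e \<Longrightarrow> w t \<in> V \<Longrightarrow> (w has_vector_derivative f (w t)) (at t within J)"
    and eq: "u s = w s"
  obtains h where "0 < h" "\<And>t. t \<in> J \<Longrightarrow> \<bar>t - s\<bar> < h \<Longrightarrow> u t = w t"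
proof -
  obtain R where R: "0 < R" "cball (u s) R \<subseteq> V" using V open_contains_cball by blast
  let ?K = "cball (u s) R"
  have contK: "continuous_on ?K (\<lambda>x. f' x v)" for v using cont R(2) continuous_on_subset by blast
  have linK: "linear (f' x)" if "x \<in> ?K" for x using that f[of x] R(2) has_derivative_linear by blast
  obtain L where L: "0 \<le> L" "\<And>x v. x \<in> ?K \<Longrightarrow> norm (f' x v) \<le> L * norm v"
    by (rule pointwise_continuous_linear_bound[OF compact_cball linK contK]) (assumption, rule that)
  have lip: "norm (f y - f z) \<le> L * norm (y - z)" if "y \<in> ?K" "z \<in> ?K" for y z
    by (rule differentiable_bound[OF convex_cball _ _ that])
      (use f R(2) L has_derivative_at_withinI in \<open>blast intro!: onorm_le\<close>)+
  obtain h1 where h1: "0 < h1" "\<And>t. t \<in> J \<Longrightarrow> dist t s < h1 \<Longrightarrow> dist (u t) (u s) < R"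
    using u(1) J(2) R(1) unfolding continuous_on_iff by metis
  obtain h2 where h2: "0 < h2" "\<And>t. t \<in> J \<Longrightarrow> dist t s < h2 \<Longrightarrow> dist (w t) (w s) < R"
    using w(1) J(2) R(1) unfolding continuous_on_iff by metis
  define h where "h = min (min h1 h2) (min e (1 / (2 * (L + 1))))"
  have h: "0 < h" using h1 h2 e L by (simp add: h_def)
  have "h * L \<le> (1 / (2 * (L + 1))) * L" unfolding h_def using L by (intro mult_right_mono) auto
  also have "\<dots> \<le> 1 / 2" using L by (simp add: field_simps)
  finally have hL: "h * L \<le> 1 / 2" .
  show thesis
  proof (rule that[OF h])
    fix t assume t: "t \<in> J" "\<bar>t - s\<bar> < h"
    let ?a = "min s t" and ?b = "max s t"
    have sub: "{?a..?b} \<subseteq> J"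
    proof
      fix r assume r: "r \<in> {?a..?b}"
      have ab: "?a \<in> J" "?b \<in> J" using t(1) J(2) by (simp_all add: min_def max_def)
      show "r \<in> J" by (rule mem_is_interval_1_I[OF J(1) ab]) (use r in auto)
    qed
    have near: "\<bar>r - s\<bar> < h" if "r \<in> {?a..?b}" for r using that t(2) by (auto simp: min_def max_def split: if_splits)
    have inK: "u r \<in> ?K" "w r \<in> ?K" if "r \<in> {?a..?b}" for r
      using h1(2)[of r] h2(2)[of r] near[OF that] sub that eq
      by (auto simp: h_def dist_real_def dist_commute less_imp_le)
    have "norm (u t - w t) \<le> 2 * (norm (u s - w s) + (?b - ?a) * 0)"
    proof (rule short_time_gronwall[OF _ _ L(1) _ order_refl])
      have "(?b - ?a) * L \<le> h * L" using t(2) L(1) by (intro mult_right_mono) (auto simp: min_def max_def)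
      then show "(?b - ?a) * L \<le> 1 / 2" using hL by linarith
      fix r assume r: "r \<in> {?a..?b}"
      have re: "r \<in> J" "\<bar>r - s\<bar> < e" using near[OF r] sub r by (auto simp: h_def)
      show "((\<lambda>t. u t - w t) has_vector_derivative f (u r) - f (w r)) (at r within {?a..?b})"
        by (intro has_vector_derivative_diff has_vector_derivative_within_subset[OF _ sub] u(2) w(2) re)
          (use inK[OF r] R(2) in auto)
      show "norm (f (u r) - f (w r)) \<le> L * norm (u r - w r) + 0"
        using lip[OF inK[OF r]] by simp
    qed auto
    then show "u t = w t" using eq by simp
  qed
qed

section \<open>Inner products on coordinate space\<close>

text \<open>The fibrewise conditions of \<open>riemannian_metric\<close>, separated so that the
  linear algebra of one tangent space can be done without the manifold.\<close>

definition inner_form :: "(real ^ 'n::finite \<Rightarrow> real ^ 'n \<Rightarrow> real) \<Rightarrow> bool" where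
  "inner_form G \<longleftrightarrow> bilinear G \<and> (\<forall>u v. G u v = G v u) \<and> (\<forall>v. v \<noteq> 0 \<longrightarrow> 0 < G v v)"

lemma inner_form_linear:
  assumes "inner_form G"
  shows "linear (G u)" "linear (\<lambda>v. G v u)" "G 0 u = 0" "G u 0 = 0"
    "G (u + v) w = G u w + G v w" "G w (u + v) = G w u + G w v"
    "G (u - v) w = G u w - G v w" "G w (u - v) = G w u - G w v"
    "G (c *\<^sub>R u) v = c * G u v" "G u (c *\<^sub>R v) = c * G u v"
  using assms unfolding inner_form_def bilinear_def
  by (auto simp: linear_0 linear_add linear_diff linear_scale
      dest: linear_0 linear_add linear_diff linear_scale
      intro: linear_0[of "\<lambda>v. G v u"] linear_add[of "\<lambda>v. G v w"] linear_diff[of "\<lambda>v. G v w"] linear_scale[of "\<lambda>u. G u v", simplified])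

lemma inner_form_inner: "inner_form (\<bullet>)"
  unfolding inner_form_def by (simp add: bilinear_def inner_commute linearI inner_add_left inner_add_right)

lemma inner_form_nonneg: "inner_form G \<Longrightarrow> 0 \<le> G v v"
  by (cases "v = 0") (auto simp: inner_form_def inner_form_linear less_imp_le)

lemma inner_form_pos: "inner_form G \<Longrightarrow> v \<noteq> 0 \<Longrightarrow> 0 < G v v"
  by (simp add: inner_form_def)

lemma inner_form_sym: "inner_form G \<Longrightarrow> G u v = G v u"
  by (simp add: inner_form_def)

lemma gram_schmidt:
  fixes G :: "real ^ 'n::finite \<Rightarrow> real ^ 'n \<Rightarrow> real"
  assumes G: "inner_form G" and P: "subspace P"
  obtains B where "finite B" "card B = dim P" "span B = P"
    "\<And>a b. a \<in> B \<Longrightarrow> b \<in> B \<Longrightarrow> G a b = (if a = b then 1 else 0)"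
proof -
  have "\<exists>B. finite B \<and> card B = dim P \<and> span B = P \<and>
      (\<forall>a\<in>B. \<forall>b\<in>B. G a b = (if a = b then 1 else 0))"
    if "subspace P" "dim P = k" for k P
    using that
  proof (induction k arbitrary: P)
    case 0
    then have "P = {0}" by (auto simp: dim_eq_0 subspace_0)
    then show ?case using 0 by (intro exI[of _ "{}"]) auto
  next
    case (Suc k)
    then have "P \<noteq> {0}" by auto
    then obtain v where v: "v \<in> P" "v \<noteq> 0" using Suc.prems(1) subspace_0 by blast
    define e where "e = (1 / sqrt (G v v)) *\<^sub>R v"
    have e: "e \<in> P" "G e e = 1" "e \<noteq> 0"
    proof -
      show "e \<in> P" unfolding e_def using v Suc.prems(1) by (simp add: subspace_scale)
      have "G e e = G v v / (sqrt (G v v) * sqrt (G v v))"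
        unfolding e_def by (simp only: inner_form_linear(9,10)[OF G]) simp
      then show "G e e = 1" using inner_form_pos[OF G v(2)] by simp
      then show "e \<noteq> 0" using inner_form_linear(3)[OF G] by auto
    qed
    define Q where "Q = {u \<in> P. G e u = 0}"
    have Q: "subspace Q"
      using Suc.prems(1) by (auto simp: Q_def subspace_def inner_form_linear[OF G])
    have eQ: "e \<notin> Q" using e by (simp add: Q_def)
    have PQ: "P = span (insert e Q)"
    proof (rule subset_antisym)
      show "span (insert e Q) \<subseteq> P"
        by (rule span_minimal) (use e Suc.prems(1) in \<open>auto simp: Q_def\<close>)
      show "P \<subseteq> span (insert e Q)"
      proof
        fix u assume "u \<in> P"
        then have "u - G e u *\<^sub>R e \<in> Q"
          using e Suc.prems(1) by (auto simp: Q_def inner_form_linear[OF G] subspace_diff subspace_scale)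
        then have "(u - G e u *\<^sub>R e) + G e u *\<^sub>R e \<in> span (insert e Q)"
          by (intro span_add span_scale) (auto intro: span_base)
        then show "u \<in> span (insert e Q)" by simp
      qed
    qed
    have "dim P = Suc (dim Q)"
    proof -
      have "e \<notin> span Q" using eQ Q by (metis span_eq_iff)
      then show ?thesis unfolding PQ dim_span dim_insert by simp
    qed
    then have "dim Q = k" using Suc.prems by simp
    from Suc.IH[OF Q this] obtain B where B: "finite B" "card B = dim Q" "span B = Q"
      "\<forall>a\<in>B. \<forall>b\<in>B. G a b = (if a = b then 1 else 0)" by blast
    have BQ: "B \<subseteq> Q" using B(3) span_superset by blast
    then have "e \<notin> B" using eQ by blast
    moreover have "span (insert e B) = P"
    proof (rule subset_antisym)
      show "span (insert e B) \<subseteq> P" unfolding PQ by (rule span_mono) (use BQ in auto)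
      have "Q \<subseteq> span (insert e B)" unfolding B(3)[symmetric] by (rule span_mono) auto
      then show "P \<subseteq> span (insert e B)"
        unfolding PQ by (intro span_minimal) (auto intro: span_base)
    qed
    moreover have "G e b = 0" "G b e = 0" if "b \<in> B" for b
      using that BQ inner_form_sym[OF G, of b e] by (auto simp: Q_def)
    ultimately show ?case
      using B e \<open>dim P = Suc (dim Q)\<close> by (intro exI[of _ "insert e B"]) auto
  qed
  then show thesis using P that by blast
qed

lemma orthonormal_basis_exists:
  fixes G :: "real ^ 'n::finite \<Rightarrow> real ^ 'n \<Rightarrow> real"
  assumes G: "inner_form G" and P: "subspace P" "dim P = CARD('p::finite)"
  obtains e :: "'p::finite \<Rightarrow> real ^ 'n" where "orthonormal_basis G e P"
proof -
  obtain B where B: "finite B" "card B = dim P" "span B = P"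
    "\<And>a b. a \<in> B \<Longrightarrow> b \<in> B \<Longrightarrow> G a b = (if a = b then 1 else 0)"
    by (rule gram_schmidt[OF G P(1)]) (rule that, assumption+)
  obtain e where e: "bij_betw e (UNIV :: 'p set) B"
    using finite_same_card_bij[OF finite_class.finite_UNIV B(1)] B(2) P(2) by metis
  have "orthonormal_basis G e P"
    unfolding orthonormal_basis_def
  proof (intro conjI allI)
    have r: "range e = B" using e by (simp add: bij_betw_def)
    then show "span (range e) = P" using B(3) by simp
    show "G (e a) (e b) = (if a = b then 1 else 0)" for a b
      using B(4)[of "e a" "e b"] r e by (auto simp: bij_betw_def inj_eq)
  qed
  then show thesis by (rule that)
qed

text \<open>\<open>B\<close> takes coordinates in a basis orthonormal for \<open>G\<close> and
  \<open>C\<close> inverts it; questions about \<open>G\<close> and \<open>ext_norm G\<close> become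
  questions about the standard inner product.\<close>

lemma inner_form_isometry:
  fixes G :: "real ^ 'n::finite \<Rightarrow> real ^ 'n \<Rightarrow> real"
  assumes G: "inner_form G"
  obtains B C :: "real ^ 'n \<Rightarrow> real ^ 'n" where "linear B" "linear C" "\<And>v. B (C v) = v" "\<And>v. C (B v) = v"
    "\<And>u v. G u v = B u \<bullet> B v"
proof -
  obtain e :: "'n \<Rightarrow> real ^ 'n" where e: "orthonormal_basis G e UNIV"
    by (rule orthonormal_basis_exists[OF G subspace_UNIV])
      (simp only: dim_UNIV DIM_cart DIM_real mult_1_right)
  have on: "G (e a) (e b) = (if a = b then 1 else 0)" for a b using e by (simp add: orthonormal_basis_def)
  define B where "B v = (\<chi> a. G (e a) v)" for v
  define C where "C w = (\<Sum>a\<in>UNIV. w $ a *\<^sub>R e a)" for w :: "real ^ 'n"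
  have B: "linear B" unfolding B_def by (intro linearI) (auto simp: vec_eq_iff inner_form_linear[OF G])
  have C: "linear C" unfolding C_def
    by (intro linearI) (auto simp: scaleR_add_left sum.distrib scaleR_sum_right)
  have BC: "B (C w) = w" for w
    by (auto simp: B_def C_def vec_eq_iff linear_sum[OF inner_form_linear(1)[OF G]] inner_form_linear[OF G] on if_distrib cong: if_cong)
  have "inj C" using BC by (metis injI)
  then have "surj C" using linear_injective_imp_surjective[OF C] by simp
  then have CB: "C (B v) = v" for v using BC by (metis surjD)
  have "G u v = B u \<bullet> B v" for u v
  proof -
    have "G u v = G (C (B u)) v" by (simp add: CB)
    also have "\<dots> = (\<Sum>a\<in>UNIV. B u $ a * G (e a) v)"
      unfolding C_def by (simp add: linear_sum[OF inner_form_linear(2)[OF G]] inner_form_linear[OF G])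
    also have "\<dots> = B u \<bullet> B v" by (simp add: inner_vec_def B_def)
    finally show ?thesis .
  qed
  then show thesis using that[OF B C BC CB] by blast
qed

lemma orthonormal_basis_expand:
  assumes G: "inner_form G" and e: "orthonormal_basis G e P" and v: "v \<in> P"
  shows "v = (\<Sum>a\<in>UNIV. G (e a) v *\<^sub>R e (a :: 'p::finite))"
proof -
  have on: "G (e a) (e b) = (if a = b then 1 else 0)" for a b using e by (simp add: orthonormal_basis_def)
  have "v \<in> span (range e)" using e v by (simp add: orthonormal_basis_def)
  then show ?thesis
  proof (induction v rule: span_induct_alt)
    case base
    then show ?case by (simp add: inner_form_linear[OF G])
  next
    case (step c x y)
    then obtain a where a: "x = e a" by blast
    have "G (e b) (c *\<^sub>R x + y) *\<^sub>R e b = (if b = a then c *\<^sub>R x else 0) + G (e b) y *\<^sub>R e b" for b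
      by (simp add: a inner_form_linear[OF G] on scaleR_add_left)
    then have "(\<Sum>b\<in>UNIV. G (e b) (c *\<^sub>R x + y) *\<^sub>R e b) = c *\<^sub>R x + (\<Sum>b\<in>UNIV. G (e b) y *\<^sub>R e b)"
      by (simp add: sum.distrib)
    then show ?case using step by simp
  qed
qed

section \<open>Exterior powers\<close>

lemma prod_sum_UNIV:
  fixes f :: "'p::finite \<Rightarrow> 'n::finite \<Rightarrow> 'c::comm_semiring_1"
  shows "(\<Prod>a\<in>UNIV. \<Sum>k\<in>UNIV. f a k) = (\<Sum>h\<in>UNIV. \<Prod>a\<in>UNIV. f a (h a))"
  using prod_sum_PiE[of UNIV "\<lambda>_. UNIV" f] by (simp add: PiE_UNIV_domain)

lemma matrix_entry:
  fixes L :: "real ^ 'n::finite \<Rightarrow> real ^ 'n"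
  assumes "linear L"
  shows "L v $ i = (\<Sum>j\<in>UNIV. matrix L $ i $ j * v $ j)"
proof -
  have "L v = matrix L *v v" using fun_cong[OF matrix_vector_mul(2)[OF assms]] by metis
  then show ?thesis by (simp add: matrix_vector_mult_def)
qed

section \<open>Functoriality, norms and determinants in the exterior power\<close>

lemma ext_map_linear: "linear (ext_map L)"
  by (intro linearI)
    (auto simp: ext_map_def vec_eq_iff algebra_simps sum.distrib sum_distrib_left)

lemma ext_map_add: "ext_map L (v + w) = ext_map L v + ext_map L w"
  and ext_map_scaleR: "ext_map L (c *\<^sub>R v) = c *\<^sub>R ext_map L v"
  and ext_map_zero: "ext_map L 0 = 0"
  and ext_map_sum: "ext_map L (sum h S) = (\<Sum>i\<in>S. ext_map L (h i))"
  by (simp_all add: linear_add[OF ext_map_linear] linear_scale[OF ext_map_linear]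
      linear_0[OF ext_map_linear] linear_sum[OF ext_map_linear])

lemma ext_map_id:
  fixes w :: "real ^ ('p::finite \<Rightarrow> 'n::finite)"
  shows "ext_map (\<lambda>v. v) w = w"
proof -
  have m: "matrix (\<lambda>v::real^'n. v) $ k $ l = (if k = l then 1 else 0)" for k l
    by (simp add: matrix_def axis_def)
  have d: "(\<Prod>a\<in>UNIV. if i a = j a then 1 else 0 :: real) = (if j = i then 1 else 0)" for i j :: "'p \<Rightarrow> 'n"
  proof (cases "j = i")
    case False
    then obtain a where "i a \<noteq> j a" by (metis ext)
    then have "\<exists>a\<in>UNIV. (if i a = j a then 1 else 0 :: real) = 0"
      by (intro bexI[of _ a]) auto
    then have "(\<Prod>a\<in>UNIV. if i a = j a then 1 else 0 :: real) = 0" by (intro prod_zero) auto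
    then show ?thesis using False by simp
  qed simp
  have "(\<Sum>j\<in>UNIV. (if j = i then 1 else 0) * w $ j) = (\<Sum>j\<in>UNIV. if j = i then w $ j else 0)" for i
    by (rule sum.cong) auto
  then show ?thesis
    by (simp add: ext_map_def vec_eq_iff m d)
qed

lemma ext_map_comp:
  fixes L M :: "real ^ 'n::finite \<Rightarrow> real ^ 'n"
  assumes "linear L" "linear M"
  shows "ext_map L (ext_map M w) = ext_map (\<lambda>v. L (M v)) w"
proof -
  have m: "matrix (\<lambda>v. L (M v)) $ i $ j = (\<Sum>k\<in>UNIV. matrix L $ i $ k * matrix M $ k $ j)" for i j
    using matrix_compose[OF assms(2,1)] by (simp add: comp_def matrix_matrix_mult_def)
  show ?thesis
    unfolding ext_map_def vec_eq_iff m prod_sum_UNIV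
    by (simp add: prod.distrib sum_distrib_left sum_distrib_right mult.assoc) (subst sum.swap, simp)
qed

text \<open>In the Leibniz expansion the permutation \<open>s\<close> acts on the multi-index
  \<open>i\<close> of the matrix of \<open>L\<close>. Replacing the summation index \<open>j\<close>
  by its composition with \<open>s\<close> moves the permutation to the vectors, where the signed
  sum is again a determinant.\<close>

lemma ext_map_wedge:
  fixes L :: "real ^ 'n::finite \<Rightarrow> real ^ 'n" and v :: "'p::finite \<Rightarrow> real ^ 'n"
  assumes L: "linear L"
  shows "ext_map L (wedge v) = wedge (\<lambda>a. L (v a))"
proof -
  have "ext_map L (wedge v) $ i = wedge (\<lambda>a. L (v a)) $ i" for i
  proof -
    let ?m = "\<lambda>k l. matrix L $ k $ l" and ?S = "{s. s permutes (UNIV :: 'p set)}"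
    have perm: "(\<Prod>a\<in>UNIV. ?m (i (s a)) (j (s a))) = (\<Prod>a\<in>UNIV. ?m (i a) (j a))" if "s permutes UNIV" for s j
      using prod.permute[OF that, of "\<lambda>a. ?m (i a) (j a)"] by (simp add: comp_def)
    have re: "(\<Sum>j\<in>UNIV. (\<Prod>a\<in>UNIV. ?m (i (s a)) (j a)) * (\<Prod>a\<in>UNIV. v a $ j a)) =
      (\<Sum>j\<in>UNIV. (\<Prod>a\<in>UNIV. ?m (i a) (j a)) * (\<Prod>a\<in>UNIV. v a $ j (s a)))" if s: "s permutes UNIV" for s
    proof -
      have "bij s" using s by (rule permutes_bij)
      then have "bij (\<lambda>j :: 'p \<Rightarrow> 'n. j \<circ> s)"
        by (intro o_bij[of "\<lambda>j. j \<circ> inv s"]) (auto simp: fun_eq_iff bij_is_inj bij_is_surj surj_f_inv_f)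
      then have "(\<Sum>j\<in>UNIV. (\<Prod>a\<in>UNIV. ?m (i (s a)) (j a)) * (\<Prod>a\<in>UNIV. v a $ j a)) =
        (\<Sum>j\<in>UNIV. (\<Prod>a\<in>UNIV. ?m (i (s a)) ((j \<circ> s) a)) * (\<Prod>a\<in>UNIV. v a $ (j \<circ> s) a))"
        by (rule sum.reindex_bij_betw[symmetric])
      then show ?thesis using perm[OF s] by simp
    qed
    have "wedge (\<lambda>a. L (v a)) $ i = (\<Sum>s\<in>?S. of_int (sign s) * (\<Prod>a\<in>UNIV. L (v a) $ i (s a)))"
      by (simp add: wedge_def det_def)
    also have "\<dots> = (\<Sum>s\<in>?S. of_int (sign s) *
      (\<Sum>j\<in>UNIV. (\<Prod>a\<in>UNIV. ?m (i (s a)) (j a)) * (\<Prod>a\<in>UNIV. v a $ j a)))"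
      by (simp add: matrix_entry[OF L] prod_sum_UNIV prod.distrib)
    also have "\<dots> = (\<Sum>s\<in>?S. of_int (sign s) *
      (\<Sum>j\<in>UNIV. (\<Prod>a\<in>UNIV. ?m (i a) (j a)) * (\<Prod>a\<in>UNIV. v a $ j (s a))))"
      by (intro sum.cong refl arg_cong2[where f=times] re) simp
    also have "\<dots> = (\<Sum>j\<in>UNIV. (\<Prod>a\<in>UNIV. ?m (i a) (j a)) * (\<Sum>s\<in>?S. of_int (sign s) * (\<Prod>a\<in>UNIV. v a $ j (s a))))"
      unfolding sum_distrib_left by (subst sum.swap) (simp add: mult.left_commute)
    also have "\<dots> = ext_map L (wedge v) $ i"
      by (simp add: ext_map_def wedge_def det_def)
    finally show ?thesis ..
  qed
  then show ?thesis by (simp add: vec_eq_iff)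
qed

text \<open>If \<open>G\<close> is the pullback of the standard inner product under
  \<open>B\<close>, the products of Gram entries in \<open>ext_norm\<close> form the Gram matrix of
  the tensor power of \<open>B\<close>, which is the map that \<open>ext_map B\<close>
  applies.\<close>

lemma ext_norm_eq:
  fixes w :: "real ^ ('p::finite \<Rightarrow> 'n::finite)"
  assumes B: "linear B" and GB: "\<And>u v. G u v = B u \<bullet> B v"
  shows "ext_norm G w = norm (ext_map B w) / sqrt (fact CARD('p))"
proof -
  let ?m = "\<lambda>k l. matrix B $ k $ l"
  have G: "G (axis k 1) (axis l 1) = (\<Sum>q\<in>UNIV. ?m q k * ?m q l)" for k l
    unfolding GB inner_vec_def by (simp add: matrix_def)
  have "(\<Sum>i\<in>UNIV. \<Sum>j\<in>UNIV. (\<Prod>a\<in>UNIV. G (axis (i a) 1) (axis (j a) 1)) * w $ i * w $ j) =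
    (\<Sum>i\<in>UNIV. \<Sum>j\<in>UNIV. \<Sum>h\<in>UNIV. ((\<Prod>a\<in>UNIV. ?m (h a) (i a)) * w $ i) * ((\<Prod>a\<in>UNIV. ?m (h a) (j a)) * w $ j))"
    unfolding G prod_sum_UNIV by (simp add: prod.distrib sum_distrib_right sum_distrib_left mult_ac)
  also have "\<dots> = (\<Sum>h\<in>UNIV. \<Sum>i\<in>UNIV. \<Sum>j\<in>UNIV. ((\<Prod>a\<in>UNIV. ?m (h a) (i a)) * w $ i) * ((\<Prod>a\<in>UNIV. ?m (h a) (j a)) * w $ j))"
    by (rule trans[OF sum.cong[OF refl sum.swap] sum.swap])
  also have "\<dots> = (norm (ext_map B w))\<^sup>2"
    unfolding power2_norm_eq_inner inner_vec_def by (simp add: ext_map_def sum_product)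
  finally show ?thesis
    by (simp add: ext_norm_def real_sqrt_divide)
qed

lemma wedge_lincomb:
  fixes f v :: "'p::finite \<Rightarrow> real ^ 'n::finite"
  assumes "\<And>b. v b = (\<Sum>a\<in>UNIV. M a b *\<^sub>R f a)"
  shows "wedge v = det (\<chi> a b. M a b) *\<^sub>R wedge f"
proof -
  have "det (\<chi> b c. v b $ i c) = det (\<chi> a b. M a b) * det (\<chi> a c. f a $ i c)" for i
  proof -
    have "(\<chi> b c. v b $ i c) = transpose (\<chi> a b. M a b) ** (\<chi> a c. f a $ i c)"
      by (simp add: vec_eq_iff matrix_matrix_mult_def transpose_def assms)
    then show ?thesis by (simp add: det_mul)
  qed
  then show ?thesis by (simp add: wedge_def vec_eq_iff)
qed

text \<open>The \<open>p!\<close> tensor products obtained by permuting the factors of an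
  orthonormal family are orthonormal, and \<open>wedge u\<close> is their signed sum. This is the
  factorial divided out in \<open>ext_norm\<close>.\<close>

lemma norm_wedge_orthonormal:
  fixes u :: "'p::finite \<Rightarrow> real ^ 'n::finite"
  assumes on: "\<And>a b. u a \<bullet> u b = (if a = b then 1 else 0)"
  shows "norm (wedge u) = sqrt (fact CARD('p))"
proof -
  let ?S = "{s. s permutes (UNIV :: 'p set)}"
  have re: "(\<Prod>a\<in>UNIV. u a $ i (s a)) = (\<Prod>a\<in>UNIV. u (inv s a) $ i a)" if "s permutes UNIV" for i :: "'p \<Rightarrow> 'n" and s
    using prod.permute[OF that, of "\<lambda>a. u (inv s a) $ i a"] permutes_inverses(2)[OF that] by (simp add: comp_def)
  have orth: "(\<Sum>i\<in>UNIV. (\<Prod>a\<in>UNIV. u a $ i (s a)) * (\<Prod>a\<in>UNIV. u a $ i (t a))) = (if s = t then 1 else 0)"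
    if s: "s permutes UNIV" and t: "t permutes UNIV" for s t
  proof -
    have "(\<Sum>i\<in>UNIV. (\<Prod>a\<in>UNIV. u a $ i (s a)) * (\<Prod>a\<in>UNIV. u a $ i (t a))) =
      (\<Sum>i\<in>UNIV. \<Prod>a\<in>UNIV. u (inv s a) $ i a * u (inv t a) $ i a)"
      unfolding re[OF s] re[OF t] by (simp add: prod.distrib)
    also have "\<dots> = (\<Prod>a\<in>UNIV. u (inv s a) \<bullet> u (inv t a))"
      unfolding inner_vec_def using prod_sum_UNIV[of "\<lambda>a k. u (inv s a) $ k * u (inv t a) $ k"] by simp
    also have "\<dots> = (\<Prod>a\<in>UNIV. if inv s a = inv t a then 1 else 0)" by (simp add: on)
    also have "\<dots> = (if s = t then 1 else 0)"
    proof (cases "s = t")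
      case False
      then have "inv s \<noteq> inv t" using permutes_inv_inv[OF s] permutes_inv_inv[OF t] by metis
      then obtain a where "inv s a \<noteq> inv t a" by blast
      then show ?thesis using False by (simp add: prod_zero_iff) blast
    qed simp
    finally show ?thesis .
  qed
  have "(norm (wedge u))\<^sup>2 = (\<Sum>i\<in>UNIV. (\<Sum>s\<in>?S. of_int (sign s) * (\<Prod>a\<in>UNIV. u a $ i (s a))) *
      (\<Sum>t\<in>?S. of_int (sign t) * (\<Prod>a\<in>UNIV. u a $ i (t a))))"
    unfolding power2_norm_eq_inner inner_vec_def by (simp add: wedge_def det_def)
  also have "\<dots> = (\<Sum>i\<in>UNIV. \<Sum>s\<in>?S. \<Sum>t\<in>?S. (of_int (sign s) * of_int (sign t)) *
      ((\<Prod>a\<in>UNIV. u a $ i (s a)) * (\<Prod>a\<in>UNIV. u a $ i (t a))))"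
    unfolding sum_product by (simp add: mult_ac)
  also have "\<dots> = (\<Sum>s\<in>?S. \<Sum>t\<in>?S. (of_int (sign s) * of_int (sign t)) *
      (\<Sum>i\<in>UNIV. (\<Prod>a\<in>UNIV. u a $ i (s a)) * (\<Prod>a\<in>UNIV. u a $ i (t a))))"
    unfolding sum_distrib_left by (subst sum.swap) (rule sum.cong[OF refl], rule sum.swap)
  also have "\<dots> = (\<Sum>s\<in>?S. \<Sum>t\<in>?S. (of_int (sign s) * of_int (sign t)) * (if s = t then 1 else 0))"
    by (intro sum.cong refl arg_cong2[where f=times] orth) auto
  also have "\<dots> = (\<Sum>s\<in>?S. 1)"
    by (intro sum.cong refl) (auto simp: if_distrib sign_idempotent finite_permutations simp flip: of_int_mult cong: if_cong)
  also have "\<dots> = fact CARD('p)" by (simp add: card_permutations)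
  finally show ?thesis by (metis norm_ge_zero real_sqrt_unique)
qed

lemma ext_norm_wedge_orthonormal:
  fixes e :: "'p::finite \<Rightarrow> real ^ 'n::finite"
  assumes G: "inner_form G" and e: "orthonormal_basis G e P"
  shows "ext_norm G (wedge e) = 1"
proof -
  obtain B C :: "real ^ 'n \<Rightarrow> real ^ 'n" where B: "linear B" "\<And>u v. G u v = B u \<bullet> B v"
    by (rule inner_form_isometry[OF G]) (rule that, assumption+)
  have "norm (wedge (\<lambda>a. B (e a))) = sqrt (fact CARD('p))"
    by (rule norm_wedge_orthonormal) (use e B(2) in \<open>simp add: orthonormal_basis_def\<close>)
  then show ?thesis by (simp add: ext_norm_eq[OF B] ext_map_wedge[OF B(1)])
qed

lemma ext_norm_scaleR: "inner_form G \<Longrightarrow> ext_norm G (c *\<^sub>R w) = \<bar>c\<bar> * ext_norm G w"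
  by (rule inner_form_isometry[of G]) (auto simp: ext_norm_eq ext_map_scaleR)

lemma ext_norm_triangle: "inner_form G \<Longrightarrow> ext_norm G (v + w) \<le> ext_norm G v + ext_norm G w"
  by (rule inner_form_isometry[of G])
    (auto simp: ext_norm_eq ext_map_add add_divide_distrib[symmetric] intro!: divide_right_mono norm_triangle_ineq)

lemma ext_norm_nonneg: "inner_form G \<Longrightarrow> 0 \<le> ext_norm G w"
  by (rule inner_form_isometry[of G]) (auto simp: ext_norm_eq)

lemma ext_norm_pos:
  fixes w :: "real ^ ('p::finite \<Rightarrow> 'n::finite)"
  assumes "inner_form G" "w \<noteq> 0"
  shows "0 < ext_norm G w"
proof -
  obtain B C :: "real ^ 'n \<Rightarrow> real ^ 'n" where B: "linear B" "linear C" "\<And>v. C (B v) = v" "\<And>u v. G u v = B u \<bullet> B v"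
    by (rule inner_form_isometry[OF assms(1)]) (rule that, assumption+)
  have "ext_map C (ext_map B w) = w" unfolding ext_map_comp[OF B(2,1)] B(3) by (rule ext_map_id)
  then have "ext_map B w \<noteq> 0" using assms(2) ext_map_zero by metis
  then show ?thesis by (simp add: ext_norm_eq[OF B(1,4)])
qed

lemma ext_norm_zero: "inner_form G \<Longrightarrow> ext_norm G 0 = 0"
  using ext_norm_scaleR[of G 0 0] by simp

lemma ext_norm_sum_le: "inner_form G \<Longrightarrow> ext_norm G (sum h S) \<le> (\<Sum>i\<in>S. ext_norm G (h i))"
  by (induction S rule: infinite_finite_induct)
    (auto simp: ext_norm_zero intro: order_trans[OF ext_norm_triangle] add_left_mono)

text \<open>This gives the description operator in \<open>abs_det_restr\<close> its value:
  \<open>L\<close> takes \<open>wedge e\<close> to a determinant times the unit vector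
  \<open>wedge f\<close>, and changing the orthonormal basis of \<open>P\<close> multiplies
  \<open>wedge e\<close> by a determinant of absolute value 1. Injectivity keeps the image of
  dimension \<open>CARD('p)\<close>, so that a basis \<open>f\<close> exists.\<close>

lemma abs_det_restr_eq:
  fixes e :: "'p::finite \<Rightarrow> real ^ 'n::finite" and g :: "('m, 'n) metric_field"
  assumes Gx: "inner_form (g x)" and Gy: "inner_form (g y)" and L: "linear L" and inj: "inj_on L P"
    and P: "subspace P" "dim P = CARD('p)" and e: "orthonormal_basis (g x) e P"
  shows "abs_det_restr TYPE('p) g x y L P = ext_norm (g y) (ext_map L (wedge e))"
proof -
  have val: "\<bar>det (\<chi> a b. g y (f a) (L (e b)))\<bar> = ext_norm (g y) (ext_map L (wedge e))"
    if e: "orthonormal_basis (g x) e P" and f: "orthonormal_basis (g y) f (L ` P)" for e f :: "'p \<Rightarrow> real ^ 'n"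
  proof -
    have "L (e b) \<in> L ` P" for b
      using e by (auto simp: orthonormal_basis_def intro: span_base)
    then have "wedge (\<lambda>b. L (e b)) = det (\<chi> a b. g y (f a) (L (e b))) *\<^sub>R wedge f"
      by (intro wedge_lincomb orthonormal_basis_expand[OF Gy f])
    then show ?thesis
      by (simp add: ext_map_wedge[OF L] ext_norm_scaleR[OF Gy] ext_norm_wedge_orthonormal[OF Gy f])
  qed
  have indep: "ext_norm (g y) (ext_map L (wedge e')) = ext_norm (g y) (ext_map L (wedge e))"
    if e': "orthonormal_basis (g x) e' P" for e' :: "'p \<Rightarrow> real ^ 'n"
  proof -
    have "e' b \<in> P" for b using e' by (auto simp: orthonormal_basis_def intro: span_base)
    then have w: "wedge e' = det (\<chi> a b. g x (e a) (e' b)) *\<^sub>R wedge e"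
      by (intro wedge_lincomb orthonormal_basis_expand[OF Gx e])
    then have "\<bar>det (\<chi> a b. g x (e a) (e' b))\<bar> = 1"
      using ext_norm_wedge_orthonormal[OF Gx e'] ext_norm_wedge_orthonormal[OF Gx e]
      by (simp add: ext_norm_scaleR[OF Gx])
    then show ?thesis by (simp add: w ext_map_scaleR ext_norm_scaleR[OF Gy])
  qed
  have "subspace (L ` P)" using P(1) L by (rule linear_subspace_image[rotated])
  moreover have "dim (L ` P) = CARD('p)"
  proof -
    have "inj_on L (span P)" using inj P(1) by (metis span_eq_iff)
    then show ?thesis using dim_image_eq[OF L, of P] P(2) by simp
  qed
  ultimately obtain f :: "'p \<Rightarrow> real ^ 'n" where f: "orthonormal_basis (g y) f (L ` P)"
    by (rule orthonormal_basis_exists[OF Gy])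
  show ?thesis
    unfolding abs_det_restr_def
  proof (rule the_equality)
    show "\<exists>(e' :: 'p \<Rightarrow> real ^ 'n) (f :: 'p \<Rightarrow> real ^ 'n). orthonormal_basis (g x) e' P \<and> orthonormal_basis (g y) f (L ` P) \<and>
      ext_norm (g y) (ext_map L (wedge e)) = \<bar>det (\<chi> a b. g y (f a) (L (e' b)))\<bar>"
      by (intro exI conjI) (rule e, rule f, rule val[OF e f, symmetric])
    fix d assume "\<exists>(e' :: 'p \<Rightarrow> real ^ 'n) (f :: 'p \<Rightarrow> real ^ 'n). orthonormal_basis (g x) e' P \<and> orthonormal_basis (g y) f (L ` P) \<and>
      d = \<bar>det (\<chi> a b. g y (f a) (L (e' b)))\<bar>"
    then obtain e' f :: "'p \<Rightarrow> real ^ 'n" where "orthonormal_basis (g x) e' P" "orthonormal_basis (g y) f (L ` P)"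
      "d = \<bar>det (\<chi> a b. g y (f a) (L (e' b)))\<bar>" by blast
    then show "d = ext_norm (g y) (ext_map L (wedge e))" using val indep by simp
  qed
qed

text \<open>For \<open>P\<close> the identity this is antisymmetrisation of tensors; for a
  projection \<open>P\<close> onto \<open>S\<close> it is a projection onto
  \<open>ext_power S\<close>. It writes elements of \<open>ext_power S\<close> as explicit
  combinations of wedges, and turns membership into a fixed-point equation that survives
  limits.\<close>

definition antisym_project :: "(real ^ 'n \<Rightarrow> real ^ 'n) \<Rightarrow> real ^ ('p::finite \<Rightarrow> 'n::finite) \<Rightarrow> real ^ ('p \<Rightarrow> 'n)" where
  "antisym_project P w = (1 / fact CARD('p)) *\<^sub>R (\<Sum>i\<in>UNIV. w $ i *\<^sub>R wedge (\<lambda>a. P (axis (i a) 1)))"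

lemma antisym_project_linear: "linear (antisym_project P)"
  by (intro linearI)
    (auto simp: antisym_project_def scaleR_add_left sum.distrib scaleR_add_right scaleR_sum_right mult_ac)

lemma antisym_project_comp:
  "linear L \<Longrightarrow> ext_map L (antisym_project P w) = antisym_project (\<lambda>v. L (P v)) w"
  by (simp add: antisym_project_def ext_map_scaleR ext_map_sum ext_map_wedge)

text \<open>At \<open>j\<close> only the multi-indices that permute \<open>j\<close> by some
  \<open>s\<close> contribute. Permuting the columns of a determinant by \<open>s\<close> yields
  \<open>sign s\<close>, which cancels the sign in front and leaves \<open>p!\<close> equal
  terms.\<close>

lemma antisym_project_id_wedge:
  fixes v :: "'p::finite \<Rightarrow> real ^ 'n::finite"
  shows "antisym_project (\<lambda>v. v) (wedge v) = wedge v"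
proof -
  let ?S = "{s. s permutes (UNIV :: 'p set)}"
  have "(\<Sum>i\<in>UNIV. wedge v $ i * wedge (\<lambda>a. axis (i a) 1) $ j) = fact CARD('p) * wedge v $ j" for j
  proof -
    have "wedge (\<lambda>a. axis (i a) 1) $ j = (\<Sum>s\<in>?S. of_int (sign s) * (if i = j \<circ> s then 1 else 0))" for i
    proof -
      have "(\<Prod>a\<in>UNIV. (axis (i a) 1 :: real ^ 'n) $ j (s a)) = (if i = j \<circ> s then 1 else 0)" for s
      proof (cases "i = j \<circ> s")
        case False
        then obtain a where "i a \<noteq> j (s a)" by (metis comp_apply ext)
        then have "\<exists>a\<in>UNIV. (axis (i a) 1 :: real ^ 'n) $ j (s a) = 0"
          by (intro bexI[of _ a]) (auto simp: axis_def)
        then have "(\<Prod>a\<in>UNIV. (axis (i a) 1 :: real ^ 'n) $ j (s a)) = 0" by (intro prod_zero) auto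
        then show ?thesis using False by simp
      qed (simp add: axis_def)
      then show ?thesis by (simp add: wedge_def det_def)
    qed
    then have "(\<Sum>i\<in>UNIV. wedge v $ i * wedge (\<lambda>a. axis (i a) 1) $ j) =
      (\<Sum>i\<in>UNIV. \<Sum>s\<in>?S. wedge v $ i * (of_int (sign s) * (if i = j \<circ> s then 1 else 0)))"
      by (simp add: sum_distrib_left)
    also have "\<dots> = (\<Sum>s\<in>?S. \<Sum>i\<in>UNIV. wedge v $ i * (of_int (sign s) * (if i = j \<circ> s then 1 else 0)))"
      by (rule sum.swap)
    also have "\<dots> = (\<Sum>s\<in>?S. wedge v $ (j \<circ> s) * of_int (sign s))"
      by (simp add: if_distrib cong: if_cong)
    also have "\<dots> = (\<Sum>s\<in>?S. wedge v $ j)"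
    proof (rule sum.cong[OF refl])
      fix s assume "s \<in> ?S"
      then have "wedge v $ (j \<circ> s) = of_int (sign s) * wedge v $ j"
        using det_permute_columns[of s "\<chi> a b. v a $ j b"] by (simp add: wedge_def)
      moreover have "of_int (sign s) * of_int (sign s) = (1 :: real)"
        unfolding of_int_mult[symmetric] sign_idempotent by simp
      ultimately show "wedge v $ (j \<circ> s) * of_int (sign s) = wedge v $ j" by (simp add: mult_ac)
    qed
    also have "\<dots> = fact CARD('p) * wedge v $ j" by (simp add: card_permutations)
    finally show ?thesis .
  qed
  then show ?thesis by (simp add: antisym_project_def vec_eq_iff)
qed

text \<open>The operator is antisymmetrisation followed by \<open>ext_map P\<close>; on wedges of
  vectors in \<open>S\<close> both factors act as the identity.\<close>

lemma antisym_project_ext_power: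
  fixes w :: "real ^ ('p::finite \<Rightarrow> 'n::finite)"
  assumes w: "w \<in> ext_power S" and P: "linear P" "\<And>v. v \<in> S \<Longrightarrow> P v = v"
  shows "antisym_project P w = w"
  using w unfolding ext_power_def
proof (induction w rule: span_induct)
  case base
  show ?case
    by (intro subspaceI)
      (auto simp: linear_add[OF antisym_project_linear] linear_scale[OF antisym_project_linear]
        linear_0[OF antisym_project_linear])
next
  case (step x)
  then obtain v where v: "x = wedge v" "\<forall>a. v a \<in> S" by blast
  have "antisym_project P x = ext_map P (antisym_project (\<lambda>v. v) x)"
    using antisym_project_comp[OF P(1), of "\<lambda>v. v" x] by simp
  also have "\<dots> = x" using v P by (simp add: antisym_project_id_wedge ext_map_wedge[OF P(1)])
  finally show ?case .
qed

lemma antisym_project_in: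
  assumes "\<And>v. P v \<in> S"
  shows "antisym_project P w \<in> ext_power S"
  unfolding antisym_project_def ext_power_def
  by (intro span_scale span_sum) (use assms in \<open>auto intro: span_base\<close>)

lemma ext_map_ext_power:
  assumes "linear L" "w \<in> ext_power S"
  shows "ext_map L w \<in> ext_power (L ` S)"
  using assms(2) unfolding ext_power_def
proof (induction w rule: span_induct)
  case base
  show ?case
    by (intro subspaceI) (auto simp: ext_map_add ext_map_scaleR ext_map_zero intro: span_add span_scale span_zero)
next
  case (step x)
  then obtain v where "x = wedge v" "\<forall>a. v a \<in> S" by blast
  then show ?case by (auto simp: ext_map_wedge[OF assms(1)] intro!: span_base)
qed

lemma norm_wedge_le:
  fixes u :: "'p::finite \<Rightarrow> real ^ 'n::finite"
  assumes "\<And>a. norm (u a) \<le> 1"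
  shows "norm (wedge u) \<le> real (CARD('p \<Rightarrow> 'n)) * fact CARD('p)"
proof -
  let ?S = "{s. s permutes (UNIV :: 'p set)}"
  have "\<bar>wedge u $ i\<bar> \<le> fact CARD('p)" for i
  proof -
    have "\<bar>wedge u $ i\<bar> \<le> (\<Sum>s\<in>?S. \<bar>of_int (sign s) * (\<Prod>a\<in>UNIV. u a $ i (s a))\<bar>)"
      unfolding wedge_def det_def by (simp add: sum_abs)
    also have "\<dots> \<le> (\<Sum>s\<in>?S. 1)"
    proof (rule sum_mono)
      fix s
      have "\<bar>of_int (sign s) * (\<Prod>a\<in>UNIV. u a $ i (s a))\<bar> = (\<Prod>a\<in>UNIV. \<bar>u a $ i (s a)\<bar>)"
        by (simp add: abs_mult sign_def abs_prod)
      also have "\<dots> \<le> 1"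
        by (rule prod_le_1) (use assms component_le_norm_cart order_trans in \<open>auto intro: order_trans[OF component_le_norm_cart]\<close>)
      finally show "\<bar>of_int (sign s) * (\<Prod>a\<in>UNIV. u a $ i (s a))\<bar> \<le> 1" .
    qed
    also have "\<dots> = fact CARD('p)" by (simp add: card_permutations)
    finally show ?thesis .
  qed
  then have "(\<Sum>i\<in>UNIV. \<bar>wedge u $ i\<bar>) \<le> (\<Sum>i\<in>(UNIV :: ('p \<Rightarrow> 'n) set). fact CARD('p))"
    by (intro sum_mono)
  then show ?thesis using norm_le_l1_cart[of "wedge u"] by simp
qed

lemma orthogonal_projection:
  fixes S :: "(real ^ 'n::finite) set"
  assumes "subspace S"
  obtains P where "linear P" "\<And>v. P v \<in> S" "\<And>v. v \<in> S \<Longrightarrow> P v = v" "\<And>v. norm (P v) \<le> norm v"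
proof -
  obtain B where B: "finite B" "card B = dim S" "span B = S"
    "\<And>a b. a \<in> B \<Longrightarrow> b \<in> B \<Longrightarrow> a \<bullet> b = (if a = b then 1 else 0)"
    by (rule gram_schmidt[OF inner_form_inner assms]) (rule that, assumption+)
  define P where "P v = (\<Sum>b\<in>B. (b \<bullet> v) *\<^sub>R b)" for v
  have lin: "linear P"
    unfolding P_def by (intro linearI) (auto simp: inner_add_right scaleR_add_left sum.distrib scaleR_sum_right)
  have inS: "P v \<in> S" for v
    unfolding P_def B(3)[symmetric] by (intro span_sum span_scale span_base)
  have Pb: "P b = b" if "b \<in> B" for b
  proof -
    have "P b = (\<Sum>a\<in>B. if a = b then b else 0)"
      unfolding P_def by (intro sum.cong refl) (use B(4) that in auto)
    then show ?thesis using B(1) that by simp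
  qed
  have fixS: "P v = v" if "v \<in> S" for v
    using that unfolding B(3)[symmetric]
  proof (induction v rule: span_induct)
    case base
    show ?case by (intro subspaceI) (use lin in \<open>auto simp: linear_add linear_scale linear_0\<close>)
  qed (rule Pb)
  have "norm (P v) \<le> norm v" for v
  proof -
    have "P v \<bullet> w = v \<bullet> P w" for w
      unfolding P_def by (simp add: inner_sum_left inner_sum_right inner_commute mult.commute)
    then have "P v \<bullet> P v = v \<bullet> P v" using fixS[OF inS] by metis
    also have "\<dots> \<le> norm v * norm (P v)" by (rule norm_cauchy_schwarz)
    finally have "norm (P v) * norm (P v) \<le> norm v * norm (P v)" by (simp add: dot_square_norm power2_eq_square)
    then show ?thesis by (metis mult_right_le_imp_le norm_ge_zero norm_zero order.strict_iff_order)
  qed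
  then show thesis using that[OF lin inS fixS] by blast
qed

text \<open>In coordinates orthonormal for \<open>G\<close>, the vector is its own
  \<open>antisym_project\<close> along an orthogonal projection \<open>P\<close>. This writes it as
  a sum of wedges of vectors \<open>P (axis k 1)\<close>, of length at most 1, with coefficients at
  most its norm, and the seminorm \<open>N\<close> is estimated term by term. What matters is that
  the factor in front of \<open>c\<close> depends only on the dimensions.\<close>

lemma ext_power_decomposable_bound:
  fixes w :: "real ^ ('p::finite \<Rightarrow> 'n::finite)"
  assumes G: "inner_form G" and S: "subspace S" and w: "w \<in> ext_power S"
    and N: "\<And>c v. N (c *\<^sub>R v) = \<bar>c\<bar> * N v" "\<And>A h. N (sum h A) \<le> (\<Sum>i\<in>(A :: ('p \<Rightarrow> 'n) set). N (h i))"
    and le: "\<And>v. (\<And>a. v a \<in> S) \<Longrightarrow> N (wedge v) \<le> c * ext_norm G (wedge v)" and c: "0 \<le> c"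
  shows "N w \<le> (real CARD('p \<Rightarrow> 'n))\<^sup>2 * fact CARD('p) * c * ext_norm G w"
proof -
  obtain B C :: "real ^ 'n \<Rightarrow> real ^ 'n" where B: "linear B" and C: "linear C"
    and BC: "\<And>v. B (C v) = v" and CB: "\<And>v. C (B v) = v" and GB: "\<And>u v. G u v = B u \<bullet> B v"
    by (rule inner_form_isometry[OF G]) (rule that, assumption+)
  obtain P where P: "linear P" "\<And>v. P v \<in> B ` S" "\<And>v. v \<in> B ` S \<Longrightarrow> P v = v" "\<And>v. norm (P v) \<le> norm v"
    by (rule orthogonal_projection[OF linear_subspace_image[OF B S]]) (rule that, assumption+)
  let ?f = "fact CARD('p) :: real" and ?K = "real CARD('p \<Rightarrow> 'n)"
  have f0: "0 < ?f" by simp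
  define w' where "w' = ext_map B w"
  have "w' = antisym_project P w'"
    unfolding w'_def by (rule antisym_project_ext_power[OF ext_map_ext_power[OF B w] P(1,3), symmetric])
  then have "ext_map C w' = antisym_project (\<lambda>v. C (P v)) w'"
    using antisym_project_comp[OF C, of P w'] by simp
  moreover have "ext_map C w' = w"
    unfolding w'_def ext_map_comp[OF C B] CB by (rule ext_map_id)
  ultimately have we: "w = (1 / ?f) *\<^sub>R (\<Sum>i\<in>UNIV. w' $ i *\<^sub>R wedge (\<lambda>a. C (P (axis (i a) 1))))"
    by (simp add: antisym_project_def)
  have wn: "norm w' = sqrt ?f * ext_norm G w"
    unfolding w'_def ext_norm_eq[OF B GB] by simp
  have tm: "N (wedge (\<lambda>a. C (P (axis (i a) 1)))) \<le> c * (?K * ?f / sqrt ?f)" for i :: "'p \<Rightarrow> 'n"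
  proof -
    have "C (P v) \<in> S" for v using P(2)[of v] CB by auto
    then have "N (wedge (\<lambda>a. C (P (axis (i a) 1)))) \<le> c * ext_norm G (wedge (\<lambda>a. C (P (axis (i a) 1))))"
      by (rule le)
    also have "ext_norm G (wedge (\<lambda>a. C (P (axis (i a) 1)))) = norm (wedge (\<lambda>a. P (axis (i a) 1))) / sqrt ?f"
      unfolding ext_norm_eq[OF B GB] ext_map_wedge[OF B] BC ..
    also have "\<dots> \<le> ?K * ?f / sqrt ?f"
      by (intro divide_right_mono norm_wedge_le order_trans[OF P(4)]) (auto simp: norm_axis_1)
    finally show ?thesis using c by (simp add: mult_left_mono)
  qed
  have "N w \<le> (1 / ?f) * (\<Sum>i\<in>UNIV. \<bar>w' $ i\<bar> * N (wedge (\<lambda>a. C (P (axis (i a) 1)))))"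
    using N(2)[of "\<lambda>i. w' $ i *\<^sub>R wedge (\<lambda>a. C (P (axis (i a) 1)))" UNIV]
    by (subst we) (simp add: N(1) divide_right_mono)
  also have "\<dots> \<le> (1 / ?f) * (\<Sum>i\<in>(UNIV :: ('p \<Rightarrow> 'n) set). norm w' * (c * (?K * ?f / sqrt ?f)))"
    by (intro mult_left_mono sum_mono order_trans[OF mult_left_mono[OF tm] mult_right_mono[OF component_le_norm_cart]])
      (use c in auto)
  also have "\<dots> = (1 / ?f) * (?K * ((sqrt ?f * ext_norm G w) * (c * (?K * ?f / sqrt ?f))))"
    by (simp add: wn)
  also have "\<dots> = ?K\<^sup>2 * c * ext_norm G w"
    using f0 by (simp add: power2_eq_square)
  also have "\<dots> \<le> ?K\<^sup>2 * ?f * c * ext_norm G w"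
    using fact_ge_1[of "CARD('p)"] c ext_norm_nonneg[OF G, of w]
    by (intro mult_right_mono) (auto simp: mult_le_cancel_left1)
  finally show ?thesis .
qed

section \<open>Charts away from the boundary\<close>

text \<open>Pointwise convergence of the maps suffices because the moving arguments are expanded in
  a fixed finite basis.\<close>

lemma linear_tendsto:
  fixes L :: "'b \<Rightarrow> 'a::euclidean_space \<Rightarrow> 'c::real_normed_vector"
  assumes L: "eventually (\<lambda>n. linear (L n)) G" and L0: "linear L0"
    and lim: "\<And>b. ((\<lambda>n. L n b) \<longlongrightarrow> L0 b) G" and v: "(v \<longlongrightarrow> v0) G"
  shows "((\<lambda>n. L n (v n)) \<longlongrightarrow> L0 v0) G"
proof -
  have e: "l w = (\<Sum>b\<in>Basis. (w \<bullet> b) *\<^sub>R l b)" if "linear l" for l :: "'a \<Rightarrow> 'c" and w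
    using linear_sum[OF that, of "\<lambda>b. (w \<bullet> b) *\<^sub>R b" Basis]
    by (simp add: linear_scale[OF that] euclidean_representation)
  have "((\<lambda>n. \<Sum>b\<in>Basis. (v n \<bullet> b) *\<^sub>R L n b) \<longlongrightarrow> (\<Sum>b\<in>Basis. (v0 \<bullet> b) *\<^sub>R L0 b)) G"
    by (intro tendsto_intros v lim)
  then have "((\<lambda>n. \<Sum>b\<in>Basis. (v n \<bullet> b) *\<^sub>R L n b) \<longlongrightarrow> L0 v0) G" by (simp only: e[OF L0, symmetric])
  then show ?thesis
    by (rule Lim_transform_eventually) (use L in \<open>eventually_elim, simp only: e[symmetric]\<close>)
qed

lemma has_derivative_cong_nhds:
  assumes "(f has_derivative D) (at x)" "eventually (\<lambda>y. f y = h y) (nhds x)"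
  shows "(h has_derivative D) (at x)"
  by (rule has_derivative_transform_eventually[OF assms(1)])
    (use assms(2) eventually_nhds_x_imp_x[OF assms(2)] in \<open>auto simp: eventually_at_filter elim: eventually_mono\<close>)

text \<open>Inside an open part of \<open>S\<close> a local extension agrees with \<open>f\<close>
  on a neighbourhood, so that its derivative is that of \<open>f\<close> itself.\<close>

lemma locally_extends_C1:
  fixes f :: "'a::euclidean_space \<Rightarrow> 'b::real_normed_vector"
  assumes ext: "locally_extends (Ck_on (Suc 0)) S f" and W: "open W" "W \<subseteq> S"
  shows "\<And>y. y \<in> W \<Longrightarrow> (f has_derivative frechet_derivative f (at y)) (at y)"
    and "\<And>v. continuous_on W (\<lambda>y. frechet_derivative f (at y) v)"
proof -
  have loc: "\<exists>U. open U \<and> y \<in> U \<and> (\<forall>z\<in>U. (f has_derivative frechet_derivative f (at z)) (at z)) \<and>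
      (\<forall>v. continuous_on U (\<lambda>z. frechet_derivative f (at z) v))" if y: "y \<in> W" for y
  proof -
    have "y \<in> S" using y W by blast
    then obtain U h where U: "open U" "y \<in> U" "Ck_on (Suc 0) U h" "\<And>z. z \<in> U \<inter> S \<Longrightarrow> h z = f z"
      using ext unfolding locally_extends_def by meson
    let ?U = "U \<inter> W"
    have d: "(f has_derivative frechet_derivative h (at z)) (at z)" if z: "z \<in> ?U" for z
    proof -
      have "h differentiable (at z)" using U(3) z by auto
      then have "(h has_derivative frechet_derivative h (at z)) (at z)"
        by (simp add: frechet_derivative_works)
      then show ?thesis
        by (rule has_derivative_transform_within_open[where s="?U"]) (use U W z in auto)
    qed
    then have e: "frechet_derivative f (at z) = frechet_derivative h (at z)" if "z \<in> ?U" for z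
      using frechet_derivative_at[OF d[OF that]] by simp
    have "continuous_on ?U (\<lambda>z. frechet_derivative f (at z) v)" for v
    proof -
      have "continuous_on ?U (\<lambda>z. frechet_derivative h (at z) v)"
        by (rule continuous_on_subset[of U]) (use U(3) in auto)
      then show ?thesis by (rule continuous_on_eq) (simp add: e)
    qed
    then show ?thesis using U W y d e by (intro exI[of _ ?U]) (auto simp: open_Int)
  qed
  then show "(f has_derivative frechet_derivative f (at y)) (at y)" if "y \<in> W" for y
    using that by blast
  show "continuous_on W (\<lambda>y. frechet_derivative f (at y) v)" for v
  proof (rule continuous_at_imp_continuous_on, rule ballI)
    fix y assume "y \<in> W"
    then show "isCont (\<lambda>y. frechet_derivative f (at y) v) y"
      using loc by (meson continuous_on_eq_continuous_at)
  qed
qed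

lemma locally_extends_mono:
  assumes "locally_extends P S f" "\<And>U h. P U h \<Longrightarrow> Q U h"
  shows "locally_extends Q S f"
  using assms unfolding locally_extends_def by meson

lemma smooth_on_C1: "smooth_on U h \<Longrightarrow> Ck_on (Suc 0) U h"
  unfolding smooth_on_def by blast

lemma locally_extends_continuous:
  assumes ext: "locally_extends smooth_on S f" and W: "open W" "W \<subseteq> S"
  shows "continuous_on W f"
proof (rule continuous_at_imp_continuous_on, rule ballI)
  fix y assume y: "y \<in> W"
  then obtain U h where U: "open U" "y \<in> U" "smooth_on U h" "\<And>z. z \<in> U \<inter> S \<Longrightarrow> h z = f z"
    using ext W(2) unfolding locally_extends_def by (meson subsetD)
  have "Ck_on 0 U h" using U(3) unfolding smooth_on_def by blast
  then have "continuous_on (U \<inter> W) h" by (auto elim: continuous_on_subset)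
  then have "continuous_on (U \<inter> W) f" by (rule continuous_on_eq) (use U(4) W(2) in auto)
  then show "isCont f y" using U y W by (simp add: continuous_on_eq_continuous_at open_Int)
qed

locale flow_setup =
  fixes A :: "('m::{t2_space, second_countable_topology}, 'n::finite) chart set"
    and g :: "('m, 'n) metric_field"
    and X :: "('m, 'n) vector_field"
    and \<Lambda> :: "'m set"
  assumes compact_UNIV: "compact (UNIV :: 'm set)"
    and atlas: "smooth_atlas A"
    and metric: "riemannian_metric A g"
    and field: "C1_vector_field A X" and inward: "inwardly_transverse A X"
    and compact_inv: "compact \<Lambda>" and invariant: "flow_invariant A X \<Lambda>"
begin

text \<open>The manifold interior. Charts have open images here, so the derivatives within the
  half-space in \<open>tangent_coord\<close> and \<open>tangent_map\<close> become ordinary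
  derivatives.\<close>

definition Mi :: "'m set" where "Mi = - manifold_boundary A"

abbreviation T :: "('m, 'n) chart \<Rightarrow> ('m, 'n) chart \<Rightarrow> 'm \<Rightarrow> real ^ 'n \<Rightarrow> real ^ 'n" where
  "T \<equiv> tangent_coord"

abbreviation ca :: "'m \<Rightarrow> ('m, 'n) chart" where "ca \<equiv> chart_at A"

lemma chart_at: "ca x \<in> A" "x \<in> fst (ca x)"
proof -
  have "\<exists>c. c \<in> A \<and> x \<in> fst c" using atlas unfolding smooth_atlas_def by blast
  from someI_ex[OF this] show "ca x \<in> A" "x \<in> fst (ca x)" unfolding chart_at_def by auto
qed

context
  fixes c assumes c: "c \<in> A"
begin

lemma chart_open: "open (fst c)"
  and chart_image: "openin (top_of_set half_space) (snd c ` fst c)"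
  and chart_homeo: "homeomorphism (fst c) (snd c ` fst c) (snd c) (chart_inv c)"
  using atlas c unfolding smooth_atlas_def by blast+

lemma chart_inv_left: "x \<in> fst c \<Longrightarrow> chart_inv c (snd c x) = x"
  and chart_inv_right: "y \<in> snd c ` fst c \<Longrightarrow> snd c (chart_inv c y) = y"
  and chart_cont: "continuous_on (fst c) (snd c)"
  and chart_inv_cont: "continuous_on (snd c ` fst c) (chart_inv c)"
  using chart_homeo unfolding homeomorphism_def by auto

lemma chart_isCont: "x \<in> fst c \<Longrightarrow> isCont (snd c) x"
  using chart_cont chart_open by (simp add: continuous_on_eq_continuous_at)

lemma chart_half_space: "x \<in> fst c \<Longrightarrow> 0 \<le> snd c x $ bdry_index"
  using openin_imp_subset[OF chart_image] by (auto simp: half_space_def)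

lemma chart_image_open_pos:
  assumes U: "open U" "U \<subseteq> fst c"
  shows "open (snd c ` U \<inter> {y. 0 < y $ bdry_index})"
proof -
  have "openin (top_of_set (fst c)) U" using U by (intro open_subset)
  then have "openin (top_of_set (snd c ` fst c)) (snd c ` U)"
    using homeomorphism_imp_open_map[OF chart_homeo] by blast
  then have "openin (top_of_set half_space) (snd c ` U)"
    using chart_image openin_trans by blast
  then obtain O' where O': "open O'" "snd c ` U = half_space \<inter> O'" by (auto simp: openin_open)
  have "open {y :: real ^ 'n. 0 < y $ bdry_index}"
    by (intro open_Collect_less continuous_intros)
  moreover have "snd c ` U \<inter> {y. 0 < y $ bdry_index} = O' \<inter> {y. 0 < y $ bdry_index}"
    unfolding O'(2) half_space_def by auto
  ultimately show ?thesis using O'(1) by (simp add: open_Int)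
qed

end

text \<open>Invariance of domain makes the boundary independent of the chart.\<close>

lemma interior_chart_change:
  assumes c: "c \<in> A" and d: "d \<in> A" and x: "x \<in> fst c" "x \<in> fst d" and pos: "0 < snd c x $ bdry_index"
  shows "0 < snd d x $ bdry_index"
proof -
  let ?S = "snd c ` (fst c \<inter> fst d) \<inter> {y. 0 < y $ bdry_index}" and ?h = "\<lambda>y. snd d (chart_inv c y)"
  have S: "open ?S" by (rule chart_image_open_pos[OF c]) (auto intro!: open_Int chart_open[OF c] chart_open[OF d])
  have inv: "chart_inv c y \<in> fst c \<inter> fst d \<and> snd c (chart_inv c y) = y" if "y \<in> ?S" for y
    using that chart_inv_left[OF c] by auto
  have cont: "continuous_on ?S ?h"
    by (rule continuous_on_compose2[OF chart_cont[OF d]])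
      (use inv in \<open>auto intro: continuous_on_subset[OF chart_inv_cont[OF c]]\<close>)
  have "inj_on ?h ?S"
  proof (rule inj_onI)
    fix y z assume "y \<in> ?S" "z \<in> ?S" "?h y = ?h z"
    then have "chart_inv c y = chart_inv c z"
      using inv chart_inv_left[OF d] by (metis IntD2)
    then show "y = z" using inv \<open>y \<in> ?S\<close> \<open>z \<in> ?S\<close> by metis
  qed
  then have op: "open (?h ` ?S)" by (rule invariance_of_domain[OF cont S])
  have "snd d x \<in> ?h ` ?S" using x pos chart_inv_left[OF c x(1)] by (intro image_eqI[of _ _ "snd c x"]) auto
  then obtain e where e: "0 < e" "ball (snd d x) e \<subseteq> ?h ` ?S" using op open_contains_ball by blast
  \<comment> \<open>The point is pushed towards the wall by \<open>e / 2\<close>. It is still in the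
    open image, hence in the half-space, so the original point was at least \<open>e / 2\<close>
    away from the wall.\<close>
  define z where "z = snd d x - (e / 2) *\<^sub>R axis bdry_index 1"
  have "z \<in> ball (snd d x) e" using e(1) by (simp add: z_def dist_norm norm_axis_1)
  then obtain y where "y \<in> ?S" "z = ?h y" using e(2) by blast
  then have "0 \<le> z $ bdry_index" using inv chart_half_space[OF d] by auto
  then show ?thesis using e(1) by (simp add: z_def)
qed

lemma Mi_iff:
  assumes c: "c \<in> A" and x: "x \<in> fst c"
  shows "x \<in> Mi \<longleftrightarrow> 0 < snd c x $ bdry_index"
proof -
  have "x \<in> Mi \<longleftrightarrow> 0 < snd (ca x) x $ bdry_index"
    using chart_half_space[OF chart_at, of x]
    by (simp only: Mi_def manifold_boundary_def Compl_iff mem_Collect_eq) linarith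
  also have "\<dots> \<longleftrightarrow> 0 < snd c x $ bdry_index"
    using interior_chart_change[OF c chart_at(1) x chart_at(2)]
      interior_chart_change[OF chart_at(1) c chart_at(2) x] by blast
  finally show ?thesis .
qed

lemma chart_image_open:
  assumes c: "c \<in> A" and U: "open U" "U \<subseteq> fst c \<inter> Mi"
  shows "open (snd c ` U)"
proof -
  have "snd c ` U = snd c ` U \<inter> {y. 0 < y $ bdry_index}" using Mi_iff[OF c] U by auto
  then show ?thesis using chart_image_open_pos[OF c U(1)] U(2) by simp
qed

lemma open_Mi: "open Mi"
proof (subst open_subopen, rule ballI)
  fix x assume x: "x \<in> Mi"
  let ?c = "ca x"
  have "open (fst ?c \<inter> snd ?c -` {y. 0 < y $ bdry_index})"
    by (intro continuous_open_preimage chart_cont chart_open chart_at open_Collect_less continuous_intros)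
  moreover have "fst ?c \<inter> snd ?c -` {y. 0 < y $ bdry_index} \<subseteq> Mi" using Mi_iff[OF chart_at(1)[of x]] by auto
  moreover have "x \<in> fst ?c \<inter> snd ?c -` {y. 0 < y $ bdry_index}"
    using x Mi_iff[OF chart_at(1) chart_at(2)] chart_at(2) by auto
  ultimately show "\<exists>T. open T \<and> x \<in> T \<and> T \<subseteq> Mi" by blast
qed

lemma chart_inv_isCont:
  assumes c: "c \<in> A" and x: "x \<in> fst c" "x \<in> Mi"
  shows "isCont (chart_inv c) (snd c x)"
proof -
  have "open (snd c ` (fst c \<inter> Mi))" by (rule chart_image_open[OF c]) (auto intro!: open_Int chart_open[OF c] open_Mi)
  moreover have "continuous_on (snd c ` (fst c \<inter> Mi)) (chart_inv c)"
    by (rule continuous_on_subset[OF chart_inv_cont[OF c]]) auto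
  ultimately show ?thesis using x by (auto simp: continuous_on_eq_continuous_at)
qed

lemma eventually_chart:
  assumes c: "c \<in> A" and x: "x \<in> fst c" "x \<in> Mi" and P: "eventually P (nhds x)"
  shows "eventually (\<lambda>z. P (chart_inv c z)) (nhds (snd c x))"
proof -
  have "filterlim (chart_inv c) (nhds x) (nhds (snd c x))"
    using chart_inv_isCont[OF c x] chart_inv_left[OF c x(1)]
    by (metis continuous_at isCont_def tendsto_at_iff_tendsto_nhds)
  then show ?thesis using P by (simp add: filterlim_iff)
qed

lemma eventually_in_chart: "c \<in> A \<Longrightarrow> x \<in> fst c \<Longrightarrow> x \<in> Mi \<Longrightarrow> eventually (\<lambda>y. y \<in> fst c \<inter> Mi) (nhds x)"
  using eventually_nhds_in_open[of "fst c \<inter> Mi" x] chart_open open_Mi by (simp add: open_Int)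

text \<open>At an interior point the overlap of two charts is a full neighbourhood in coordinates,
  so \<open>tangent_coord\<close> is an ordinary derivative; the smooth local extensions of the
  transition map supply its continuity.\<close>

lemma transition_derivative:
  assumes c: "c \<in> A" and d: "d \<in> A" and x: "x \<in> fst c" "x \<in> fst d" "x \<in> Mi"
  shows "((\<lambda>y. snd d (chart_inv c y)) has_derivative T c d x) (at (snd c x))"
    and "\<And>v. continuous_on (snd c ` (fst c \<inter> fst d \<inter> Mi)) (\<lambda>y. T c d (chart_inv c y) v)"
proof -
  let ?S = "snd c ` (fst c \<inter> fst d)" and ?W = "snd c ` (fst c \<inter> fst d \<inter> Mi)"
  have W: "open ?W" by (rule chart_image_open[OF c]) (auto intro!: open_Int chart_open[OF c] chart_open[OF d] open_Mi)
  have "locally_extends smooth_on ?S (snd d \<circ> chart_inv c)" using atlas c d unfolding smooth_atlas_def by blast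
  then have ext: "locally_extends (Ck_on (Suc 0)) ?S (snd d \<circ> chart_inv c)"
    by (rule locally_extends_mono) (rule smooth_on_C1)
  have WS: "?W \<subseteq> ?S" by auto
  have eq: "T c d y = frechet_derivative (snd d \<circ> chart_inv c) (at (snd c y))" if y: "y \<in> fst c \<inter> fst d \<inter> Mi" for y
  proof -
    have "snd c y \<in> interior ?S" by (rule interiorI[OF W _ WS]) (use y in blast)
    then show ?thesis unfolding tangent_coord_def by (simp only: at_within_interior)
  qed
  have xW: "snd c x \<in> ?W" using x by auto
  show "((\<lambda>y. snd d (chart_inv c y)) has_derivative T c d x) (at (snd c x))"
    using locally_extends_C1(1)[OF ext W WS xW] eq[of x] x by (simp add: comp_def)
  show "continuous_on ?W (\<lambda>y. T c d (chart_inv c y) v)" for v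
    by (rule continuous_on_eq[OF locally_extends_C1(2)[OF ext W WS]])
      (use eq chart_inv_left[OF c] in auto)
qed

lemma T_linear: "c \<in> A \<Longrightarrow> d \<in> A \<Longrightarrow> x \<in> fst c \<Longrightarrow> x \<in> fst d \<Longrightarrow> x \<in> Mi \<Longrightarrow> linear (T c d x)"
  using transition_derivative(1) has_derivative_linear by blast

lemma T_id:
  assumes c: "c \<in> A" and x: "x \<in> fst c" "x \<in> Mi"
  shows "T c c x v = v"
proof -
  have "eventually (\<lambda>y. snd c (chart_inv c y) = y) (nhds (snd c x))"
  proof -
    have "open (snd c ` (fst c \<inter> Mi))" by (rule chart_image_open[OF c]) (auto intro!: open_Int chart_open[OF c] open_Mi)
    then have "eventually (\<lambda>y. y \<in> snd c ` (fst c \<inter> Mi)) (nhds (snd c x))"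
      using x by (intro eventually_nhds_in_open) auto
    then show ?thesis by eventually_elim (use chart_inv_right[OF c] in auto)
  qed
  then have "eventually (\<lambda>y. y = snd c (chart_inv c y)) (nhds (snd c x))" by eventually_elim simp
  from has_derivative_cong_nhds[OF has_derivative_ident this]
  have "((\<lambda>y. snd c (chart_inv c y)) has_derivative (\<lambda>v. v)) (at (snd c x))" .
  from has_derivative_unique[OF transition_derivative(1)[OF c c x(1) x] this] show ?thesis by simp
qed

lemma T_comp:
  assumes c: "c \<in> A" and d: "d \<in> A" and e: "e \<in> A" and x: "x \<in> fst c" "x \<in> fst d" "x \<in> fst e" "x \<in> Mi"
  shows "T d e x (T c d x v) = T c e x v"
proof -
  have "((\<lambda>y. snd e (chart_inv d y)) \<circ> (\<lambda>y. snd d (chart_inv c y)) has_derivative T d e x \<circ> T c d x) (at (snd c x))"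
    by (rule diff_chain_at[OF transition_derivative(1)[OF c d x(1,2,4)]])
      (use transition_derivative(1)[OF d e x(2,3,4)] chart_inv_left[OF c x(1)] in simp)
  moreover have "eventually (\<lambda>y. snd e (chart_inv d (snd d (chart_inv c y))) = snd e (chart_inv c y)) (nhds (snd c x))"
    using eventually_chart[OF c x(1,4) eventually_in_chart[OF d x(2,4)]]
    by eventually_elim (use chart_inv_left[OF d] in auto)
  ultimately have "((\<lambda>y. snd e (chart_inv c y)) has_derivative T d e x \<circ> T c d x) (at (snd c x))"
    unfolding comp_def by (rule has_derivative_cong_nhds)
  from has_derivative_unique[OF this transition_derivative(1)[OF c e x(1,3,4)]] show ?thesis
    by (simp add: fun_eq_iff)
qed

lemma T_inverse:
  assumes "c \<in> A" "d \<in> A" "x \<in> fst c" "x \<in> fst d" "x \<in> Mi"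
  shows "T d c x (T c d x v) = v"
  using T_comp[OF assms(1,2,1,3,4,3,5)] T_id[OF assms(1,3,5)] by simp

lemma T_tendsto:
  assumes c: "c \<in> A" and d: "d \<in> A" and x: "x \<in> fst c" "x \<in> fst d" "x \<in> Mi"
    and xi: "(\<xi> \<longlongrightarrow> x) G" and v: "(\<nu> \<longlongrightarrow> v) G"
  shows "((\<lambda>n. T c d (\<xi> n) (\<nu> n)) \<longlongrightarrow> T c d x v) G"
proof (rule linear_tendsto[OF _ T_linear[OF c d x] _ v])
  have op: "open (fst c \<inter> fst d \<inter> Mi)" by (intro open_Int chart_open c d open_Mi)
  then have ev: "eventually (\<lambda>n. \<xi> n \<in> fst c \<inter> fst d \<inter> Mi) G" using xi x by (auto dest: topological_tendstoD)
  then show "eventually (\<lambda>n. linear (T c d (\<xi> n))) G"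
    by eventually_elim (use T_linear[OF c d] in auto)
  fix b
  let ?W = "snd c ` (fst c \<inter> fst d \<inter> Mi)"
  have "open ?W" by (rule chart_image_open[OF c op]) auto
  then have "isCont (\<lambda>y. T c d (chart_inv c y) b) (snd c x)"
    using transition_derivative(2)[OF c d x] x by (auto simp: continuous_on_eq_continuous_at)
  moreover have "((\<lambda>n. snd c (\<xi> n)) \<longlongrightarrow> snd c x) G"
    using chart_isCont[OF c x(1)] xi by (rule isCont_tendsto_compose)
  ultimately have "((\<lambda>n. T c d (chart_inv c (snd c (\<xi> n))) b) \<longlongrightarrow> T c d (chart_inv c (snd c x)) b) G"
    by (rule isCont_tendsto_compose)
  then show "((\<lambda>n. T c d (\<xi> n) b) \<longlongrightarrow> T c d x b) G"
    unfolding chart_inv_left[OF c x(1)]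
    by (rule Lim_transform_eventually) (use ev in \<open>eventually_elim, auto simp: chart_inv_left[OF c]\<close>)
qed

text \<open>The coordinates \<open>\<nu> n\<close> refer to the preferred chart at \<open>\<xi> n\<close>, which jumps with \<open>n\<close>; they are compared in
  a fixed chart around the limit.\<close>

definition tlim :: "'b filter \<Rightarrow> ('b \<Rightarrow> 'm) \<Rightarrow> ('b \<Rightarrow> real ^ 'n) \<Rightarrow> 'm \<Rightarrow> real ^ 'n \<Rightarrow> bool" where
  "tlim G \<xi> \<nu> x v \<longleftrightarrow> (\<xi> \<longlongrightarrow> x) G \<and>
    (\<forall>c\<in>A. x \<in> fst c \<longrightarrow> ((\<lambda>n. T (ca (\<xi> n)) c (\<xi> n) (\<nu> n)) \<longlongrightarrow> T (ca x) c x v) G)"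

text \<open>One chart around the limit suffices: the transition derivative to any other chart is
  continuous there and carries the convergence over.\<close>

lemma tlimI:
  assumes x: "x \<in> Mi" and c: "c \<in> A" "x \<in> fst c" and xi: "(\<xi> \<longlongrightarrow> x) G"
    and lim: "((\<lambda>n. T (ca (\<xi> n)) c (\<xi> n) (\<nu> n)) \<longlongrightarrow> T (ca x) c x v) G"
  shows "tlim G \<xi> \<nu> x v"
  unfolding tlim_def
proof (intro conjI ballI impI xi)
  fix d assume d: "d \<in> A" "x \<in> fst d"
  have "((\<lambda>n. T c d (\<xi> n) (T (ca (\<xi> n)) c (\<xi> n) (\<nu> n))) \<longlongrightarrow> T c d x (T (ca x) c x v)) G"
    by (rule T_tendsto[OF c(1) d(1) c(2) d(2) x xi lim])
  then have "((\<lambda>n. T c d (\<xi> n) (T (ca (\<xi> n)) c (\<xi> n) (\<nu> n))) \<longlongrightarrow> T (ca x) d x v) G"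
    using T_comp[OF chart_at(1) c(1) d(1) chart_at(2) c(2) d(2) x] by simp
  moreover have "open (fst c \<inter> fst d \<inter> Mi)" by (intro open_Int chart_open c(1) d(1) open_Mi)
  then have "eventually (\<lambda>n. \<xi> n \<in> fst c \<inter> fst d \<inter> Mi) G" using xi x c d by (auto dest: topological_tendstoD)
  then have "eventually (\<lambda>n. T c d (\<xi> n) (T (ca (\<xi> n)) c (\<xi> n) (\<nu> n)) = T (ca (\<xi> n)) d (\<xi> n) (\<nu> n)) G"
    by eventually_elim (use T_comp[OF chart_at(1) c(1) d(1) chart_at(2)] in auto)
  ultimately show "((\<lambda>n. T (ca (\<xi> n)) d (\<xi> n) (\<nu> n)) \<longlongrightarrow> T (ca x) d x v) G"
    by (rule Lim_transform_eventually)
qed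

lemma tlimD:
  assumes "tlim G \<xi> \<nu> x v"
  shows "(\<xi> \<longlongrightarrow> x) G" "c \<in> A \<Longrightarrow> x \<in> fst c \<Longrightarrow> ((\<lambda>n. T (ca (\<xi> n)) c (\<xi> n) (\<nu> n)) \<longlongrightarrow> T (ca x) c x v) G"
  using assms unfolding tlim_def by blast+

lemma inner_form_metric: "inner_form (g x)"
  using metric unfolding riemannian_metric_def inner_form_def by blast

text \<open>In the fixed chart at \<open>x\<close> the coefficients of the metric converge by
  smoothness; bilinearity then takes care of the two moving arguments, one at a time.\<close>

lemma metric_tendsto:
  assumes x: "x \<in> Mi" and u: "tlim G \<xi> \<mu> x u" and v: "tlim G \<xi> \<nu> x v"
  shows "((\<lambda>n. g (\<xi> n) (\<mu> n) (\<nu> n)) \<longlongrightarrow> g x u v) G"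
proof -
  let ?c = "ca x"
  note c = chart_at[of x]
  define Gc where "Gc y a b = g y (T ?c (ca y) y a) (T ?c (ca y) y b)" for y a b
  have xi: "(\<xi> \<longlongrightarrow> x) G" by (rule tlimD[OF u])
  have op: "open (fst ?c \<inter> Mi)" by (intro open_Int chart_open c(1) open_Mi)
  then have ev: "eventually (\<lambda>n. \<xi> n \<in> fst ?c \<inter> Mi) G" using xi x c(2) by (auto dest: topological_tendstoD)
  have lin: "linear (T ?c (ca y) y)" if "y \<in> fst ?c \<inter> Mi" for y
    using that T_linear[OF c(1) chart_at(1) _ chart_at(2)] by blast
  have bil: "linear (Gc y a)" "linear (\<lambda>a. Gc y a b)" if "y \<in> fst ?c \<inter> Mi" for y a b
    unfolding Gc_def
    using linear_compose[OF lin[OF that] inner_form_linear(1)[OF inner_form_metric]]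
      linear_compose[OF lin[OF that] inner_form_linear(2)[OF inner_form_metric]] by (auto simp: comp_def)
  have conv: "((\<lambda>n. Gc (\<xi> n) a b) \<longlongrightarrow> Gc x a b) G" for a b
  proof -
    let ?f = "\<lambda>y. let x = chart_inv ?c y; T' = T ?c (ca x) x in g x (T' a) (T' b)"
    have ext: "locally_extends smooth_on (snd ?c ` fst ?c) ?f"
      using metric c(1) unfolding riemannian_metric_def by blast
    have W: "open (snd ?c ` (fst ?c \<inter> Mi))" by (rule chart_image_open[OF c(1) op]) auto
    have "continuous_on (snd ?c ` (fst ?c \<inter> Mi)) ?f"
      by (rule locally_extends_continuous[OF ext W]) auto
    then have "isCont ?f (snd ?c x)" using W x c(2) by (auto simp: continuous_on_eq_continuous_at)
    moreover have "((\<lambda>n. snd ?c (\<xi> n)) \<longlongrightarrow> snd ?c x) G"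
      using chart_isCont[OF c] xi by (rule isCont_tendsto_compose)
    ultimately have "((\<lambda>n. ?f (snd ?c (\<xi> n))) \<longlongrightarrow> ?f (snd ?c x)) G" by (rule isCont_tendsto_compose)
    moreover have "?f (snd ?c x) = Gc x a b" by (simp add: Gc_def chart_inv_left[OF c] Let_def)
    ultimately have "((\<lambda>n. ?f (snd ?c (\<xi> n))) \<longlongrightarrow> Gc x a b) G" by simp
    then show ?thesis
      by (rule Lim_transform_eventually)
        (use ev in \<open>eventually_elim, auto simp: Gc_def Let_def chart_inv_left[OF c(1)]\<close>)
  qed
  have xc: "x \<in> fst ?c \<inter> Mi" using x c by blast
  let ?u = "\<lambda>n. T (ca (\<xi> n)) ?c (\<xi> n) (\<mu> n)" and ?v = "\<lambda>n. T (ca (\<xi> n)) ?c (\<xi> n) (\<nu> n)"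
  have "((\<lambda>n. Gc (\<xi> n) (?u n) (?v n)) \<longlongrightarrow> Gc x (T ?c ?c x u) (T ?c ?c x v)) G"
  proof (rule linear_tendsto[OF _ bil(1)[OF xc] _ tlimD(2)[OF v c]])
    show "eventually (\<lambda>n. linear (Gc (\<xi> n) (?u n))) G" using ev by eventually_elim (rule bil(1))
    show "((\<lambda>n. Gc (\<xi> n) (?u n) b) \<longlongrightarrow> Gc x (T ?c ?c x u) b) G" for b
    proof (rule linear_tendsto[OF _ bil(2)[OF xc] conv tlimD(2)[OF u c]])
      show "eventually (\<lambda>n. linear (\<lambda>a. Gc (\<xi> n) a b)) G"
        using ev by eventually_elim (rule bil(2))
    qed
  qed
  moreover have "Gc x (T ?c ?c x u) (T ?c ?c x v) = g x u v"
    unfolding Gc_def using T_id[OF c x] by simp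
  ultimately have "((\<lambda>n. Gc (\<xi> n) (?u n) (?v n)) \<longlongrightarrow> g x u v) G" by simp
  then show ?thesis
  proof (rule Lim_transform_eventually)
    show "eventually (\<lambda>n. Gc (\<xi> n) (?u n) (?v n) = g (\<xi> n) (\<mu> n) (\<nu> n)) G"
      using ev by eventually_elim (use T_inverse[OF chart_at(1) c(1) chart_at(2)] in \<open>auto simp: Gc_def\<close>)
  qed
qed

end

section \<open>Integral curves\<close>

lemma at_within_Un_bot:
  assumes "open S" "t \<in> S" "S \<inter> I = S \<inter> J"
  shows "at t within I = at t within J"
  using at_within_nhd[OF assms(2,1), of I J] assms(3) by blast

lemma has_vector_derivative_Un:
  assumes "(f has_vector_derivative f') (at x within S)" "(f has_vector_derivative f') (at x within T)"
  shows "(f has_vector_derivative f') (at x within (S \<union> T))"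
  using assms unfolding has_vector_derivative_def has_derivative_within
  by (auto simp: at_within_union intro: filterlim_sup)

context flow_setup begin

lemma field_derivative_exists:
  assumes c: "c \<in> A"
  shows "\<And>y. y \<in> snd c ` (fst c \<inter> Mi) \<Longrightarrow>
      (field_coord A X c has_derivative frechet_derivative (field_coord A X c) (at y)) (at y)"
    and "\<And>v. continuous_on (snd c ` (fst c \<inter> Mi)) (\<lambda>y. frechet_derivative (field_coord A X c) (at y) v)"
    and "open (snd c ` (fst c \<inter> Mi))"
proof -
  show W: "open (snd c ` (fst c \<inter> Mi))"
    by (rule chart_image_open[OF c]) (auto intro!: open_Int chart_open[OF c] open_Mi)
  have ext: "locally_extends (Ck_on (Suc 0)) (snd c ` fst c) (field_coord A X c)"
    using field c unfolding C1_vector_field_def by simp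
  have sub: "snd c ` (fst c \<inter> Mi) \<subseteq> snd c ` fst c" by blast
  show "\<And>y. y \<in> snd c ` (fst c \<inter> Mi) \<Longrightarrow>
      (field_coord A X c has_derivative frechet_derivative (field_coord A X c) (at y)) (at y)"
    by (rule locally_extends_C1(1)[OF ext W sub])
  show "\<And>v. continuous_on (snd c ` (fst c \<inter> Mi)) (\<lambda>y. frechet_derivative (field_coord A X c) (at y) v)"
    by (rule locally_extends_C1(2)[OF ext W sub])
qed

lemma field_coord_at: "c \<in> A \<Longrightarrow> x \<in> fst c \<Longrightarrow> field_coord A X c (snd c x) = T (ca x) c x (X x)"
  by (simp add: field_coord_def chart_inv_left Let_def)

lemma eventually_in_open_within:
  assumes "continuous_on I \<gamma>" "s \<in> I" "open U" "\<gamma> s \<in> U"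
  shows "eventually (\<lambda>r. \<gamma> r \<in> U) (at s within I)"
  using assms unfolding continuous_on_def by (blast intro: topological_tendstoD)

lemma change_chart_derivative:
  assumes c: "c \<in> A" and d: "d \<in> A" and s: "s \<in> I" "\<gamma> s \<in> fst c" "\<gamma> s \<in> fst d" "\<gamma> s \<in> Mi"
    and cont: "continuous_on I \<gamma>"
    and der: "((\<lambda>r. snd d (\<gamma> r)) has_vector_derivative v) (at s within I)"
  shows "((\<lambda>r. snd c (\<gamma> r)) has_vector_derivative T d c (\<gamma> s) v) (at s within I)"
proof -
  have "((\<lambda>y. snd c (chart_inv d y)) \<circ> (\<lambda>r. snd d (\<gamma> r)) has_vector_derivative T d c (\<gamma> s) v) (at s within I)"
    by (rule vector_derivative_diff_chain_within[OF der])
      (rule has_derivative_at_withinI, rule transition_derivative(1)[OF d c s(3,2,4)])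
  moreover have "eventually (\<lambda>r. snd c (chart_inv d (snd d (\<gamma> r))) = snd c (\<gamma> r)) (at s within I)"
    using eventually_in_open_within[OF cont s(1) chart_open[OF d] s(3)]
    by eventually_elim (simp add: chart_inv_left[OF d])
  ultimately show ?thesis
    unfolding has_vector_derivative_def
    by (auto intro: has_derivative_transform_eventually simp: comp_def chart_inv_left[OF d s(3)] s(1))
qed

lemma integral_curve_chart:
  assumes \<gamma>: "integral_curve A X \<gamma> I" and s: "s \<in> I" "\<gamma> s \<in> Mi" and c: "c \<in> A" "\<gamma> s \<in> fst c"
  shows "((\<lambda>r. snd c (\<gamma> r)) has_vector_derivative field_coord A X c (snd c (\<gamma> s))) (at s within I)"
  unfolding field_coord_at[OF c]
  by (rule change_chart_derivative[where \<gamma>=\<gamma> and d="ca (\<gamma> s)"])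
    (use \<gamma> s c chart_at in \<open>auto simp: integral_curve_def\<close>)

lemma integral_curveI:
  assumes cont: "continuous_on I \<gamma>"
    and c: "\<And>s. s \<in> I \<Longrightarrow> c s \<in> A \<and> \<gamma> s \<in> fst (c s) \<inter> Mi \<and>
      ((\<lambda>r. snd (c s) (\<gamma> r)) has_vector_derivative field_coord A X (c s) (snd (c s) (\<gamma> s))) (at s within I)"
  shows "integral_curve A X \<gamma> I"
  unfolding integral_curve_def
proof (intro conjI ballI cont)
  fix s assume s: "s \<in> I"
  note cs = c[OF s]
  have "((\<lambda>r. snd (ca (\<gamma> s)) (\<gamma> r)) has_vector_derivative
      T (c s) (ca (\<gamma> s)) (\<gamma> s) (T (ca (\<gamma> s)) (c s) (\<gamma> s) (X (\<gamma> s)))) (at s within I)"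
    by (rule change_chart_derivative[OF chart_at(1) _ s chart_at(2)])
      (use cs cont field_coord_at[of "c s" "\<gamma> s"] in auto)
  then show "((\<lambda>r. snd (ca (\<gamma> s)) (\<gamma> r)) has_vector_derivative X (\<gamma> s)) (at s within I)"
    using T_inverse[OF chart_at(1), of "c s" "\<gamma> s" "\<gamma> s"] cs chart_at(2)[of "\<gamma> s"] by simp
qed

lemma integral_curve_subset: "integral_curve A X \<gamma> I \<Longrightarrow> J \<subseteq> I \<Longrightarrow> integral_curve A X \<gamma> J"
  unfolding integral_curve_def
  by (meson continuous_on_subset has_vector_derivative_within_subset subsetD)

lemma integral_curve_cong:
  assumes "integral_curve A X \<gamma> I" and eq: "\<And>s. s \<in> I \<Longrightarrow> \<eta> s = \<gamma> s"
  shows "integral_curve A X \<eta> I"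
  unfolding integral_curve_def
proof (intro conjI ballI)
  show "continuous_on I \<eta>"
    by (rule continuous_on_eq[of I \<gamma>]) (use assms in \<open>auto simp: integral_curve_def\<close>)
  fix s assume s: "s \<in> I"
  have "((\<lambda>r. snd (ca (\<gamma> s)) (\<gamma> r)) has_vector_derivative X (\<gamma> s)) (at s within I)"
    using assms(1) s unfolding integral_curve_def by blast
  then show "((\<lambda>r. snd (ca (\<eta> s)) (\<eta> r)) has_vector_derivative X (\<eta> s)) (at s within I)"
    unfolding eq[OF s] by (rule has_vector_derivative_transform[OF s, rotated]) (simp add: eq)
qed

lemma integral_curve_shift:
  assumes \<gamma>: "integral_curve A X \<gamma> I"
  shows "integral_curve A X (\<lambda>r. \<gamma> (r + t)) {r. r + t \<in> I}"
  unfolding integral_curve_def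
proof (intro conjI ballI)
  show "continuous_on {r. r + t \<in> I} (\<lambda>r. \<gamma> (r + t))"
    by (rule continuous_on_compose2[of I \<gamma>]) (use \<gamma> in \<open>auto simp: integral_curve_def intro!: continuous_intros\<close>)
  fix s assume "s \<in> {r. r + t \<in> I}"
  then have s: "s + t \<in> I" by simp
  have "((\<lambda>r. snd (ca (\<gamma> (s + t))) (\<gamma> r)) has_vector_derivative X (\<gamma> (s + t))) (at (s + t) within (\<lambda>r. r + t) ` {r. r + t \<in> I})"
    using \<gamma> s unfolding integral_curve_def by (auto intro: has_vector_derivative_within_subset)
  moreover have "((\<lambda>r. r + t) has_vector_derivative 1) (at s within {r. r + t \<in> I})"
    by (auto intro!: derivative_eq_intros)
  ultimately have "((\<lambda>r. snd (ca (\<gamma> (s + t))) (\<gamma> r)) \<circ> (\<lambda>r. r + t) has_vector_derivative 1 *\<^sub>R X (\<gamma> (s + t)))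
      (at s within {r. r + t \<in> I})"
    by (intro vector_diff_chain_within)
  then show "((\<lambda>r. snd (ca (\<gamma> (s + t))) (\<gamma> (r + t))) has_vector_derivative X (\<gamma> (s + t))) (at s within {r. r + t \<in> I})"
    by (simp add: comp_def)
qed

lemma integral_curve_glue:
  assumes 1: "integral_curve A X \<gamma> {a..b}" and 2: "integral_curve A X \<gamma> {b..c}" and ab: "a \<le> b" "b \<le> c"
  shows "integral_curve A X \<gamma> {a..c}"
proof -
  have U: "{a..c} = {a..b} \<union> {b..c}" using ab by auto
  show ?thesis
    unfolding integral_curve_def
  proof (intro conjI ballI)
    show "continuous_on {a..c} \<gamma>"
      unfolding U by (rule continuous_on_closed_Un) (use 1 2 in \<open>auto simp: integral_curve_def\<close>)
    fix s assume s: "s \<in> {a..c}"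
    let ?D = "\<lambda>I. ((\<lambda>r. snd (ca (\<gamma> s)) (\<gamma> r)) has_vector_derivative X (\<gamma> s)) (at s within I)"
    consider "s < b" | "s = b" | "b < s" by linarith
    then show "?D {a..c}"
    proof cases
      case 1
      have "at s within {a..c} = at s within {a..b}"
        by (rule at_within_Un_bot[of "{..<b}"]) (use 1 ab in auto)
      then show ?thesis using assms(1) s 1 by (auto simp: integral_curve_def)
    next
      case 2
      then show ?thesis unfolding U using assms(1,2) ab
        by (intro has_vector_derivative_Un) (auto simp: integral_curve_def)
    next
      case 3
      have "at s within {a..c} = at s within {b..c}"
        by (rule at_within_Un_bot[of "{b<..}"]) (use 3 ab in auto)
      then show ?thesis using assms(2) s 3 by (auto simp: integral_curve_def)
    qed
  qed
qed

text \<open>A boundary point has no past, since the field points inwards there.\<close>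

lemma integral_curve_interior:
  assumes \<gamma>: "integral_curve A X \<gamma> {a..b}" and s: "a < s" "s \<le> b"
  shows "\<gamma> s \<in> Mi"
proof (rule ccontr)
  assume "\<gamma> s \<notin> Mi"
  then have bd: "\<gamma> s \<in> manifold_boundary A" by (simp add: Mi_def)
  let ?d = "ca (\<gamma> s)"
  have sI: "s \<in> {a..b}" using s by simp
  have "((\<lambda>r. snd ?d (\<gamma> r)) has_vector_derivative X (\<gamma> s)) (at s within {a..b})"
    using \<gamma> sI unfolding integral_curve_def by blast
  then have "((\<lambda>r. snd ?d (\<gamma> r) $ bdry_index) has_vector_derivative X (\<gamma> s) $ bdry_index) (at s within {a..b})"
    using bounded_linear.has_vector_derivative[OF bounded_linear_vec_nth] by blast
  then have der: "((\<lambda>r. snd ?d (\<gamma> r) $ bdry_index) has_real_derivative X (\<gamma> s) $ bdry_index) (at s within {a..b})"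
    by (simp add: has_real_derivative_iff_has_vector_derivative)
  have "0 < X (\<gamma> s) $ bdry_index" using inward bd unfolding inwardly_transverse_def by blast
  from has_real_derivative_pos_inc_left[OF der this]
  obtain e where e: "0 < e" "\<And>h. 0 < h \<Longrightarrow> s - h \<in> {a..b} \<Longrightarrow> h < e \<Longrightarrow>
      snd ?d (\<gamma> (s - h)) $ bdry_index < snd ?d (\<gamma> s) $ bdry_index" by blast
  have "eventually (\<lambda>r. \<gamma> r \<in> fst ?d) (at s within {a..b})"
    by (rule eventually_in_open_within[OF _ sI chart_open chart_at(2)])
      (use \<gamma> chart_at in \<open>auto simp: integral_curve_def\<close>)
  then obtain e' where e': "0 < e'" "\<And>r. r \<in> {a..b} \<Longrightarrow> r \<noteq> s \<Longrightarrow> dist r s < e' \<Longrightarrow> \<gamma> r \<in> fst ?d"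
    unfolding eventually_at by blast
  define h where "h = min (min (e / 2) (e' / 2)) (s - a)"
  have h: "0 < h" "s - h \<in> {a..b}" "h < e" "h < e'" using e e' s by (auto simp: h_def)
  have "\<gamma> (s - h) \<in> fst ?d" using e'(2)[OF h(2)] h by (simp add: dist_real_def)
  then have "0 \<le> snd ?d (\<gamma> (s - h)) $ bdry_index" by (rule chart_half_space[OF chart_at(1)])
  moreover have "snd ?d (\<gamma> s) $ bdry_index = 0" using bd by (simp add: manifold_boundary_def)
  ultimately show False using e(2)[OF h(1,2,3)] by simp
qed

text \<open>A curve can meet the boundary only at the earliest time of its interval. For
  \<open>t \<ge> 0\<close> this is time 0, covered by the hypothesis on \<open>\<gamma> 0\<close>;
  for \<open>t < 0\<close> it is \<open>t\<close> itself, which is therefore left out.\<close>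

lemma integral_curve_seg_interior:
  assumes \<gamma>: "integral_curve A X \<gamma> (closed_segment 0 t)" and 0: "\<gamma> 0 \<in> Mi"
    and s: "s \<in> closed_segment 0 t" "0 \<le> t \<or> s \<noteq> t"
  shows "\<gamma> s \<in> Mi"
proof (cases "0 \<le> t")
  case True
  then have "integral_curve A X \<gamma> {0..t}" using \<gamma> by (simp add: closed_segment_eq_real_ivl)
  then show ?thesis
    using integral_curve_interior[of \<gamma> 0 t s] s(1) 0 True
    by (cases "s = 0") (auto simp: closed_segment_eq_real_ivl)
next
  case False
  then have "integral_curve A X \<gamma> {t..0}" using \<gamma> by (simp add: closed_segment_eq_real_ivl)
  then show ?thesis
    using integral_curve_interior[of \<gamma> t 0 s] s False by (auto simp: closed_segment_eq_real_ivl)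
qed

text \<open>The times of agreement are closed because the manifold is Hausdorff, and open by local
  uniqueness in a chart, within the connected set \<open>J\<close> on which both curves are
  interior.\<close>

lemma integral_curve_unique:
  assumes \<gamma>: "integral_curve A X \<gamma> (closed_segment 0 t)" and \<eta>: "integral_curve A X \<eta> (closed_segment 0 t)"
    and 0: "\<gamma> 0 = \<eta> 0" "\<gamma> 0 \<in> Mi" and s: "s \<in> closed_segment 0 t"
  shows "\<gamma> s = \<eta> s"
proof -
  let ?S = "closed_segment 0 t"
  define J where "J = {s \<in> ?S. 0 \<le> t \<or> s \<noteq> t}"
  have JS: "J \<subseteq> ?S" by (auto simp: J_def)
  have Jint: "is_interval J"
    unfolding is_interval_1 J_def by (auto simp: closed_segment_eq_real_ivl split: if_splits)
  have J0: "0 \<in> J" by (auto simp: J_def)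
  have cont: "continuous_on ?S \<gamma>" "continuous_on ?S \<eta>" using \<gamma> \<eta> by (auto simp: integral_curve_def)
  have contJ: "continuous_on J \<gamma>" "continuous_on J \<eta>" using cont JS continuous_on_subset by blast+
  have JMi: "\<gamma> r \<in> Mi" "\<eta> r \<in> Mi" if "r \<in> J" for r
    using that integral_curve_seg_interior[OF \<gamma> 0(2), of r] integral_curve_seg_interior[OF \<eta>, of r] 0
    by (auto simp: J_def)
  have diag: "closed {p :: 'm \<times> 'm. fst p = snd p}"
    using closed_diagonal by (rule back_subst[of closed]) auto
  have closedeq: "closedin (top_of_set R) {r \<in> R. \<gamma> r = \<eta> r}" if "R \<subseteq> ?S" for R
  proof -
    have "continuous_on R (\<lambda>r. (\<gamma> r, \<eta> r))"
      by (intro continuous_on_Pair continuous_on_subset[OF cont(1) that] continuous_on_subset[OF cont(2) that])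
    from continuous_closedin_preimage[OF this diag] show ?thesis by (simp add: vimage_def Int_def)
  qed
  define E where "E = {r \<in> J. \<gamma> r = \<eta> r}"
  have "openin (top_of_set J) E"
  proof (subst openin_subopen, rule ballI)
    fix r assume r: "r \<in> E"
    then have rJ: "r \<in> J" and eq: "\<gamma> r = \<eta> r" by (auto simp: E_def)
    let ?c = "ca (\<gamma> r)"
    note c = chart_at[of "\<gamma> r"]
    have op: "open (fst ?c \<inter> Mi)" by (intro open_Int chart_open c open_Mi)
    have "eventually (\<lambda>q. \<gamma> q \<in> fst ?c \<inter> Mi) (at r within J)" "eventually (\<lambda>q. \<eta> q \<in> fst ?c \<inter> Mi) (at r within J)"
      using eventually_in_open_within[OF contJ(1) rJ op] eventually_in_open_within[OF contJ(2) rJ op]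
        c JMi[OF rJ] eq by auto
    then have "eventually (\<lambda>q. \<gamma> q \<in> fst ?c \<inter> Mi \<and> \<eta> q \<in> fst ?c \<inter> Mi) (at r within J)" by (rule eventually_conj)
    then obtain e where e: "0 < e" "\<And>q. q \<in> J \<Longrightarrow> q \<noteq> r \<Longrightarrow> dist q r < e \<Longrightarrow> \<gamma> q \<in> fst ?c \<inter> Mi \<and> \<eta> q \<in> fst ?c \<inter> Mi"
      unfolding eventually_at by blast
    have ein: "\<gamma> q \<in> fst ?c \<inter> Mi \<and> \<eta> q \<in> fst ?c \<inter> Mi" if "q \<in> J" "dist q r < e" for q
      using e(2)[OF that(1) _ that(2)] c JMi[OF rJ] eq by (cases "q = r") auto
    let ?I = "J \<inter> ball r e"
    have Iint: "is_interval ?I" by (intro is_interval_Int Jint is_interval_ball_real)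
    have rI: "r \<in> ?I" using rJ e(1) by simp
    have IS: "?I \<subseteq> ?S" using JS by blast
    have inI: "\<gamma> q \<in> fst ?c" "\<eta> q \<in> fst ?c" "\<gamma> q \<in> Mi" "\<eta> q \<in> Mi" if "q \<in> ?I" for q
      using ein[of q] that by (auto simp: dist_commute)
    let ?V = "snd ?c ` (fst ?c \<inter> Mi)"
    have cu: "continuous_on ?I (\<lambda>q. snd ?c (\<gamma> q))"
      by (rule continuous_on_compose2[OF chart_cont[OF c(1)] continuous_on_subset[OF cont(1) IS]]) (use inI in auto)
    have cw: "continuous_on ?I (\<lambda>q. snd ?c (\<eta> q))"
      by (rule continuous_on_compose2[OF chart_cont[OF c(1)] continuous_on_subset[OF cont(2) IS]]) (use inI in auto)
    have du: "((\<lambda>q. snd ?c (\<gamma> q)) has_vector_derivative field_coord A X ?c (snd ?c (\<gamma> q))) (at q within ?I)"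
      if "q \<in> ?I" for q
      by (rule integral_curve_chart[OF integral_curve_subset[OF \<gamma> IS] that]) (use inI[OF that] c in auto)
    have dw: "((\<lambda>q. snd ?c (\<eta> q)) has_vector_derivative field_coord A X ?c (snd ?c (\<eta> q))) (at q within ?I)"
      if "q \<in> ?I" for q
      by (rule integral_curve_chart[OF integral_curve_subset[OF \<eta> IS] that]) (use inI[OF that] c in auto)
    obtain h where h: "0 < h" "\<And>q. q \<in> ?I \<Longrightarrow> \<bar>q - r\<bar> < h \<Longrightarrow> snd ?c (\<gamma> q) = snd ?c (\<eta> q)"
    proof (rule solutions_agree_near[OF field_derivative_exists(3)[OF c(1)] _ field_derivative_exists(1,2)[OF c(1)] Iint rI zero_less_one cu _ cw])
      show "snd ?c (\<gamma> r) \<in> ?V" using inI[OF rI] by blast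
    qed (use du dw eq in auto)
    let ?T = "J \<inter> ball r (min e h)"
    have "openin (top_of_set J) ?T" by (simp add: openin_open_Int)
    moreover have "r \<in> ?T" using rJ e h by simp
    moreover have "?T \<subseteq> E"
    proof
      fix q assume q: "q \<in> ?T"
      then have qI: "q \<in> ?I" and "\<bar>q - r\<bar> < h" by (auto simp: dist_real_def)
      then have "snd ?c (\<gamma> q) = snd ?c (\<eta> q)" by (intro h(2))
      then have "\<gamma> q = \<eta> q" using chart_inv_left[OF c(1)] inI[OF qI] by metis
      then show "q \<in> E" using q by (simp add: E_def)
    qed
    ultimately show "\<exists>T. openin (top_of_set J) T \<and> r \<in> T \<and> T \<subseteq> E" by blast
  qed
  moreover have "closedin (top_of_set J) E" unfolding E_def by (rule closedeq[OF JS])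
  moreover have "connected J" using Jint is_interval_connected by blast
  moreover have "E \<noteq> {}" using J0 0 by (auto simp: E_def)
  ultimately have EJ: "E = J" using connected_clopen by blast
  show ?thesis
  proof (cases "s \<in> J")
    case True
    then show ?thesis using EJ by (auto simp: E_def)
  next
    case False
    \<comment> \<open>The left endpoint may lie on the boundary, where local uniqueness in a chart
      was not established; agreement extends to it by continuity.\<close>
    then have t: "s = t" "t < 0" using s by (auto simp: J_def)
    let ?R = "{r \<in> ?S. \<gamma> r = \<eta> r}"
    have "closed ?R" using closedin_closed_trans[OF closedeq[OF order_refl] closed_segment] .
    moreover have "{t<..<0} \<subseteq> ?R"
    proof
      fix r assume "r \<in> {t<..<0}"
      then have "r \<in> J" by (auto simp: J_def closed_segment_eq_real_ivl)
      then show "r \<in> ?R" using EJ JS by (auto simp: E_def)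
    qed
    ultimately have "closure {t<..<0} \<subseteq> ?R" by (rule closure_minimal[rotated])
    moreover have "t \<in> closure {t<..<0}" using t(2) by (simp add: closure_greaterThanLessThan)
    ultimately show ?thesis using t(1) by blast
  qed
qed

text \<open>Uniqueness of integral curves is what lets the description operator in
  \<open>flow\<close> pick a value.\<close>

lemma flow_eqI:
  assumes "integral_curve A X \<gamma> (closed_segment 0 t)" "\<gamma> 0 \<in> Mi"
  shows "flow A X t (\<gamma> 0) = \<gamma> t"
  unfolding flow_def
proof (rule the_equality)
  show "\<exists>\<eta>. integral_curve A X \<eta> (closed_segment 0 t) \<and> \<eta> 0 = \<gamma> 0 \<and> \<eta> t = \<gamma> t" using assms by blast
  fix y assume "\<exists>\<eta>. integral_curve A X \<eta> (closed_segment 0 t) \<and> \<eta> 0 = \<gamma> 0 \<and> \<eta> t = y"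
  then obtain \<eta> where "integral_curve A X \<eta> (closed_segment 0 t)" "\<eta> 0 = \<gamma> 0" "\<eta> t = y" by blast
  then show "y = \<gamma> t" using integral_curve_unique[of \<eta> t \<gamma> t] assms by auto
qed

lemma flow_eq_interval:
  assumes \<gamma>: "integral_curve A X \<gamma> {a..b}" "\<gamma> 0 \<in> Mi" "\<gamma> 0 = x" and t: "a \<le> 0" "0 \<le> b" "t \<in> {a..b}"
  shows "flow A X t x = \<gamma> t"
proof -
  have "closed_segment 0 t \<subseteq> {a..b}" using t by (auto simp: closed_segment_eq_real_ivl)
  then show ?thesis using flow_eqI[OF integral_curve_subset[OF \<gamma>(1)] \<gamma>(2)] \<gamma>(3) by simp
qed

text \<open>Invariance supplies a curve through \<open>x\<close> that exists since time -1, so time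
  0 is not the earliest time of its interval.\<close>

lemma Lambda_interior: "\<Lambda> \<subseteq> Mi"
proof
  fix x assume "x \<in> \<Lambda>"
  then have "(-1, x) \<in> flow_domain A X" using invariant unfolding flow_invariant_def by blast
  then obtain \<gamma> where "integral_curve A X \<gamma> (closed_segment 0 (-1))" "\<gamma> 0 = x"
    unfolding flow_domain_def by blast
  then show "x \<in> Mi" using integral_curve_interior[of \<gamma> "-1" 0 0] by (simp add: closed_segment_eq_real_ivl)
qed

lemma flow_Lambda: "x \<in> \<Lambda> \<Longrightarrow> flow A X t x \<in> \<Lambda>"
  using invariant unfolding flow_invariant_def by blast

text \<open>The local flow of the coordinate field is carried back by the chart at
  \<open>x0\<close>, and uniqueness identifies it with \<open>flow\<close>. The derivative
  \<open>W\<close> stays expressed in that one chart, where its continuity makes sense.\<close>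

lemma local_flow:
  assumes x0: "x0 \<in> Mi"
  obtains N d W where "open N" "x0 \<in> N" "N \<subseteq> fst (ca x0) \<inter> Mi" "0 < (d::real)"
    "\<And>y. y \<in> N \<Longrightarrow> integral_curve A X (\<lambda>t. flow A X t y) {-d..d}"
    "\<And>y. y \<in> N \<Longrightarrow> flow A X 0 y = y"
    "\<And>y t. y \<in> N \<Longrightarrow> t \<in> {-d..d} \<Longrightarrow> flow A X t y \<in> fst (ca x0) \<inter> Mi"
    "continuous_on ({-d..d} \<times> N) (\<lambda>(t, y). flow A X t y)"
    "\<And>y t. y \<in> N \<Longrightarrow> t \<in> {-d..d} \<Longrightarrow>
      ((\<lambda>z. snd (ca x0) (flow A X t (chart_inv (ca x0) z))) has_derivative W t y) (at (snd (ca x0) y))"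
    "\<And>v. continuous_on ({-d..d} \<times> N) (\<lambda>(t, y). W t y v)"
proof -
  let ?c = "ca x0"
  note c = chart_at[of x0]
  let ?V = "snd ?c ` (fst ?c \<inter> Mi)" and ?f = "field_coord A X ?c"
  have V0: "snd ?c x0 \<in> ?V" using x0 c by blast
  obtain r d \<phi> W where r: "0 < r" "0 < (d::real)"
    and \<phi>V: "\<And>t x. t \<in> {-d..d} \<Longrightarrow> x \<in> ball (snd ?c x0) r \<Longrightarrow> \<phi> t x \<in> ?V"
    and \<phi>0: "\<And>x. x \<in> ball (snd ?c x0) r \<Longrightarrow> \<phi> 0 x = x"
    and \<phi>d: "\<And>t x. t \<in> {-d..d} \<Longrightarrow> x \<in> ball (snd ?c x0) r \<Longrightarrow>
      ((\<lambda>t. \<phi> t x) has_vector_derivative ?f (\<phi> t x)) (at t within {-d..d})"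
    and \<phi>c: "continuous_on ({-d..d} \<times> ball (snd ?c x0) r) (\<lambda>(t, x). \<phi> t x)"
    and \<phi>W: "\<And>t x. t \<in> {-d..d} \<Longrightarrow> x \<in> ball (snd ?c x0) r \<Longrightarrow> (\<phi> t has_derivative W t x) (at x)"
    and Wc: "\<And>v. continuous_on ({-d..d} \<times> ball (snd ?c x0) r) (\<lambda>(t, x). W t x v)"
    by (rule local_flow_C1[OF field_derivative_exists(3)[OF c(1)] V0 field_derivative_exists(1,2)[OF c(1)]])
      (assumption, rule that, assumption+)
  let ?B = "ball (snd ?c x0) r" and ?I = "{-d..d}"
  define N where "N = fst ?c \<inter> Mi \<inter> snd ?c -` ?B"
  have N: "y \<in> fst ?c" "y \<in> Mi" "snd ?c y \<in> ?B" if "y \<in> N" for y using that by (auto simp: N_def)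
  have opN: "open N"
    unfolding N_def
    by (rule continuous_open_preimage[OF continuous_on_subset[OF chart_cont[OF c(1)]]])
      (auto intro!: open_Int chart_open c(1) open_Mi)
  have inv: "chart_inv ?c (\<phi> t (snd ?c y)) \<in> fst ?c \<inter> Mi \<and> snd ?c (chart_inv ?c (\<phi> t (snd ?c y))) = \<phi> t (snd ?c y)"
    if "y \<in> N" "t \<in> ?I" for y t
    using \<phi>V[OF that(2) N(3)[OF that(1)]] chart_inv_left[OF c(1)] by auto
  have start: "chart_inv ?c (\<phi> 0 (snd ?c y)) = y" if "y \<in> N" for y
    using \<phi>0[OF N(3)[OF that]] chart_inv_left[OF c(1) N(1)[OF that]] by simp
  have curve: "integral_curve A X (\<lambda>t. chart_inv ?c (\<phi> t (snd ?c y))) ?I" if y: "y \<in> N" for y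
  proof (rule integral_curveI[where c="\<lambda>_. ?c"])
    have "continuous_on ?I (\<lambda>t. \<phi> t (snd ?c y))"
      using \<phi>d[OF _ N(3)[OF y]] by (meson continuous_on_eq_continuous_within has_vector_derivative_continuous)
    then show "continuous_on ?I (\<lambda>t. chart_inv ?c (\<phi> t (snd ?c y)))"
      by (rule continuous_on_compose2[OF chart_inv_cont[OF c(1)]]) (use \<phi>V[OF _ N(3)[OF y]] in blast)
    fix s assume s: "s \<in> ?I"
    have "((\<lambda>r. snd ?c (chart_inv ?c (\<phi> r (snd ?c y)))) has_vector_derivative ?f (\<phi> s (snd ?c y))) (at s within ?I)"
      by (rule has_vector_derivative_transform[OF s _ \<phi>d[OF s N(3)[OF y]]]) (use inv[OF y] in auto)
    then show "?c \<in> A \<and> chart_inv ?c (\<phi> s (snd ?c y)) \<in> fst ?c \<inter> Mi \<and>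
      ((\<lambda>r. snd ?c (chart_inv ?c (\<phi> r (snd ?c y)))) has_vector_derivative
        ?f (snd ?c (chart_inv ?c (\<phi> s (snd ?c y))))) (at s within ?I)"
      using c inv[OF y s] by simp
  qed
  have flow: "flow A X t y = chart_inv ?c (\<phi> t (snd ?c y))" if "y \<in> N" "t \<in> ?I" for y t
    by (rule flow_eq_interval[OF curve[OF that(1)]]) (use that start N r in auto)
  show thesis
  proof (rule that[OF opN, of d "\<lambda>t y. W t (snd ?c y)"])
    show "x0 \<in> N" using x0 c r by (simp add: N_def)
    show "N \<subseteq> fst ?c \<inter> Mi" by (auto simp: N_def)
    show "0 < d" by (rule r)
    show "integral_curve A X (\<lambda>t. flow A X t y) ?I" if "y \<in> N" for y
      by (rule integral_curve_cong[OF curve[OF that]]) (use flow that in auto)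
    show "flow A X 0 y = y" if "y \<in> N" for y using flow[OF that, of 0] start[OF that] r by simp
    show "flow A X t y \<in> fst ?c \<inter> Mi" if "y \<in> N" "t \<in> ?I" for y t using flow[OF that] inv[OF that] by simp
    have cc: "continuous_on (?I \<times> N) (\<lambda>p. (fst p, snd ?c (snd p)))"
      by (intro continuous_intros continuous_on_compose2[OF chart_cont[OF c(1)]]) (use N in auto)
    have "continuous_on (?I \<times> N) (\<lambda>p. (\<lambda>(t, x). \<phi> t x) (fst p, snd ?c (snd p)))"
      by (rule continuous_on_compose2[OF \<phi>c cc]) (use N in auto)
    then have "continuous_on (?I \<times> N) (\<lambda>p. chart_inv ?c ((\<lambda>(t, x). \<phi> t x) (fst p, snd ?c (snd p))))"
    proof (rule continuous_on_compose2[OF chart_inv_cont[OF c(1)]])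
      show "(\<lambda>p. (\<lambda>(t, x). \<phi> t x) (fst p, snd ?c (snd p))) ` (?I \<times> N) \<subseteq> snd ?c ` fst ?c"
      proof
        fix y assume "y \<in> (\<lambda>p. (\<lambda>(t, x). \<phi> t x) (fst p, snd ?c (snd p))) ` (?I \<times> N)"
        then obtain t q where "t \<in> ?I" "q \<in> N" "y = \<phi> t (snd ?c q)" by auto
        then show "y \<in> snd ?c ` fst ?c" using \<phi>V N(3) by blast
      qed
    qed
    then show "continuous_on (?I \<times> N) (\<lambda>(t, y). flow A X t y)"
      by (rule continuous_on_eq) (use flow in auto)
    show "continuous_on (?I \<times> N) (\<lambda>(t, y). W t (snd ?c y) v)" for v
      using continuous_on_compose2[OF Wc cc, of v] N by (auto simp: case_prod_beta image_subset_iff)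
    fix y t assume y: "y \<in> N" and t: "t \<in> ?I"
    have yB: "snd ?c y \<in> ?B" using N y by blast
    have "eventually (\<lambda>y. y \<in> N) (nhds y)" using opN y by (rule eventually_nhds_in_open)
    then have ev1: "eventually (\<lambda>z. chart_inv ?c z \<in> N) (nhds (snd ?c y))"
      by (rule eventually_chart[OF c(1) N(1,2)[OF y]])
    have "open (snd ?c ` N)" by (rule chart_image_open[OF c(1) opN]) (auto simp: N_def)
    then have ev2: "eventually (\<lambda>z. z \<in> snd ?c ` N) (nhds (snd ?c y))"
      by (rule eventually_nhds_in_open) (use y in blast)
    have "eventually (\<lambda>z. \<phi> t z = snd ?c (flow A X t (chart_inv ?c z))) (nhds (snd ?c y))"
      using ev1 ev2
    proof eventually_elim
      case (elim z)
      then have "snd ?c (chart_inv ?c z) = z" using chart_inv_left[OF c(1)] N(1) by auto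
      then show ?case using flow[OF elim(1) t] inv[OF elim(1) t] by simp
    qed
    then show "((\<lambda>z. snd ?c (flow A X t (chart_inv ?c z))) has_derivative W t (snd ?c y)) (at (snd ?c y))"
      by (rule has_derivative_cong_nhds[OF \<phi>W[OF t yB]])
  qed
qed

end

section \<open>The derivative cocycle\<close>

context flow_setup begin

definition flow_box :: "'m \<Rightarrow> 'm set \<Rightarrow> real \<Rightarrow> (real \<Rightarrow> 'm \<Rightarrow> real ^ 'n \<Rightarrow> real ^ 'n) \<Rightarrow> bool" where
  "flow_box x0 N d W \<longleftrightarrow> open N \<and> N \<subseteq> fst (ca x0) \<inter> Mi \<and> 0 < d \<and>
    (\<forall>y\<in>N. integral_curve A X (\<lambda>t. flow A X t y) {-d..d}) \<and>
    (\<forall>y\<in>N. flow A X 0 y = y) \<and>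
    (\<forall>y\<in>N. \<forall>t\<in>{-d..d}. flow A X t y \<in> fst (ca x0) \<inter> Mi) \<and>
    continuous_on ({-d..d} \<times> N) (\<lambda>(t, y). flow A X t y) \<and>
    (\<forall>y\<in>N. \<forall>t\<in>{-d..d}.
      ((\<lambda>z. snd (ca x0) (flow A X t (chart_inv (ca x0) z))) has_derivative W t y) (at (snd (ca x0) y))) \<and>
    (\<forall>v. continuous_on ({-d..d} \<times> N) (\<lambda>(t, y). W t y v))"

lemma flow_boxD:
  assumes "flow_box x0 N d W"
  shows "open N" "N \<subseteq> fst (ca x0) \<inter> Mi" "0 < d"
    "\<And>y. y \<in> N \<Longrightarrow> integral_curve A X (\<lambda>t. flow A X t y) {-d..d}"
    "\<And>y. y \<in> N \<Longrightarrow> flow A X 0 y = y"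
    "\<And>y t. y \<in> N \<Longrightarrow> t \<in> {-d..d} \<Longrightarrow> flow A X t y \<in> fst (ca x0) \<inter> Mi"
    "continuous_on ({-d..d} \<times> N) (\<lambda>(t, y). flow A X t y)"
    "\<And>y t. y \<in> N \<Longrightarrow> t \<in> {-d..d} \<Longrightarrow>
      ((\<lambda>z. snd (ca x0) (flow A X t (chart_inv (ca x0) z))) has_derivative W t y) (at (snd (ca x0) y))"
    "\<And>v. continuous_on ({-d..d} \<times> N) (\<lambda>(t, y). W t y v)"
  using assms unfolding flow_box_def by blast+

lemma flow_box_exists:
  assumes "x0 \<in> Mi"
  shows "\<exists>N d W. x0 \<in> N \<and> flow_box x0 N d W"
proof -
  obtain N d W where *: "open N" "x0 \<in> N" "N \<subseteq> fst (ca x0) \<inter> Mi" "0 < (d::real)"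
    "\<And>y. y \<in> N \<Longrightarrow> integral_curve A X (\<lambda>t. flow A X t y) {-d..d}"
    "\<And>y. y \<in> N \<Longrightarrow> flow A X 0 y = y"
    "\<And>y t. y \<in> N \<Longrightarrow> t \<in> {-d..d} \<Longrightarrow> flow A X t y \<in> fst (ca x0) \<inter> Mi"
    "continuous_on ({-d..d} \<times> N) (\<lambda>(t, y). flow A X t y)"
    "\<And>y t. y \<in> N \<Longrightarrow> t \<in> {-d..d} \<Longrightarrow>
      ((\<lambda>z. snd (ca x0) (flow A X t (chart_inv (ca x0) z))) has_derivative W t y) (at (snd (ca x0) y))"
    "\<And>v. continuous_on ({-d..d} \<times> N) (\<lambda>(t, y). W t y v)"
    by (rule local_flow[OF assms]) (rule that)
  have "flow_box x0 N d W"
    unfolding flow_box_def by (intro conjI ballI allI *)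
  then show ?thesis using *(2) by blast
qed

lemma flow_zero: "x \<in> Mi \<Longrightarrow> flow A X 0 x = x"
  using flow_box_exists flow_boxD(5) by blast

lemma flow_box_cont_time:
  assumes b: "flow_box x0 N d W" and t: "t \<in> {-d..d}"
  shows "continuous_on N (flow A X t)"
proof -
  have "continuous_on N (\<lambda>y. (\<lambda>(t, y). flow A X t y) (t, y))"
    by (rule continuous_on_compose2[OF flow_boxD(7)[OF b]]) (use t in \<open>auto intro!: continuous_intros\<close>)
  then show ?thesis by simp
qed

lemma uniform_flow_box:
  obtains d0 where "0 < d0" "\<And>x. x \<in> \<Lambda> \<Longrightarrow> \<exists>x0 N d W. flow_box x0 N d W \<and> x \<in> N \<and> d0 \<le> d"
proof -
  have "\<forall>x0\<in>\<Lambda>. \<exists>N d W. x0 \<in> N \<and> flow_box x0 N d W"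
    using flow_box_exists Lambda_interior by blast
  then obtain N where "\<forall>x0\<in>\<Lambda>. \<exists>d W. x0 \<in> N x0 \<and> flow_box x0 (N x0) d W" using bchoice by metis
  then obtain d where "\<forall>x0\<in>\<Lambda>. \<exists>W. x0 \<in> N x0 \<and> flow_box x0 (N x0) (d x0) W" using bchoice by metis
  then obtain W where W: "\<And>x0. x0 \<in> \<Lambda> \<Longrightarrow> x0 \<in> N x0 \<and> flow_box x0 (N x0) (d x0) (W x0)" using bchoice by metis
  have op: "\<And>x0. x0 \<in> \<Lambda> \<Longrightarrow> open (N x0)" using W flow_boxD(1) by blast
  have cov: "\<Lambda> \<subseteq> (\<Union>x0\<in>\<Lambda>. N x0)" using W by blast
  obtain F where F: "F \<subseteq> \<Lambda>" "finite F" "\<Lambda> \<subseteq> (\<Union>x0\<in>F. N x0)"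
    by (rule compactE_image[OF compact_inv op cov])
  \<comment> \<open>The inserted 1 gives the minimum a value if the subcover is empty.\<close>
  define d0 where "d0 = Min (insert 1 (d ` F))"
  show thesis
  proof (rule that)
    have "\<And>x0. x0 \<in> F \<Longrightarrow> 0 < d x0" using F(1) W flow_boxD(3) by blast
    then show "0 < d0" using F(2) by (simp add: d0_def)
    fix x assume "x \<in> \<Lambda>"
    then obtain x0 where x0: "x0 \<in> F" "x \<in> N x0" using F(3) by blast
    have "d0 \<le> d x0" unfolding d0_def using F(2) x0(1) by (intro Min_le) auto
    then show "\<exists>x0 N d W. flow_box x0 N d W \<and> x \<in> N \<and> d0 \<le> d" using x0 W F(1) by blast
  qed
qed

text \<open>The derivative at a point of \<open>\<Lambda>\<close> involves neighbours outside
  \<open>\<Lambda>\<close>, whose orbits need not exist for long. Starting from duration 0, each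
  round prolongs the curves of a smaller neighbourhood by \<open>d0\<close> at both ends: the images
  of \<open>x\<close> at times \<open>K\<close> and \<open>- K\<close> stay in
  \<open>\<Lambda>\<close> and so lie in boxes of at least that duration.\<close>

lemma long_flow_nhd:
  assumes x: "x \<in> \<Lambda>"
  obtains N where "open N" "x \<in> N" "N \<subseteq> Mi"
    "\<And>y. y \<in> N \<Longrightarrow> integral_curve A X (\<lambda>t. flow A X t y) {-b..b}"
    "\<And>y t. y \<in> N \<Longrightarrow> t \<in> {-b..b} \<Longrightarrow> flow A X t y \<in> Mi"
    "\<And>t. t \<in> {-b..b} \<Longrightarrow> continuous_on N (flow A X t)"
proof -
  obtain d0 where d0: "0 < d0" "\<And>x. x \<in> \<Lambda> \<Longrightarrow> \<exists>x0 N d W. flow_box x0 N d W \<and> x \<in> N \<and> d0 \<le> d"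
    by (rule uniform_flow_box) (rule that)
  define good where "good K x N \<longleftrightarrow> open N \<and> x \<in> N \<and> N \<subseteq> Mi \<and>
    (\<forall>y\<in>N. integral_curve A X (\<lambda>t. flow A X t y) {-K..K}) \<and>
    (\<forall>y\<in>N. \<forall>t\<in>{-K..K}. flow A X t y \<in> Mi) \<and> (\<forall>t\<in>{-K..K}. continuous_on N (flow A X t))" for K x N
  have step: "\<exists>N. good (K + d0) x N" if K: "0 \<le> K" and N: "good K x N" and x: "x \<in> \<Lambda>" for K x N
  proof -
    let ?p = "flow A X K" and ?q = "flow A X (- K)"
    obtain x1 N1 d1 W1 where b1: "flow_box x1 N1 d1 W1" and x1: "?p x \<in> N1" "d0 \<le> d1"
      using d0(2)[OF flow_Lambda[OF x]] by blast
    obtain x2 N2 d2 W2 where b2: "flow_box x2 N2 d2 W2" and x2: "?q x \<in> N2" "d0 \<le> d2"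
      using d0(2)[OF flow_Lambda[OF x]] by blast
    have NK: "open N" "x \<in> N" "N \<subseteq> Mi" "\<And>y. y \<in> N \<Longrightarrow> integral_curve A X (\<lambda>t. flow A X t y) {-K..K}"
      "\<And>y t. y \<in> N \<Longrightarrow> t \<in> {-K..K} \<Longrightarrow> flow A X t y \<in> Mi" "\<And>t. t \<in> {-K..K} \<Longrightarrow> continuous_on N (flow A X t)"
      using N unfolding good_def by blast+
    have KI: "K \<in> {-K..K}" "- K \<in> {-K..K}" using K by auto
    define N' where "N' = (N \<inter> ?p -` N1) \<inter> (N \<inter> ?q -` N2)"
    have opN': "open N'"
      unfolding N'_def
      by (intro open_Int continuous_open_preimage[OF NK(6)[OF KI(1)] NK(1) flow_boxD(1)[OF b1]]
          continuous_open_preimage[OF NK(6)[OF KI(2)] NK(1) flow_boxD(1)[OF b2]])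
    have N': "y \<in> N" "?p y \<in> N1" "?q y \<in> N2" if "y \<in> N'" for y using that by (auto simp: N'_def)
    \<comment> \<open>The prolonged curve has three pieces: the known one in the middle, and at each
      end the flow of the box that the curve has reached. Points of \<open>N'\<close> are those
      whose images at times \<open>K\<close> and \<open>- K\<close> lie in the boxes.\<close>
    define \<Gamma> where "\<Gamma> y r = (if K < r then flow A X (r - K) (?p y)
      else if r < - K then flow A X (r + K) (?q y) else flow A X r y)" for y r
    have right: "\<Gamma> y r = flow A X (r - K) (?p y)" if "y \<in> N'" "K \<le> r" for y r
      using flow_boxD(5)[OF b1 N'(2)[OF that(1)]] that K by (cases "r = K") (auto simp: \<Gamma>_def)
    have left: "\<Gamma> y r = flow A X (r + K) (?q y)" if "y \<in> N'" "r \<le> - K" for y r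
    proof (cases "r = - K")
      case True
      then show ?thesis using flow_boxD(5)[OF b2 N'(3)[OF that(1)]] K by (auto simp: \<Gamma>_def)
    qed (use that K in \<open>auto simp: \<Gamma>_def\<close>)
    have mid: "\<Gamma> y r = flow A X r y" if "r \<in> {-K..K}" for y r using that by (auto simp: \<Gamma>_def)
    have curve: "integral_curve A X (\<Gamma> y) {-(K + d0)..K + d0}" if y: "y \<in> N'" for y
    proof (rule integral_curve_glue[of _ _ K])
      show "integral_curve A X (\<Gamma> y) {-(K + d0)..K}"
      proof (rule integral_curve_glue[of _ _ "- K"])
        have "integral_curve A X (\<lambda>r. flow A X (r + K) (?q y)) {-(K + d0)..- K}"
          by (rule integral_curve_subset[OF integral_curve_shift[OF flow_boxD(4)[OF b2 N'(3)[OF y]]]])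
            (use x2(2) d0 in auto)
        then show "integral_curve A X (\<Gamma> y) {-(K + d0)..- K}"
          by (rule integral_curve_cong) (use left[OF y] in auto)
        show "integral_curve A X (\<Gamma> y) {- K..K}"
          by (rule integral_curve_cong[OF NK(4)[OF N'(1)[OF y]]]) (rule mid)
      qed (use K d0 in auto)
      have "integral_curve A X (\<lambda>r. flow A X (r + (- K)) (?p y)) {K..K + d0}"
        by (rule integral_curve_subset[OF integral_curve_shift[OF flow_boxD(4)[OF b1 N'(2)[OF y]]]])
          (use x1(2) d0 in auto)
      then show "integral_curve A X (\<Gamma> y) {K..K + d0}"
        by (rule integral_curve_cong) (use right[OF y] in auto)
    qed (use K d0 in auto)
    have \<Gamma>0: "\<Gamma> y 0 = y" if "y \<in> N'" for y
      using mid[of 0 y] K flow_zero[of y] N'(1)[OF that] NK(3) by auto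
    have yMi: "y \<in> Mi" if "y \<in> N'" for y using N'(1)[OF that] NK(3) by blast
    have flow: "flow A X t y = \<Gamma> y t" if y: "y \<in> N'" and t: "t \<in> {-(K + d0)..K + d0}" for y t
      by (rule flow_eq_interval[OF curve[OF y]]) (use \<Gamma>0[OF y] yMi[OF y] K d0 t in auto)
    have part: "t \<in> {-K..K} \<or> K \<le> t \<and> t - K \<in> {-d1..d1} \<or> t \<le> - K \<and> t + K \<in> {-d2..d2}"
      if "t \<in> {-(K + d0)..K + d0}" for t
      using that x1(2) x2(2) d0(1) K by auto
    have "good (K + d0) x N'"
      unfolding good_def
    proof (intro conjI ballI opN')
      show "x \<in> N'" using NK(2) x1 x2 by (simp add: N'_def)
      show "N' \<subseteq> Mi" using yMi by blast
      show "integral_curve A X (\<lambda>t. flow A X t y) {-(K + d0)..K + d0}" if "y \<in> N'" for y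
        by (rule integral_curve_cong[OF curve[OF that]]) (rule flow[OF that])
      show "flow A X t y \<in> Mi" if y: "y \<in> N'" and t: "t \<in> {-(K + d0)..K + d0}" for y t
      proof -
        consider "t \<in> {-K..K}" | "K \<le> t" "t - K \<in> {-d1..d1}" | "t \<le> - K" "t + K \<in> {-d2..d2}"
          using part[OF t] by blast
        then show ?thesis
        proof cases
          case 1
          then show ?thesis by (rule NK(5)[OF N'(1)[OF y]])
        next
          case 2
          then show ?thesis using flow_boxD(6)[OF b1 N'(2)[OF y] 2(2)] flow[OF y t] right[OF y 2(1)] by simp
        next
          case 3
          then show ?thesis using flow_boxD(6)[OF b2 N'(3)[OF y] 3(2)] flow[OF y t] left[OF y 3(1)] by simp
        qed
      qed
      show "continuous_on N' (flow A X t)" if t: "t \<in> {-(K + d0)..K + d0}" for t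
      proof -
        have sub: "N' \<subseteq> N" using N' by blast
        consider "t \<in> {-K..K}" | "K \<le> t" "t - K \<in> {-d1..d1}" | "t \<le> - K" "t + K \<in> {-d2..d2}"
          using part[OF t] by blast
        then show ?thesis
        proof cases
          case 1
          then show ?thesis using NK(6) sub continuous_on_subset by blast
        next
          case 2
          have "continuous_on N' (\<lambda>y. flow A X (t - K) (?p y))"
            by (rule continuous_on_compose2[OF flow_box_cont_time[OF b1 2(2)] continuous_on_subset[OF NK(6)[OF KI(1)] sub]])
              (use N' in blast)
          then show ?thesis by (rule continuous_on_eq) (use flow[OF _ t] right[OF _ 2(1)] in simp)
        next
          case 3
          have "continuous_on N' (\<lambda>y. flow A X (t + K) (?q y))"
            by (rule continuous_on_compose2[OF flow_box_cont_time[OF b2 3(2)] continuous_on_subset[OF NK(6)[OF KI(2)] sub]])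
              (use N' in blast)
          then show ?thesis by (rule continuous_on_eq) (use flow[OF _ t] left[OF _ 3(1)] in simp)
        qed
      qed
    qed
    then show ?thesis by blast
  qed
  have base: "\<exists>N. good (real k * d0) x N" for k
  proof (induction k)
    case 0
    obtain x1 N1 d1 W1 where b: "flow_box x1 N1 d1 W1" and x1: "x \<in> N1" using d0(2)[OF x] by blast
    have "good 0 x N1"
      unfolding good_def
    proof (intro conjI ballI)
      have 0: "(0::real) \<in> {-d1..d1}" using flow_boxD(3)[OF b] by simp
      show "open N1" "x \<in> N1" "N1 \<subseteq> Mi" using flow_boxD(1,2)[OF b] x1 by auto
      show "integral_curve A X (\<lambda>t. flow A X t y) {- 0..0}" if "y \<in> N1" for y
        by (rule integral_curve_subset[OF flow_boxD(4)[OF b that]]) (use 0 in auto)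
      show "flow A X t y \<in> Mi" if "y \<in> N1" "t \<in> {- 0..0}" for t y
        using flow_boxD(6)[OF b that(1) 0] that(2) by auto
      show "continuous_on N1 (flow A X t)" if "t \<in> {- 0..0}" for t
        using flow_box_cont_time[OF b 0] that by auto
    qed
    then show ?case by auto
  next
    case (Suc k)
    then obtain N where N: "good (real k * d0) x N" by blast
    have "real (Suc k) * d0 = real k * d0 + d0" by (simp add: algebra_simps)
    then show ?case using step[OF _ N x] d0(1) by simp
  qed
  obtain k :: nat where k: "b < real k * d0" using ex_less_of_nat_mult[OF d0(1)] by blast
  obtain N where N: "good (real k * d0) x N" using base by blast
  have sub: "{-b..b} \<subseteq> {-(real k * d0)..real k * d0}" using k by auto
  show thesis
    by (rule that[of N]) (use N sub integral_curve_subset[OF _ sub] in \<open>auto simp: good_def\<close>)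
qed

lemma flow_isCont:
  assumes x: "x \<in> \<Lambda>"
  shows "isCont (flow A X t) x"
proof -
  obtain N where N: "open N" "x \<in> N" "\<And>s. s \<in> {-\<bar>t\<bar>..\<bar>t\<bar>} \<Longrightarrow> continuous_on N (flow A X s)"
    by (rule long_flow_nhd[OF x, of "\<bar>t\<bar>"]) (rule that)
  have "t \<in> {-\<bar>t\<bar>..\<bar>t\<bar>}" using abs_ge_self[of t] abs_ge_minus_self[of t] by simp
  from N(3)[OF this] N(1,2) show ?thesis by (simp add: continuous_on_eq_continuous_at)
qed

lemma eventually_isCont:
  assumes "isCont h x" "eventually P (nhds (h x))"
  shows "eventually (\<lambda>y. P (h y)) (nhds x)"
  by (rule eventually_compose_filterlim[OF assms(2)])
    (use assms(1) in \<open>simp add: isCont_def tendsto_at_iff_tendsto_nhds\<close>)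

text \<open>The identity is needed on a neighbourhood, and not only on \<open>\<Lambda>\<close>, so
  that both sides can be differentiated; the cocycle property of \<open>D\<close> comes from
  it.\<close>

lemma flow_add_near:
  assumes x: "x \<in> \<Lambda>"
  shows "eventually (\<lambda>y. flow A X (s + t) y = flow A X s (flow A X t y)) (nhds x)"
proof -
  let ?b = "\<bar>s\<bar> + \<bar>t\<bar>"
  obtain N where N: "open N" "x \<in> N" "N \<subseteq> Mi"
    "\<And>y. y \<in> N \<Longrightarrow> integral_curve A X (\<lambda>t. flow A X t y) {-?b..?b}"
    "\<And>y t. y \<in> N \<Longrightarrow> t \<in> {-?b..?b} \<Longrightarrow> flow A X t y \<in> Mi"
    by (rule long_flow_nhd[OF x, of ?b]) (rule that)
  have "flow A X (s + t) y = flow A X s (flow A X t y)" if y: "y \<in> N" for y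
  proof -
    have "closed_segment 0 s \<subseteq> {r. r + t \<in> {-?b..?b}}"
      by (auto simp: closed_segment_eq_real_ivl split: if_splits)
    then have "integral_curve A X (\<lambda>r. flow A X (r + t) y) (closed_segment 0 s)"
      by (rule integral_curve_subset[OF integral_curve_shift[OF N(4)[OF y]]])
    moreover have "t \<in> {-?b..?b}"
      using abs_ge_self[of t] abs_ge_minus_self[of t] abs_ge_zero[of s] unfolding atLeastAtMost_iff by linarith
    then have "flow A X (0 + t) y \<in> Mi" using N(5)[OF y] by simp
    ultimately have "flow A X s (flow A X (0 + t) y) = flow A X (s + t) y" by (rule flow_eqI)
    then show ?thesis by simp
  qed
  then show ?thesis
    using eventually_nhds_in_open[OF N(1,2)] by (auto elim: eventually_mono)
qed

lemma flow_add: "x \<in> \<Lambda> \<Longrightarrow> flow A X (s + t) x = flow A X s (flow A X t x)"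
  using eventually_nhds_x_imp_x[OF flow_add_near] .

text \<open>Continuity of \<open>h\<close> is part of the notion: the coordinate expression is
  meaningful only while images of nearby points remain in the chart at \<open>h x\<close>, since
  outside its domain the coordinate function is arbitrary.\<close>

definition tdiff :: "('m \<Rightarrow> 'm) \<Rightarrow> 'm \<Rightarrow> bool" where
  "tdiff h x \<longleftrightarrow> x \<in> Mi \<and> h x \<in> Mi \<and> isCont h x \<and>
    ((\<lambda>z. snd (ca (h x)) (h (chart_inv (ca x) z))) has_derivative tangent_map A h x) (at (snd (ca x) x))"

text \<open>The chain rule through two transition maps; a derivative found in convenient charts can
  thus be read off in the preferred ones.\<close>

lemma tdiff_chartI:
  assumes x: "x \<in> Mi" "h x \<in> Mi" and h: "isCont h x"
    and c: "c \<in> A" "x \<in> fst c" and d: "d \<in> A" "h x \<in> fst d"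
    and W: "((\<lambda>z. snd d (h (chart_inv c z))) has_derivative W) (at (snd c x))"
  shows "tdiff h x" and "tangent_map A h x v = T d (ca (h x)) (h x) (W (T (ca x) c x v))"
proof -
  let ?c = "ca x" and ?d = "ca (h x)"
  note cx = chart_at[of x] and dx = chart_at[of "h x"]
  let ?L = "T d ?d (h x) \<circ> (W \<circ> T ?c c x)"
  have 1: "((\<lambda>z. snd d (h (chart_inv c z))) \<circ> (\<lambda>z. snd c (chart_inv ?c z)) has_derivative (W \<circ> T ?c c x)) (at (snd ?c x))"
    if "((\<lambda>z. snd d (h (chart_inv c z))) has_derivative W) (at (snd c (chart_inv ?c (snd ?c x))))"
    for W
    by (rule diff_chain_at[OF transition_derivative(1)[OF cx(1) c(1) cx(2) c(2) x(1)] that])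
  note 1 = 1[of W, unfolded chart_inv_left[OF cx], OF W]
  have 2: "((\<lambda>y. snd ?d (chart_inv d y)) \<circ> ((\<lambda>z. snd d (h (chart_inv c z))) \<circ> (\<lambda>z. snd c (chart_inv ?c z))) has_derivative ?L) (at (snd ?c x))"
    by (rule diff_chain_at[OF 1])
      (use transition_derivative(1)[OF d(1) dx(1) d(2) dx(2) x(2)] in \<open>simp add: chart_inv_left[OF cx] chart_inv_left[OF c]\<close>)
  have "eventually (\<lambda>z. chart_inv ?c z \<in> fst c \<inter> Mi) (nhds (snd ?c x))"
    by (rule eventually_chart[OF cx x(1) eventually_in_chart[OF c x(1)]])
  moreover have "eventually (\<lambda>z. h (chart_inv ?c z) \<in> fst d \<inter> Mi) (nhds (snd ?c x))"
    by (rule eventually_chart[OF cx x(1) eventually_isCont[OF h eventually_in_chart[OF d x(2)]]])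
  ultimately have "eventually (\<lambda>z. ((\<lambda>y. snd ?d (chart_inv d y)) \<circ> ((\<lambda>z. snd d (h (chart_inv c z))) \<circ> (\<lambda>z. snd c (chart_inv ?c z)))) z =
      snd ?d (h (chart_inv ?c z))) (nhds (snd ?c x))"
    by eventually_elim (auto simp: chart_inv_left[OF c(1)] chart_inv_left[OF d(1)])
  from has_derivative_cong_nhds[OF 2 this]
  have D: "((\<lambda>z. snd ?d (h (chart_inv ?c z))) has_derivative ?L) (at (snd ?c x))" .
  have "open (snd ?c ` (fst ?c \<inter> Mi))"
    by (rule chart_image_open[OF cx(1)]) (auto intro!: open_Int chart_open[OF cx(1)] open_Mi)
  then have "snd ?c x \<in> interior (snd ?c ` fst ?c)"
    by (rule interiorI) (use x cx in auto)
  then have tm: "tangent_map A h x = frechet_derivative (\<lambda>z. snd ?d (h (chart_inv ?c z))) (at (snd ?c x))"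
    unfolding tangent_map_def by (simp only: at_within_interior comp_def)
  also have "\<dots> = ?L" using frechet_derivative_at[OF D] by simp
  finally have tmL: "tangent_map A h x = ?L" .
  then show "tangent_map A h x v = T d ?d (h x) (W (T ?c c x v))" by simp
  show "tdiff h x" unfolding tdiff_def using x h D tmL by simp
qed

lemma tdiff_linear: "tdiff h x \<Longrightarrow> linear (tangent_map A h x)"
  unfolding tdiff_def using has_derivative_linear by blast

lemma tdiff_cong:
  assumes h: "tdiff h x" and ev: "eventually (\<lambda>y. h y = k y) (nhds x)"
  shows "tdiff k x" "tangent_map A k x v = tangent_map A h x v"
proof -
  have kx: "k x = h x" using eventually_nhds_x_imp_x[OF ev] by simp
  have x: "x \<in> Mi" "k x \<in> Mi" using h kx by (auto simp: tdiff_def)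
  have kc: "isCont k x" using h isCont_cong[OF ev] by (simp add: tdiff_def)
  have D: "((\<lambda>z. snd (ca (k x)) (k (chart_inv (ca x) z))) has_derivative tangent_map A h x) (at (snd (ca x) x))"
    unfolding kx
    by (rule has_derivative_cong_nhds)
      (use h eventually_chart[OF chart_at x(1) ev] in \<open>auto simp: tdiff_def elim: eventually_mono\<close>)
  note * = tdiff_chartI[OF x kc chart_at chart_at D]
  show "tdiff k x" by (rule *(1))
  show "tangent_map A k x v = tangent_map A h x v"
    unfolding *(2) using T_id[OF chart_at(1) chart_at(2)] x by simp
qed

lemma tdiff_comp:
  assumes h: "tdiff h x" and k: "tdiff k (h x)"
  shows "tdiff (\<lambda>y. k (h y)) x" "tangent_map A (\<lambda>y. k (h y)) x v = tangent_map A k (h x) (tangent_map A h x v)"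
proof -
  have x: "x \<in> Mi" "h x \<in> Mi" "k (h x) \<in> Mi" using h k by (auto simp: tdiff_def)
  have hc: "isCont h x" using h by (simp add: tdiff_def)
  have cont: "isCont (\<lambda>y. k (h y)) x"
    by (rule isCont_o2[OF hc]) (use k in \<open>simp add: tdiff_def\<close>)
  let ?d = "ca (h x)" and ?e = "ca (k (h x))"
  have "((\<lambda>z. snd ?e (k (chart_inv ?d z))) \<circ> (\<lambda>z. snd ?d (h (chart_inv (ca x) z))) has_derivative
      tangent_map A k (h x) \<circ> tangent_map A h x) (at (snd (ca x) x))"
    by (rule diff_chain_at) (use h k in \<open>simp_all add: tdiff_def chart_inv_left[OF chart_at]\<close>)
  moreover have "eventually (\<lambda>y. h y \<in> fst ?d \<inter> Mi) (nhds x)"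
    by (rule eventually_isCont[OF hc eventually_in_chart[OF chart_at x(2)]])
  then have "eventually (\<lambda>z. h (chart_inv (ca x) z) \<in> fst ?d \<inter> Mi) (nhds (snd (ca x) x))"
    by (rule eventually_chart[OF chart_at x(1)])
  then have "eventually (\<lambda>z. ((\<lambda>z. snd ?e (k (chart_inv ?d z))) \<circ> (\<lambda>z. snd ?d (h (chart_inv (ca x) z)))) z =
      snd ?e (k (h (chart_inv (ca x) z)))) (nhds (snd (ca x) x))"
    by eventually_elim (auto simp: chart_inv_left[OF chart_at(1)])
  ultimately have D: "((\<lambda>z. snd ?e (k (h (chart_inv (ca x) z)))) has_derivative
      tangent_map A k (h x) \<circ> tangent_map A h x) (at (snd (ca x) x))"
    by (rule has_derivative_cong_nhds)
  note * = tdiff_chartI[where h="\<lambda>y. k (h y)", OF x(1,3) cont chart_at chart_at D]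
  show "tdiff (\<lambda>y. k (h y)) x" by (rule *(1))
  show "tangent_map A (\<lambda>y. k (h y)) x v = tangent_map A k (h x) (tangent_map A h x v)"
    unfolding *(2) using T_id[OF chart_at(1) chart_at(2)] x by simp
qed

lemma tangent_map_id:
  assumes x: "x \<in> Mi"
  shows "tdiff (\<lambda>y. y) x" "tangent_map A (\<lambda>y. y) x v = v"
proof -
  have D: "((\<lambda>z. snd (ca x) (chart_inv (ca x) z)) has_derivative T (ca x) (ca x) x) (at (snd (ca x) x))"
    by (rule transition_derivative(1)[OF chart_at(1) chart_at(1) chart_at(2) chart_at(2) x])
  note * = tdiff_chartI[where h="\<lambda>y. y", OF x x continuous_ident chart_at chart_at D]
  show "tdiff (\<lambda>y. y) x" by (rule *(1))
  show "tangent_map A (\<lambda>y. y) x v = v"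
    unfolding *(2) using T_id[OF chart_at(1) chart_at(2) x] by simp
qed

abbreviation "\<phi> \<equiv> flow A X"
abbreviation "D \<equiv> Dflow A X"

lemma Dflow_box:
  assumes b: "flow_box x0 N d W" and y: "y \<in> N" and t: "t \<in> {-d..d}"
  shows "tdiff (\<phi> t) y" "D t y v = T (ca x0) (ca (\<phi> t y)) (\<phi> t y) (W t y (T (ca y) (ca x0) y v))"
proof -
  have yM: "y \<in> Mi" "y \<in> fst (ca x0)" using flow_boxD(2)[OF b] y by auto
  have fM: "\<phi> t y \<in> Mi" "\<phi> t y \<in> fst (ca x0)" using flow_boxD(6)[OF b y t] by auto
  have "isCont (\<phi> t) y"
    using flow_box_cont_time[OF b t] flow_boxD(1)[OF b] y by (simp add: continuous_on_eq_continuous_at)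
  note * = tdiff_chartI[OF yM(1) fM(1) this chart_at(1) yM(2) chart_at(1) fM(2) flow_boxD(8)[OF b y t]]
  show "tdiff (\<phi> t) y" by (rule *(1))
  show "D t y v = T (ca x0) (ca (\<phi> t y)) (\<phi> t y) (W t y (T (ca y) (ca x0) y v))"
    unfolding Dflow_def by (rule *(2))
qed

text \<open>The time is cut into \<open>k\<close> equal steps short enough for the boxes, and the
  chain rule is applied along points of the orbit, all of which stay in
  \<open>\<Lambda>\<close>.\<close>

lemma tdiff_flow:
  assumes x: "x \<in> \<Lambda>"
  shows "tdiff (\<phi> t) x"
proof -
  obtain d0 where d0: "0 < d0" "\<And>x. x \<in> \<Lambda> \<Longrightarrow> \<exists>x0 N d W. flow_box x0 N d W \<and> x \<in> N \<and> d0 \<le> d"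
    by (rule uniform_flow_box) (rule that)
  have small: "tdiff (\<phi> s) x" if s: "\<bar>s\<bar> \<le> d0" and x: "x \<in> \<Lambda>" for s x
  proof -
    obtain x0 N d W where "flow_box x0 N d W" "x \<in> N" "d0 \<le> d" using d0(2)[OF x] by blast
    then show ?thesis using s by (intro Dflow_box(1)) auto
  qed
  obtain k :: nat where k: "\<bar>t\<bar> < real k * d0" using ex_less_of_nat_mult[OF d0(1)] by blast
  then have k0: "0 < real k" using d0(1) by (cases k) auto
  define s where "s = t / real k"
  have s: "\<bar>s\<bar> \<le> d0" using k k0 by (simp add: s_def field_simps)
  have "tdiff (\<phi> (real j * s)) x" for j
  proof (induction j)
    case 0
    show ?case using small[of 0 x] x d0 by simp
  next
    case (Suc j)
    have "tdiff (\<lambda>y. \<phi> s (\<phi> (real j * s) y)) x"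
      by (rule tdiff_comp(1)[OF Suc small[OF s flow_Lambda[OF x]]])
    moreover have "eventually (\<lambda>y. \<phi> s (\<phi> (real j * s) y) = \<phi> (real (Suc j) * s) y) (nhds x)"
      using flow_add_near[OF x, of s "real j * s"] by eventually_elim (simp add: algebra_simps)
    ultimately show ?case by (rule tdiff_cong(1))
  qed
  from this[of k] show ?thesis using k0 by (simp add: s_def)
qed

lemma Dflow_linear: "x \<in> \<Lambda> \<Longrightarrow> linear (D t x)"
  unfolding Dflow_def by (rule tdiff_linear[OF tdiff_flow])

lemma Dflow_add:
  assumes x: "x \<in> \<Lambda>"
  shows "D (s + t) x v = D s (\<phi> t x) (D t x v)"
proof -
  have c: "tdiff (\<lambda>y. \<phi> s (\<phi> t y)) x" "tangent_map A (\<lambda>y. \<phi> s (\<phi> t y)) x v = D s (\<phi> t x) (D t x v)"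
    unfolding Dflow_def
    using tdiff_comp[OF tdiff_flow[OF x] tdiff_flow[OF flow_Lambda[OF x]]] by blast+
  have "eventually (\<lambda>y. \<phi> s (\<phi> t y) = \<phi> (s + t) y) (nhds x)"
    using flow_add_near[OF x, of s t] by eventually_elim simp
  from tdiff_cong(2)[OF c(1) this] show ?thesis unfolding Dflow_def[of _ _ "s + t"] by (simp add: c(2))
qed

lemma Dflow_zero:
  assumes x: "x \<in> \<Lambda>"
  shows "D 0 x v = v"
proof -
  have xM: "x \<in> Mi" using x Lambda_interior by blast
  have "eventually (\<lambda>y. y \<in> Mi) (nhds x)" by (rule eventually_nhds_in_open[OF open_Mi xM])
  then have "eventually (\<lambda>y. y = \<phi> 0 y) (nhds x)" by eventually_elim (simp add: flow_zero)
  from tdiff_cong(2)[OF tangent_map_id(1)[OF xM] this] show ?thesis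
    unfolding Dflow_def using tangent_map_id(2)[OF xM] by simp
qed

lemma Dflow_inverse: "x \<in> \<Lambda> \<Longrightarrow> D (- t) (\<phi> t x) (D t x v) = v"
  using Dflow_add[of x "- t" t] Dflow_zero by simp

lemma flow_inverse: "x \<in> \<Lambda> \<Longrightarrow> \<phi> (- t) (\<phi> t x) = x" "x \<in> \<Lambda> \<Longrightarrow> \<phi> t (\<phi> (- t) x) = x"
  using flow_add[of x "- t" t] flow_add[of x t "- t"] flow_zero Lambda_interior by auto

lemma Dflow_inverse': "x \<in> \<Lambda> \<Longrightarrow> D t x (D (- t) (\<phi> t x) v) = v"
  using Dflow_add[OF flow_Lambda, of x t "- t" t v] Dflow_zero[OF flow_Lambda] flow_inverse[of x t] by simp

lemma tlim_box:
  assumes b: "flow_box x0 N d W" and x: "x \<in> N" and t: "\<bar>t\<bar> < d"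
    and \<tau>: "(\<tau> \<longlongrightarrow> t) G" and lim: "tlim G \<xi> \<nu> x v"
  shows "tlim G (\<lambda>n. \<phi> (\<tau> n) (\<xi> n)) (\<lambda>n. D (\<tau> n) (\<xi> n) (\<nu> n)) (\<phi> t x) (D t x v)"
proof -
  let ?c = "ca x0"
  have xi: "(\<xi> \<longlongrightarrow> x) G" by (rule tlimD[OF lim])
  have tI: "t \<in> {-d..d}" using t by auto
  have evN: "eventually (\<lambda>n. \<xi> n \<in> N) G" using topological_tendstoD[OF xi flow_boxD(1)[OF b] x] .
  have "eventually (\<lambda>n. \<tau> n \<in> {-d<..<d}) G" by (rule topological_tendstoD[OF \<tau>]) (use t in auto)
  then have evt: "eventually (\<lambda>n. \<tau> n \<in> {-d..d}) G" by eventually_elim auto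
  have ev: "eventually (\<lambda>n. (\<tau> n, \<xi> n) \<in> {-d..d} \<times> N) G" using evN evt by eventually_elim auto
  have pair: "((\<lambda>n. (\<tau> n, \<xi> n)) \<longlongrightarrow> (t, x)) G" by (intro tendsto_Pair \<tau> xi)
  have px: "(t, x) \<in> {-d..d} \<times> N" using tI x by blast
  have fl: "((\<lambda>n. \<phi> (\<tau> n) (\<xi> n)) \<longlongrightarrow> \<phi> t x) G"
    using continuous_on_tendsto_compose[OF flow_boxD(7)[OF b] pair px ev] by simp
  have xc: "x \<in> fst ?c" "x \<in> Mi" using flow_boxD(2)[OF b] x by auto
  have fc: "\<phi> t x \<in> fst ?c" "\<phi> t x \<in> Mi" using flow_boxD(6)[OF b x tI] by auto
  have lin: "linear (W s y)" if "y \<in> N" "s \<in> {-d..d}" for s y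
    using flow_boxD(8)[OF b that] has_derivative_linear by blast
  have W: "((\<lambda>n. W (\<tau> n) (\<xi> n) (T (ca (\<xi> n)) ?c (\<xi> n) (\<nu> n))) \<longlongrightarrow> W t x (T (ca x) ?c x v)) G"
  proof (rule linear_tendsto[OF _ lin[OF x tI] _ tlimD(2)[OF lim chart_at(1) xc(1)]])
    show "eventually (\<lambda>n. linear (W (\<tau> n) (\<xi> n))) G" using evN evt by eventually_elim (rule lin)
    show "((\<lambda>n. W (\<tau> n) (\<xi> n) v) \<longlongrightarrow> W t x v) G" for v
      using continuous_on_tendsto_compose[OF flow_boxD(9)[OF b] pair px ev, of v] by simp
  qed
  have red: "T (ca (\<phi> s y)) ?c (\<phi> s y) (D s y w) = W s y (T (ca y) ?c y w)" if "y \<in> N" "s \<in> {-d..d}" for s y w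
    unfolding Dflow_box(2)[OF b that]
    by (rule T_inverse[OF chart_at(1) chart_at(1) _ chart_at(2)]) (use flow_boxD(6)[OF b that] in auto)
  show ?thesis
  proof (rule tlimI[OF fc(2) chart_at(1) fc(1) fl])
    have "eventually (\<lambda>n. W (\<tau> n) (\<xi> n) (T (ca (\<xi> n)) ?c (\<xi> n) (\<nu> n)) =
        T (ca (\<phi> (\<tau> n) (\<xi> n))) ?c (\<phi> (\<tau> n) (\<xi> n)) (D (\<tau> n) (\<xi> n) (\<nu> n))) G"
      using evN evt by eventually_elim (simp add: red)
    from Lim_transform_eventually[OF W this]
    show "((\<lambda>n. T (ca (\<phi> (\<tau> n) (\<xi> n))) ?c (\<phi> (\<tau> n) (\<xi> n)) (D (\<tau> n) (\<xi> n) (\<nu> n))) \<longlongrightarrow>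
        T (ca (\<phi> t x)) ?c (\<phi> t x) (D t x v)) G"
      unfolding red[OF x tI] .
  qed
qed

text \<open>Boxes give the claim for short times. Only the limiting time \<open>t\<close> is cut
  into short steps; the moving remainder \<open>\<tau> n - t\<close> tends to 0 and goes into one
  final box.\<close>

theorem tlim_flow:
  assumes x: "x \<in> \<Lambda>" and ev: "eventually (\<lambda>n. \<xi> n \<in> \<Lambda>) G"
    and \<tau>: "(\<tau> \<longlongrightarrow> t) G" and lim: "tlim G \<xi> \<nu> x v"
  shows "tlim G (\<lambda>n. \<phi> (\<tau> n) (\<xi> n)) (\<lambda>n. D (\<tau> n) (\<xi> n) (\<nu> n)) (\<phi> t x) (D t x v)"
proof -
  obtain d0 where d0: "0 < d0" "\<And>x. x \<in> \<Lambda> \<Longrightarrow> \<exists>x0 N d W. flow_box x0 N d W \<and> x \<in> N \<and> d0 \<le> d"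
    by (rule uniform_flow_box) (rule that)
  have cong: "tlim G \<xi>' \<nu>' x v"
    if l: "tlim G \<xi> \<nu> x v" and e: "eventually (\<lambda>n. \<xi> n = \<xi>' n \<and> \<nu> n = \<nu>' n) G" for \<xi> \<xi>' \<nu> \<nu>' x v
    unfolding tlim_def
  proof (intro conjI ballI impI)
    have "eventually (\<lambda>n. \<xi> n = \<xi>' n) G" using e by eventually_elim simp
    then show "(\<xi>' \<longlongrightarrow> x) G" by (rule Lim_transform_eventually[OF tlimD(1)[OF l]])
    fix c assume c: "c \<in> A" "x \<in> fst c"
    have "eventually (\<lambda>n. T (ca (\<xi> n)) c (\<xi> n) (\<nu> n) = T (ca (\<xi>' n)) c (\<xi>' n) (\<nu>' n)) G"
      using e by eventually_elim simp
    then show "((\<lambda>n. T (ca (\<xi>' n)) c (\<xi>' n) (\<nu>' n)) \<longlongrightarrow> T (ca x) c x v) G"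
      by (rule Lim_transform_eventually[OF tlimD(2)[OF l c]])
  qed
  have small: "tlim G (\<lambda>n. \<phi> (\<tau> n) (\<xi> n)) (\<lambda>n. D (\<tau> n) (\<xi> n) (\<nu> n)) (\<phi> s x) (D s x v)"
    if s: "\<bar>s\<bar> < d0" and x: "x \<in> \<Lambda>" and lim: "(\<tau> \<longlongrightarrow> s) G" "tlim G \<xi> \<nu> x v" for s x \<tau> \<xi> \<nu> v
  proof -
    obtain x0 N d W where b: "flow_box x0 N d W" "x \<in> N" "d0 \<le> d" using d0(2)[OF x] by blast
    show ?thesis by (rule tlim_box[OF b(1,2) _ lim]) (use s b(3) in simp)
  qed
  obtain k :: nat where k: "\<bar>t\<bar> < real k * d0" using ex_less_of_nat_mult[OF d0(1)] by blast
  then have k0: "0 < real k" using d0(1) by (cases k) auto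
  define s where "s = t / real k"
  have s: "\<bar>s\<bar> < d0" using k k0 by (simp add: s_def field_simps)
  have iter: "tlim G (\<lambda>n. \<phi> (real j * s) (\<xi> n)) (\<lambda>n. D (real j * s) (\<xi> n) (\<nu> n)) (\<phi> (real j * s) x) (D (real j * s) x v)" for j
  proof (induction j)
    case 0
    show ?case using small[OF _ x tendsto_const lim, of 0] d0 by simp
  next
    case (Suc j)
    have e: "\<phi> s (\<phi> (real j * s) y) = \<phi> (real (Suc j) * s) y"
      "D s (\<phi> (real j * s) y) (D (real j * s) y w) = D (real (Suc j) * s) y w" if "y \<in> \<Lambda>" for y w
      using flow_add[OF that, of s "real j * s"] Dflow_add[OF that, of s "real j * s" w]
      by (simp_all add: algebra_simps)
    show ?case
      unfolding e[OF x, symmetric]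
      by (rule cong[OF small[OF s flow_Lambda[OF x] tendsto_const Suc]])
        (use ev in \<open>eventually_elim, simp add: e\<close>)
  qed
  have t: "real k * s = t" using k0 by (simp add: s_def)
  have "((\<lambda>n. \<tau> n - t) \<longlongrightarrow> 0) G" using tendsto_diff[OF \<tau> tendsto_const, of t] by simp
  from small[OF _ flow_Lambda[OF x] this iter[of k, unfolded t]] d0
  have "tlim G (\<lambda>n. \<phi> (\<tau> n - t) (\<phi> t (\<xi> n))) (\<lambda>n. D (\<tau> n - t) (\<phi> t (\<xi> n)) (D t (\<xi> n) (\<nu> n)))
      (\<phi> 0 (\<phi> t x)) (D 0 (\<phi> t x) (D t x v))" by simp
  then have "tlim G (\<lambda>n. \<phi> (\<tau> n - t) (\<phi> t (\<xi> n))) (\<lambda>n. D (\<tau> n - t) (\<phi> t (\<xi> n)) (D t (\<xi> n) (\<nu> n)))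
      (\<phi> t x) (D t x v)"
    using flow_add[OF x, of 0 t] Dflow_add[OF x, of 0 t v] by simp
  then show ?thesis
  proof (rule cong)
    show "eventually (\<lambda>n. \<phi> (\<tau> n - t) (\<phi> t (\<xi> n)) = \<phi> (\<tau> n) (\<xi> n) \<and>
        D (\<tau> n - t) (\<phi> t (\<xi> n)) (D t (\<xi> n) (\<nu> n)) = D (\<tau> n) (\<xi> n) (\<nu> n)) G"
      using ev
    proof eventually_elim
      case (elim n)
      then show ?case
        using flow_add[OF elim, of "\<tau> n - t" t] Dflow_add[OF elim, of "\<tau> n - t" t "\<nu> n"] by simp
    qed
  qed
qed

end

section \<open>Continuity of the splitting\<close>

lemma tendsto_det:
  fixes M :: "'b \<Rightarrow> real ^ 'n ^ 'n::finite"
  assumes "\<And>i j. ((\<lambda>n. M n $ i $ j) \<longlongrightarrow> M0 $ i $ j) G"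
  shows "((\<lambda>n. det (M n)) \<longlongrightarrow> det M0) G"
  unfolding det_def by (intro tendsto_intros assms)

lemma ext_map_tendsto:
  fixes L :: "'b \<Rightarrow> real ^ 'n::finite \<Rightarrow> real ^ 'n" and w :: "'b \<Rightarrow> real ^ ('p::finite \<Rightarrow> 'n)"
  assumes lim: "\<And>b. ((\<lambda>n. L n b) \<longlongrightarrow> L0 b) G" and w: "(w \<longlongrightarrow> w0) G"
  shows "((\<lambda>n. ext_map (L n) (w n)) \<longlongrightarrow> ext_map L0 w0) G"
proof (rule vec_tendstoI)
  fix i :: "'p \<Rightarrow> 'n"
  have m: "((\<lambda>n. matrix (L n) $ k $ l) \<longlongrightarrow> matrix L0 $ k $ l) G" for k l
    using tendsto_vec_nth[OF lim[of "axis l 1"], of k] by (simp add: matrix_def)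
  show "((\<lambda>n. ext_map (L n) (w n) $ i) \<longlongrightarrow> ext_map L0 w0 $ i) G"
    by (simp add: ext_map_def) (intro tendsto_sum tendsto_mult tendsto_prod tendsto_vec_nth[OF w] m)
qed

lemma antisym_project_tendsto:
  fixes P :: "'b \<Rightarrow> real ^ 'n::finite \<Rightarrow> real ^ 'n" and w :: "'b \<Rightarrow> real ^ ('p::finite \<Rightarrow> 'n)"
  assumes lim: "\<And>b. ((\<lambda>n. P n b) \<longlongrightarrow> P0 b) G" and w: "(w \<longlongrightarrow> w0) G"
  shows "((\<lambda>n. antisym_project (P n) (w n)) \<longlongrightarrow> antisym_project P0 w0) G"
proof -
  have "((\<lambda>n. wedge (\<lambda>a. P n (axis (i a) 1))) \<longlongrightarrow> wedge (\<lambda>a. P0 (axis (i a) 1))) G" for i :: "'p \<Rightarrow> 'n"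
    unfolding wedge_def by (intro tendsto_vec_lambda tendsto_det) (simp add: tendsto_vec_nth[OF lim])
  then show ?thesis
    unfolding antisym_project_def by (intro tendsto_intros tendsto_vec_nth[OF w])
qed

lemma ext_norm_ext_map:
  fixes w :: "real ^ ('p::finite \<Rightarrow> 'n::finite)"
  assumes G: "inner_form G" and L: "linear L"
  shows "ext_norm G (ext_map L w) = ext_norm (\<lambda>u v. G (L u) (L v)) w"
proof -
  obtain B C :: "real ^ 'n \<Rightarrow> real ^ 'n" where B: "linear B" "\<And>u v. G u v = B u \<bullet> B v"
    by (rule inner_form_isometry[OF G]) (rule that, assumption+)
  have "linear (\<lambda>v. B (L v))" using linear_compose[OF L B(1)] by (simp add: comp_def)
  then show ?thesis
    by (simp add: ext_norm_eq[OF B] ext_norm_eq[of "\<lambda>v. B (L v)"] B(2) ext_map_comp[OF B(1) L])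
qed

lemma ext_norm_tendsto:
  fixes w :: "'b \<Rightarrow> real ^ ('p::finite \<Rightarrow> 'n::finite)"
  assumes lim: "\<And>a b. ((\<lambda>n. G n a b) \<longlongrightarrow> G0 a b) F" and w: "(w \<longlongrightarrow> w0) F"
  shows "((\<lambda>n. ext_norm (G n) (w n)) \<longlongrightarrow> ext_norm G0 w0) F"
  unfolding ext_norm_def by (intro tendsto_intros tendsto_vec_nth[OF w] lim) simp

locale flow_splitting = flow_setup A g X \<Lambda>
  for A :: "('m::{t2_space, second_countable_topology}, 'n::finite) chart set"
    and g :: "('m, 'n) metric_field"
    and X :: "('m, 'n) vector_field"
    and \<Lambda> :: "'m set" +
  fixes E F :: "'m \<Rightarrow> (real ^ 'n) set"
  assumes splitting: "continuous_invariant_splitting A X \<Lambda> E F"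
begin

lemma in_Mi: "x \<in> \<Lambda> \<Longrightarrow> x \<in> Mi"
  using Lambda_interior by blast

lemma
  assumes "x \<in> \<Lambda>"
  shows subspace_E: "subspace (E x)" and subspace_F: "subspace (F x)"
    and E_nonzero: "E x \<noteq> {0}" and F_nonzero: "F x \<noteq> {0}"
    and E_F: "E x \<inter> F x = {0}" and E_plus_F: "\<exists>a\<in>E x. \<exists>b\<in>F x. v = a + b"
    and D_E: "D t x ` E x = E (\<phi> t x)" and D_F: "D t x ` F x = F (\<phi> t x)"
proof -
  note * = splitting[unfolded continuous_invariant_splitting_def]
  show "subspace (E x)" "subspace (F x)"
    using *[THEN conjunct1] *[THEN conjunct2, THEN conjunct1] assms unfolding continuous_subbundle_def by simp_all
  have "E x \<noteq> {0} \<and> F x \<noteq> {0} \<and> E x \<inter> F x = {0} \<and> (\<forall>v. \<exists>a\<in>E x. \<exists>b\<in>F x. v = a + b)"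
    using *[THEN conjunct2, THEN conjunct2, THEN conjunct1] assms by (rule bspec)
  then show "E x \<noteq> {0}" "F x \<noteq> {0}" "E x \<inter> F x = {0}" "\<exists>a\<in>E x. \<exists>b\<in>F x. v = a + b" by simp_all
  show "D t x ` E x = E (\<phi> t x)" "D t x ` F x = F (\<phi> t x)"
    using *[THEN conjunct2, THEN conjunct2, THEN conjunct2] assms by simp_all
qed

text \<open>The projection onto \<open>F x\<close> along \<open>E x\<close>. It turns membership in
  \<open>E x\<close> and in \<open>F x\<close> into the equations \<open>PF x v = 0\<close> and
  \<open>PF x v = v\<close>, which pass to limits.\<close>

definition PF :: "'m \<Rightarrow> real ^ 'n \<Rightarrow> real ^ 'n" where
  "PF x v = (THE b. b \<in> F x \<and> v - b \<in> E x)"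

lemma PF_eqI:
  assumes x: "x \<in> \<Lambda>" and b: "b \<in> F x" "v - b \<in> E x"
  shows "PF x v = b"
  unfolding PF_def
proof (rule the_equality)
  fix b' assume b': "b' \<in> F x \<and> v - b' \<in> E x"
  have "(v - b) - (v - b') \<in> E x" using b b' subspace_E[OF x] subspace_diff by blast
  moreover have "b' - b \<in> F x" using b b' subspace_F[OF x] subspace_diff by blast
  ultimately have "b' - b \<in> E x \<inter> F x" by simp
  then show "b' = b" using E_F[OF x] by simp
qed (use b in simp)

lemma PF_in:
  assumes x: "x \<in> \<Lambda>"
  shows "PF x v \<in> F x" "v - PF x v \<in> E x"
proof -
  obtain a b where ab: "a \<in> E x" "b \<in> F x" "v = a + b" using E_plus_F[OF x] by blast
  then have "PF x v = b" by (intro PF_eqI[OF x]) auto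
  then show "PF x v \<in> F x" "v - PF x v \<in> E x" using ab by auto
qed

lemma PF_F: "x \<in> \<Lambda> \<Longrightarrow> v \<in> F x \<Longrightarrow> PF x v = v"
  by (rule PF_eqI) (auto simp: subspace_0 subspace_E)

lemma PF_E: "x \<in> \<Lambda> \<Longrightarrow> v \<in> E x \<longleftrightarrow> PF x v = 0"
  using PF_eqI[of x 0 v] PF_in(2)[of x v] subspace_0[OF subspace_F, of x] by auto

lemma PF_F_iff: "x \<in> \<Lambda> \<Longrightarrow> v \<in> F x \<longleftrightarrow> PF x v = v"
  using PF_F PF_in(1) by metis

lemma PF_linear:
  assumes x: "x \<in> \<Lambda>"
  shows "linear (PF x)"
proof (rule linearI)
  fix u v c
  have "(u + v) - (PF x u + PF x v) = (u - PF x u) + (v - PF x v)" by simp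
  then have "(u + v) - (PF x u + PF x v) \<in> E x"
    using PF_in(2)[OF x] subspace_add[OF subspace_E[OF x]] by presburger
  then show "PF x (u + v) = PF x u + PF x v"
    by (intro PF_eqI[OF x] subspace_add[OF subspace_F[OF x]] PF_in(1)[OF x])
  have "c *\<^sub>R v - c *\<^sub>R PF x v = c *\<^sub>R (v - PF x v)" by (simp add: scaleR_diff_right)
  then have "c *\<^sub>R v - c *\<^sub>R PF x v \<in> E x"
    using PF_in(2)[OF x] subspace_scale[OF subspace_E[OF x]] by presburger
  then show "PF x (c *\<^sub>R v) = c *\<^sub>R PF x v"
    by (intro PF_eqI[OF x] subspace_scale[OF subspace_F[OF x]] PF_in(1)[OF x])
qed

lemma span_image_lessThan:
  fixes h :: "nat \<Rightarrow> real ^ 'n"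
  assumes "v \<in> span (h ` {..<k})"
  shows "\<exists>\<alpha>. v = (\<Sum>i<k. \<alpha> i *\<^sub>R h i)"
  using assms
proof (induction v rule: span_induct_alt)
  case base
  show ?case by (rule exI[of _ "\<lambda>_. 0"]) simp
next
  case (step c x y)
  then obtain \<alpha> i where *: "y = (\<Sum>i<k. \<alpha> i *\<^sub>R h i)" "i < k" "x = h i" by blast
  have "(\<alpha> j + (if j = i then c else 0)) *\<^sub>R h j = \<alpha> j *\<^sub>R h j + (if j = i then c *\<^sub>R h i else 0)" for j
    by (simp add: scaleR_add_left)
  then have "c *\<^sub>R x + y = (\<Sum>j<k. (\<alpha> j + (if j = i then c else 0)) *\<^sub>R h j)"
    using * by (simp add: sum.distrib)
  then show ?case by (rule exI[of _ "\<lambda>j. \<alpha> j + (if j = i then c else 0)"])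
qed

lemma subbundle_frame:
  assumes S: "continuous_subbundle A \<Lambda> S" and x: "x \<in> \<Lambda>"
  obtains U k and e :: "nat \<Rightarrow> 'm \<Rightarrow> real ^ 'n" where "open U" "x \<in> U" "U \<subseteq> fst (ca x)"
    "\<And>i. i < k \<Longrightarrow> continuous_on (U \<inter> \<Lambda>) (e i)"
    "\<And>y. y \<in> U \<inter> \<Lambda> \<Longrightarrow> inj_on (\<lambda>i. e i y) {..<k} \<and> independent ((\<lambda>i. e i y) ` {..<k}) \<and>
      span ((\<lambda>i. e i y) ` {..<k}) = T (ca y) (ca x) y ` S y"
proof -
  obtain U k and e :: "nat \<Rightarrow> 'm \<Rightarrow> real ^ 'n" where *: "open U \<and> x \<in> U \<and> U \<subseteq> fst (ca x) \<and>
        (\<forall>i<k. continuous_on (U \<inter> \<Lambda>) (e i)) \<and>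
        (\<forall>y\<in>U \<inter> \<Lambda>. inj_on (\<lambda>i. e i y) {..<k} \<and> independent ((\<lambda>i. e i y) ` {..<k}) \<and>
           span ((\<lambda>i. e i y) ` {..<k}) = T (ca y) (ca x) y ` S y)"
    using bspec[OF conjunct2[OF S[unfolded continuous_subbundle_def]] x] by (elim exE) (rule that)
  show thesis by (rule that[of U k e]) (use * in simp_all)
qed

lemma eventually_in_chart_Mi:
  assumes "(\<xi> \<longlongrightarrow> x) G" "c \<in> A" "x \<in> fst c" "x \<in> Mi"
  shows "eventually (\<lambda>n. \<xi> n \<in> fst c \<inter> Mi) G"
  by (rule topological_tendstoD[OF assms(1) open_Int[OF chart_open[OF assms(2)] open_Mi]])
    (use assms in simp)

text \<open>Local frames of \<open>E\<close> and \<open>F\<close> together form a continuous basis.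
  Cramer's rule writes the coordinates of a vector in it as quotients of determinants, hence
  continuously, and \<open>PF\<close> keeps the coordinates belonging to \<open>F\<close>.\<close>

lemma tlim_PF:
  assumes x: "x \<in> \<Lambda>" and ev: "eventually (\<lambda>n. \<xi> n \<in> \<Lambda>) G" and lim: "tlim G \<xi> \<nu> x v"
  shows "tlim G \<xi> (\<lambda>n. PF (\<xi> n) (\<nu> n)) x (PF x v)"
proof -
  let ?c = "ca x"
  define Tx where "Tx y = T (ca y) ?c y" for y
  note xM = in_Mi[OF x]
  have sub: "continuous_subbundle A \<Lambda> E" "continuous_subbundle A \<Lambda> F"
    using splitting unfolding continuous_invariant_splitting_def by simp_all
  obtain U1 k and e :: "nat \<Rightarrow> 'm \<Rightarrow> real ^ 'n" where e: "open U1" "x \<in> U1" "U1 \<subseteq> fst ?c"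
    "\<And>i. i < k \<Longrightarrow> continuous_on (U1 \<inter> \<Lambda>) (e i)"
    "\<And>y. y \<in> U1 \<inter> \<Lambda> \<Longrightarrow> inj_on (\<lambda>i. e i y) {..<k} \<and> independent ((\<lambda>i. e i y) ` {..<k}) \<and>
      span ((\<lambda>i. e i y) ` {..<k}) = T (ca y) ?c y ` E y"
    by (rule subbundle_frame[OF sub(1) x]) (rule that, assumption+)
  obtain U2 l and f :: "nat \<Rightarrow> 'm \<Rightarrow> real ^ 'n" where f: "open U2" "x \<in> U2" "U2 \<subseteq> fst ?c"
    "\<And>i. i < l \<Longrightarrow> continuous_on (U2 \<inter> \<Lambda>) (f i)"
    "\<And>y. y \<in> U2 \<inter> \<Lambda> \<Longrightarrow> inj_on (\<lambda>i. f i y) {..<l} \<and> independent ((\<lambda>i. f i y) ` {..<l}) \<and>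
      span ((\<lambda>i. f i y) ` {..<l}) = T (ca y) ?c y ` F y"
    by (rule subbundle_frame[OF sub(2) x]) (rule that, assumption+)
  note e = e[folded Tx_def] and f = f[folded Tx_def]
  define U where "U = U1 \<inter> U2 \<inter> \<Lambda>"
  have xU: "x \<in> U" using e f x by (simp add: U_def)
  have Uc: "y \<in> fst ?c" "y \<in> \<Lambda>" "y \<in> Mi" if "y \<in> U" for y using that e(3) in_Mi by (auto simp: U_def)
  have evU: "eventually (\<lambda>n. \<xi> n \<in> U) G"
    using topological_tendstoD[OF tlimD(1)[OF lim] e(1,2)] topological_tendstoD[OF tlimD(1)[OF lim] f(1,2)] ev
    by eventually_elim (simp add: U_def)
  have Tlin: "linear (Tx y)" if "y \<in> U" for y
    unfolding Tx_def by (rule T_linear[OF chart_at(1) chart_at(1) chart_at(2)]) (use Uc[OF that] in auto)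
  have Tsurj: "\<exists>v. u = Tx y v" if "y \<in> U" for y u
    unfolding Tx_def
    using T_inverse[OF chart_at(1) chart_at(1) Uc(1)[OF that] chart_at(2) Uc(3)[OF that], of u] by metis
  have Txx: "Tx x v = v" for v unfolding Tx_def by (rule T_id[OF chart_at xM])
  have dims: "k + l = CARD('n)"
  proof -
    have "dim (E x) = k" "dim (F x) = l"
    proof -
      have "E x = span ((\<lambda>i. e i x) ` {..<k})" using e(5)[of x] e(2) x by (simp add: Txx)
      then show "dim (E x) = k"
        using e(5)[of x] e(2) x dim_span_eq_card_independent[of "(\<lambda>i. e i x) ` {..<k}"] by (simp add: card_image)
      have "F x = span ((\<lambda>i. f i x) ` {..<l})" using f(5)[of x] f(2) x by (simp add: Txx)
      then show "dim (F x) = l"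
        using f(5)[of x] f(2) x dim_span_eq_card_independent[of "(\<lambda>i. f i x) ` {..<l}"] by (simp add: card_image)
    qed
    moreover have "{a + b |a b. a \<in> E x \<and> b \<in> F x} = UNIV" using E_plus_F[OF x] by blast
    ultimately have "dim (UNIV :: (real ^ 'n) set) = k + l"
      using dim_sums_Int[OF subspace_E[OF x] subspace_F[OF x]] E_F[OF x] by simp
    then show ?thesis by simp
  qed
  have "card (UNIV :: 'n set) = card {..<k + l}" using dims by simp
  from finite_same_card_bij[OF finite_class.finite_UNIV finite_lessThan this]
  \<comment> \<open>The numbering makes the first \<open>k\<close> columns of \<open>M\<close> the
    frame of \<open>E\<close> and the other \<open>l\<close> columns the frame of
    \<open>F\<close>.\<close>
  obtain idx :: "'n \<Rightarrow> nat" where idx: "bij_betw idx UNIV {..<k + l}" by (elim exE) (rule that)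
  define col where "col j y = (if idx j < k then e (idx j) y else f (idx j - k) y)" for j y
  define M where "M y = (\<chi> i j. col j y $ i)" for y
  define R where "R y w = (\<Sum>j\<in>UNIV. (if idx j < k then 0 else w $ j) *\<^sub>R col j y)" for y and w :: "real ^ 'n"
  have Mv: "M y *v w = (\<Sum>j\<in>UNIV. w $ j *\<^sub>R col j y)" for y w
    by (simp add: M_def matrix_vector_mult_def vec_eq_iff mult.commute)
  have rep: "\<exists>w. M y *v w = Tx y v \<and> R y w = Tx y (PF y v)" if y: "y \<in> U" for y v
  proof -
    have "Tx y (v - PF y v) \<in> span ((\<lambda>i. e i y) ` {..<k})"
      using e(5)[of y] y PF_in(2)[OF Uc(2)[OF y]] by (auto simp: U_def)
    then obtain \<alpha> where \<alpha>: "Tx y (v - PF y v) = (\<Sum>i<k. \<alpha> i *\<^sub>R e i y)" using span_image_lessThan by blast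
    have "Tx y (PF y v) \<in> span ((\<lambda>i. f i y) ` {..<l})"
      using f(5)[of y] y PF_in(1)[OF Uc(2)[OF y]] by (auto simp: U_def)
    then obtain \<beta> where \<beta>: "Tx y (PF y v) = (\<Sum>i<l. \<beta> i *\<^sub>R f i y)" using span_image_lessThan by blast
    define w :: "real ^ 'n" where "w = (\<chi> j. if idx j < k then \<alpha> (idx j) else \<beta> (idx j - k))"
    have split: "(\<Sum>i<k + l. h i) = (\<Sum>i<k. h i) + (\<Sum>i<l. h (k + i))" for h :: "nat \<Rightarrow> real ^ 'n"
      by (induction l) (auto simp: add.assoc)
    have "R y w = (\<Sum>j\<in>UNIV. (\<lambda>i. if i < k then 0 else \<beta> (i - k) *\<^sub>R f (i - k) y) (idx j))"
      unfolding R_def by (intro sum.cong) (auto simp: w_def col_def)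
    also have "\<dots> = (\<Sum>i<k + l. if i < k then 0 else \<beta> (i - k) *\<^sub>R f (i - k) y)"
      by (rule sum.reindex_bij_betw[OF idx])
    also have "\<dots> = Tx y (PF y v)" unfolding split \<beta> by simp
    finally have 1: "R y w = Tx y (PF y v)" .
    have "M y *v w = (\<Sum>j\<in>UNIV. (\<lambda>i. if i < k then \<alpha> i *\<^sub>R e i y else \<beta> (i - k) *\<^sub>R f (i - k) y) (idx j))"
      unfolding Mv by (intro sum.cong) (auto simp: w_def col_def)
    also have "\<dots> = (\<Sum>i<k + l. if i < k then \<alpha> i *\<^sub>R e i y else \<beta> (i - k) *\<^sub>R f (i - k) y)"
      by (rule sum.reindex_bij_betw[OF idx])
    also have "\<dots> = Tx y (v - PF y v) + Tx y (PF y v)" unfolding split \<alpha> \<beta> by simp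
    also have "\<dots> = Tx y v" using linear_add[OF Tlin[OF y], of "v - PF y v" "PF y v"] by simp
    finally show ?thesis using 1 by blast
  qed
  have det: "det (M y) \<noteq> 0" if y: "y \<in> U" for y
  proof -
    have "surj (\<lambda>w. M y *v w)"
      unfolding surj_def
    proof
      fix u
      obtain v where v: "u = Tx y v" using Tsurj[OF y] by blast
      obtain w where "M y *v w = Tx y v" using rep[OF y, of v] by blast
      then show "\<exists>w. u = M y *v w" unfolding v by (intro exI[of _ w]) simp
    qed
    then have "invertible (M y)"
      using matrix_right_invertible_surjective[of "M y"] invertible_right_inverse[of "M y"] by blast
    then show ?thesis by (simp add: invertible_det_nz)
  qed
  define sol where "sol y b = (\<chi> j. det (\<chi> i j'. if j' = j then b $ i else M y $ i $ j') / det (M y))" for y b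
  have PFsol: "Tx y (PF y v) = R y (sol y (Tx y v))" if y: "y \<in> U" for y v
  proof -
    obtain w where w: "M y *v w = Tx y v" "R y w = Tx y (PF y v)" using rep[OF y] by blast
    then have "w = sol y (Tx y v)" using cramer[OF det[OF y], of w "Tx y v"] by (simp add: sol_def)
    then show ?thesis using w by simp
  qed
  have col: "((\<lambda>n. col j (\<xi> n)) \<longlongrightarrow> col j x) G" for j
  proof -
    have "idx j < k + l" using idx by (auto simp: bij_betw_def)
    then have "continuous_on U (col j)"
      unfolding col_def U_def
      by (cases "idx j < k") (auto intro!: continuous_on_subset[OF e(4)] continuous_on_subset[OF f(4)])
    from continuous_on_tendsto_compose[OF this tlimD(1)[OF lim] xU evU] show ?thesis .
  qed
  have Mlim: "((\<lambda>n. M (\<xi> n) $ i $ j) \<longlongrightarrow> M x $ i $ j) G" for i j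
    using tendsto_vec_nth[OF col] by (simp add: M_def)
  have Tlim: "((\<lambda>n. Tx (\<xi> n) (\<nu> n)) \<longlongrightarrow> Tx x v) G"
    unfolding Tx_def by (rule tlimD(2)[OF lim chart_at])
  have sollim: "((\<lambda>n. sol (\<xi> n) (Tx (\<xi> n) (\<nu> n))) \<longlongrightarrow> sol x (Tx x v)) G"
    unfolding sol_def
  proof (intro tendsto_vec_lambda tendsto_divide tendsto_det)
    show "((\<lambda>n. (\<chi> i j'. if j' = j then Tx (\<xi> n) (\<nu> n) $ i else M (\<xi> n) $ i $ j') $ i $ j') \<longlongrightarrow>
      (\<chi> i j'. if j' = j then Tx x v $ i else M x $ i $ j') $ i $ j') G" for j i j'
      using tendsto_vec_nth[OF Tlim] Mlim by simp
  qed (use Mlim det[OF xU] in auto)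
  have "((\<lambda>n. R (\<xi> n) (sol (\<xi> n) (Tx (\<xi> n) (\<nu> n)))) \<longlongrightarrow> R x (sol x (Tx x v))) G"
    unfolding R_def
  proof (intro tendsto_sum tendsto_scaleR col)
    show "((\<lambda>n. if idx j < k then 0 else sol (\<xi> n) (Tx (\<xi> n) (\<nu> n)) $ j) \<longlongrightarrow>
      (if idx j < k then 0 else sol x (Tx x v) $ j)) G" for j
      using tendsto_vec_nth[OF sollim] by simp
  qed
  then have "((\<lambda>n. R (\<xi> n) (sol (\<xi> n) (Tx (\<xi> n) (\<nu> n)))) \<longlongrightarrow> Tx x (PF x v)) G"
    using PFsol[OF xU, of v] by simp
  moreover have "eventually (\<lambda>n. R (\<xi> n) (sol (\<xi> n) (Tx (\<xi> n) (\<nu> n))) = Tx (\<xi> n) (PF (\<xi> n) (\<nu> n))) G"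
    using evU by eventually_elim (simp add: PFsol)
  ultimately have "((\<lambda>n. Tx (\<xi> n) (PF (\<xi> n) (\<nu> n))) \<longlongrightarrow> Tx x (PF x v)) G"
    by (rule Lim_transform_eventually)
  then show ?thesis
    unfolding Tx_def by (rule tlimI[OF xM chart_at tlimD(1)[OF lim]])
qed

lemma tlim_frame:
  assumes x: "x \<in> Mi" and c: "c \<in> A" "x \<in> fst c" and xi: "(\<xi> \<longlongrightarrow> x) G" and b: "(b \<longlongrightarrow> b0) G"
  shows "tlim G \<xi> (\<lambda>n. T c (ca (\<xi> n)) (\<xi> n) (b n)) x (T c (ca x) x b0)"
proof (rule tlimI[OF x c xi])
  have "eventually (\<lambda>n. \<xi> n \<in> fst c \<inter> Mi) G" by (rule eventually_in_chart_Mi[OF xi c x])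
  then have "eventually (\<lambda>n. b n = T (ca (\<xi> n)) c (\<xi> n) (T c (ca (\<xi> n)) (\<xi> n) (b n))) G"
    by eventually_elim (use T_inverse[OF c(1) chart_at(1) _ chart_at(2)] in auto)
  then show "((\<lambda>n. T (ca (\<xi> n)) c (\<xi> n) (T c (ca (\<xi> n)) (\<xi> n) (b n))) \<longlongrightarrow> T (ca x) c x (T c (ca x) x b0)) G"
    unfolding T_inverse[OF c(1) chart_at(1) c(2) chart_at(2) x]
    by (rule Lim_transform_eventually[OF b])
qed

text \<open>The counterpart of \<open>tlim\<close> for \<open>p\<close>-vectors, on which a change
  of chart acts by the exterior power of the transition derivative.\<close>

definition extlim :: "'b filter \<Rightarrow> ('b \<Rightarrow> 'm) \<Rightarrow> ('b \<Rightarrow> real ^ ('p::finite \<Rightarrow> 'n)) \<Rightarrow> 'm \<Rightarrow> real ^ ('p \<Rightarrow> 'n) \<Rightarrow> bool" where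
  "extlim G \<xi> \<omega> x w \<longleftrightarrow> (\<xi> \<longlongrightarrow> x) G \<and>
    (\<forall>c\<in>A. x \<in> fst c \<longrightarrow> ((\<lambda>n. ext_map (T (ca (\<xi> n)) c (\<xi> n)) (\<omega> n)) \<longlongrightarrow> ext_map (T (ca x) c x) w) G)"

lemma extlimD:
  assumes "extlim G \<xi> \<omega> x w"
  shows "(\<xi> \<longlongrightarrow> x) G"
    "c \<in> A \<Longrightarrow> x \<in> fst c \<Longrightarrow> ((\<lambda>n. ext_map (T (ca (\<xi> n)) c (\<xi> n)) (\<omega> n)) \<longlongrightarrow> ext_map (T (ca x) c x) w) G"
  using assms unfolding extlim_def by blast+

lemma ext_T_comp:
  assumes "c \<in> A" "d \<in> A" "e \<in> A" "x \<in> fst c" "x \<in> fst d" "x \<in> fst e" "x \<in> Mi"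
  shows "ext_map (T d e x) (ext_map (T c d x) w) = ext_map (T c e x) w"
proof -
  have "(\<lambda>v. T d e x (T c d x v)) = T c e x" using T_comp[OF assms] by (simp add: fun_eq_iff)
  then show ?thesis
    using ext_map_comp[OF T_linear[OF assms(2,3,5,6,7)] T_linear[OF assms(1,2,4,5,7)], of w] by simp
qed

lemma ext_T_inverse:
  assumes "c \<in> A" "d \<in> A" "x \<in> fst c" "x \<in> fst d" "x \<in> Mi"
  shows "ext_map (T d c x) (ext_map (T c d x) w) = w"
proof -
  have "(\<lambda>v. T c c x v) = (\<lambda>v. v)" using T_id[OF assms(1,3,5)] by (simp add: fun_eq_iff)
  then show ?thesis
    using ext_T_comp[OF assms(1,2,1,3,4,3,5), of w] ext_map_id[of w] by simp
qed

lemma extlimI: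
  assumes x: "x \<in> Mi" and c: "c \<in> A" "x \<in> fst c" and xi: "(\<xi> \<longlongrightarrow> x) G"
    and lim: "((\<lambda>n. ext_map (T (ca (\<xi> n)) c (\<xi> n)) (\<omega> n)) \<longlongrightarrow> ext_map (T (ca x) c x) w) G"
  shows "extlim G \<xi> \<omega> x w"
  unfolding extlim_def
proof (intro conjI ballI impI xi)
  fix d assume d: "d \<in> A" "x \<in> fst d"
  have "((\<lambda>n. ext_map (T c d (\<xi> n)) (ext_map (T (ca (\<xi> n)) c (\<xi> n)) (\<omega> n))) \<longlongrightarrow>
      ext_map (T c d x) (ext_map (T (ca x) c x) w)) G"
    by (rule ext_map_tendsto[OF T_tendsto[OF c(1) d(1) c(2) d(2) x xi tendsto_const] lim])
  then have "((\<lambda>n. ext_map (T c d (\<xi> n)) (ext_map (T (ca (\<xi> n)) c (\<xi> n)) (\<omega> n))) \<longlongrightarrow> ext_map (T (ca x) d x) w) G"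
    unfolding ext_T_comp[OF chart_at(1) c(1) d(1) chart_at(2) c(2) d(2) x] .
  moreover have "eventually (\<lambda>n. \<xi> n \<in> fst c \<inter> fst d \<inter> Mi) G"
    using eventually_in_chart_Mi[OF xi c x] eventually_in_chart_Mi[OF xi d x] by eventually_elim simp
  then have "eventually (\<lambda>n. ext_map (T c d (\<xi> n)) (ext_map (T (ca (\<xi> n)) c (\<xi> n)) (\<omega> n)) =
      ext_map (T (ca (\<xi> n)) d (\<xi> n)) (\<omega> n)) G"
    by eventually_elim (use ext_T_comp[OF chart_at(1) c(1) d(1) chart_at(2)] in auto)
  ultimately show "((\<lambda>n. ext_map (T (ca (\<xi> n)) d (\<xi> n)) (\<omega> n)) \<longlongrightarrow> ext_map (T (ca x) d x) w) G"
    by (rule Lim_transform_eventually)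
qed

lemma ext_norm_extlim:
  fixes w :: "real ^ ('p::finite \<Rightarrow> 'n)"
  assumes x: "x \<in> Mi" and lim: "extlim G \<xi> \<omega> x w"
  shows "((\<lambda>n. ext_norm (g (\<xi> n)) (\<omega> n)) \<longlongrightarrow> ext_norm (g x) w) G"
proof -
  let ?c = "ca x"
  note c = chart_at[of x]
  have xi: "(\<xi> \<longlongrightarrow> x) G" by (rule extlimD(1)[OF lim])
  have e: "ext_norm (g y) u = ext_norm (\<lambda>a b. g y (T ?c (ca y) y a) (T ?c (ca y) y b)) (ext_map (T (ca y) ?c y) u)"
    if "y \<in> fst ?c \<inter> Mi" for y and u :: "real ^ ('p \<Rightarrow> 'n)"
    using that ext_norm_ext_map[OF inner_form_metric T_linear[OF c(1) chart_at(1), of y y], where w="ext_map (T (ca y) ?c y) u"]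
      ext_T_inverse[OF chart_at(1) c(1) chart_at(2), of y u] chart_at(2)[of y] by auto
  have "((\<lambda>n. ext_norm (\<lambda>a b. g (\<xi> n) (T ?c (ca (\<xi> n)) (\<xi> n) a) (T ?c (ca (\<xi> n)) (\<xi> n) b))
        (ext_map (T (ca (\<xi> n)) ?c (\<xi> n)) (\<omega> n))) \<longlongrightarrow>
      ext_norm (\<lambda>a b. g x (T ?c (ca x) x a) (T ?c (ca x) x b)) (ext_map (T (ca x) ?c x) w)) G"
    by (intro ext_norm_tendsto metric_tendsto[OF x] tlim_frame[OF x c xi] tendsto_const extlimD(2)[OF lim c])
  then have "((\<lambda>n. ext_norm (\<lambda>a b. g (\<xi> n) (T ?c (ca (\<xi> n)) (\<xi> n) a) (T ?c (ca (\<xi> n)) (\<xi> n) b))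
        (ext_map (T (ca (\<xi> n)) ?c (\<xi> n)) (\<omega> n))) \<longlongrightarrow> ext_norm (g x) w) G"
    using e[of x w] x c by simp
  moreover have "eventually (\<lambda>n. \<xi> n \<in> fst ?c \<inter> Mi) G" by (rule eventually_in_chart_Mi[OF xi c x])
  then have "eventually (\<lambda>n. ext_norm (\<lambda>a b. g (\<xi> n) (T ?c (ca (\<xi> n)) (\<xi> n) a) (T ?c (ca (\<xi> n)) (\<xi> n) b))
        (ext_map (T (ca (\<xi> n)) ?c (\<xi> n)) (\<omega> n)) = ext_norm (g (\<xi> n)) (\<omega> n)) G"
    by eventually_elim (rule e[symmetric])
  ultimately show ?thesis by (rule Lim_transform_eventually)
qed

lemma extlim_scaleR:
  assumes lim: "extlim G \<xi> \<omega> x w" and s: "(s \<longlongrightarrow> s0) G"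
  shows "extlim G \<xi> (\<lambda>n. s n *\<^sub>R \<omega> n) x (s0 *\<^sub>R w)"
  unfolding extlim_def ext_map_scaleR
  by (intro conjI ballI impI tendsto_scaleR s extlimD(1)[OF lim] extlimD(2)[OF lim])

lemma tlim_scaleR:
  assumes x: "x \<in> Mi" and lim: "tlim G \<xi> \<nu> x v" and s: "(s \<longlongrightarrow> s0) G"
  shows "tlim G \<xi> (\<lambda>n. s n *\<^sub>R \<nu> n) x (s0 *\<^sub>R v)"
proof (rule tlimI[OF x chart_at tlimD(1)[OF lim]])
  let ?c = "ca x"
  note c = chart_at[of x]
  have "eventually (\<lambda>n. \<xi> n \<in> fst ?c \<inter> Mi) G" by (rule eventually_in_chart_Mi[OF tlimD(1)[OF lim] c x])
  then have "eventually (\<lambda>n. s n *\<^sub>R T (ca (\<xi> n)) ?c (\<xi> n) (\<nu> n) = T (ca (\<xi> n)) ?c (\<xi> n) (s n *\<^sub>R \<nu> n)) G"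
    by eventually_elim (use linear_scale[OF T_linear[OF chart_at(1) c(1) chart_at(2)]] in auto)
  moreover have "((\<lambda>n. s n *\<^sub>R T (ca (\<xi> n)) ?c (\<xi> n) (\<nu> n)) \<longlongrightarrow> s0 *\<^sub>R T ?c ?c x v) G"
    by (intro tendsto_scaleR s tlimD(2)[OF lim c])
  then have "((\<lambda>n. s n *\<^sub>R T (ca (\<xi> n)) ?c (\<xi> n) (\<nu> n)) \<longlongrightarrow> T ?c ?c x (s0 *\<^sub>R v)) G"
    using linear_scale[OF T_linear[OF c(1) c(1) c(2) c(2) x]] by simp
  ultimately show "((\<lambda>n. T (ca (\<xi> n)) ?c (\<xi> n) (s n *\<^sub>R \<nu> n)) \<longlongrightarrow> T ?c ?c x (s0 *\<^sub>R v)) G"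
    by (rule Lim_transform_eventually[rotated])
qed

text \<open>Conjugated to fixed charts at \<open>x\<close> and at its image, \<open>D\<close>
  becomes a family of linear maps that converges on every fixed vector by \<open>tlim_flow\<close>.
  Exterior powers are polynomial in the matrix entries and converge with them.\<close>

lemma extlim_flow:
  fixes w :: "real ^ ('p::finite \<Rightarrow> 'n)"
  assumes x: "x \<in> \<Lambda>" and ev: "eventually (\<lambda>n. \<xi> n \<in> \<Lambda>) G"
    and \<tau>: "(\<tau> \<longlongrightarrow> t) G" and lim: "extlim G \<xi> \<omega> x w"
  shows "extlim G (\<lambda>n. \<phi> (\<tau> n) (\<xi> n)) (\<lambda>n. ext_map (D (\<tau> n) (\<xi> n)) (\<omega> n)) (\<phi> t x) (ext_map (D t x) w)"
proof -
  let ?c = "ca x" and ?d = "ca (\<phi> t x)"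
  note c = chart_at[of x] and d = chart_at[of "\<phi> t x"]
  note xM = in_Mi[OF x]
  note fM = in_Mi[OF flow_Lambda[OF x], of t]
  have xi: "(\<xi> \<longlongrightarrow> x) G" by (rule extlimD(1)[OF lim])
  define L where "L s y a = T (ca (\<phi> s y)) ?d (\<phi> s y) (D s y (T ?c (ca y) y a))" for s y a
  have tf: "tlim G (\<lambda>n. \<phi> (\<tau> n) (\<xi> n)) (\<lambda>n. D (\<tau> n) (\<xi> n) (T ?c (ca (\<xi> n)) (\<xi> n) b)) (\<phi> t x) (D t x (T ?c (ca x) x b))" for b
    by (rule tlim_flow[OF x ev \<tau> tlim_frame[OF xM c xi tendsto_const]])
  have fl: "((\<lambda>n. \<phi> (\<tau> n) (\<xi> n)) \<longlongrightarrow> \<phi> t x) G" by (rule tlimD(1)[OF tf])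
  have Ll: "((\<lambda>n. L (\<tau> n) (\<xi> n) b) \<longlongrightarrow> L t x b) G" for b
    unfolding L_def by (rule tlimD(2)[OF tf d])
  have eq: "ext_map (T (ca (\<phi> s y)) ?d (\<phi> s y)) (ext_map (D s y) u) = ext_map (L s y) (ext_map (T (ca y) ?c y) u)"
    if y: "y \<in> \<Lambda>" "y \<in> fst ?c" "\<phi> s y \<in> fst ?d" for s y and u :: "real ^ ('p \<Rightarrow> 'n)"
  proof -
    have yM: "y \<in> Mi" "\<phi> s y \<in> Mi" using in_Mi y flow_Lambda by auto
    have l1: "linear (T (ca (\<phi> s y)) ?d (\<phi> s y))" by (rule T_linear[OF chart_at(1) d(1) chart_at(2) y(3) yM(2)])
    have l2: "linear (D s y)" by (rule Dflow_linear[OF y(1)])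
    have l3: "linear (T ?c (ca y) y)" by (rule T_linear[OF c(1) chart_at(1) y(2) chart_at(2) yM(1)])
    have l12: "linear (\<lambda>v. T (ca (\<phi> s y)) ?d (\<phi> s y) (D s y v))" using linear_compose[OF l2 l1] by (simp add: comp_def)
    have "ext_map (L s y) (ext_map (T (ca y) ?c y) u) =
        ext_map (\<lambda>v. T (ca (\<phi> s y)) ?d (\<phi> s y) (D s y v)) (ext_map (T ?c (ca y) y) (ext_map (T (ca y) ?c y) u))"
      unfolding ext_map_comp[OF l12 l3] L_def by simp
    also have "\<dots> = ext_map (\<lambda>v. T (ca (\<phi> s y)) ?d (\<phi> s y) (D s y v)) u"
      unfolding ext_T_inverse[OF chart_at(1) c(1) chart_at(2) y(2) yM(1)] ..
    finally show ?thesis unfolding ext_map_comp[OF l1 l2] ..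
  qed
  show ?thesis
  proof (rule extlimI[OF fM d fl])
    have "((\<lambda>n. ext_map (L (\<tau> n) (\<xi> n)) (ext_map (T (ca (\<xi> n)) ?c (\<xi> n)) (\<omega> n))) \<longlongrightarrow>
        ext_map (L t x) (ext_map (T (ca x) ?c x) w)) G"
      by (rule ext_map_tendsto[OF Ll extlimD(2)[OF lim c]])
    then have "((\<lambda>n. ext_map (L (\<tau> n) (\<xi> n)) (ext_map (T (ca (\<xi> n)) ?c (\<xi> n)) (\<omega> n))) \<longlongrightarrow>
        ext_map (T (ca (\<phi> t x)) ?d (\<phi> t x)) (ext_map (D t x) w)) G"
      unfolding eq[OF x c(2) d(2)] .
    moreover have "eventually (\<lambda>n. \<phi> (\<tau> n) (\<xi> n) \<in> fst ?d) G" by (rule topological_tendstoD[OF fl chart_open[OF d(1)] d(2)])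
    then have "eventually (\<lambda>n. ext_map (L (\<tau> n) (\<xi> n)) (ext_map (T (ca (\<xi> n)) ?c (\<xi> n)) (\<omega> n)) =
        ext_map (T (ca (\<phi> (\<tau> n) (\<xi> n))) ?d (\<phi> (\<tau> n) (\<xi> n))) (ext_map (D (\<tau> n) (\<xi> n)) (\<omega> n))) G"
      using ev topological_tendstoD[OF xi chart_open[OF c(1)] c(2)] by eventually_elim (simp add: eq)
    ultimately show "((\<lambda>n. ext_map (T (ca (\<phi> (\<tau> n) (\<xi> n))) ?d (\<phi> (\<tau> n) (\<xi> n))) (ext_map (D (\<tau> n) (\<xi> n)) (\<omega> n))) \<longlongrightarrow>
        ext_map (T (ca (\<phi> t x)) ?d (\<phi> t x)) (ext_map (D t x) w)) G"
      by (rule Lim_transform_eventually)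
  qed
qed

text \<open>Elements of \<open>ext_power (F y)\<close> are fixed by \<open>antisym_project\<close>
  along \<open>PF y\<close>. In a fixed chart this operator depends continuously on
  \<open>y\<close>, so the fixed-point equation passes to the limit.\<close>

lemma extlim_ext_power:
  assumes x: "x \<in> \<Lambda>" and ev: "eventually (\<lambda>n. \<xi> n \<in> \<Lambda>) G" and ne: "G \<noteq> bot"
    and lim: "extlim G \<xi> \<omega> x w" and \<omega>: "eventually (\<lambda>n. \<omega> n \<in> ext_power (F (\<xi> n))) G"
  shows "w \<in> ext_power (F x)"
proof -
  let ?c = "ca x"
  note c = chart_at[of x] and xM = in_Mi[OF x]
  have xi: "(\<xi> \<longlongrightarrow> x) G" by (rule extlimD(1)[OF lim])
  define P where "P y a = T (ca y) ?c y (PF y (T ?c (ca y) y a))" for y a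
  have Pl: "((\<lambda>n. P (\<xi> n) b) \<longlongrightarrow> P x b) G" for b
    unfolding P_def by (rule tlimD(2)[OF tlim_PF[OF x ev tlim_frame[OF xM c xi tendsto_const]] c])
  have P: "linear (P y)" "\<And>v. P y v \<in> T (ca y) ?c y ` F y" "\<And>v. v \<in> T (ca y) ?c y ` F y \<Longrightarrow> P y v = v"
    if y: "y \<in> \<Lambda>" "y \<in> fst ?c" for y
  proof -
    note yM = in_Mi[OF y(1)]
    have l1: "linear (T (ca y) ?c y)" by (rule T_linear[OF chart_at(1) c(1) chart_at(2) y(2) yM])
    have l3: "linear (T ?c (ca y) y)" by (rule T_linear[OF c(1) chart_at(1) y(2) chart_at(2) yM])
    show "linear (P y)"
      using linear_compose[OF linear_compose[OF l3 PF_linear[OF y(1)]] l1] by (simp add: P_def[abs_def] comp_def)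
    show "P y v \<in> T (ca y) ?c y ` F y" for v unfolding P_def using PF_in(1)[OF y(1)] by blast
    show "P y v = v" if "v \<in> T (ca y) ?c y ` F y" for v
      using that T_inverse[OF chart_at(1) c(1) chart_at(2) y(2) yM] PF_F[OF y(1)] by (auto simp: P_def)
  qed
  have "eventually (\<lambda>n. \<xi> n \<in> fst ?c) G" by (rule topological_tendstoD[OF xi chart_open[OF c(1)] c(2)])
  then have "eventually (\<lambda>n. ext_map (T (ca (\<xi> n)) ?c (\<xi> n)) (\<omega> n) =
      antisym_project (P (\<xi> n)) (ext_map (T (ca (\<xi> n)) ?c (\<xi> n)) (\<omega> n))) G"
    using ev \<omega>
  proof eventually_elim
    case (elim n)
    have l1: "linear (T (ca (\<xi> n)) ?c (\<xi> n))"
      by (rule T_linear[OF chart_at(1) c(1) chart_at(2) elim(1) in_Mi[OF elim(2)]])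
    show ?case
      using antisym_project_ext_power[OF ext_map_ext_power[OF l1 elim(3)] P(1,3)[OF elim(2,1)]] by simp
  qed
  then have "((\<lambda>n. antisym_project (P (\<xi> n)) (ext_map (T (ca (\<xi> n)) ?c (\<xi> n)) (\<omega> n))) \<longlongrightarrow> ext_map (T (ca x) ?c x) w) G"
    by (rule Lim_transform_eventually[OF extlimD(2)[OF lim c]])
  moreover have "((\<lambda>n. antisym_project (P (\<xi> n)) (ext_map (T (ca (\<xi> n)) ?c (\<xi> n)) (\<omega> n))) \<longlongrightarrow>
      antisym_project (P x) (ext_map (T (ca x) ?c x) w)) G"
    by (rule antisym_project_tendsto[OF Pl extlimD(2)[OF lim c]])
  ultimately have "antisym_project (P x) (ext_map (T ?c ?c x) w) = ext_map (T ?c ?c x) w"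
    using tendsto_unique[OF ne] by blast
  moreover have "ext_map (T ?c ?c x) w = w"
  proof -
    have "(\<lambda>v. T ?c ?c x v) = (\<lambda>v. v)" using T_id[OF c xM] by (simp add: fun_eq_iff)
    then show ?thesis using ext_map_id[of w] by simp
  qed
  moreover have "T ?c ?c x ` F x = F x" using T_id[OF c xM] by simp
  ultimately show ?thesis using antisym_project_in[of "P x" "F x" w] P(2)[OF x c(2)] by metis
qed

end

section \<open>The compact bundle of unit vectors\<close>

type_synonym ('m, 'n, 'p) state = "'m \<times> (real ^ 'n) \<times> (real ^ 'n) \<times> (real ^ ('p \<Rightarrow> 'n))"
type_synonym ('n, 'p) code = "real \<times> (real ^ 'n) \<times> (real ^ 'n) \<times> (real ^ 'n) \<times> (real ^ ('p \<Rightarrow> 'n))"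

text \<open>By compactness \<open>N\<close> has a positive minimum \<open>\<mu>\<close> over unit
  vectors, and by homogeneity \<open>1 / \<mu>\<close> bounds all vectors of \<open>N\<close>-length
  1. This serves to compare Riemannian and coordinate norms uniformly over a coordinate
  ball.\<close>

lemma homogeneous_bound:
  fixes N :: "'a::metric_space \<Rightarrow> 'b::euclidean_space \<Rightarrow> real"
  assumes Q: "compact Q" and cont: "continuous_on (Q \<times> sphere 0 1) (\<lambda>(q, v). N q v)"
    and hom: "\<And>q s v. q \<in> Q \<Longrightarrow> N q (s *\<^sub>R v) = \<bar>s\<bar> * N q v"
    and pos: "\<And>q v. q \<in> Q \<Longrightarrow> v \<noteq> 0 \<Longrightarrow> 0 < N q v"
  shows "\<exists>C. \<forall>q\<in>Q. \<forall>v. N q v = 1 \<longrightarrow> norm v \<le> C"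
proof (cases "Q \<times> sphere (0::'b) 1 = {}")
  case True
  obtain b :: 'b where "b \<in> Basis" using nonempty_Basis by blast
  then have "b \<in> sphere 0 1" by simp
  then have "sphere (0::'b) 1 \<noteq> {}" by blast
  then have "Q = {}" using True by auto
  then show ?thesis by blast
next
  case False
  have "compact (Q \<times> sphere (0::'b) 1)" by (intro compact_Times Q compact_sphere)
  from continuous_attains_inf[OF this False cont]
  obtain p where p: "p \<in> Q \<times> sphere 0 1" "\<And>p'. p' \<in> Q \<times> sphere 0 1 \<Longrightarrow> (\<lambda>(q, v). N q v) p \<le> (\<lambda>(q, v). N q v) p'"
    by blast
  define \<mu> where "\<mu> = (\<lambda>(q, v). N q v) p"
  have "snd p \<noteq> 0" using p(1) by auto
  then have \<mu>: "0 < \<mu>" using p(1) pos[of "fst p" "snd p"] unfolding \<mu>_def by (auto simp: case_prod_beta)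
  show ?thesis
  proof (intro exI[of _ "1 / \<mu>"] ballI allI impI)
    fix q v assume q: "q \<in> Q" and N: "N q v = 1"
    have "v \<noteq> 0" using hom[OF q, of 0 0] N by auto
    then have "\<mu> \<le> N q ((1 / norm v) *\<^sub>R v)"
      unfolding \<mu>_def using p(2)[of "(q, (1 / norm v) *\<^sub>R v)"] q by simp
    also have "\<dots> = 1 / norm v" using hom[OF q, of "1 / norm v" v] N by simp
    finally show "norm v \<le> 1 / \<mu>" using \<mu> \<open>v \<noteq> 0\<close> by (simp add: field_simps)
  qed
qed

context flow_setup begin

abbreviation "tn \<equiv> tangent_norm g"

lemma tn_scaleR: "tn x (c *\<^sub>R v) = \<bar>c\<bar> * tn x v"
proof -
  have "g x (c *\<^sub>R v) (c *\<^sub>R v) = c\<^sup>2 * g x v v"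
    by (simp add: inner_form_linear[OF inner_form_metric] power2_eq_square)
  then show ?thesis by (simp add: tangent_norm_def real_sqrt_mult)
qed

lemma tn_pos: "v \<noteq> 0 \<Longrightarrow> 0 < tn x v"
  by (simp add: tangent_norm_def inner_form_pos[OF inner_form_metric])

lemma tn_nonneg: "0 \<le> tn x v"
  by (simp add: tangent_norm_def inner_form_nonneg[OF inner_form_metric])

lemma tn_zero: "tn x 0 = 0"
  using tn_scaleR[of x 0 0] by simp

lemma tn_tendsto: "x \<in> Mi \<Longrightarrow> tlim G \<xi> \<nu> x v \<Longrightarrow> ((\<lambda>n. tn (\<xi> n) (\<nu> n)) \<longlongrightarrow> tn x v) G"
  unfolding tangent_norm_def by (intro tendsto_real_sqrt metric_tendsto)

lemma tlim_cong:
  assumes l: "tlim G \<xi> \<nu> x v" and e: "eventually (\<lambda>n. \<xi> n = \<xi>' n) G" "eventually (\<lambda>n. \<nu> n = \<nu>' n) G"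
  shows "tlim G \<xi>' \<nu>' x v"
  unfolding tlim_def
proof (intro conjI ballI impI)
  show "(\<xi>' \<longlongrightarrow> x) G" by (rule Lim_transform_eventually[OF tlimD(1)[OF l] e(1)])
  fix c assume c: "c \<in> A" "x \<in> fst c"
  have "eventually (\<lambda>n. T (ca (\<xi> n)) c (\<xi> n) (\<nu> n) = T (ca (\<xi>' n)) c (\<xi>' n) (\<nu>' n)) G"
    using e by eventually_elim simp
  then show "((\<lambda>n. T (ca (\<xi>' n)) c (\<xi>' n) (\<nu>' n)) \<longlongrightarrow> T (ca x) c x v) G"
    by (rule Lim_transform_eventually[OF tlimD(2)[OF l c]])
qed

end

context flow_splitting begin

lemma extlim_cong:
  assumes l: "extlim G \<xi> \<omega> x w" and e: "eventually (\<lambda>n. \<xi> n = \<xi>' n) G" "eventually (\<lambda>n. \<omega> n = \<omega>' n) G"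
  shows "extlim G \<xi>' \<omega>' x w"
  unfolding extlim_def
proof (intro conjI ballI impI)
  show "(\<xi>' \<longlongrightarrow> x) G" by (rule Lim_transform_eventually[OF extlimD(1)[OF l] e(1)])
  fix c assume c: "c \<in> A" "x \<in> fst c"
  have "eventually (\<lambda>n. ext_map (T (ca (\<xi> n)) c (\<xi> n)) (\<omega> n) = ext_map (T (ca (\<xi>' n)) c (\<xi>' n)) (\<omega>' n)) G"
    using e by eventually_elim simp
  then show "((\<lambda>n. ext_map (T (ca (\<xi>' n)) c (\<xi>' n)) (\<omega>' n)) \<longlongrightarrow> ext_map (T (ca x) c x) w) G"
    by (rule Lim_transform_eventually[OF extlimD(2)[OF l c]])
qed

lemma extlim_frame:
  fixes b0 :: "real ^ ('p::finite \<Rightarrow> 'n)"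
  assumes x: "x \<in> Mi" and c: "c \<in> A" "x \<in> fst c" and xi: "(\<xi> \<longlongrightarrow> x) G" and b: "(b \<longlongrightarrow> b0) G"
  shows "extlim G \<xi> (\<lambda>n. ext_map (T c (ca (\<xi> n)) (\<xi> n)) (b n)) x (ext_map (T c (ca x) x) b0)"
proof (rule extlimI[OF x c xi])
  have "eventually (\<lambda>n. \<xi> n \<in> fst c \<inter> Mi) G" by (rule eventually_in_chart_Mi[OF xi c x])
  then have "eventually (\<lambda>n. b n = ext_map (T (ca (\<xi> n)) c (\<xi> n)) (ext_map (T c (ca (\<xi> n)) (\<xi> n)) (b n))) G"
  proof eventually_elim
    case (elim n)
    then show ?case using ext_T_inverse[OF c(1) chart_at(1) _ chart_at(2), of "\<xi> n" "b n"] by auto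
  qed
  then show "((\<lambda>n. ext_map (T (ca (\<xi> n)) c (\<xi> n)) (ext_map (T c (ca (\<xi> n)) (\<xi> n)) (b n))) \<longlongrightarrow>
      ext_map (T (ca x) c x) (ext_map (T c (ca x) x) b0)) G"
    unfolding ext_T_inverse[OF c(1) chart_at(1) c(2) chart_at(2) x]
    by (rule Lim_transform_eventually[OF b])
qed

lemma D_nonzero: "x \<in> \<Lambda> \<Longrightarrow> v \<noteq> 0 \<Longrightarrow> D t x v \<noteq> 0"
  using Dflow_inverse[of x t v] linear_0[OF Dflow_linear[OF flow_Lambda, of x "- t" t]] by auto

lemma ext_D_add:
  fixes w :: "real ^ ('p::finite \<Rightarrow> 'n)"
  assumes "x \<in> \<Lambda>"
  shows "ext_map (D (s + t) x) w = ext_map (D s (\<phi> t x)) (ext_map (D t x) w)"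
proof -
  have "D (s + t) x = (\<lambda>v. D s (\<phi> t x) (D t x v))" using Dflow_add[OF assms] by (simp add: fun_eq_iff)
  then show ?thesis by (simp add: ext_map_comp[OF Dflow_linear[OF flow_Lambda[OF assms]] Dflow_linear[OF assms]])
qed

lemma ext_D_zero:
  fixes w :: "real ^ ('p::finite \<Rightarrow> 'n)"
  assumes "x \<in> \<Lambda>"
  shows "ext_map (D 0 x) w = w"
proof -
  have "D 0 x = (\<lambda>v. v)" using Dflow_zero[OF assms] by (simp add: fun_eq_iff)
  then show ?thesis using ext_map_id[of w] by simp
qed

lemma ext_D_inverse:
  fixes w :: "real ^ ('p::finite \<Rightarrow> 'n)"
  assumes "x \<in> \<Lambda>"
  shows "ext_map (D (- t) (\<phi> t x)) (ext_map (D t x) w) = w"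
  using ext_D_add[OF assms, of "- t" t w] ext_D_zero[OF assms, of w] by simp

lemma ext_D_nonzero:
  fixes w :: "real ^ ('p::finite \<Rightarrow> 'n)"
  shows "x \<in> \<Lambda> \<Longrightarrow> w \<noteq> 0 \<Longrightarrow> ext_map (D t x) w \<noteq> 0"
  using ext_D_inverse[of x t w] ext_map_zero[of "D (- t) (\<phi> t x)"] by metis

definition Zst :: "('m, 'n, 'p::finite) state set" where
  "Zst = {(x, u, v, w). x \<in> \<Lambda> \<and> u \<in> E x \<and> tn x u = 1 \<and> v \<in> F x \<and> tn x v = 1 \<and>
    w \<in> ext_power (F x) \<and> ext_norm (g x) w = 1}"

text \<open>The product topology of the type would be the wrong notion here, as the vector
  components refer to preferred charts that jump with the base point.\<close>

definition zlim :: "'b filter \<Rightarrow> ('b \<Rightarrow> ('m, 'n, 'p::finite) state) \<Rightarrow> ('m, 'n, 'p) state \<Rightarrow> bool" where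
  "zlim G \<zeta> z \<longleftrightarrow> tlim G (\<lambda>n. fst (\<zeta> n)) (\<lambda>n. fst (snd (\<zeta> n))) (fst z) (fst (snd z)) \<and>
    tlim G (\<lambda>n. fst (\<zeta> n)) (\<lambda>n. fst (snd (snd (\<zeta> n)))) (fst z) (fst (snd (snd z))) \<and>
    extlim G (\<lambda>n. fst (\<zeta> n)) (\<lambda>n. snd (snd (snd (\<zeta> n)))) (fst z) (snd (snd (snd z)))"

definition \<Psi> :: "real \<Rightarrow> ('m, 'n, 'p::finite) state \<Rightarrow> ('m, 'n, 'p) state" where
  "\<Psi> t z = (case z of (x, u, v, w) \<Rightarrow> (\<phi> t x,
    (1 / tn (\<phi> t x) (D t x u)) *\<^sub>R D t x u,
    (1 / tn (\<phi> t x) (D t x v)) *\<^sub>R D t x v,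
    (1 / ext_norm (g (\<phi> t x)) (ext_map (D t x) w)) *\<^sub>R ext_map (D t x) w))"

lemma ZstD:
  fixes z :: "('m, 'n, 'p::finite) state"
  assumes "z \<in> Zst"
  obtains x u v w where "z = (x, u, v, w)" "x \<in> \<Lambda>" "u \<in> E x" "tn x u = 1" "u \<noteq> 0" "v \<in> F x" "tn x v = 1" "v \<noteq> 0"
    "w \<in> ext_power (F x)" "ext_norm (g x) w = 1" "w \<noteq> 0"
proof -
  obtain x u v w where z: "z = (x, u, v, w)" by (cases z)
  then have "x \<in> \<Lambda>" "u \<in> E x" "tn x u = 1" "v \<in> F x" "tn x v = 1"
    "w \<in> ext_power (F x)" "ext_norm (g x) w = 1" using assms by (auto simp: Zst_def)
  moreover have "ext_norm (g x) (0 :: real ^ ('p \<Rightarrow> 'n)) = 0" by (rule ext_norm_zero[OF inner_form_metric])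
  moreover from calculation have "u \<noteq> 0" "v \<noteq> 0" "w \<noteq> 0" using tn_zero[of x] by auto
  ultimately show thesis using that z by blast
qed

lemma subbundle_scale:
  assumes x: "x \<in> \<Lambda>"
  shows "u \<in> E x \<Longrightarrow> c *\<^sub>R D t x u \<in> E (\<phi> t x)" "v \<in> F x \<Longrightarrow> c *\<^sub>R D t x v \<in> F (\<phi> t x)"
    "w \<in> ext_power (F x) \<Longrightarrow> c *\<^sub>R ext_map (D t x) w \<in> ext_power (F (\<phi> t x))"
proof -
  show "u \<in> E x \<Longrightarrow> c *\<^sub>R D t x u \<in> E (\<phi> t x)"
    by (rule subspace_scale[OF subspace_E[OF flow_Lambda[OF x]]]) (use D_E[OF x, of t] in blast)
  show "v \<in> F x \<Longrightarrow> c *\<^sub>R D t x v \<in> F (\<phi> t x)"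
    by (rule subspace_scale[OF subspace_F[OF flow_Lambda[OF x]]]) (use D_F[OF x, of t] in blast)
  assume "w \<in> ext_power (F x)"
  from ext_map_ext_power[OF Dflow_linear[OF x, of t] this]
  have "ext_map (D t x) w \<in> ext_power (F (\<phi> t x))" unfolding D_F[OF x] .
  then show "c *\<^sub>R ext_map (D t x) w \<in> ext_power (F (\<phi> t x))"
    unfolding ext_power_def by (rule span_scale)
qed

lemma Psi_in:
  assumes "z \<in> Zst"
  shows "\<Psi> t z \<in> Zst"
proof -
  obtain x u v w where z: "z = (x, u, v, w)" and x: "x \<in> \<Lambda>" and u: "u \<in> E x" "u \<noteq> 0"
    and v: "v \<in> F x" "v \<noteq> 0" and w: "w \<in> ext_power (F x)" "w \<noteq> 0"
    by (rule ZstD[OF assms]) (rule that)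
  have pos: "0 < tn (\<phi> t x) (D t x u)" "0 < tn (\<phi> t x) (D t x v)" "0 < ext_norm (g (\<phi> t x)) (ext_map (D t x) w)"
    using tn_pos D_nonzero[OF x] u v w ext_norm_pos[OF inner_form_metric ext_D_nonzero[OF x]] by blast+
  show ?thesis
    unfolding z \<Psi>_def Zst_def
    using pos subbundle_scale(1)[OF x u(1)] subbundle_scale(2)[OF x v(1)] subbundle_scale(3)[OF x w(1)] flow_Lambda[OF x]
    by (simp add: tn_scaleR ext_norm_scaleR[OF inner_form_metric])
qed

lemma Psi_zero:
  assumes "z \<in> Zst"
  shows "\<Psi> 0 z = z"
proof -
  obtain x u v w where z: "z = (x, u, v, w)" and x: "x \<in> \<Lambda>" and n: "tn x u = 1" "tn x v = 1" "ext_norm (g x) w = 1"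
    by (rule ZstD[OF assms]) (rule that)
  show ?thesis
    unfolding z \<Psi>_def using flow_zero[OF in_Mi[OF x]] Dflow_zero[OF x] ext_D_zero[OF x, of w] n by simp
qed

lemma Psi_add:
  assumes "z \<in> Zst"
  shows "\<Psi> (s + t) z = \<Psi> s (\<Psi> t z)"
proof -
  obtain x u v w where z: "z = (x, u, v, w)" and x: "x \<in> \<Lambda>" and u: "u \<noteq> 0" and v: "v \<noteq> 0" and w: "w \<noteq> 0"
    by (rule ZstD[OF assms]) (rule that)
  have pos: "0 < tn (\<phi> t x) (D t x u)" "0 < tn (\<phi> t x) (D t x v)" "0 < ext_norm (g (\<phi> t x)) (ext_map (D t x) w)"
    using tn_pos D_nonzero[OF x] u v w ext_norm_pos[OF inner_form_metric ext_D_nonzero[OF x]] by blast+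
  \<comment> \<open>The positive factor from normalising at time \<open>t\<close> drops out when the
    result is normalised again after a further time \<open>s\<close>.\<close>
  have cancel: "(1 / (\<bar>1 / a\<bar> * b)) * (1 / a) = 1 / b" if "0 < a" for a b :: real
    using that by simp
  show ?thesis
    unfolding z \<Psi>_def prod.case
    by (simp only: linear_scale[OF Dflow_linear[OF flow_Lambda[OF x]]] ext_map_scaleR tn_scaleR
        ext_norm_scaleR[OF inner_form_metric] scaleR_scaleR cancel[OF pos(1)] cancel[OF pos(2)] cancel[OF pos(3)]
        flow_add[OF x] Dflow_add[OF x] ext_D_add[OF x])
qed

lemma zlim_flow:
  assumes z: "z \<in> Zst" and ev: "eventually (\<lambda>n. \<zeta> n \<in> Zst) G" and \<tau>: "(\<tau> \<longlongrightarrow> t) G" and lim: "zlim G \<zeta> z"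
  shows "zlim G (\<lambda>n. \<Psi> (\<tau> n) (\<zeta> n)) (\<Psi> t z)"
proof -
  obtain x u v w where ze: "z = (x, u, v, w)" and x: "x \<in> \<Lambda>" and u: "u \<noteq> 0" and v: "v \<noteq> 0" and w: "w \<noteq> 0"
    by (rule ZstD[OF z]) (rule that)
  note fM = in_Mi[OF flow_Lambda[OF x], of t]
  have ev': "eventually (\<lambda>n. fst (\<zeta> n) \<in> \<Lambda>) G" using ev by eventually_elim (auto simp: Zst_def)
  have l: "tlim G (\<lambda>n. fst (\<zeta> n)) (\<lambda>n. fst (snd (\<zeta> n))) x u"
    "tlim G (\<lambda>n. fst (\<zeta> n)) (\<lambda>n. fst (snd (snd (\<zeta> n)))) x v"
    "extlim G (\<lambda>n. fst (\<zeta> n)) (\<lambda>n. snd (snd (snd (\<zeta> n)))) x w"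
    using lim unfolding zlim_def ze by simp_all
  note f = tlim_flow[OF x ev' \<tau> l(1)] tlim_flow[OF x ev' \<tau> l(2)] extlim_flow[OF x ev' \<tau> l(3)]
  have nz: "tn (\<phi> t x) (D t x u) \<noteq> 0" "tn (\<phi> t x) (D t x v) \<noteq> 0" "ext_norm (g (\<phi> t x)) (ext_map (D t x) w) \<noteq> 0"
    using tn_pos[OF D_nonzero[OF x u], of "\<phi> t x" t] tn_pos[OF D_nonzero[OF x v], of "\<phi> t x" t]
      ext_norm_pos[OF inner_form_metric[of "\<phi> t x"] ext_D_nonzero[OF x w, of t]] by simp_all
  show ?thesis
    unfolding zlim_def ze \<Psi>_def case_prod_beta fst_conv snd_conv
    by (intro conjI tlim_scaleR[OF fM] extlim_scaleR f tendsto_divide tendsto_const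
        tn_tendsto[OF fM] ext_norm_extlim[OF fM] nz)
qed

text \<open>Every condition on the vectors is an equation between converging quantities: unit norms,
  \<open>PF\<close> applied to \<open>u\<close> and \<open>v\<close>, and the projection onto the
  exterior power applied to \<open>w\<close>.\<close>

lemma Zst_closed:
  assumes ne: "G \<noteq> bot" and x: "fst z \<in> \<Lambda>" and ev: "eventually (\<lambda>n. \<zeta> n \<in> Zst) G" and lim: "zlim G \<zeta> z"
  shows "z \<in> Zst"
proof -
  obtain x u v w where ze: "z = (x, u, v, w)" by (cases z)
  have x: "x \<in> \<Lambda>" using x ze by simp
  note xM = in_Mi[OF x] and c = chart_at[of x]
  let ?\<xi> = "\<lambda>n. fst (\<zeta> n)" and ?u = "\<lambda>n. fst (snd (\<zeta> n))" and ?v = "\<lambda>n. fst (snd (snd (\<zeta> n)))" and ?w = "\<lambda>n. snd (snd (snd (\<zeta> n)))"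
  have evs: "eventually (\<lambda>n. ?\<xi> n \<in> \<Lambda> \<and> ?u n \<in> E (?\<xi> n) \<and> tn (?\<xi> n) (?u n) = 1 \<and> ?v n \<in> F (?\<xi> n) \<and> tn (?\<xi> n) (?v n) = 1 \<and>
      ?w n \<in> ext_power (F (?\<xi> n)) \<and> ext_norm (g (?\<xi> n)) (?w n) = 1) G"
    using ev by eventually_elim (auto simp: Zst_def)
  have l: "tlim G ?\<xi> ?u x u" "tlim G ?\<xi> ?v x v" "extlim G ?\<xi> ?w x w"
    using lim unfolding zlim_def ze by simp_all
  have ev': "eventually (\<lambda>n. ?\<xi> n \<in> \<Lambda>) G" using evs by eventually_elim simp
  have lim1: "r = 1" if "(h \<longlongrightarrow> r) G" "eventually (\<lambda>n. h n = 1) G" for h and r :: real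
    using tendsto_unique[OF ne that(1) tendsto_eventually[OF that(2)]] .
  have n: "tn x u = 1" "tn x v = 1" "ext_norm (g x) w = 1"
    by (rule lim1[OF tn_tendsto[OF xM l(1)]], use evs in \<open>eventually_elim, simp\<close>)
      (rule lim1[OF tn_tendsto[OF xM l(2)]], use evs in \<open>eventually_elim, simp\<close>,
       rule lim1[OF ext_norm_extlim[OF xM l(3)]], use evs in \<open>eventually_elim, simp\<close>)
  have "w \<in> ext_power (F x)"
    by (rule extlim_ext_power[OF x ev' ne l(3)]) (use evs in \<open>eventually_elim, simp\<close>)
  moreover have "u \<in> E x"
  proof -
    have "eventually (\<lambda>n. T (ca (?\<xi> n)) (ca x) (?\<xi> n) (PF (?\<xi> n) (?u n)) = 0) G"
      using evs eventually_in_chart_Mi[OF tlimD(1)[OF l(1)] c xM]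
    proof eventually_elim
      case (elim n)
      then have "PF (?\<xi> n) (?u n) = 0" using PF_E by blast
      then show ?case using elim linear_0[OF T_linear[OF chart_at(1) c(1) chart_at(2)]] by auto
    qed
    from tendsto_unique[OF ne tlimD(2)[OF tlim_PF[OF x ev' l(1)] c] tendsto_eventually[OF this]]
    show ?thesis using T_id[OF c xM] PF_E[OF x] by simp
  qed
  moreover have "v \<in> F x"
  proof -
    have "eventually (\<lambda>n. ?v n = PF (?\<xi> n) (?v n)) G"
      using evs by eventually_elim (use PF_F in auto)
    then have "tlim G ?\<xi> (\<lambda>n. PF (?\<xi> n) (?v n)) x v" by (intro tlim_cong[OF l(2)]) simp_all
    from tendsto_unique[OF ne tlimD(2)[OF tlim_PF[OF x ev' l(2)] c] tlimD(2)[OF this c]]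
    show ?thesis using T_id[OF c xM] PF_F_iff[OF x] by simp
  qed
  ultimately show ?thesis using n x by (simp add: ze Zst_def)
qed

text \<open>Closed coordinate balls make the set of codes compact; that the open balls already cover
  \<open>\<Lambda>\<close> ensures that states near a given one have codes in the same
  chart.\<close>

definition good_cover :: "nat \<Rightarrow> (nat \<Rightarrow> 'm) \<Rightarrow> (nat \<Rightarrow> real) \<Rightarrow> bool" where
  "good_cover m xs r \<longleftrightarrow>
    (\<forall>i<m. cball (snd (ca (xs i)) (xs i)) (r i) \<subseteq> snd (ca (xs i)) ` (fst (ca (xs i)) \<inter> Mi)) \<and>
    (\<forall>x\<in>\<Lambda>. \<exists>i<m. x \<in> fst (ca (xs i)) \<and> snd (ca (xs i)) x \<in> ball (snd (ca (xs i)) (xs i)) (r i))"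

lemma good_cover_exists: "\<exists>m xs r. good_cover m xs r"
proof -
  have "\<exists>r>0. cball (snd (ca x) x) r \<subseteq> snd (ca x) ` (fst (ca x) \<inter> Mi)" if "x \<in> \<Lambda>" for x
  proof -
    have "open (snd (ca x) ` (fst (ca x) \<inter> Mi))"
      by (rule chart_image_open[OF chart_at(1)]) (auto intro!: open_Int chart_open[OF chart_at(1)] open_Mi)
    moreover have "snd (ca x) x \<in> snd (ca x) ` (fst (ca x) \<inter> Mi)" using chart_at(2) in_Mi[OF that] by blast
    ultimately show ?thesis using open_contains_cball by blast
  qed
  then obtain \<rho> where \<rho>: "\<And>x. x \<in> \<Lambda> \<Longrightarrow> 0 < \<rho> x" "\<And>x. x \<in> \<Lambda> \<Longrightarrow> cball (snd (ca x) x) (\<rho> x) \<subseteq> snd (ca x) ` (fst (ca x) \<inter> Mi)"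
    by metis
  define N where "N x = fst (ca x) \<inter> snd (ca x) -` ball (snd (ca x) x) (\<rho> x)" for x
  have op: "\<And>x. x \<in> \<Lambda> \<Longrightarrow> open (N x)"
    unfolding N_def by (rule continuous_open_preimage[OF chart_cont[OF chart_at(1)] chart_open[OF chart_at(1)] open_ball])
  have cov: "\<Lambda> \<subseteq> (\<Union>x\<in>\<Lambda>. N x)" using \<rho>(1) chart_at(2) by (auto simp: N_def)
  obtain S where S: "S \<subseteq> \<Lambda>" "finite S" "\<Lambda> \<subseteq> (\<Union>x\<in>S. N x)"
    by (rule compactE_image[OF compact_inv op cov])
  obtain xs where xs: "bij_betw xs {0..<card S} S" using ex_bij_betw_nat_finite[OF S(2)] by blast
  have "good_cover (card S) xs (\<lambda>i. \<rho> (xs i))"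
    unfolding good_cover_def
  proof (intro conjI allI impI ballI)
    fix i assume "i < card S"
    then have "xs i \<in> S" using xs by (auto simp: bij_betw_def)
    then show "cball (snd (ca (xs i)) (xs i)) (\<rho> (xs i)) \<subseteq> snd (ca (xs i)) ` (fst (ca (xs i)) \<inter> Mi)"
      using \<rho>(2) S(1) by blast
  next
    fix x assume "x \<in> \<Lambda>"
    then obtain y where y: "y \<in> S" "x \<in> N y" using S(3) by blast
    moreover have "xs ` {0..<card S} = S" using xs by (simp add: bij_betw_def)
    ultimately obtain i where "i < card S" "xs i = y" by (metis atLeastLessThan_iff imageE)
    then show "\<exists>i<card S. x \<in> fst (ca (xs i)) \<and> snd (ca (xs i)) x \<in> ball (snd (ca (xs i)) (xs i)) (\<rho> (xs i))"
      using y(2) by (auto simp: N_def)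
  qed
  then show ?thesis by blast
qed

text \<open>The index of the chart is stored as a real number to keep the codes in a Euclidean space.\<close>

definition \<Theta> :: "(nat \<Rightarrow> 'm) \<Rightarrow> ('n, 'p::finite) code \<Rightarrow> ('m, 'n, 'p) state" where
  "\<Theta> xs k = (case k of (\<rho>, y, u, v, w) \<Rightarrow>
    let c = ca (xs (nat \<lfloor>\<rho>\<rfloor>)); x = chart_inv c y; S = T c (ca x) x in (x, S u, S v, ext_map S w))"

definition Kpre :: "nat \<Rightarrow> (nat \<Rightarrow> 'm) \<Rightarrow> (nat \<Rightarrow> real) \<Rightarrow> ('n, 'p::finite) code set" where
  "Kpre m xs r = {k. \<exists>i<m. fst k = real i \<and> fst (snd k) \<in> cball (snd (ca (xs i)) (xs i)) (r i)}"

definition Kset :: "nat \<Rightarrow> (nat \<Rightarrow> 'm) \<Rightarrow> (nat \<Rightarrow> real) \<Rightarrow> ('n, 'p::finite) code set" where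
  "Kset m xs r = {k \<in> Kpre m xs r. \<Theta> xs k \<in> Zst}"

lemma Theta_zlim:
  assumes cov: "good_cover m xs r" and ev: "eventually (\<lambda>n. k n \<in> Kpre m xs r) G"
    and k0: "k0 \<in> Kpre m xs r" and k: "(k \<longlongrightarrow> k0) G"
  shows "zlim G (\<lambda>n. \<Theta> xs (k n)) (\<Theta> xs k0)"
proof -
  obtain i y u v w where i: "i < m" and k0e: "k0 = (real i, y, u, v, w)" and y: "y \<in> cball (snd (ca (xs i)) (xs i)) (r i)"
    using k0 by (cases k0) (auto simp: Kpre_def)
  let ?c = "ca (xs i)"
  note c = chart_at(1)[of "xs i"]
  let ?\<rho> = "\<lambda>n. fst (k n)" and ?y = "\<lambda>n. fst (snd (k n))" and ?u = "\<lambda>n. fst (snd (snd (k n)))"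
    and ?v = "\<lambda>n. fst (snd (snd (snd (k n))))" and ?w = "\<lambda>n. snd (snd (snd (snd (k n))))"
  have lim: "(?\<rho> \<longlongrightarrow> real i) G" "(?y \<longlongrightarrow> y) G" "(?u \<longlongrightarrow> u) G" "(?v \<longlongrightarrow> v) G" "(?w \<longlongrightarrow> w) G"
    using tendsto_fst[OF k] tendsto_fst[OF tendsto_snd[OF k]] tendsto_fst[OF tendsto_snd[OF tendsto_snd[OF k]]]
      tendsto_fst[OF tendsto_snd[OF tendsto_snd[OF tendsto_snd[OF k]]]]
      tendsto_snd[OF tendsto_snd[OF tendsto_snd[OF tendsto_snd[OF k]]]] by (simp_all add: k0e)
  \<comment> \<open>Chart indices are integers, so convergence makes them eventually equal and only
    one chart is involved.\<close>
  have "eventually (\<lambda>n. dist (?\<rho> n) (real i) < 1) G" by (rule tendstoD[OF lim(1)]) simp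
  then have evi: "eventually (\<lambda>n. ?\<rho> n = real i) G"
    using ev by eventually_elim (auto simp: Kpre_def dist_real_def)
  have y': "y \<in> snd ?c ` (fst ?c \<inter> Mi)" using cov i y unfolding good_cover_def by blast
  then obtain x where x: "x \<in> fst ?c" "x \<in> Mi" "y = snd ?c x" by blast
  have xy: "chart_inv ?c y = x" using chart_inv_left[OF c x(1)] x(3) by simp
  have xi: "((\<lambda>n. chart_inv ?c (?y n)) \<longlongrightarrow> x) G"
    using isCont_tendsto_compose[OF chart_inv_isCont[OF c x(1,2)], of ?y G] lim(2) x(3) xy by simp
  have e: "eventually (\<lambda>n. fst (\<Theta> xs (k n)) = chart_inv ?c (?y n)) G"
    "eventually (\<lambda>n. fst (snd (\<Theta> xs (k n))) = T ?c (ca (chart_inv ?c (?y n))) (chart_inv ?c (?y n)) (?u n)) G"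
    "eventually (\<lambda>n. fst (snd (snd (\<Theta> xs (k n)))) = T ?c (ca (chart_inv ?c (?y n))) (chart_inv ?c (?y n)) (?v n)) G"
    "eventually (\<lambda>n. snd (snd (snd (\<Theta> xs (k n)))) = ext_map (T ?c (ca (chart_inv ?c (?y n))) (chart_inv ?c (?y n))) (?w n)) G"
    using evi by (eventually_elim, simp add: \<Theta>_def case_prod_beta Let_def)+
  note e' = e[THEN eventually_mono, OF sym]
  have \<Theta>0: "\<Theta> xs k0 = (x, T ?c (ca x) x u, T ?c (ca x) x v, ext_map (T ?c (ca x) x) w)"
    by (simp add: \<Theta>_def k0e xy Let_def)
  show ?thesis
    unfolding zlim_def \<Theta>0 fst_conv snd_conv
    by (intro conjI tlim_cong[OF tlim_frame[OF x(2) c x(1) xi lim(3)] e'(1,2)]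
        tlim_cong[OF tlim_frame[OF x(2) c x(1) xi lim(4)] e'(1,3)]
        extlim_cong[OF extlim_frame[OF x(2) c x(1) xi lim(5)] e'(1,4)])
qed

lemma code_of_state:
  fixes z :: "('m, 'n, 'p::finite) state"
  assumes cov: "good_cover m xs r" and i: "i < m" and z: "z \<in> Zst"
    and x: "fst z \<in> fst (ca (xs i))" "snd (ca (xs i)) (fst z) \<in> ball (snd (ca (xs i)) (xs i)) (r i)"
  defines "c \<equiv> ca (xs i)"
  defines "k \<equiv> (real i, snd c (fst z), T (ca (fst z)) c (fst z) (fst (snd z)), T (ca (fst z)) c (fst z) (fst (snd (snd z))),
    ext_map (T (ca (fst z)) c (fst z)) (snd (snd (snd z))))"
  shows "k \<in> Kset m xs r" "\<Theta> xs k = z"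
proof -
  have cA: "c \<in> A" unfolding c_def by (rule chart_at(1))
  have xc: "fst z \<in> fst c" using x(1) by (simp add: c_def)
  have xM: "fst z \<in> Mi" using z in_Mi by (auto simp: Zst_def)
  show \<Theta>: "\<Theta> xs k = z"
    unfolding k_def \<Theta>_def
    by (simp add: Let_def c_def[symmetric] chart_inv_left[OF cA xc] T_inverse[OF chart_at(1) cA chart_at(2) xc xM]
        ext_T_inverse[OF chart_at(1) cA chart_at(2) xc xM])
  have "k \<in> Kpre m xs r"
    unfolding Kpre_def k_def using i x(2) by (auto simp: c_def intro!: exI[of _ i])
  then show "k \<in> Kset m xs r" using z \<Theta> by (simp add: Kset_def)
qed

lemma Theta_image:
  assumes cov: "good_cover m xs r"
  shows "\<Theta> xs ` (Kset m xs r) = (Zst :: ('m, 'n, 'p::finite) state set)"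
proof
  show "\<Theta> xs ` (Kset m xs r) \<subseteq> (Zst :: ('m, 'n, 'p) state set)" by (auto simp: Kset_def)
  show "(Zst :: ('m, 'n, 'p) state set) \<subseteq> \<Theta> xs ` (Kset m xs r)"
  proof
    fix z :: "('m, 'n, 'p) state" assume z: "z \<in> Zst"
    then have "fst z \<in> \<Lambda>" by (auto simp: Zst_def)
    then obtain i where i: "i < m" "fst z \<in> fst (ca (xs i))" "snd (ca (xs i)) (fst z) \<in> ball (snd (ca (xs i)) (xs i)) (r i)"
      using cov unfolding good_cover_def by blast
    from code_of_state[OF cov i(1) z i(2,3)] show "z \<in> \<Theta> xs ` (Kset m xs r)" by (metis imageI)
  qed
qed

text \<open>A converging family of states lifts to a converging family of codes: all states close to
  the limit are coded in one chart, in which \<open>zlim\<close> is ordinary convergence.\<close>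

lemma continuous_zlim:
  fixes f :: "('m, 'n, 'p::finite) state \<Rightarrow> real"
  assumes cov: "good_cover m xs r" and f: "continuous_on (Kset m xs r) (f \<circ> \<Theta> xs)"
    and z: "z \<in> Zst" and ev: "eventually (\<lambda>n. \<zeta> n \<in> Zst) G" and lim: "zlim G \<zeta> z"
  shows "((\<lambda>n. f (\<zeta> n)) \<longlongrightarrow> f z) G"
proof -
  have "fst z \<in> \<Lambda>" using z by (auto simp: Zst_def)
  then obtain i where i: "i < m" "fst z \<in> fst (ca (xs i))" "snd (ca (xs i)) (fst z) \<in> ball (snd (ca (xs i)) (xs i)) (r i)"
    using cov unfolding good_cover_def by blast
  define c where "c = ca (xs i)"
  have c: "c \<in> A" "fst z \<in> fst c" using chart_at(1) i(2) by (auto simp: c_def)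
  define k where "k z = (real i, snd c (fst z), T (ca (fst z)) c (fst z) (fst (snd z)), T (ca (fst z)) c (fst z) (fst (snd (snd z))),
    ext_map (T (ca (fst z)) c (fst z)) (snd (snd (snd z))))" for z :: "('m, 'n, 'p) state"
  have l: "tlim G (\<lambda>n. fst (\<zeta> n)) (\<lambda>n. fst (snd (\<zeta> n))) (fst z) (fst (snd z))"
    "tlim G (\<lambda>n. fst (\<zeta> n)) (\<lambda>n. fst (snd (snd (\<zeta> n)))) (fst z) (fst (snd (snd z)))"
    "extlim G (\<lambda>n. fst (\<zeta> n)) (\<lambda>n. snd (snd (snd (\<zeta> n)))) (fst z) (snd (snd (snd z)))"
    using lim unfolding zlim_def by blast+
  have sl: "((\<lambda>n. snd c (fst (\<zeta> n))) \<longlongrightarrow> snd c (fst z)) G"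
    by (rule isCont_tendsto_compose[OF chart_isCont[OF c] tlimD(1)[OF l(1)]])
  have kl: "((\<lambda>n. k (\<zeta> n)) \<longlongrightarrow> k z) G"
    unfolding k_def by (intro tendsto_Pair tendsto_const sl tlimD(2)[OF l(1) c] tlimD(2)[OF l(2) c] extlimD(2)[OF l(3) c])
  have "eventually (\<lambda>n. snd c (fst (\<zeta> n)) \<in> ball (snd c (xs i)) (r i)) G"
    by (rule topological_tendstoD[OF sl open_ball]) (use i(3) in \<open>simp add: c_def\<close>)
  moreover have "eventually (\<lambda>n. fst (\<zeta> n) \<in> fst c) G"
    by (rule topological_tendstoD[OF tlimD(1)[OF l(1)] chart_open[OF c(1)] c(2)])
  ultimately have kev: "eventually (\<lambda>n. k (\<zeta> n) \<in> Kset m xs r \<and> \<Theta> xs (k (\<zeta> n)) = \<zeta> n) G"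
    using ev
  proof eventually_elim
    case (elim n)
    then show ?case using code_of_state[OF cov i(1), of "\<zeta> n"] by (simp add: k_def c_def)
  qed
  have k0: "k z \<in> Kset m xs r" "\<Theta> xs (k z) = z"
    using code_of_state[OF cov i(1) z i(2,3)] by (simp_all add: k_def c_def)
  have "eventually (\<lambda>n. k (\<zeta> n) \<in> Kset m xs r) G" using kev by eventually_elim simp
  from continuous_on_tendsto_compose[OF f kl k0(1) this]
  have "((\<lambda>n. f (\<Theta> xs (k (\<zeta> n)))) \<longlongrightarrow> f z) G" by (simp add: k0(2))
  then show ?thesis
    by (rule Lim_transform_eventually) (use kev in \<open>eventually_elim, simp\<close>)
qed

text \<open>Over each of the finitely many closed balls, \<open>homogeneous_bound\<close> applies to
  the norms transported into the chart; they are positive on nonzero vectors because the transition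
  derivatives are invertible.\<close>

lemma Kset_bounded:
  assumes cov: "good_cover m xs r"
  shows "bounded (Kset m xs r :: ('n, 'p::finite) code set)"
proof -
  have "\<exists>C C'. \<forall>k\<in>Kset m xs r. fst k = real i \<longrightarrow> norm (fst (snd (snd k))) \<le> C \<and> norm (fst (snd (snd (snd k)))) \<le> C \<and>
      norm (snd (snd (snd (snd (k :: ('n, 'p) code))))) \<le> C'" if i: "i < m" for i
  proof -
    let ?c = "ca (xs i)"
    note c = chart_at(1)[of "xs i"]
    let ?Q = "cball (snd ?c (xs i)) (r i)"
    have Q: "\<exists>x. x \<in> fst ?c \<and> x \<in> Mi \<and> q = snd ?c x \<and> chart_inv ?c q = x" if "q \<in> ?Q" for q
    proof -
      have "q \<in> snd ?c ` (fst ?c \<inter> Mi)" using cov i that unfolding good_cover_def by blast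
      then show ?thesis using chart_inv_left[OF c] by auto
    qed
    define S where "S q = T ?c (ca (chart_inv ?c q)) (chart_inv ?c q)" for q
    have Slin: "linear (S q)" if q: "q \<in> ?Q" for q
    proof -
      obtain x where x: "x \<in> fst ?c" "x \<in> Mi" "chart_inv ?c q = x" using Q[OF q] by blast
      show ?thesis unfolding S_def x(3) by (rule T_linear[OF c chart_at(1) x(1) chart_at(2) x(2)])
    qed
    have Snz: "S q v \<noteq> 0" if q: "q \<in> ?Q" and v0: "v \<noteq> 0" for q v
    proof
      assume e: "S q v = 0"
      obtain x where x: "x \<in> fst ?c" "x \<in> Mi" "chart_inv ?c q = x" using Q[OF q] by blast
      have "v = T (ca x) ?c x (S q v)"
        unfolding S_def x(3) by (rule T_inverse[OF c chart_at(1) x(1) chart_at(2) x(2), symmetric])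
      also have "\<dots> = 0" unfolding e by (rule linear_0[OF T_linear[OF chart_at(1) c chart_at(2) x(1,2)]])
      finally show False using v0 by simp
    qed
    have extnz: "ext_map (S q) w \<noteq> 0" if q: "q \<in> ?Q" and v0: "w \<noteq> 0" for q and w :: "real ^ ('p \<Rightarrow> 'n)"
    proof
      assume e: "ext_map (S q) w = 0"
      obtain x where x: "x \<in> fst ?c" "x \<in> Mi" "chart_inv ?c q = x" using Q[OF q] by blast
      have "w = ext_map (T (ca x) ?c x) (ext_map (S q) w)"
        unfolding S_def x(3) by (rule ext_T_inverse[OF c chart_at(1) x(1) chart_at(2) x(2), symmetric])
      also have "\<dots> = 0" unfolding e by (rule ext_map_zero)
      finally show False using v0 by simp
    qed
    have xl: "((\<lambda>p. chart_inv ?c (fst p)) \<longlongrightarrow> chart_inv ?c (fst p0)) (at p0 within ?Q \<times> R)"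
      if q: "fst p0 \<in> ?Q" for p0 :: "(real ^ 'n) \<times> 'z::topological_space" and R
    proof -
      obtain x where x: "x \<in> fst ?c" "x \<in> Mi" "fst p0 = snd ?c x" "chart_inv ?c (fst p0) = x" using Q[OF q] by blast
      have "((\<lambda>p. fst p) \<longlongrightarrow> snd ?c x) (at p0 within ?Q \<times> R)"
        using tendsto_fst[OF tendsto_ident_at, of p0 "?Q \<times> R"] x(3) by simp
      from isCont_tendsto_compose[OF chart_inv_isCont[OF c x(1,2)] this] show ?thesis using x(3) by simp
    qed
    have "continuous_on (?Q \<times> sphere 0 1) (\<lambda>(q, v). tn (chart_inv ?c q) (S q v))"
      unfolding continuous_on_def
    proof
      fix p0 :: "(real ^ 'n) \<times> (real ^ 'n)" assume p0: "p0 \<in> ?Q \<times> sphere 0 1"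
      then have q0: "fst p0 \<in> ?Q" by auto
      then have x: "chart_inv ?c (fst p0) \<in> Mi" "chart_inv ?c (fst p0) \<in> fst ?c" using Q by blast+
      have "tlim (at p0 within ?Q \<times> sphere 0 1) (\<lambda>p. chart_inv ?c (fst p)) (\<lambda>p. S (fst p) (snd p))
          (chart_inv ?c (fst p0)) (S (fst p0) (snd p0))"
        unfolding S_def by (rule tlim_frame[OF x(1) c x(2) xl[OF q0] tendsto_snd[OF tendsto_ident_at]])
      from tn_tendsto[OF x(1) this]
      show "((\<lambda>(q, v). tn (chart_inv ?c q) (S q v)) \<longlongrightarrow> (case p0 of (q, v) \<Rightarrow> tn (chart_inv ?c q) (S q v))) (at p0 within ?Q \<times> sphere 0 1)"
        unfolding case_prod_beta .
    qed
    moreover have "tn (chart_inv ?c q) (S q (s *\<^sub>R v)) = \<bar>s\<bar> * tn (chart_inv ?c q) (S q v)" if "q \<in> ?Q" for q s v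
      by (simp only: linear_scale[OF Slin[OF that]] tn_scaleR)
    moreover have "0 < tn (chart_inv ?c q) (S q v)" if "q \<in> ?Q" "v \<noteq> 0" for q v
      by (rule tn_pos[OF Snz[OF that]])
    ultimately have "\<exists>C. \<forall>q\<in>?Q. \<forall>v. tn (chart_inv ?c q) (S q v) = 1 \<longrightarrow> norm v \<le> C"
      by (rule homogeneous_bound[OF compact_cball])
    then obtain C where C: "\<And>q v. q \<in> ?Q \<Longrightarrow> tn (chart_inv ?c q) (S q v) = 1 \<Longrightarrow> norm v \<le> C" by blast
    have "continuous_on (?Q \<times> sphere 0 1) (\<lambda>(q, w :: real ^ ('p \<Rightarrow> 'n)). ext_norm (g (chart_inv ?c q)) (ext_map (S q) w))"
      unfolding continuous_on_def
    proof
      fix p0 :: "(real ^ 'n) \<times> (real ^ ('p \<Rightarrow> 'n))" assume p0: "p0 \<in> ?Q \<times> sphere 0 1"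
      then have q0: "fst p0 \<in> ?Q" by auto
      then have x: "chart_inv ?c (fst p0) \<in> Mi" "chart_inv ?c (fst p0) \<in> fst ?c" using Q by blast+
      have "extlim (at p0 within ?Q \<times> sphere 0 1) (\<lambda>p. chart_inv ?c (fst p)) (\<lambda>p. ext_map (S (fst p)) (snd p))
          (chart_inv ?c (fst p0)) (ext_map (S (fst p0)) (snd p0))"
        unfolding S_def by (rule extlim_frame[OF x(1) c x(2) xl[OF q0] tendsto_snd[OF tendsto_ident_at]])
      from ext_norm_extlim[OF x(1) this]
      show "((\<lambda>(q, w). ext_norm (g (chart_inv ?c q)) (ext_map (S q) w)) \<longlongrightarrow>
          (case p0 of (q, w) \<Rightarrow> ext_norm (g (chart_inv ?c q)) (ext_map (S q) w))) (at p0 within ?Q \<times> sphere 0 1)"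
        unfolding case_prod_beta .
    qed
    moreover have "ext_norm (g (chart_inv ?c q)) (ext_map (S q) (s *\<^sub>R w)) = \<bar>s\<bar> * ext_norm (g (chart_inv ?c q)) (ext_map (S q) w)"
      if "q \<in> ?Q" for q s and w :: "real ^ ('p \<Rightarrow> 'n)"
      by (simp only: ext_map_scaleR ext_norm_scaleR[OF inner_form_metric])
    moreover have "0 < ext_norm (g (chart_inv ?c q)) (ext_map (S q) w)" if "q \<in> ?Q" "w \<noteq> 0" for q and w :: "real ^ ('p \<Rightarrow> 'n)"
      by (rule ext_norm_pos[OF inner_form_metric extnz[OF that]])
    ultimately have "\<exists>C. \<forall>q\<in>?Q. \<forall>w :: real ^ ('p \<Rightarrow> 'n). ext_norm (g (chart_inv ?c q)) (ext_map (S q) w) = 1 \<longrightarrow> norm w \<le> C"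
      by (rule homogeneous_bound[OF compact_cball])
    then obtain C' where C': "\<And>q w. q \<in> ?Q \<Longrightarrow> ext_norm (g (chart_inv ?c q)) (ext_map (S q) (w :: real ^ ('p \<Rightarrow> 'n))) = 1 \<Longrightarrow> norm w \<le> C'"
      by blast
    show ?thesis
    proof (rule exI[of _ C], rule exI[of _ C'], intro ballI impI)
      fix k :: "('n, 'p) code" assume k: "k \<in> Kset m xs r" and ki: "fst k = real i"
      obtain y u v w where ke: "k = (real i, y, u, v, w)" using ki by (cases k) auto
      have y: "y \<in> ?Q" using k by (auto simp: Kset_def Kpre_def ke)
      have "\<Theta> xs k \<in> Zst" using k by (simp add: Kset_def)
      then have "tn (chart_inv ?c y) (S y u) = 1" "tn (chart_inv ?c y) (S y v) = 1" "ext_norm (g (chart_inv ?c y)) (ext_map (S y) w) = 1"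
        by (simp_all add: ke \<Theta>_def Let_def Zst_def S_def)
      then show "norm (fst (snd (snd k))) \<le> C \<and> norm (fst (snd (snd (snd k)))) \<le> C \<and> norm (snd (snd (snd (snd k)))) \<le> C'"
        using C[OF y] C'[OF y] by (simp add: ke)
    qed
  qed
  then obtain C C' where C: "\<And>i k. i < m \<Longrightarrow> k \<in> Kset m xs r \<Longrightarrow> fst k = real i \<Longrightarrow>
      norm (fst (snd (snd k))) \<le> C i \<and> norm (fst (snd (snd (snd k)))) \<le> C i \<and>
      norm (snd (snd (snd (snd (k :: ('n, 'p) code))))) \<le> C' i" by metis
  let ?B = "\<lambda>i. {real i} \<times> cball (snd (ca (xs i)) (xs i)) (r i) \<times> cball (0 :: real ^ 'n) (C i) \<times> cball (0 :: real ^ 'n) (C i) \<times>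
    cball (0 :: real ^ ('p \<Rightarrow> 'n)) (C' i)"
  have "Kset m xs r \<subseteq> (\<Union>i<m. ?B i)"
  proof
    fix k :: "('n, 'p) code" assume k: "k \<in> Kset m xs r"
    then obtain i where i: "i < m" "fst k = real i" "fst (snd k) \<in> cball (snd (ca (xs i)) (xs i)) (r i)"
      by (auto simp: Kset_def Kpre_def)
    have "k \<in> ?B i" using C[OF i(1) k i(2)] i(2,3) by (cases k) auto
    then show "k \<in> (\<Union>i<m. ?B i)" using i(1) by blast
  qed
  moreover have "bounded (\<Union>i<m. ?B i)"
    by (intro bounded_UN ballI bounded_Times bounded_cball) auto
  ultimately show ?thesis by (rule bounded_subset[rotated])
qed

text \<open>Limits of codes give limits of states by \<open>Theta_zlim\<close>, and the limit is a
  state by \<open>Zst_closed\<close> once its base point is known to lie in the closed set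
  \<open>\<Lambda>\<close>.\<close>

lemma Kset_compact:
  assumes cov: "good_cover m xs r"
  shows "compact (Kset m xs r :: ('n, 'p::finite) code set)"
  unfolding compact_eq_bounded_closed
proof (intro conjI Kset_bounded[OF cov])
  show "closed (Kset m xs r :: ('n, 'p) code set)"
    unfolding closed_sequential_limits
  proof (intro allI impI)
    fix k and k0 :: "('n, 'p) code" assume "(\<forall>n. k n \<in> Kset m xs r) \<and> k \<longlonglongrightarrow> k0"
    then have kK: "\<And>n. k n \<in> Kset m xs r" and k: "k \<longlonglongrightarrow> k0" by auto
    have "closed (\<Union>i<m. {real i} \<times> cball (snd (ca (xs i)) (xs i)) (r i) \<times> (UNIV :: ((real ^ 'n) \<times> (real ^ 'n) \<times> (real ^ ('p \<Rightarrow> 'n))) set))"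
      by (intro closed_UN ballI closed_Times) auto
    moreover have "(\<Union>i<m. {real i} \<times> cball (snd (ca (xs i)) (xs i)) (r i) \<times> (UNIV :: ((real ^ 'n) \<times> (real ^ 'n) \<times> (real ^ ('p \<Rightarrow> 'n))) set)) = Kpre m xs r"
      by (auto simp: Kpre_def)
    ultimately have "closed (Kpre m xs r :: ('n, 'p) code set)" by simp
    then have k0: "k0 \<in> Kpre m xs r"
      by (rule closed_sequentially[of _ k]) (use kK k in \<open>auto simp: Kset_def\<close>)
    have lim: "zlim sequentially (\<lambda>n. \<Theta> xs (k n)) (\<Theta> xs k0)"
      by (rule Theta_zlim[OF cov _ k0 k]) (use kK in \<open>simp add: Kset_def\<close>)
    have Z: "\<Theta> xs (k n) \<in> Zst" for n using kK by (simp add: Kset_def)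
    have "(\<lambda>n. fst (\<Theta> xs (k n))) \<longlonglongrightarrow> fst (\<Theta> xs k0)" using lim unfolding zlim_def tlim_def by blast
    moreover have "closed \<Lambda>" using compact_inv by (rule compact_imp_closed)
    moreover have "fst (\<Theta> xs (k n)) \<in> \<Lambda>" for n using Z[of n] by (auto simp: Zst_def)
    ultimately have "fst (\<Theta> xs k0) \<in> \<Lambda>"
      using Lim_in_closed_set[of \<Lambda> "\<lambda>n. fst (\<Theta> xs (k n))" sequentially] by auto
    then have "\<Theta> xs k0 \<in> Zst"
      by (rule Zst_closed[OF sequentially_bot _ _ lim]) (use Z in simp)
    then show "k0 \<in> Kset m xs r" using k0 by (simp add: Kset_def)
  qed
qed

text \<open>The hypothesis speaks of filters on pairs of time and code because continuity is tested
  along the punctured neighbourhoods of such a pair.\<close>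

lemma Theta_continuous:
  fixes h :: "real \<Rightarrow> ('m, 'n, 'p::finite) state \<Rightarrow> real"
  assumes cov: "good_cover m xs r"
    and h: "\<And>(G :: (real \<times> ('n, 'p) code) filter) \<tau> t \<zeta> z. (\<tau> \<longlongrightarrow> t) G \<Longrightarrow> eventually (\<lambda>n. \<zeta> n \<in> Zst) G \<Longrightarrow>
      z \<in> Zst \<Longrightarrow> zlim G \<zeta> z \<Longrightarrow> ((\<lambda>n. h (\<tau> n) (\<zeta> n)) \<longlongrightarrow> h t z) G"
  shows "continuous_on (UNIV \<times> Kset m xs r) (\<lambda>(t, k). h t (\<Theta> xs k))"
  unfolding continuous_on_def
proof
  fix p0 :: "real \<times> ('n, 'p) code" assume p0: "p0 \<in> UNIV \<times> Kset m xs r"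
  let ?G = "at p0 within UNIV \<times> Kset m xs r"
  have k0: "snd p0 \<in> Kset m xs r" using p0 by auto
  have "eventually (\<lambda>p. p \<in> UNIV \<times> Kset m xs r) ?G" by (simp add: eventually_at_filter)
  then have ev: "eventually (\<lambda>p. snd p \<in> Kset m xs r) ?G" by eventually_elim auto
  have "((\<lambda>p. h (fst p) (\<Theta> xs (snd p))) \<longlongrightarrow> h (fst p0) (\<Theta> xs (snd p0))) ?G"
  proof (rule h)
    show "((\<lambda>p. fst p) \<longlongrightarrow> fst p0) ?G" by (rule tendsto_fst[OF tendsto_ident_at])
    show "eventually (\<lambda>p. \<Theta> xs (snd p) \<in> Zst) ?G" using ev by eventually_elim (simp add: Kset_def)
    show "\<Theta> xs (snd p0) \<in> Zst" using k0 by (simp add: Kset_def)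
    show "zlim ?G (\<lambda>p. \<Theta> xs (snd p)) (\<Theta> xs (snd p0))"
      by (rule Theta_zlim[OF cov _ _ tendsto_snd[OF tendsto_ident_at]])
        (use ev k0 in \<open>auto simp: Kset_def elim: eventually_mono\<close>)
  qed
  then show "((\<lambda>(t, k). h t (\<Theta> xs k)) \<longlongrightarrow> (case p0 of (t, k) \<Rightarrow> h t (\<Theta> xs k))) ?G"
    unfolding case_prod_beta .
qed

theorem bundle_quotient_flow:
  assumes cov: "good_cover m xs r"
  shows "quotient_flow (Kset m xs r :: ('n, 'p::finite) code set) (\<Theta> xs) \<Psi>"
proof (rule quotient_flow.intro)
  show "compact (Kset m xs r :: ('n, 'p) code set)" by (rule Kset_compact[OF cov])
  fix z :: "('m, 'n, 'p) state" assume "z \<in> \<Theta> xs ` Kset m xs r"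
  then have z: "z \<in> Zst" unfolding Theta_image[OF cov] .
  show "\<Psi> t z \<in> \<Theta> xs ` Kset m xs r" for t unfolding Theta_image[OF cov] by (rule Psi_in[OF z])
  show "\<Psi> (s + t) z = \<Psi> s (\<Psi> t z)" for s t by (rule Psi_add[OF z])
  show "\<Psi> 0 z = z" by (rule Psi_zero[OF z])
next
  fix f :: "('m, 'n, 'p) state \<Rightarrow> real" assume f: "continuous_on (Kset m xs r) (f \<circ> \<Theta> xs)"
  show "continuous_on (UNIV \<times> Kset m xs r) (\<lambda>(t, k). f (\<Psi> t (\<Theta> xs k)))"
  proof (rule Theta_continuous[OF cov])
    fix G :: "(real \<times> ('n, 'p) code) filter" and \<tau> :: "real \<times> ('n, 'p) code \<Rightarrow> real" and t \<zeta> and z :: "('m, 'n, 'p) state"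
    assume a: "(\<tau> \<longlongrightarrow> t) G" "eventually (\<lambda>n. \<zeta> n \<in> Zst) G" "z \<in> Zst" "zlim G \<zeta> z"
    have "eventually (\<lambda>n. \<Psi> (\<tau> n) (\<zeta> n) \<in> Zst) G" using a(2) by eventually_elim (rule Psi_in)
    from continuous_zlim[OF cov f Psi_in[OF a(3)] this zlim_flow[OF a(3,2,1,4)]]
    show "((\<lambda>n. f (\<Psi> (\<tau> n) (\<zeta> n))) \<longlongrightarrow> f (\<Psi> t z)) G" .
  qed
qed

end

section \<open>Growth rates over the invariant set\<close>

lemma (in quotient_flow) cocycle_linear_bound:
  assumes a: "cocycle a"
  shows "\<exists>B. \<forall>z\<in>\<Theta> ` K. \<forall>t\<ge>0. \<bar>a t z\<bar> \<le> B * (t + 1)"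
proof -
  obtain B where B: "0 \<le> B" "\<And>t z. 0 \<le> t \<Longrightarrow> t \<le> 1 \<Longrightarrow> z \<in> \<Theta> ` K \<Longrightarrow> \<bar>a t z\<bar> \<le> B"
    by (rule cocycle_bounded[OF a, of 1]) (rule that)
  have n: "\<bar>a (s + real n) z\<bar> \<le> B * (real n + 1)" if "z \<in> \<Theta> ` K" "0 \<le> s" "s \<le> 1" for n s z
    using that(1)
  proof (induction n arbitrary: z)
    case 0
    then show ?case using B(2)[OF that(2,3)] by simp
  next
    case (Suc n)
    have "a (s + real (Suc n)) z = a (s + real n) (\<Psi> 1 z) + a 1 z"
      using cocycle_add[OF a Suc.prems, of "s + real n" 1] by (simp add: ac_simps)
    moreover have "\<bar>a 1 z\<bar> \<le> B" using B(2)[of 1 z] Suc.prems by simp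
    moreover have "\<bar>a (s + real n) (\<Psi> 1 z)\<bar> \<le> B * (real n + 1)" by (rule Suc.IH[OF flow_in[OF Suc.prems]])
    moreover have "B * (real (Suc n) + 1) = B * (real n + 1) + B" by (simp add: algebra_simps)
    ultimately show ?case by linarith
  qed
  have "\<bar>a t z\<bar> \<le> B * (t + 1)" if z: "z \<in> \<Theta> ` K" and t: "0 \<le> t" for t z
  proof -
    have "\<bar>a t z\<bar> \<le> B * (real (nat \<lfloor>t\<rfloor>) + 1)"
      using n[OF z, of "t - real (nat \<lfloor>t\<rfloor>)" "nat \<lfloor>t\<rfloor>"] t of_int_floor_le[of t] floor_correct[of t] by simp
    also have "\<dots> \<le> B * (t + 1)" using t B(1) by (intro mult_left_mono) auto
    finally show ?thesis .
  qed
  then show ?thesis by blast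
qed

text \<open>By Urysohn's lemma each point of an open set has a continuous function that is positive
  there and zero outside the set. By Lindelof's theorem countably many of these positivity sets fill
  the open set, so measurability of real functions of \<open>f\<close> is enough.\<close>

lemma open_measurable_compact_Hausdorff:
  fixes f :: "'z \<Rightarrow> 'm::{t2_space, second_countable_topology}"
  assumes compact: "compact (UNIV :: 'm set)"
    and f: "\<And>h :: 'm \<Rightarrow> real. continuous_on UNIV h \<Longrightarrow> (\<lambda>z. h (f z)) \<in> borel_measurable M"
  shows "f \<in> borel_measurable M"
proof (rule borel_measurableI)
  fix S :: "'m set" assume S: "open S"
  have "Hausdorff_space (euclidean :: 'm topology)"
    unfolding Hausdorff_space_def disjnt_def using hausdorff by (metis open_openin)
  then have normal: "normal_space (euclidean :: 'm topology)"
    by (intro compact_Hausdorff_or_regular_imp_normal_space) (use compact in \<open>auto simp: compact_space_def\<close>)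
  have "\<exists>h :: 'm \<Rightarrow> real. continuous_on UNIV h \<and> 0 < h x \<and> (\<forall>y. y \<notin> S \<longrightarrow> h y = 0)" if x: "x \<in> S" for x
  proof -
    have "disjnt (- S) {x}" using x by (auto simp: disjnt_def)
    moreover have "closedin euclidean (- S)" "closedin euclidean {x}" using S by auto
    ultimately obtain h where h: "continuous_map euclidean (top_of_set {0..1::real}) h" "h ` (- S) \<subseteq> {0}" "h ` {x} \<subseteq> {1}"
      using Urysohn_lemma[OF normal, of "- S" "{x}" 0 1] by auto
    have "continuous_on UNIV h" using h(1) by (simp add: continuous_map_in_subtopology)
    then show ?thesis using h by (intro exI[of _ h]) auto
  qed
  then obtain h :: "'m \<Rightarrow> 'm \<Rightarrow> real" where h: "\<And>x. x \<in> S \<Longrightarrow> continuous_on UNIV (h x)" "\<And>x. x \<in> S \<Longrightarrow> 0 < h x x"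
    "\<And>x y. x \<in> S \<Longrightarrow> y \<notin> S \<Longrightarrow> h x y = 0" by metis
  have op: "open U" if "U \<in> (\<lambda>x. {y. 0 < h x y}) ` S" for U
    using that h(1) by (auto intro!: open_Collect_less continuous_intros)
  obtain \<F> where \<F>: "\<F> \<subseteq> (\<lambda>x. {y. 0 < h x y}) ` S" "countable \<F>" "\<Union>\<F> = \<Union>((\<lambda>x. {y. 0 < h x y}) ` S)"
    using Lindelof[of "(\<lambda>x. {y. 0 < h x y}) ` S"] op by blast
  have "\<Union>((\<lambda>x. {y. 0 < h x y}) ` S) = S"
  proof
    show "\<Union>((\<lambda>x. {y. 0 < h x y}) ` S) \<subseteq> S" using h(3) by fastforce
    show "S \<subseteq> \<Union>((\<lambda>x. {y. 0 < h x y}) ` S)" using h(2) by blast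
  qed
  then have "f -` S \<inter> space M = (\<Union>U\<in>\<F>. f -` U \<inter> space M)" using \<F>(3) by blast
  also have "\<dots> \<in> sets M"
  proof (rule sets.countable_UN''[OF \<F>(2)])
    fix U assume "U \<in> \<F>"
    then obtain x where x: "x \<in> S" "U = {y. 0 < h x y}" using \<F>(1) by blast
    have "(\<lambda>z. h x (f z)) \<in> borel_measurable M" by (rule f[OF h(1)[OF x(1)]])
    then have "{z \<in> space M. 0 < h x (f z)} \<in> sets M" by measurable
    also have "{z \<in> space M. 0 < h x (f z)} = f -` U \<inter> space M" using x(2) by auto
    finally show "f -` U \<inter> space M \<in> sets M" .
  qed
  finally show "f -` S \<inter> space M \<in> sets M" .
qed

locale flow_bundle = flow_splitting A g X \<Lambda> E F
  for A :: "('m::{t2_space, second_countable_topology}, 'n::finite) chart set"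
    and g :: "('m, 'n) metric_field"
    and X :: "('m, 'n) vector_field"
    and \<Lambda> :: "'m set"
    and E F :: "'m \<Rightarrow> (real ^ 'n) set" +
  fixes p :: "'p::finite itself"
  assumes dim_F: "x \<in> \<Lambda> \<Longrightarrow> CARD('p) \<le> dim (F x)"
begin

abbreviation Z :: "('m, 'n, 'p) state set" where "Z \<equiv> Zst"

text \<open>Choosing one cover once turns the code set into a constant of the locale, over which
  \<open>quotient_flow\<close> can be interpreted.\<close>

definition cover :: "nat \<times> (nat \<Rightarrow> 'm) \<times> (nat \<Rightarrow> real)" where
  "cover = (SOME c. good_cover (fst c) (fst (snd c)) (snd (snd c)))"

abbreviation K0 :: "('n, 'p) code set" where "K0 \<equiv> Kset (fst cover) (fst (snd cover)) (snd (snd cover))"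
abbreviation \<Theta>0 :: "('n, 'p) code \<Rightarrow> ('m, 'n, 'p) state" where "\<Theta>0 \<equiv> \<Theta> (fst (snd cover))"

lemma cover: "good_cover (fst cover) (fst (snd cover)) (snd (snd cover))"
proof -
  obtain m xs r where "good_cover m xs r" using good_cover_exists by blast
  then have "\<exists>c. good_cover (fst c) (fst (snd c)) (snd (snd c))" by (intro exI[of _ "(m, xs, r)"]) simp
  then show ?thesis unfolding cover_def by (rule someI_ex)
qed

sublocale Q: quotient_flow K0 \<Theta>0 \<Psi>
  by (rule bundle_quotient_flow[OF cover])

lemma image_Z: "\<Theta>0 ` K0 = Z"
  by (rule Theta_image[OF cover])

definition dE :: "real \<Rightarrow> ('m, 'n, 'p) state \<Rightarrow> real" where
  "dE t z = ln (tn (\<phi> t (fst z)) (D t (fst z) (fst (snd z))))"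

definition dF :: "real \<Rightarrow> ('m, 'n, 'p) state \<Rightarrow> real" where
  "dF t z = ln (tn (\<phi> t (fst z)) (D t (fst z) (fst (snd (snd z)))))"

definition dW :: "real \<Rightarrow> ('m, 'n, 'p) state \<Rightarrow> real" where
  "dW t z = ln (ext_norm (g (\<phi> t (fst z))) (ext_map (D t (fst z)) (snd (snd (snd z)))))"

lemma cocycleI:
  fixes d :: "real \<Rightarrow> ('m, 'n, 'p) state \<Rightarrow> real"
  assumes add: "\<And>s t z. z \<in> Z \<Longrightarrow> d (s + t) z = d s (\<Psi> t z) + d t z"
    and lim: "\<And>(G :: (real \<times> ('n, 'p) code) filter) \<tau> t \<zeta> z. (\<tau> \<longlongrightarrow> t) G \<Longrightarrow> eventually (\<lambda>n. \<zeta> n \<in> Zst) G \<Longrightarrow>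
      z \<in> Zst \<Longrightarrow> zlim G \<zeta> z \<Longrightarrow> ((\<lambda>n. d (\<tau> n) (\<zeta> n)) \<longlongrightarrow> d t z) G"
  shows "Q.cocycle d"
  unfolding Q.cocycle_def image_Z
  using add Theta_continuous[OF cover, of d, OF lim] by blast

lemma state_limits:
  fixes z :: "('m, 'n, 'p) state"
  assumes z: "z \<in> Z" and ev: "eventually (\<lambda>n. \<zeta> n \<in> Z) G" and \<tau>: "(\<tau> \<longlongrightarrow> t) G" and lim: "zlim G \<zeta> z"
  shows "((\<lambda>n. dE (\<tau> n) (\<zeta> n)) \<longlongrightarrow> dE t z) G" "((\<lambda>n. dF (\<tau> n) (\<zeta> n)) \<longlongrightarrow> dF t z) G"
    "((\<lambda>n. dW (\<tau> n) (\<zeta> n)) \<longlongrightarrow> dW t z) G"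
proof -
  obtain x u v w where ze: "z = (x, u, v, w)" and x: "x \<in> \<Lambda>" and u: "u \<noteq> 0" and v: "v \<noteq> 0" and w: "w \<noteq> 0"
    by (rule ZstD[OF z]) (rule that)
  note fM = in_Mi[OF flow_Lambda[OF x], of t]
  have ev': "eventually (\<lambda>n. fst (\<zeta> n) \<in> \<Lambda>) G" using ev by eventually_elim (auto simp: Zst_def)
  have l: "tlim G (\<lambda>n. fst (\<zeta> n)) (\<lambda>n. fst (snd (\<zeta> n))) x u"
    "tlim G (\<lambda>n. fst (\<zeta> n)) (\<lambda>n. fst (snd (snd (\<zeta> n)))) x v"
    "extlim G (\<lambda>n. fst (\<zeta> n)) (\<lambda>n. snd (snd (snd (\<zeta> n)))) x w"
    using lim unfolding zlim_def ze by simp_all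
  have nz: "tn (\<phi> t x) (D t x u) \<noteq> 0" "tn (\<phi> t x) (D t x v) \<noteq> 0" "ext_norm (g (\<phi> t x)) (ext_map (D t x) w) \<noteq> 0"
    using tn_pos[OF D_nonzero[OF x u], of "\<phi> t x" t] tn_pos[OF D_nonzero[OF x v], of "\<phi> t x" t]
      ext_norm_pos[OF inner_form_metric[of "\<phi> t x"] ext_D_nonzero[OF x w, of t]] by simp_all
  show "((\<lambda>n. dE (\<tau> n) (\<zeta> n)) \<longlongrightarrow> dE t z) G"
    unfolding dE_def ze fst_conv snd_conv by (rule tendsto_ln[OF tn_tendsto[OF fM tlim_flow[OF x ev' \<tau> l(1)]] nz(1)])
  show "((\<lambda>n. dF (\<tau> n) (\<zeta> n)) \<longlongrightarrow> dF t z) G"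
    unfolding dF_def ze fst_conv snd_conv by (rule tendsto_ln[OF tn_tendsto[OF fM tlim_flow[OF x ev' \<tau> l(2)]] nz(2)])
  show "((\<lambda>n. dW (\<tau> n) (\<zeta> n)) \<longlongrightarrow> dW t z) G"
    unfolding dW_def ze fst_conv snd_conv by (rule tendsto_ln[OF ext_norm_extlim[OF fM extlim_flow[OF x ev' \<tau> l(3)]] nz(3)])
qed

lemma d_add:
  fixes z :: "('m, 'n, 'p) state"
  assumes z: "z \<in> Z"
  shows "dE (s + t) z = dE s (\<Psi> t z) + dE t z" "dF (s + t) z = dF s (\<Psi> t z) + dF t z"
    "dW (s + t) z = dW s (\<Psi> t z) + dW t z"
proof -
  obtain x u v w where ze: "z = (x, u, v, w)" and x: "x \<in> \<Lambda>" and u: "u \<noteq> 0" and v: "v \<noteq> 0" and w: "w \<noteq> 0"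
    by (rule ZstD[OF z]) (rule that)
  have pos: "0 < tn (\<phi> t x) (D t x u)" "0 < tn (\<phi> t x) (D t x v)" "0 < ext_norm (g (\<phi> t x)) (ext_map (D t x) w)" for t
    using tn_pos D_nonzero[OF x] u v w ext_norm_pos[OF inner_form_metric ext_D_nonzero[OF x]] by blast+
  have cancel: "ln (\<bar>1 / a\<bar> * b) = ln b - ln a" if "0 < a" "0 < b" for a b :: real
    using that by (simp add: ln_div)
  show "dE (s + t) z = dE s (\<Psi> t z) + dE t z"
    unfolding dE_def ze \<Psi>_def prod.case fst_conv snd_conv linear_scale[OF Dflow_linear[OF flow_Lambda[OF x]]] tn_scaleR
      flow_add[OF x, symmetric] Dflow_add[OF x, symmetric] cancel[OF pos(1) pos(1)] by simp
  show "dF (s + t) z = dF s (\<Psi> t z) + dF t z"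
    unfolding dF_def ze \<Psi>_def prod.case fst_conv snd_conv linear_scale[OF Dflow_linear[OF flow_Lambda[OF x]]] tn_scaleR
      flow_add[OF x, symmetric] Dflow_add[OF x, symmetric] cancel[OF pos(2) pos(2)] by simp
  show "dW (s + t) z = dW s (\<Psi> t z) + dW t z"
    unfolding dW_def ze \<Psi>_def prod.case fst_conv snd_conv ext_map_scaleR ext_norm_scaleR[OF inner_form_metric]
      flow_add[OF x, symmetric] ext_D_add[OF x, symmetric] cancel[OF pos(3) pos(3)] by simp
qed

lemma d_cocycle: "Q.cocycle dE" "Q.cocycle dF" "Q.cocycle dW"
  "Q.cocycle (\<lambda>t z. dE t z - dF t z)" "Q.cocycle (\<lambda>t z. - dW t z)"
proof -
  show "Q.cocycle dE" by (rule cocycleI[OF d_add(1) state_limits(1)])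
  show "Q.cocycle dF" by (rule cocycleI[OF d_add(2) state_limits(2)])
  show "Q.cocycle dW" by (rule cocycleI[OF d_add(3) state_limits(3)])
  show "Q.cocycle (\<lambda>t z. dE t z - dF t z)"
    by (rule cocycleI) (simp add: d_add, intro tendsto_diff state_limits)
  show "Q.cocycle (\<lambda>t z. - dW t z)"
    by (rule cocycleI) (simp add: d_add, intro tendsto_minus state_limits)
qed

lemma flow_measurable_Lambda: "\<phi> t \<in> measurable (restrict_space borel \<Lambda>) (restrict_space borel \<Lambda>)"
proof (rule measurable_restrict_space2)
  show "\<phi> t \<in> space (restrict_space borel \<Lambda>) \<rightarrow> \<Lambda>" using flow_Lambda by (auto simp: space_restrict_space)
  have "continuous_on \<Lambda> (\<phi> t)" using flow_isCont by (blast intro: continuous_at_imp_continuous_on)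
  then show "\<phi> t \<in> borel_measurable (restrict_space borel \<Lambda>)" by (rule borel_measurable_continuous_on_restrict)
qed

lemma fst_measurable:
  assumes "sets \<nu> = sets (quotient_baire K0 \<Theta>0)"
  shows "fst \<in> measurable \<nu> (restrict_space borel \<Lambda>)"
proof -
  have sp: "space \<nu> = Z" using sets_eq_imp_space_eq[OF assms] image_Z by simp
  have "fst \<in> borel_measurable \<nu>"
  proof (rule open_measurable_compact_Hausdorff[OF compact_UNIV])
    fix h :: "'m \<Rightarrow> real" assume h: "continuous_on UNIV h"
    have "continuous_on (UNIV \<times> K0) (\<lambda>(t :: real, k). h (fst (\<Theta>0 k)))"
    proof (rule Theta_continuous[OF cover, of "\<lambda>_ z. h (fst z)"])
      fix G :: "(real \<times> ('n, 'p) code) filter" and \<tau> :: "real \<times> ('n, 'p) code \<Rightarrow> real" and t \<zeta> and z :: "('m, 'n, 'p) state"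
      assume "zlim G \<zeta> z"
      then have "((\<lambda>n. fst (\<zeta> n)) \<longlongrightarrow> fst z) G" unfolding zlim_def tlim_def by blast
      then show "((\<lambda>n. h (fst (\<zeta> n))) \<longlongrightarrow> h (fst z)) G"
        using h continuous_on_tendsto_compose[of UNIV h "\<lambda>n. fst (\<zeta> n)" "fst z" G] by simp
    qed
    then have "continuous_on K0 (\<lambda>k. (\<lambda>(t, k). h (fst (\<Theta>0 k))) (0::real, k))"
      by (rule continuous_on_compose2) (auto intro!: continuous_intros)
    then have "continuous_on K0 ((\<lambda>z. h (fst z)) \<circ> \<Theta>0)" by (simp add: comp_def)
    from measurable_from_quotient_baire[OF this]
    show "(\<lambda>z. h (fst z)) \<in> borel_measurable \<nu>" using measurable_cong_sets[OF assms refl] by blast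
  qed
  then show ?thesis
    by (rule measurable_restrict_space2[rotated]) (auto simp: sp Zst_def)
qed

text \<open>The base projection intertwines \<open>\<Psi> t\<close> with \<open>\<phi> t\<close>, so
  the hypothesis of total probability, which concerns measures on \<open>\<Lambda>\<close>, can be
  brought to bear on the states.\<close>

lemma projection_invariant:
  assumes "Q.invariant_prob \<nu>"
  shows "invariant_probability A X \<Lambda> (distr \<nu> (restrict_space borel \<Lambda>) fst)"
proof -
  let ?R = "restrict_space borel \<Lambda>"
  have \<nu>: "prob_space \<nu>" "sets \<nu> = sets (quotient_baire K0 \<Theta>0)" "\<Psi> t \<in> measurable \<nu> \<nu>" "distr \<nu> \<nu> (\<Psi> t) = \<nu>" for t
    using assms unfolding Q.invariant_prob_def by blast+
  note f = fst_measurable[OF \<nu>(2)]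
  have sp: "space \<nu> = Z" using sets_eq_imp_space_eq[OF \<nu>(2)] image_Z by simp
  have "distr (distr \<nu> ?R fst) (distr \<nu> ?R fst) (\<phi> t) = distr \<nu> ?R fst" for t
  proof -
    have "distr (distr \<nu> ?R fst) (distr \<nu> ?R fst) (\<phi> t) = distr (distr \<nu> ?R fst) ?R (\<phi> t)"
      by (rule distr_cong) auto
    also have "\<dots> = distr \<nu> ?R (\<phi> t \<circ> fst)" by (rule distr_distr[OF flow_measurable_Lambda f])
    also have "\<dots> = distr \<nu> ?R (fst \<circ> \<Psi> t)"
      by (rule distr_cong) (auto simp: \<Psi>_def split: prod.splits)
    also have "\<dots> = distr (distr \<nu> \<nu> (\<Psi> t)) ?R fst" by (rule distr_distr[OF f \<nu>(3), symmetric])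
    also have "\<dots> = distr \<nu> ?R fst" unfolding \<nu>(4) ..
    finally show ?thesis .
  qed
  then show ?thesis
    unfolding invariant_probability_def using prob_space.prob_space_distr[OF \<nu>(1) f] by simp
qed

text \<open>The pushed-down measure gives \<open>Y\<close> full measure, so almost every state lies
  over \<open>Y\<close> and has growth rates for all three of its vectors. If each such state had a
  negative rate for \<open>d\<close>, the rate would be negative almost everywhere, which the
  measure excludes.\<close>

lemma nonuniform_imp_state:
  assumes d: "Q.cocycle d" and non: "\<not> (\<exists>C. \<exists>l>0. \<forall>z\<in>Z. \<forall>t>0. d t z \<le> C - l * t)"
    and Y: "total_probability A X \<Lambda> Y"
  obtains z \<alpha> \<beta> \<gamma> where "z \<in> Z" "fst z \<in> Y" "((\<lambda>t. dE t z / t) \<longlongrightarrow> \<alpha>) at_top" "((\<lambda>t. dF t z / t) \<longlongrightarrow> \<beta>) at_top"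
    "((\<lambda>t. dW t z / t) \<longlongrightarrow> \<gamma>) at_top" "\<And>l. ((\<lambda>t. d t z / t) \<longlongrightarrow> l) at_top \<Longrightarrow> 0 \<le> l"
proof -
  obtain \<nu> where \<nu>: "Q.invariant_prob \<nu>"
    and lim: "\<And>a. Q.cocycle a \<Longrightarrow> AE z in \<nu>. \<exists>l. ((\<lambda>t. a t z / t) \<longlongrightarrow> l) at_top"
    and neg: "\<not> (AE z in \<nu>. \<exists>l<0. ((\<lambda>t. d t z / t) \<longlongrightarrow> l) at_top)"
    by (rule Q.nonuniform_imp_nonnegative_average[OF d non[folded image_Z]]) (rule that, assumption+)
  let ?R = "restrict_space borel \<Lambda>"
  have \<nu>': "prob_space \<nu>" "sets \<nu> = sets (quotient_baire K0 \<Theta>0)"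
    using \<nu> unfolding Q.invariant_prob_def by blast+
  interpret prob_space \<nu> by fact
  note f = fst_measurable[OF \<nu>'(2)]
  have sp: "space \<nu> = Z" using sets_eq_imp_space_eq[OF \<nu>'(2)] image_Z by simp
  have m: "measure (distr \<nu> ?R fst) Y = 1"
    using Y projection_invariant[OF \<nu>] unfolding total_probability_def by blast
  \<comment> \<open>\<open>measure\<close> is 0 on sets that are not measurable, so the value 1
    already shows that \<open>Y\<close> is measurable.\<close>
  then have Ys: "Y \<in> sets ?R" using measure_notin_sets[of Y "distr \<nu> ?R fst"] by auto
  have "prob (fst -` Y \<inter> space \<nu>) = 1" using m measure_distr[OF f Ys] by simp
  then have "AE z in \<nu>. z \<in> fst -` Y \<inter> space \<nu>"
    using AE_in_set_eq_1 measurable_sets[OF f Ys] by blast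
  then have AE: "AE z in \<nu>. z \<in> Z \<and> fst z \<in> Y \<and> (\<exists>l. ((\<lambda>t. dE t z / t) \<longlongrightarrow> l) at_top) \<and>
      (\<exists>l. ((\<lambda>t. dF t z / t) \<longlongrightarrow> l) at_top) \<and> (\<exists>l. ((\<lambda>t. dW t z / t) \<longlongrightarrow> l) at_top)"
    using lim[OF d_cocycle(1)] lim[OF d_cocycle(2)] lim[OF d_cocycle(3)] by eventually_elim (auto simp: sp)
  have "\<exists>z. z \<in> Z \<and> fst z \<in> Y \<and> (\<exists>l. ((\<lambda>t. dE t z / t) \<longlongrightarrow> l) at_top) \<and>
      (\<exists>l. ((\<lambda>t. dF t z / t) \<longlongrightarrow> l) at_top) \<and> (\<exists>l. ((\<lambda>t. dW t z / t) \<longlongrightarrow> l) at_top) \<and>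
      (\<forall>l. ((\<lambda>t. d t z / t) \<longlongrightarrow> l) at_top \<longrightarrow> 0 \<le> l)"
  proof (rule ccontr)
    assume no: "\<not> ?thesis"
    have "AE z in \<nu>. \<exists>l<0. ((\<lambda>t. d t z / t) \<longlongrightarrow> l) at_top"
      using AE by eventually_elim (use no in \<open>meson not_le\<close>)
    then show False using neg by blast
  qed
  then show thesis using that by blast
qed

section \<open>Unit vectors in the fibres, operator norm and co-norm\<close>

lemma unit_ex: "v \<noteq> 0 \<Longrightarrow> tn x ((1 / tn x v) *\<^sub>R v) = 1"
  using tn_pos[of v x] by (simp add: tn_scaleR)

lemma unit_E: "x \<in> \<Lambda> \<Longrightarrow> \<exists>u\<in>E x. tn x u = 1"
proof -
  assume x: "x \<in> \<Lambda>"
  have "E x \<noteq> {0}" using splitting x unfolding continuous_invariant_splitting_def by blast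
  then obtain u where "u \<in> E x" "u \<noteq> 0" using subspace_0[OF subspace_E[OF x]] by blast
  then show ?thesis using unit_ex[of u x] subspace_scale[OF subspace_E[OF x], of u] by blast
qed

lemma unit_F: "x \<in> \<Lambda> \<Longrightarrow> \<exists>v\<in>F x. tn x v = 1"
proof -
  assume x: "x \<in> \<Lambda>"
  have "F x \<noteq> {0}" using splitting x unfolding continuous_invariant_splitting_def by blast
  then obtain u where "u \<in> F x" "u \<noteq> 0" using subspace_0[OF subspace_F[OF x]] by blast
  then show ?thesis using unit_ex[of u x] subspace_scale[OF subspace_F[OF x], of u] by blast
qed

lemma unit_wedge:
  fixes e :: "'p \<Rightarrow> real ^ 'n"
  assumes e: "orthonormal_basis (g x) e P" and P: "P \<subseteq> F x"
  shows "wedge e \<in> ext_power (F x)" "ext_norm (g x) (wedge e) = 1"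
proof -
  have "e a \<in> F x" for a using e P unfolding orthonormal_basis_def by (metis rangeI span_base subsetD)
  then show "wedge e \<in> ext_power (F x)" unfolding ext_power_def by (intro span_base) blast
  show "ext_norm (g x) (wedge e) = 1" by (rule ext_norm_wedge_orthonormal[OF inner_form_metric e])
qed

text \<open>The bound on the dimension of \<open>F x\<close> makes its exterior power nonzero.
  Without a unit \<open>w\<close> there would be no states over \<open>x\<close>, and nothing could
  be read off for \<open>u\<close> and \<open>v\<close> either.\<close>

lemma unit_ext: "x \<in> \<Lambda> \<Longrightarrow> \<exists>w\<in>ext_power (F x). ext_norm (g x) (w :: real ^ ('p \<Rightarrow> 'n)) = 1"
proof -
  assume x: "x \<in> \<Lambda>"
  obtain P where P: "subspace P" "P \<subseteq> span (F x)" "dim P = CARD('p)"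
    using choose_subspace_of_subspace[OF dim_F[OF x]] by blast
  obtain e :: "'p \<Rightarrow> real ^ 'n" where "orthonormal_basis (g x) e P"
    by (rule orthonormal_basis_exists[OF inner_form_metric P(1,3)]) (rule that)
  moreover have "P \<subseteq> F x" using P(2) subspace_F[OF x] by (simp add: span_eq_iff[THEN iffD2])
  ultimately show ?thesis using unit_wedge by blast
qed

lemma state_EF:
  assumes "x \<in> \<Lambda>" "u \<in> E x" "tn x u = 1" "v \<in> F x" "tn x v = 1"
  shows "\<exists>w. (x, u, v, w) \<in> Z"
  using unit_ext[OF assms(1)] assms by (auto simp: Zst_def)

lemma state_E: "x \<in> \<Lambda> \<Longrightarrow> u \<in> E x \<Longrightarrow> tn x u = 1 \<Longrightarrow> \<exists>v w. (x, u, v, w) \<in> Z"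
  using unit_F state_EF by meson

lemma state_F: "x \<in> \<Lambda> \<Longrightarrow> v \<in> F x \<Longrightarrow> tn x v = 1 \<Longrightarrow> \<exists>u w. (x, u, v, w) \<in> Z"
  using unit_E state_EF by meson

lemma state_W: "x \<in> \<Lambda> \<Longrightarrow> w \<in> ext_power (F x) \<Longrightarrow> ext_norm (g x) w = 1 \<Longrightarrow> \<exists>u v. (x, u, v, w) \<in> Z"
  using unit_E[of x] unit_F[of x] by (auto simp: Zst_def)

text \<open>For fixed \<open>x\<close> and \<open>t\<close> the bound is uniform over unit vectors,
  which makes the set under the supremum in \<open>restr_norm\<close> bounded above.\<close>

lemma growth_E:
  "\<exists>B. \<forall>x\<in>\<Lambda>. \<forall>t\<ge>0. \<forall>u\<in>E x. tn x u = 1 \<longrightarrow> \<bar>ln (tn (\<phi> t x) (D t x u))\<bar> \<le> B * (t + 1)"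
proof -
  obtain B where B: "\<forall>z\<in>Z. \<forall>t\<ge>0. \<bar>dE t z\<bar> \<le> B * (t + 1)"
    using Q.cocycle_linear_bound[OF d_cocycle(1)] unfolding image_Z by blast
  have "\<bar>ln (tn (\<phi> t x) (D t x u))\<bar> \<le> B * (t + 1)" if "x \<in> \<Lambda>" "0 \<le> t" "u \<in> E x" "tn x u = 1" for x t u
  proof -
    have "\<exists>v w. (x, u, v, w) \<in> Z" by (rule state_E[OF that(1,3,4)])
    then show ?thesis using B that(2) by (fastforce simp: dE_def)
  qed
  then show ?thesis by blast
qed

lemma growth_F:
  "\<exists>B. \<forall>x\<in>\<Lambda>. \<forall>t\<ge>0. \<forall>v\<in>F x. tn x v = 1 \<longrightarrow> \<bar>ln (tn (\<phi> t x) (D t x v))\<bar> \<le> B * (t + 1)"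
proof -
  obtain B where B: "\<forall>z\<in>Z. \<forall>t\<ge>0. \<bar>dF t z\<bar> \<le> B * (t + 1)"
    using Q.cocycle_linear_bound[OF d_cocycle(2)] unfolding image_Z by blast
  have "\<bar>ln (tn (\<phi> t x) (D t x v))\<bar> \<le> B * (t + 1)" if "x \<in> \<Lambda>" "0 \<le> t" "v \<in> F x" "tn x v = 1" for x t v
  proof -
    have "\<exists>u w. (x, u, v, w) \<in> Z" by (rule state_F[OF that(1,3,4)])
    then show ?thesis using B that(2) by (fastforce simp: dF_def)
  qed
  then show ?thesis by blast
qed

lemma D_pos: "x \<in> \<Lambda> \<Longrightarrow> tn x v = 1 \<Longrightarrow> 0 < tn (\<phi> t x) (D t x v)"
  using tn_pos[OF D_nonzero[of x v t], of "\<phi> t x"] tn_zero[of x] by (cases "v = 0") simp_all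

lemma E_le_restr_norm:
  assumes x: "x \<in> \<Lambda>" "0 \<le> t" and u: "u \<in> E x" "tn x u = 1"
  shows "tn (\<phi> t x) (D t x u) \<le> restr_norm g x (\<phi> t x) (D t x) (E x)"
proof -
  obtain B where B: "\<And>u. u \<in> E x \<Longrightarrow> tn x u = 1 \<Longrightarrow> \<bar>ln (tn (\<phi> t x) (D t x u))\<bar> \<le> B"
    using growth_E x by blast
  have "tn (\<phi> t x) (D t x u) \<le> exp B" if "u \<in> E x" "tn x u = 1" for u
    using B[OF that] D_pos[OF x(1) that(2), of t] by (metis abs_le_D1 exp_le_cancel_iff exp_ln)
  then show ?thesis
    unfolding restr_norm_def by (intro cSUP_upper bdd_aboveI2[of _ _ "exp B"]) (use u in auto)
qed

lemma restr_norm_E_pos: "x \<in> \<Lambda> \<Longrightarrow> 0 \<le> t \<Longrightarrow> 0 < restr_norm g x (\<phi> t x) (D t x) (E x)"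
  using unit_E E_le_restr_norm D_pos by (meson less_le_trans)

lemma restr_conorm_F_le: "x \<in> \<Lambda> \<Longrightarrow> v \<in> F x \<Longrightarrow> tn x v = 1 \<Longrightarrow> restr_conorm g x (\<phi> t x) (D t x) (F x) \<le> tn (\<phi> t x) (D t x v)"
  unfolding restr_conorm_def by (intro cINF_lower bdd_belowI2[of _ 0]) (auto simp: tn_nonneg)

text \<open>The linear bound on the logarithm keeps the upper rate of the co-norm finite, which
  matters when extended reals are subtracted in \<open>dominated_gap\<close>.\<close>

lemma restr_conorm_F_bounds:
  "\<exists>B. \<forall>x\<in>\<Lambda>. \<forall>t\<ge>0. 0 < restr_conorm g x (\<phi> t x) (D t x) (F x) \<and>
    \<bar>ln (restr_conorm g x (\<phi> t x) (D t x) (F x))\<bar> \<le> B * (t + 1)"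
proof -
  obtain B where B: "\<And>x t v. x \<in> \<Lambda> \<Longrightarrow> 0 \<le> t \<Longrightarrow> v \<in> F x \<Longrightarrow> tn x v = 1 \<Longrightarrow> \<bar>ln (tn (\<phi> t x) (D t x v))\<bar> \<le> B * (t + 1)"
    using growth_F by blast
  have "0 < restr_conorm g x (\<phi> t x) (D t x) (F x) \<and> \<bar>ln (restr_conorm g x (\<phi> t x) (D t x) (F x))\<bar> \<le> B * (t + 1)"
    if x: "x \<in> \<Lambda>" and t: "0 \<le> t" for x t
  proof -
    let ?c = "restr_conorm g x (\<phi> t x) (D t x) (F x)"
    have "exp (- (B * (t + 1))) \<le> tn (\<phi> t x) (D t x v)" if "v \<in> F x" "tn x v = 1" for v
      using B[OF x t that] D_pos[OF x that(2), of t] by (metis abs_le_D2 exp_le_cancel_iff exp_ln minus_le_iff)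
    then have lo: "exp (- (B * (t + 1))) \<le> ?c"
      unfolding restr_conorm_def by (intro cINF_greatest) (use unit_F[OF x] in auto)
    then have c: "0 < ?c" using exp_gt_zero less_le_trans by blast
    obtain v where v: "v \<in> F x" "tn x v = 1" using unit_F[OF x] by blast
    have "ln ?c \<le> ln (tn (\<phi> t x) (D t x v))" using restr_conorm_F_le[OF x v] c by (simp add: ln_mono)
    then have "ln ?c \<le> B * (t + 1)" using B[OF x t v] by linarith
    moreover have "- (B * (t + 1)) \<le> ln ?c" using lo c by (simp add: ln_ge_iff)
    ultimately show ?thesis using c by linarith
  qed
  then show ?thesis by blast
qed

text \<open>Domination is stated with backward norms on \<open>F\<close>, while the cocycles run
  forward: normalising the preimage of a unit vector turns its backward growth into the reciprocal
  of a forward growth.\<close>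

lemma F_backward:
  assumes x: "x \<in> \<Lambda>" and v: "v \<in> F (\<phi> t x)" "tn (\<phi> t x) v = 1"
  shows "\<exists>v'\<in>F x. tn x v' = 1 \<and> tn x (D (- t) (\<phi> t x) v) = 1 / tn (\<phi> t x) (D t x v')"
proof -
  obtain v0 where v0: "v0 \<in> F x" "v = D t x v0" using v(1) D_F[OF x, of t] by blast
  have b: "D (- t) (\<phi> t x) v = v0" using Dflow_inverse[OF x] v0(2) by simp
  have "v0 \<noteq> 0" using v0(2) v(2) linear_0[OF Dflow_linear[OF x]] tn_zero by auto
  then have p: "0 < tn x v0" by (rule tn_pos)
  have "tn (\<phi> t x) (D t x ((1 / tn x v0) *\<^sub>R v0)) = 1 / tn x v0"
    using p v(2) by (simp add: linear_scale[OF Dflow_linear[OF x]] tn_scaleR v0(2)[symmetric])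
  then show ?thesis
    using unit_ex[OF \<open>v0 \<noteq> 0\<close>] subspace_scale[OF subspace_F[OF x] v0(1)] p b by (intro bexI[of _ "(1 / tn x v0) *\<^sub>R v0"]) auto
qed

lemma F_le_restr_norm_backward:
  assumes x: "x \<in> \<Lambda>" "0 \<le> t" and v: "v \<in> F x" "tn x v = 1"
  shows "1 / tn (\<phi> t x) (D t x v) \<le> restr_norm g (\<phi> t x) x (D (- t) (\<phi> t x)) (F (\<phi> t x))"
proof -
  let ?s = "tn (\<phi> t x) (D t x v)"
  have s: "0 < ?s" by (rule D_pos[OF x(1) v(2)])
  obtain B where B: "\<And>u. u \<in> F x \<Longrightarrow> tn x u = 1 \<Longrightarrow> \<bar>ln (tn (\<phi> t x) (D t x u))\<bar> \<le> B"
    using growth_F x by blast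
  have bd: "tn x (D (- t) (\<phi> t x) v') \<le> exp B" if v': "v' \<in> F (\<phi> t x)" "tn (\<phi> t x) v' = 1" for v'
  proof -
    obtain u where u: "u \<in> F x" "tn x u = 1" "tn x (D (- t) (\<phi> t x) v') = 1 / tn (\<phi> t x) (D t x u)"
      using F_backward[OF x(1) v'] by blast
    have p: "0 < tn (\<phi> t x) (D t x u)" by (rule D_pos[OF x(1) u(2)])
    have "- B \<le> ln (tn (\<phi> t x) (D t x u))" using B[OF u(1,2)] by linarith
    then have "exp (- B) \<le> tn (\<phi> t x) (D t x u)" using p by (simp add: ln_ge_iff)
    then show ?thesis using p by (simp add: u(3) exp_minus field_simps)
  qed
  have "1 / ?s = tn x (D (- t) (\<phi> t x) ((1 / ?s) *\<^sub>R D t x v))"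
    using s v(2) by (simp add: linear_scale[OF Dflow_linear[OF flow_Lambda[OF x(1)]]] tn_scaleR Dflow_inverse[OF x(1)])
  also have "\<dots> \<le> restr_norm g (\<phi> t x) x (D (- t) (\<phi> t x)) (F (\<phi> t x))"
    unfolding restr_norm_def
  proof (rule cSUP_upper)
    show "(1 / ?s) *\<^sub>R D t x v \<in> {v \<in> F (\<phi> t x). tn (\<phi> t x) v = 1}"
      using subbundle_scale(2)[OF x(1) v(1)] s by (simp add: tn_scaleR)
    show "bdd_above ((\<lambda>v. tn x (D (- t) (\<phi> t x) v)) ` {v \<in> F (\<phi> t x). tn (\<phi> t x) v = 1})"
      by (rule bdd_aboveI2[of _ _ "exp B"]) (use bd in auto)
  qed
  finally show ?thesis .
qed

end

section \<open>From uniform cocycle bounds to singular hyperbolicity\<close>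

context flow_bundle begin

lemma uniform_E_contracted:
  assumes "\<exists>C. \<exists>l>0. \<forall>z\<in>Z. \<forall>t>0. dE t z \<le> C - l * t"
  shows "uniformly_contracted A g X \<Lambda> E"
proof -
  obtain C l where l: "0 < l" and C: "\<And>z t. z \<in> Z \<Longrightarrow> 0 < t \<Longrightarrow> dE t z \<le> C - l * t" using assms by blast
  have "restr_norm g x (\<phi> t x) (D t x) (E x) \<le> exp C * exp (- l * t)" if x: "x \<in> \<Lambda>" and t: "0 < t" for x t
    unfolding restr_norm_def
  proof (rule cSUP_least)
    show "{v \<in> E x. tn x v = 1} \<noteq> {}" using unit_E[OF x] by blast
    fix u assume "u \<in> {v \<in> E x. tn x v = 1}"
    then have u: "u \<in> E x" "tn x u = 1" by auto
    obtain v w where "(x, u, v, w) \<in> Z" using state_E[OF x u] by blast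
    from C[OF this t] have "ln (tn (\<phi> t x) (D t x u)) \<le> C - l * t" by (simp add: dE_def)
    then have "tn (\<phi> t x) (D t x u) \<le> exp (C - l * t)" using D_pos[OF x u(2), of t] by (metis exp_le_cancel_iff exp_ln)
    then show "tn (\<phi> t x) (D t x u) \<le> exp C * exp (- l * t)" by (simp add: mult_exp_exp)
  qed
  then show ?thesis
    unfolding uniformly_contracted_def by (intro exI[of _ "exp C"] exI[of _ l] conjI ballI allI impI l exp_gt_zero) auto
qed

text \<open>A state carries \<open>u\<close> and \<open>v\<close> over the same point, chosen
  independently. So the bound on \<open>dE - dF\<close> holds for every pair, and the suprema over
  \<open>u\<close> and over \<open>v\<close> can be taken separately.\<close>

lemma uniform_difference_dominated:
  assumes "\<exists>C. \<exists>l>0. \<forall>z\<in>Z. \<forall>t>0. dE t z - dF t z \<le> C - l * t"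
  shows "dominated_splitting A g X \<Lambda> E F"
proof -
  obtain C l where l: "0 < l" and C: "\<And>z t. z \<in> Z \<Longrightarrow> 0 < t \<Longrightarrow> dE t z - dF t z \<le> C - l * t" using assms by blast
  \<comment> \<open>The factor 2 makes the inequality strict, as domination requires.\<close>
  have "restr_norm g x (\<phi> t x) (D t x) (E x) * restr_norm g (\<phi> t x) x (D (- t) (\<phi> t x)) (F (\<phi> t x)) < 2 * exp C * exp (- l * t)"
    if x: "x \<in> \<Lambda>" and t: "0 < t" for x t
  proof -
    let ?a = "restr_norm g x (\<phi> t x) (D t x) (E x)" and ?c = "exp (C - l * t)"
    have a: "0 < ?a" using restr_norm_E_pos[OF x, of t] t by simp
    have "restr_norm g (\<phi> t x) x (D (- t) (\<phi> t x)) (F (\<phi> t x)) \<le> ?c / ?a"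
      unfolding restr_norm_def[of g "\<phi> t x" x]
    proof (rule cSUP_least)
      show "{v \<in> F (\<phi> t x). tn (\<phi> t x) v = 1} \<noteq> {}" using unit_F[OF flow_Lambda[OF x]] by blast
      fix v' assume "v' \<in> {v \<in> F (\<phi> t x). tn (\<phi> t x) v = 1}"
      then have "v' \<in> F (\<phi> t x)" "tn (\<phi> t x) v' = 1" by auto
      from F_backward[OF x this] obtain v where v: "v \<in> F x" "tn x v = 1"
        "tn x (D (- t) (\<phi> t x) v') = 1 / tn (\<phi> t x) (D t x v)" by blast
      let ?s = "tn (\<phi> t x) (D t x v)"
      have s: "0 < ?s" by (rule D_pos[OF x v(2)])
      have "?a \<le> ?c * ?s"
        unfolding restr_norm_def[of g x "\<phi> t x"]
      proof (rule cSUP_least)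
        show "{v \<in> E x. tn x v = 1} \<noteq> {}" using unit_E[OF x] by blast
        fix u assume "u \<in> {v \<in> E x. tn x v = 1}"
        then have u: "u \<in> E x" "tn x u = 1" by auto
        obtain w where "(x, u, v, w) \<in> Z" using state_EF[OF x u v(1,2)] by blast
        from C[OF this t] have "ln (tn (\<phi> t x) (D t x u)) \<le> (C - l * t) + ln ?s" by (simp add: dE_def dF_def)
        then have "tn (\<phi> t x) (D t x u) \<le> exp ((C - l * t) + ln ?s)"
          using D_pos[OF x u(2), of t] by (metis exp_le_cancel_iff exp_ln)
        also have "\<dots> = ?c * ?s" using s by (simp add: exp_add)
        finally show "tn (\<phi> t x) (D t x u) \<le> ?c * ?s" .
      qed
      then have "1 / ?s \<le> ?c / ?a" using s a by (simp add: divide_le_eq le_divide_eq mult.commute)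
      then show "tn x (D (- t) (\<phi> t x) v') \<le> ?c / ?a" unfolding v(3) .
    qed
    then have "?a * restr_norm g (\<phi> t x) x (D (- t) (\<phi> t x)) (F (\<phi> t x)) \<le> ?c" using a by (simp add: field_simps)
    also have "?c < 2 * exp C * exp (- l * t)" by (simp add: mult.assoc mult_exp_exp)
    finally show ?thesis .
  qed
  then show ?thesis
    unfolding dominated_splitting_def
    by (intro conjI splitting exI[of _ "2 * exp C"] exI[of _ l] ballI allI impI l) auto
qed

lemma abs_det_flow:
  fixes e :: "'p \<Rightarrow> real ^ 'n"
  assumes x: "x \<in> \<Lambda>" and P: "subspace P" "dim P = CARD('p)" and e: "orthonormal_basis (g x) e P"
  shows "abs_det_restr TYPE('p) g x (\<phi> t x) (D t x) P = ext_norm (g (\<phi> t x)) (ext_map (D t x) (wedge e))"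
  by (rule abs_det_restr_eq[where g=g, OF inner_form_metric inner_form_metric Dflow_linear[OF x] _ P e])
    (metis inj_onI Dflow_inverse[OF x])

lemma uniform_W_expanding:
  assumes "\<exists>C. \<exists>l>0. \<forall>z\<in>Z. \<forall>t>0. - dW t z \<le> C - l * t"
  shows "sectionally_expanding TYPE('p) A g X \<Lambda> F"
proof -
  obtain C l where l: "0 < l" and C: "\<And>z t. z \<in> Z \<Longrightarrow> 0 < t \<Longrightarrow> - dW t z \<le> C - l * t" using assms by blast
  \<comment> \<open>Halving the constant makes the inequality strict.\<close>
  have "exp (- C) / 2 * exp (l * t) < abs_det_restr TYPE('p) g x (\<phi> t x) (D t x) P"
    if t: "0 < t" and x: "x \<in> \<Lambda>" and P: "subspace P" "P \<subseteq> F x" "dim P = CARD('p)" for x t P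
  proof -
    obtain e :: "'p \<Rightarrow> real ^ 'n" where e: "orthonormal_basis (g x) e P"
      by (rule orthonormal_basis_exists[OF inner_form_metric P(1,3)]) (rule that)
    note w = unit_wedge[OF e P(2)]
    have "ext_norm (g x) (0 :: real ^ ('p \<Rightarrow> 'n)) = 0" by (rule ext_norm_zero[OF inner_form_metric])
    then have "wedge e \<noteq> 0" using w(2) by auto
    then have p: "0 < ext_norm (g (\<phi> t x)) (ext_map (D t x) (wedge e))"
      by (intro ext_norm_pos[OF inner_form_metric] ext_D_nonzero[OF x])
    obtain u v where "(x, u, v, wedge e) \<in> Z" using state_W[OF x w] by blast
    from C[OF this t] have "- C + l * t \<le> ln (ext_norm (g (\<phi> t x)) (ext_map (D t x) (wedge e)))" by (simp add: dW_def)
    then have "exp (- C + l * t) \<le> ext_norm (g (\<phi> t x)) (ext_map (D t x) (wedge e))" using p by (simp add: ln_ge_iff)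
    moreover have "exp (- C) / 2 * exp (l * t) < exp (- C + l * t)" unfolding exp_add by simp
    ultimately show ?thesis unfolding abs_det_flow[OF x P(1,3) e] by linarith
  qed
  then show ?thesis
    unfolding sectionally_expanding_def
    by (intro exI[of _ "exp (- C) / 2"] exI[of _ l] conjI allI ballI impI l) auto
qed

lemma total_probability_imp_singular_hyperbolic:
  assumes Y: "total_probability A X \<Lambda> Y"
    and gap: "\<And>x. x \<in> Y \<Longrightarrow>
        Liminf at_top (\<lambda>t. ereal (1 / t * ln (restr_norm g x (\<phi> t x) (D t x) (E x))))
        - Limsup at_top (\<lambda>t. ereal (1 / t * ln (restr_conorm g x (\<phi> t x) (D t x) (F x)))) < 0"
    and neg: "\<And>x r. x \<in> Y \<Longrightarrow> r \<in> lyapunov_exponents A g X E x \<Longrightarrow> r < 0"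
    and pos: "\<And>x r. x \<in> Y \<Longrightarrow> r \<in> sectional_lyapunov_exponents TYPE('p) A g X F x \<Longrightarrow> 0 < r"
  shows "singular_hyperbolic TYPE('p) A g X \<Lambda> E F"
proof -
  have "\<exists>C. \<exists>l>0. \<forall>z\<in>Z. \<forall>t>0. dE t z \<le> C - l * t"
  proof (rule ccontr)
    assume non: "\<not> ?thesis"
    obtain z \<alpha> where z: "z \<in> Z" "fst z \<in> Y" "((\<lambda>t. dE t z / t) \<longlongrightarrow> \<alpha>) at_top"
      "\<And>l. ((\<lambda>t. dE t z / t) \<longlongrightarrow> l) at_top \<Longrightarrow> 0 \<le> l"
      by (rule nonuniform_imp_state[OF d_cocycle(1) non Y]) (rule that, assumption+)
    obtain x u v w where ze: "z = (x, u, v, w)" "u \<in> E x" "u \<noteq> 0" by (rule ZstD[OF z(1)]) (rule that)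
    have "\<alpha> \<in> lyapunov_exponents A g X E x"
      unfolding lyapunov_exponents_def using z(3) ze by (auto simp: dE_def intro!: bexI[of _ u])
    then show False using neg[of x \<alpha>] z(4)[OF z(3)] z(2) ze(1) by simp
  qed
  moreover have "\<exists>C. \<exists>l>0. \<forall>z\<in>Z. \<forall>t>0. - dW t z \<le> C - l * t"
  proof (rule ccontr)
    assume non: "\<not> ?thesis"
    obtain z \<gamma> where z: "z \<in> Z" "fst z \<in> Y" "((\<lambda>t. dW t z / t) \<longlongrightarrow> \<gamma>) at_top"
      "\<And>l. ((\<lambda>t. - dW t z / t) \<longlongrightarrow> l) at_top \<Longrightarrow> 0 \<le> l"
      by (rule nonuniform_imp_state[OF d_cocycle(5) non Y]) (rule that, assumption+)
    obtain x u v w where ze: "z = (x, u, v, w)" "w \<in> ext_power (F x)" "w \<noteq> 0" by (rule ZstD[OF z(1)]) (rule that)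
    have "\<gamma> \<in> sectional_lyapunov_exponents TYPE('p) A g X F x"
      unfolding sectional_lyapunov_exponents_def using z(3) ze by (auto simp: dW_def intro!: bexI[of _ w])
    moreover have "((\<lambda>t. - dW t z / t) \<longlongrightarrow> - \<gamma>) at_top" using tendsto_minus[OF z(3)] by simp
    ultimately show False using pos[of x \<gamma>] z(4) z(2) ze(1) by force
  qed
  moreover have "\<exists>C. \<exists>l>0. \<forall>z\<in>Z. \<forall>t>0. dE t z - dF t z \<le> C - l * t"
  proof (rule ccontr)
    assume non: "\<not> ?thesis"
    obtain z \<alpha> \<beta> where z: "z \<in> Z" "fst z \<in> Y" "((\<lambda>t. dE t z / t) \<longlongrightarrow> \<alpha>) at_top" "((\<lambda>t. dF t z / t) \<longlongrightarrow> \<beta>) at_top"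
      "\<And>l. ((\<lambda>t. (dE t z - dF t z) / t) \<longlongrightarrow> l) at_top \<Longrightarrow> 0 \<le> l"
      by (rule nonuniform_imp_state[OF d_cocycle(4) non Y]) (rule that, assumption+)
    obtain x u v w where ze: "z = (x, u, v, w)" "x \<in> \<Lambda>" "u \<in> E x" "tn x u = 1" "v \<in> F x" "tn x v = 1"
      by (rule ZstD[OF z(1)]) (rule that)
    let ?a = "\<lambda>t. restr_norm g x (\<phi> t x) (D t x) (E x)" and ?b = "\<lambda>t. restr_conorm g x (\<phi> t x) (D t x) (F x)"
    obtain B where B: "\<And>t. 0 \<le> t \<Longrightarrow> 0 < ?b t" using restr_conorm_F_bounds ze(2) by blast
    have "((\<lambda>t. (dE t z - dF t z) / t) \<longlongrightarrow> \<alpha> - \<beta>) at_top"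
      using tendsto_diff[OF z(3,4)] by (simp add: diff_divide_distrib)
    then have ge: "0 \<le> \<alpha> - \<beta>" by (rule z(5))
    \<comment> \<open>A single unit vector bounds the operator norm from below and the co-norm from
      above, so \<open>\<alpha>\<close> is at most the lower limit and \<open>\<beta>\<close> at
      least the upper limit in condition (1).\<close>
    have "ereal \<alpha> = Liminf at_top (\<lambda>t. ereal (dE t z / t))"
      using z(3) by (intro lim_imp_Liminf[symmetric]) auto
    also have "\<dots> \<le> Liminf at_top (\<lambda>t. ereal (1 / t * ln (?a t)))"
    proof (rule Liminf_mono)
      show "\<forall>\<^sub>F t in at_top. ereal (dE t z / t) \<le> ereal (1 / t * ln (?a t))"
        using eventually_gt_at_top[of 0]
      proof eventually_elim
        case (elim t)
        have "ln (tn (\<phi> t x) (D t x u)) \<le> ln (?a t)"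
          using E_le_restr_norm[OF ze(2) _ ze(3,4), of t] D_pos[OF ze(2,4), of t] elim by (intro ln_mono) auto
        then show ?case using elim by (simp add: dE_def ze(1) divide_right_mono)
      qed
    qed
    finally have a: "ereal \<alpha> \<le> Liminf at_top (\<lambda>t. ereal (1 / t * ln (?a t)))" .
    have "Limsup at_top (\<lambda>t. ereal (1 / t * ln (?b t))) \<le> Limsup at_top (\<lambda>t. ereal (dF t z / t))"
    proof (rule Limsup_mono)
      show "\<forall>\<^sub>F t in at_top. ereal (1 / t * ln (?b t)) \<le> ereal (dF t z / t)"
        using eventually_gt_at_top[of 0]
      proof eventually_elim
        case (elim t)
        have "ln (?b t) \<le> ln (tn (\<phi> t x) (D t x v))"
          using restr_conorm_F_le[OF ze(2,5,6), of t] B[of t] elim by (intro ln_mono) auto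
        then show ?case using elim by (simp add: dF_def ze(1) divide_right_mono)
      qed
    qed
    also have "\<dots> = ereal \<beta>"
      using z(4) by (intro lim_imp_Limsup) auto
    finally have b: "Limsup at_top (\<lambda>t. ereal (1 / t * ln (?b t))) \<le> ereal \<beta>" .
    have "0 \<le> ereal \<alpha> - ereal \<beta>" using ge by simp
    also have "\<dots> \<le> Liminf at_top (\<lambda>t. ereal (1 / t * ln (?a t))) - Limsup at_top (\<lambda>t. ereal (1 / t * ln (?b t)))"
      by (rule ereal_minus_mono[OF a b])
    also have "\<dots> < 0" using gap[of x] z(2) ze(1) by simp
    finally show False by simp
  qed
  ultimately show ?thesis
    unfolding singular_hyperbolic_def partially_hyperbolic_splitting_def
    using uniform_E_contracted uniform_difference_dominated uniform_W_expanding by blast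
qed

text \<open>The factors of a wedge may be linearly dependent, while sectional expansion speaks only
  of subspaces of dimension \<open>CARD('p)\<close>; a basis of the span of the factors is therefore
  enlarged inside \<open>S\<close>.\<close>

lemma subspace_containing:
  fixes u :: "'p \<Rightarrow> real ^ 'n"
  assumes S: "subspace S" "CARD('p) \<le> dim S" and u: "\<And>a. u a \<in> S"
  obtains P where "subspace P" "P \<subseteq> S" "dim P = CARD('p)" "\<And>a. u a \<in> P"
proof -
  obtain B where B: "B \<subseteq> range u" "independent B" "range u \<subseteq> span B"
    by (rule maximal_independent_subset) (rule that)
  have "B \<subseteq> S" using B(1) u by blast
  then obtain C where C: "B \<subseteq> C" "C \<subseteq> S" "independent C" "S \<subseteq> span C"
    by (rule maximal_independent_subset_extend[OF _ B(2)]) (rule that)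
  have fin: "finite C" using C(3) by (rule independent_imp_finite)
  have "card C = dim S" using basis_card_eq_dim[OF C(2,4,3)] by simp
  moreover have "card B \<le> CARD('p)" using card_mono[OF _ B(1)] card_image_le[of UNIV u] by simp
  ultimately obtain Q where Q: "B \<subseteq> Q" "Q \<subseteq> C" "card Q = CARD('p)"
    using exists_subset_between[OF _ _ C(1) fin] S(2) by metis
  show thesis
  proof (rule that[of "span Q"])
    show "span Q \<subseteq> S" using span_minimal[OF _ S(1)] Q(2) C(2) by blast
    show "dim (span Q) = CARD('p)"
      using dim_eq_card_independent[OF independent_mono[OF C(3) Q(2)]] Q(3) by simp
    show "u a \<in> span Q" for a using B(3) span_mono[OF Q(1)] by blast
  qed simp
qed

text \<open>Sums of wedges can cancel, so a lower bound would not pass to them. This is why the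
  inverse map is estimated, first on wedges with constant \<open>1 / c\<close>, and then on all
  \<open>p\<close>-vectors through \<open>ext_power_decomposable_bound\<close>.\<close>

lemma expanding_ext:
  assumes sec: "\<And>P. subspace P \<Longrightarrow> P \<subseteq> F x \<Longrightarrow> dim P = CARD('p) \<Longrightarrow>
      c < abs_det_restr TYPE('p) g x (\<phi> t x) (D t x) P"
    and c: "0 < c" and x: "x \<in> \<Lambda>" and w: "(w :: real ^ ('p \<Rightarrow> 'n)) \<in> ext_power (F x)"
  shows "c * ext_norm (g x) w \<le> (real CARD('p \<Rightarrow> 'n))\<^sup>2 * fact CARD('p) * ext_norm (g (\<phi> t x)) (ext_map (D t x) w)"
proof -
  let ?y = "\<phi> t x"
  have le: "ext_norm (g x) (ext_map (D (- t) ?y) (wedge v)) \<le> (1 / c) * ext_norm (g ?y) (wedge v)"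
    if v: "\<And>a. v a \<in> F ?y" for v :: "'p \<Rightarrow> real ^ 'n"
  proof -
    define u where "u a = D (- t) ?y (v a)" for a
    have uF: "u a \<in> F x" for a
      using D_F[OF flow_Lambda[OF x], of "- t" t] v[of a] flow_inverse(1)[OF x, of t] unfolding u_def by auto
    obtain P where P: "subspace P" "P \<subseteq> F x" "dim P = CARD('p)" "\<And>a. u a \<in> P"
      by (rule subspace_containing[OF subspace_F[OF x] dim_F[OF x], of u, OF uF]) (rule that, assumption+)
    obtain e :: "'p \<Rightarrow> real ^ 'n" where e: "orthonormal_basis (g x) e P"
      by (rule orthonormal_basis_exists[OF inner_form_metric P(1,3)]) (rule that)
    \<comment> \<open>The exterior power of a \<open>p\<close>-dimensional subspace is a line,
      spanned by one unit wedge; the case of dependent factors is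
      \<open>\<kappa> = 0\<close>.\<close>
    obtain \<kappa> where \<kappa>: "wedge u = \<kappa> *\<^sub>R wedge e"
      using wedge_lincomb[of u _ e, OF orthonormal_basis_expand[OF inner_form_metric e P(4)]] by blast
    have wu: "ext_map (D (- t) ?y) (wedge v) = wedge u"
      unfolding u_def by (rule ext_map_wedge[OF Dflow_linear[OF flow_Lambda[OF x]]])
    have "wedge v = ext_map (D t x) (wedge u)"
      unfolding ext_map_wedge[OF Dflow_linear[OF x]] u_def Dflow_inverse'[OF x] ..
    then have "ext_norm (g ?y) (wedge v) = \<bar>\<kappa>\<bar> * ext_norm (g ?y) (ext_map (D t x) (wedge e))"
      by (simp add: \<kappa> ext_map_scaleR ext_norm_scaleR[OF inner_form_metric])
    also have "\<dots> \<ge> \<bar>\<kappa>\<bar> * c"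
      using sec[OF P(1-3)] unfolding abs_det_flow[OF x P(1,3) e] by (intro mult_left_mono) auto
    finally have "\<bar>\<kappa>\<bar> * c \<le> ext_norm (g ?y) (wedge v)" .
    moreover have "ext_norm (g x) (wedge u) = \<bar>\<kappa>\<bar>"
      by (simp add: \<kappa> ext_norm_scaleR[OF inner_form_metric] ext_norm_wedge_orthonormal[OF inner_form_metric e])
    ultimately show ?thesis unfolding wu using c by (simp add: field_simps)
  qed
  have "ext_map (D t x) w \<in> ext_power (F ?y)" using ext_map_ext_power[OF Dflow_linear[OF x] w] D_F[OF x] by metis
  from ext_power_decomposable_bound[OF inner_form_metric subspace_F[OF flow_Lambda[OF x]] this,
      where N="\<lambda>w. ext_norm (g x) (ext_map (D (- t) ?y) w)" and c="1 / c", OF _ _ le]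
  have "ext_norm (g x) (ext_map (D (- t) ?y) (ext_map (D t x) w)) \<le>
      (real CARD('p \<Rightarrow> 'n))\<^sup>2 * fact CARD('p) * (1 / c) * ext_norm (g ?y) (ext_map (D t x) w)"
    using c by (simp add: ext_map_scaleR ext_map_sum ext_norm_scaleR[OF inner_form_metric] ext_norm_sum_le[OF inner_form_metric])
  then show ?thesis unfolding ext_D_inverse[OF x] using c by (simp add: field_simps)
qed

section \<open>Exponents and rates of a singular hyperbolic set\<close>

lemma tendsto_const_over_t: "((\<lambda>t. C / t) \<longlongrightarrow> (0::real)) at_top"
  by (rule tendsto_divide_0[OF tendsto_const filterlim_at_top_imp_at_infinity[OF filterlim_ident]])

lemma exponent_le:
  fixes q :: "real \<Rightarrow> real"
  assumes lim: "((\<lambda>t. 1 / t * ln (q t)) \<longlongrightarrow> r) at_top"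
    and le: "\<And>t. 0 < t \<Longrightarrow> 0 < q t \<and> q t \<le> C * exp (- l * t)" and C: "0 < C"
  shows "r \<le> - l"
proof (rule tendsto_le[OF _ _ lim, of "\<lambda>t. ln C / t - l"])
  show "((\<lambda>t. ln C / t - l) \<longlongrightarrow> - l) at_top"
    using tendsto_diff[OF tendsto_const_over_t tendsto_const] by simp
  show "\<forall>\<^sub>F t in at_top. 1 / t * ln (q t) \<le> ln C / t - l"
    using eventually_gt_at_top[of 0]
  proof eventually_elim
    case (elim t)
    have "ln (q t) \<le> ln (C * exp (- l * t))" using le[OF elim] C by (intro ln_mono) auto
    also have "\<dots> = ln C - l * t" using C by (simp add: ln_mult)
    finally show ?case using elim by (simp add: field_simps)
  qed
qed simp

lemma exponent_ge:
  fixes q :: "real \<Rightarrow> real"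
  assumes lim: "((\<lambda>t. 1 / t * ln (q t)) \<longlongrightarrow> r) at_top"
    and ge: "\<And>t. 0 < t \<Longrightarrow> C * exp (l * t) \<le> q t" and C: "0 < C"
  shows "l \<le> r"
proof (rule tendsto_le[OF _ lim, of "\<lambda>t. ln C / t + l"])
  show "((\<lambda>t. ln C / t + l) \<longlongrightarrow> l) at_top"
    using tendsto_add[OF tendsto_const_over_t tendsto_const] by simp
  show "\<forall>\<^sub>F t in at_top. ln C / t + l \<le> 1 / t * ln (q t)"
    using eventually_gt_at_top[of 0]
  proof eventually_elim
    case (elim t)
    have "ln C + l * t = ln (C * exp (l * t))" using C by (simp add: ln_mult)
    also have "\<dots> \<le> ln (q t)" using ge[OF elim] C by (intro ln_mono) auto
    finally have "(ln C + l * t) / t \<le> ln (q t) / t" using elim by (intro divide_right_mono) auto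
    then show ?case using elim by (simp add: add_divide_distrib)
  qed
qed simp

lemma contracted_exponents:
  assumes con: "uniformly_contracted A g X \<Lambda> E" and x: "x \<in> \<Lambda>" and r: "r \<in> lyapunov_exponents A g X E x"
  shows "r < 0"
proof -
  obtain K l where K: "0 < K" "0 < l" "\<And>t. 0 < t \<Longrightarrow> restr_norm g x (\<phi> t x) (D t x) (E x) \<le> K * exp (- l * t)"
    using con x unfolding uniformly_contracted_def by blast
  obtain v where v: "v \<in> E x" "v \<noteq> 0" "((\<lambda>t. 1 / t * ln (tn (\<phi> t x) (D t x v))) \<longlongrightarrow> r) at_top"
    using r unfolding lyapunov_exponents_def by blast
  have p: "0 < tn x v" by (rule tn_pos[OF v(2)])
  have "0 < tn (\<phi> t x) (D t x v) \<and> tn (\<phi> t x) (D t x v) \<le> (K * tn x v) * exp (- l * t)" if t: "0 < t" for t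
  proof
    show "0 < tn (\<phi> t x) (D t x v)" by (rule tn_pos[OF D_nonzero[OF x v(2)]])
    have "tn (\<phi> t x) (D t x ((1 / tn x v) *\<^sub>R v)) \<le> restr_norm g x (\<phi> t x) (D t x) (E x)"
      using t by (intro E_le_restr_norm[OF x] subspace_scale[OF subspace_E[OF x] v(1)] unit_ex[OF v(2)]) simp
    then have "tn (\<phi> t x) (D t x ((1 / tn x v) *\<^sub>R v)) \<le> K * exp (- l * t)" using K(3)[OF t] by linarith
    then have "tn (\<phi> t x) (D t x v) / tn x v \<le> K * exp (- l * t)"
      using p by (simp add: linear_scale[OF Dflow_linear[OF x]] tn_scaleR)
    then show "tn (\<phi> t x) (D t x v) \<le> (K * tn x v) * exp (- l * t)" using p by (simp add: field_simps)
  qed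
  from exponent_le[OF v(3) this] show ?thesis using K p by simp
qed

lemma expanding_exponents:
  assumes exp: "sectionally_expanding TYPE('p) A g X \<Lambda> F" and x: "x \<in> \<Lambda>"
    and r: "r \<in> sectional_lyapunov_exponents TYPE('p) A g X F x"
  shows "0 < r"
proof -
  obtain C l where C: "0 < C" "0 < l" "\<And>t P. 0 < t \<Longrightarrow> subspace P \<Longrightarrow> P \<subseteq> F x \<Longrightarrow> dim P = CARD('p) \<Longrightarrow>
      C * exp (l * t) < abs_det_restr TYPE('p) g x (\<phi> t x) (D t x) P"
    using exp x unfolding sectionally_expanding_def by blast
  obtain w :: "real ^ ('p \<Rightarrow> 'n)" where w: "w \<in> ext_power (F x)" "w \<noteq> 0"
    "((\<lambda>t. 1 / t * ln (ext_norm (g (\<phi> t x)) (ext_map (D t x) w))) \<longlongrightarrow> r) at_top"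
    using r unfolding sectional_lyapunov_exponents_def by blast
  define M :: real where "M = (real CARD('p \<Rightarrow> 'n))\<^sup>2 * fact CARD('p)"
  have M: "0 < M" unfolding M_def by (simp add: zero_less_card_finite)
  have p: "0 < ext_norm (g x) w" by (rule ext_norm_pos[OF inner_form_metric w(2)])
  have "(C * ext_norm (g x) w / M) * exp (l * t) \<le> ext_norm (g (\<phi> t x)) (ext_map (D t x) w)" if t: "0 < t" for t
  proof -
    have "C * exp (l * t) * ext_norm (g x) w \<le> M * ext_norm (g (\<phi> t x)) (ext_map (D t x) w)"
      unfolding M_def by (rule expanding_ext[OF C(3)[OF t] _ x w(1)]) (use C(1) in simp_all)
    then have "C * exp (l * t) * ext_norm (g x) w / M \<le> ext_norm (g (\<phi> t x)) (ext_map (D t x) w)"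
      using M by (simp add: divide_le_eq mult.commute)
    then show ?thesis by (simp add: ac_simps)
  qed
  from exponent_ge[OF w(3) this] show ?thesis using C M p by simp
qed

text \<open>The co-norm on \<open>F\<close> is at least the reciprocal of the backward norm, so
  domination puts the rate of the operator norm on \<open>E\<close> below that of the co-norm by
  \<open>l\<close>, up to \<open>ln K / t\<close>. The bound is obtained for the upper limit of the
  first rate and passes to its lower limit.\<close>

lemma dominated_gap:
  assumes dom: "dominated_splitting A g X \<Lambda> E F" and x: "x \<in> \<Lambda>"
  shows "Liminf at_top (\<lambda>t. ereal (1 / t * ln (restr_norm g x (\<phi> t x) (D t x) (E x))))
    - Limsup at_top (\<lambda>t. ereal (1 / t * ln (restr_conorm g x (\<phi> t x) (D t x) (F x)))) < 0"
proof -
  let ?a = "\<lambda>t. restr_norm g x (\<phi> t x) (D t x) (E x)" and ?b = "\<lambda>t. restr_conorm g x (\<phi> t x) (D t x) (F x)"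
    and ?R = "\<lambda>t. restr_norm g (\<phi> t x) x (D (- t) (\<phi> t x)) (F (\<phi> t x))"
  obtain K l where K: "0 < K" "0 < l" "\<And>t. 0 < t \<Longrightarrow> ?a t * ?R t < K * exp (- l * t)"
    using dom x unfolding dominated_splitting_def by blast
  obtain B where B: "\<And>t. 0 \<le> t \<Longrightarrow> 0 < ?b t \<and> \<bar>ln (?b t)\<bar> \<le> B * (t + 1)"
    using restr_conorm_F_bounds x by blast
  have ab: "ln (?a t) \<le> ln K - l * t + ln (?b t)" if t: "0 < t" for t
  proof -
    have a: "0 < ?a t" using restr_norm_E_pos[OF x] t by simp
    obtain v0 where v0: "v0 \<in> F x" "tn x v0 = 1" using unit_F[OF x] by blast
    have R: "0 < ?R t"
      using F_le_restr_norm_backward[OF x _ v0, of t] D_pos[OF x v0(2), of t] t by (simp add: less_le_trans[rotated])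
    have "1 / ?R t \<le> ?b t"
      unfolding restr_conorm_def
    proof (rule cINF_greatest)
      show "{v \<in> F x. tn x v = 1} \<noteq> {}" using v0 by blast
      fix v assume "v \<in> {v \<in> F x. tn x v = 1}"
      then have v: "v \<in> F x" "tn x v = 1" by auto
      show "1 / ?R t \<le> tn (\<phi> t x) (D t x v)"
        using F_le_restr_norm_backward[OF x _ v, of t] D_pos[OF x v(2), of t] t R by (simp add: field_simps)
    qed
    then have "1 \<le> ?R t * ?b t" using R by (simp add: field_simps)
    then have "?a t \<le> ?a t * (?R t * ?b t)" using a by simp
    also have "\<dots> \<le> K * exp (- l * t) * ?b t"
      using mult_right_mono[OF less_imp_le[OF K(3)[OF t]], of "?b t"] B[of t] t by (simp add: mult.assoc)
    finally have "ln (?a t) \<le> ln (K * exp (- l * t) * ?b t)" using a by (intro ln_mono) auto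
    also have "\<dots> = ln K - l * t + ln (?b t)" using K(1) B[of t] t by (simp add: ln_mult)
    finally show ?thesis .
  qed
  have bb: "\<bar>1 / t * ln (?b t)\<bar> \<le> 2 * \<bar>B\<bar>" if t: "1 \<le> t" for t
  proof -
    have "\<bar>ln (?b t)\<bar> \<le> B * (t + 1)" using B[of t] t by simp
    also have "\<dots> \<le> \<bar>B\<bar> * (2 * t)" using t by (intro mult_mono) auto
    finally show ?thesis using t by (simp add: abs_mult field_simps)
  qed
  \<comment> \<open>The extended upper limit must be shown finite before it is subtracted; the bound
    \<open>bb\<close> confines the rate to a fixed interval for \<open>t \<ge> 1\<close>.\<close>
  let ?L = "Limsup at_top (\<lambda>t. ereal (1 / t * ln (?b t)))"
  have "?L \<le> ereal (2 * \<bar>B\<bar>)"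
    by (rule Limsup_bounded, rule eventually_mono[OF eventually_ge_at_top[of 1]])
      (simp only: ereal_less_eq, rule abs_le_D1[OF bb])
  moreover have "ereal (- (2 * \<bar>B\<bar>)) \<le> Liminf at_top (\<lambda>t. ereal (1 / t * ln (?b t)))"
    by (rule Liminf_bounded, rule eventually_mono[OF eventually_ge_at_top[of 1]])
      (simp only: ereal_less_eq, use abs_le_D2[OF bb] in \<open>simp only: minus_le_iff\<close>)
  then have "ereal (- (2 * \<bar>B\<bar>)) \<le> ?L"
    by (rule order_trans) (simp add: Liminf_le_Limsup)
  ultimately obtain m where m: "?L = ereal m" by (cases ?L) auto
  have "\<forall>\<^sub>F t in at_top. ereal (1 / t * ln (?b t)) < ereal (m + l / 4)"
    by (rule Limsup_lessD) (use m K(2) in simp)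
  moreover have "\<forall>\<^sub>F t in at_top. ln K / t < l / 4"
    by (rule order_tendstoD(2)[OF tendsto_const_over_t]) (use K(2) in simp)
  \<comment> \<open>Two errors below \<open>l / 4\<close> against the gap \<open>l\<close> leave a
    rate below \<open>m - l / 2\<close>, hence below \<open>m - l / 4\<close>.\<close>
  ultimately have "\<forall>\<^sub>F t in at_top. ereal (1 / t * ln (?a t)) \<le> ereal (m - l / 4)"
    using eventually_gt_at_top[of 0]
  proof eventually_elim
    case (elim t)
    have "1 / t * ln (?a t) \<le> 1 / t * (ln K - l * t + ln (?b t))" using ab[OF elim(3)] elim(3) by (intro mult_left_mono) auto
    also have "\<dots> = ln K / t - l + 1 / t * ln (?b t)" using elim(3) by (simp add: field_simps)
    also have "\<dots> \<le> m - l / 4" using elim(1)[unfolded less_ereal.simps] elim(2) K(2) by argo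
    finally show ?case by simp
  qed
  then have "Limsup at_top (\<lambda>t. ereal (1 / t * ln (?a t))) \<le> ereal (m - l / 4)" by (rule Limsup_bounded)
  then have "Liminf at_top (\<lambda>t. ereal (1 / t * ln (?a t))) \<le> ereal (m - l / 4)"
    by (rule order_trans[rotated]) (simp add: Liminf_le_Limsup)
  then have "Liminf at_top (\<lambda>t. ereal (1 / t * ln (?a t))) - ereal m \<le> ereal (m - l / 4) - ereal m"
    by (rule ereal_minus_mono) simp
  also have "\<dots> < 0" using K(2) by simp
  finally show ?thesis unfolding m .
qed

text \<open>Singular hyperbolicity gives the estimates at every point, so in that direction
  \<open>\<Lambda>\<close> itself serves as the set of total probability.\<close>

lemma Lambda_total_probability: "total_probability A X \<Lambda> \<Lambda>"
  unfolding total_probability_def invariant_probability_def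
proof (intro conjI subset_refl allI impI)
  fix \<mu> assume "prob_space \<mu> \<and> sets \<mu> = sets (restrict_space borel \<Lambda>) \<and> (\<forall>t. distr \<mu> \<mu> (flow A X t) = \<mu>)"
  then have "prob_space \<mu>" "space \<mu> = \<Lambda>" by (auto dest: sets_eq_imp_space_eq simp: space_restrict_space)
  then show "measure \<mu> \<Lambda> = 1" using prob_space.prob_space by metis
qed

theorem singular_hyperbolic_iff:
  "singular_hyperbolic TYPE('p) A g X \<Lambda> E F \<longleftrightarrow>
    (\<exists>Y. total_probability A X \<Lambda> Y \<and>
      (\<forall>x\<in>Y.
        Liminf at_top (\<lambda>t. ereal (1 / t * ln (restr_norm g x (flow A X t x) (Dflow A X t x) (E x))))
        - Limsup at_top (\<lambda>t. ereal (1 / t * ln (restr_conorm g x (flow A X t x) (Dflow A X t x) (F x))))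
        < 0 \<and>
        (\<forall>r\<in>lyapunov_exponents A g X E x. r < 0) \<and>
        (\<forall>r\<in>sectional_lyapunov_exponents TYPE('p) A g X F x. 0 < r)))"
proof
  assume "singular_hyperbolic TYPE('p) A g X \<Lambda> E F"
  then have "dominated_splitting A g X \<Lambda> E F" "uniformly_contracted A g X \<Lambda> E" "sectionally_expanding TYPE('p) A g X \<Lambda> F"
    unfolding singular_hyperbolic_def partially_hyperbolic_splitting_def by blast+
  then show "\<exists>Y. total_probability A X \<Lambda> Y \<and>
      (\<forall>x\<in>Y.
        Liminf at_top (\<lambda>t. ereal (1 / t * ln (restr_norm g x (flow A X t x) (Dflow A X t x) (E x))))
        - Limsup at_top (\<lambda>t. ereal (1 / t * ln (restr_conorm g x (flow A X t x) (Dflow A X t x) (F x))))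
        < 0 \<and>
        (\<forall>r\<in>lyapunov_exponents A g X E x. r < 0) \<and>
        (\<forall>r\<in>sectional_lyapunov_exponents TYPE('p) A g X F x. 0 < r))"
    using Lambda_total_probability dominated_gap contracted_exponents expanding_exponents by blast
next
  assume "\<exists>Y. total_probability A X \<Lambda> Y \<and>
      (\<forall>x\<in>Y.
        Liminf at_top (\<lambda>t. ereal (1 / t * ln (restr_norm g x (flow A X t x) (Dflow A X t x) (E x))))
        - Limsup at_top (\<lambda>t. ereal (1 / t * ln (restr_conorm g x (flow A X t x) (Dflow A X t x) (F x))))
        < 0 \<and>
        (\<forall>r\<in>lyapunov_exponents A g X E x. r < 0) \<and>
        (\<forall>r\<in>sectional_lyapunov_exponents TYPE('p) A g X F x. 0 < r))"
  then obtain Y where Y: "total_probability A X \<Lambda> Y" and H: "\<forall>x\<in>Y.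
        Liminf at_top (\<lambda>t. ereal (1 / t * ln (restr_norm g x (flow A X t x) (Dflow A X t x) (E x))))
        - Limsup at_top (\<lambda>t. ereal (1 / t * ln (restr_conorm g x (flow A X t x) (Dflow A X t x) (F x))))
        < 0 \<and>
        (\<forall>r\<in>lyapunov_exponents A g X E x. r < 0) \<and>
        (\<forall>r\<in>sectional_lyapunov_exponents TYPE('p) A g X F x. 0 < r)" by blast
  show "singular_hyperbolic TYPE('p) A g X \<Lambda> E F"
    by (rule total_probability_imp_singular_hyperbolic[OF Y]) (use H in blast)+
qed

end

theorem corollary1p8:
  fixes A :: "('m::{t2_space, second_countable_topology}, 'n::finite) chart set"
    and g :: "('m, 'n) metric_field"
    and X :: "('m, 'n) vector_field"
    and \<Lambda> :: "'m set"
    and E F :: "'m \<Rightarrow> (real ^ 'n) set"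
  assumes "compact (UNIV :: 'm set)" and "connected (UNIV :: 'm set)"
    and "smooth_atlas A" and "CARD('n) \<ge> 3"
    and "riemannian_metric A g"
    and "C1_vector_field A X" and "inwardly_transverse A X"
    and "compact \<Lambda>" and "flow_invariant A X \<Lambda>"
    and "\<forall>\<sigma>\<in>\<Lambda>. singularity X \<sigma> \<longrightarrow> hyperbolic_singularity A X \<sigma>"
    and "continuous_invariant_splitting A X \<Lambda> E F"
    and "2 \<le> CARD('p::finite)" and "\<forall>x\<in>\<Lambda>. CARD('p) \<le> dim (F x)"
  shows "singular_hyperbolic TYPE('p) A g X \<Lambda> E F \<longleftrightarrow>
    (\<exists>Y. total_probability A X \<Lambda> Y \<and>
      (\<forall>x\<in>Y.
        Liminf at_top (\<lambda>t. ereal (1 / t * ln (restr_norm g x (flow A X t x) (Dflow A X t x) (E x))))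
        - Limsup at_top (\<lambda>t. ereal (1 / t * ln (restr_conorm g x (flow A X t x) (Dflow A X t x) (F x))))
        < 0 \<and>
        (\<forall>r\<in>lyapunov_exponents A g X E x. r < 0) \<and>
        (\<forall>r\<in>sectional_lyapunov_exponents TYPE('p) A g X F x. 0 < r)))"
proof -
  interpret flow_bundle A g X \<Lambda> E F "TYPE('p)"
    using assms by unfold_locales auto
  show ?thesis by (rule singular_hyperbolic_iff)
qed

end
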